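(* For every integer $i\geq 3$ and every $r\in\mathbb{N}$ there exists a monomial ideal $I$ (in a polynomial ring in finitely many variables) such that each of the Kodiyalam polynomials $\mathfrak{P}_3^k(I),\mathfrak{P}_4^k(I),\dots,\mathfrak{P}_{i+r}^k(I)$ has the coefficient at some degree $\ge r$ depending on the characteristic of $k$; that is, for every $j$ with $3\leq j\leq i+r$ there exist an integer $d\geq r$ and fields $k,k'$ of different characteristics such that the coefficients of degree $d$ of $\mathfrak{P}_j^{k}(I)$ and $\mathfrak{P}_j^{k'}(I)$ are different.
   Context: $\mathbb{N}$ includes $0$. A monomial ideal $I$ has a unique minimal system $G(I)$ of monic monomial generators, which makes sense over every coefficient field. For a field $k$, $\beta_i^k(I)=\dim_k\mathrm{Tor}_i^R(I,k)$ denotes the $i$-th (total) Betti number of the ideal generated by $G(I)$ in the polynomial ring $R=k[x_1,\dots,x_n]$ (of $I$ as a module, not of $R/I$). By a theorem of Kodiyalam, for every homogeneous ideal $I$ of $k[x_1,\dots,x_n]$ and every $1\le j\le n$ there is a polynomial $\mathfrak{P}_j^k(I)(h)$ in one variable $h$ such that $\mathfrak{P}_j^k(I)(h)=\beta_{j-1}^k(I^h)$ for all sufficiently large integers $h$; it is called the $j$-th Kodiyalam polynomial of $I$. *)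

theory Defs
  imports
    "HOL-Algebra.Indexed_Polynomials"
    "HOL-Algebra.Ideal_Product"
    "HOL-Computational_Algebra.Polynomial"
begin

(* HOL-Algebra has no characteristic; this mirrors the type-class constant CHAR('a). *)
definition ring_char :: "('a, 'b) ring_scheme \<Rightarrow> nat" where
  "ring_char R = Gcd {n::nat. [n] \<cdot>\<^bsub>R\<^esub> \<one>\<^bsub>R\<^esub> = \<zero>\<^bsub>R\<^esub>}"


subsection \<open>The polynomial ring and monomial ideals\<close>

(* k[x_0, ..., x_{n-1}].  A monomial is the multiset of the indices of its variables, so
   products of monomials are multiset sums and divisibility is the submultiset relation. *)
definition mpoly_ring :: "nat \<Rightarrow> 'a ring \<Rightarrow> (nat multiset \<Rightarrow> 'a) ring" where
  "mpoly_ring n k =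
    \<lparr> carrier = ring.indexed_pset k {..<n} (carrier k),
      monoid.mult = (\<lambda>P Q m. \<Oplus>\<^bsub>k\<^esub>u\<in>{u. u \<subseteq># m}. P u \<otimes>\<^bsub>k\<^esub> Q (m - u)),
      one = ring.indexed_const k \<one>\<^bsub>k\<^esub>,
      zero = ring.indexed_const k \<zero>\<^bsub>k\<^esub>,
      add = ring.indexed_padd k \<rparr>"

definition monic_monomial :: "'a ring \<Rightarrow> nat multiset \<Rightarrow> (nat multiset \<Rightarrow> 'a)" where
  "monic_monomial k u = (\<lambda>m. if m = u then \<one>\<^bsub>k\<^esub> else \<zero>\<^bsub>k\<^esub>)"

(* The sets G(I), for I a monomial ideal in n variables: the finite antichains for divisibility. *)
definition minimal_monomial_system :: "nat \<Rightarrow> nat multiset set \<Rightarrow> bool" where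
  "minimal_monomial_system n G \<longleftrightarrow>
     finite G \<and> (\<forall>u\<in>G. set_mset u \<subseteq> {..<n}) \<and> (\<forall>u\<in>G. \<forall>v\<in>G. u \<subseteq># v \<longrightarrow> u = v)"

definition monomial_ideal :: "nat \<Rightarrow> 'a ring \<Rightarrow> nat multiset set \<Rightarrow> (nat multiset \<Rightarrow> 'a) set" where
  "monomial_ideal n k G = Idl\<^bsub>mpoly_ring n k\<^esub> (monic_monomial k ` G)"

definition ideal_power :: "'r ring \<Rightarrow> 'r set \<Rightarrow> nat \<Rightarrow> 'r set" where
  "ideal_power R I h = I [^]\<^bsub>ideals_set R\<^esub> h"


subsection \<open>Free resolutions and Tor\<close>

(* The elements of R^q, as functions vanishing from index q on. *)
definition free_vecs :: "'r ring \<Rightarrow> nat \<Rightarrow> (nat \<Rightarrow> 'r) set" where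
  "free_vecs R q = {v. (\<forall>b<q. v b \<in> carrier R) \<and> (\<forall>b\<ge>q. v b = \<zero>\<^bsub>R\<^esub>)}"

(* The map R^q -> R^p given by the p x q matrix A; entries outside that range are ignored. *)
definition mat_map :: "'r ring \<Rightarrow> nat \<Rightarrow> nat \<Rightarrow> (nat \<Rightarrow> nat \<Rightarrow> 'r) \<Rightarrow> (nat \<Rightarrow> 'r) \<Rightarrow> (nat \<Rightarrow> 'r)" where
  "mat_map R p q A v = (\<lambda>a. if a < p then \<Oplus>\<^bsub>R\<^esub>b\<in>{..<q}. A a b \<otimes>\<^bsub>R\<^esub> v b else \<zero>\<^bsub>R\<^esub>)"

definition mat_ker :: "'r ring \<Rightarrow> nat \<Rightarrow> nat \<Rightarrow> (nat \<Rightarrow> nat \<Rightarrow> 'r) \<Rightarrow> (nat \<Rightarrow> 'r) set" where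
  "mat_ker R p q A = {v \<in> free_vecs R q. mat_map R p q A v = (\<lambda>_. \<zero>\<^bsub>R\<^esub>)}"

definition mat_im :: "'r ring \<Rightarrow> nat \<Rightarrow> nat \<Rightarrow> (nat \<Rightarrow> nat \<Rightarrow> 'r) \<Rightarrow> (nat \<Rightarrow> 'r) set" where
  "mat_im R p q A = mat_map R p q A ` free_vecs R q"

(* The sequence  ... -> R^(m 2) --D 1--> R^(m 1) --D 0--> R^(m 0) --e--> I -> 0  is exact,
   where e sends v to the sum of the e b * v b.  Finite ranks are no restriction for
   polynomial rings over fields, which are noetherian. *)
definition free_resolution ::
  "'r ring \<Rightarrow> 'r set \<Rightarrow> (nat \<Rightarrow> nat) \<Rightarrow> (nat \<Rightarrow> 'r) \<Rightarrow> (nat \<Rightarrow> nat \<Rightarrow> nat \<Rightarrow> 'r) \<Rightarrow> bool" where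
  "free_resolution R I m e D \<longleftrightarrow>
     (\<forall>b<m 0. e b \<in> carrier R) \<and>
     (\<forall>i. \<forall>a<m i. \<forall>b<m (Suc i). D i a b \<in> carrier R) \<and>
     (\<lambda>v. \<Oplus>\<^bsub>R\<^esub>b\<in>{..<m 0}. e b \<otimes>\<^bsub>R\<^esub> v b) ` free_vecs R (m 0) = I \<and>
     {v \<in> free_vecs R (m 0). (\<Oplus>\<^bsub>R\<^esub>b\<in>{..<m 0}. e b \<otimes>\<^bsub>R\<^esub> v b) = \<zero>\<^bsub>R\<^esub>} = mat_im R (m 0) (m 1) (D 0) \<and>
     (\<forall>i. mat_ker R (m i) (m (Suc i)) (D i) = mat_im R (m (Suc i)) (m (Suc (Suc i))) (D (Suc i)))"

(* As a module over R = k[x_0, ..., x_{n-1}], k is R/(x_0, ..., x_{n-1}).  Hence R^q tensored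
   with k is k^q, and a matrix over R induces the matrix of the constant terms of its entries. *)
definition reduce_mat :: "(nat \<Rightarrow> nat \<Rightarrow> (nat multiset \<Rightarrow> 'a)) \<Rightarrow> (nat \<Rightarrow> nat \<Rightarrow> 'a)" where
  "reduce_mat A = (\<lambda>a b. A a b {#})"

(* Cycles and boundaries in degree i of the complex F tensor k, where F is given by m and D. *)
definition tor_cycles ::
  "'a ring \<Rightarrow> (nat \<Rightarrow> nat) \<Rightarrow> (nat \<Rightarrow> nat \<Rightarrow> nat \<Rightarrow> (nat multiset \<Rightarrow> 'a)) \<Rightarrow> nat \<Rightarrow> (nat \<Rightarrow> 'a) set" where
  "tor_cycles k m D i =
     (case i of 0 \<Rightarrow> free_vecs k (m 0)
      | Suc i' \<Rightarrow> mat_ker k (m i') (m (Suc i')) (reduce_mat (D i')))"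

definition tor_boundaries ::
  "'a ring \<Rightarrow> (nat \<Rightarrow> nat) \<Rightarrow> (nat \<Rightarrow> nat \<Rightarrow> nat \<Rightarrow> (nat multiset \<Rightarrow> 'a)) \<Rightarrow> nat \<Rightarrow> (nat \<Rightarrow> 'a) set" where
  "tor_boundaries k m D i = mat_im k (m i) (m (Suc i)) (reduce_mat (D i))"

(* dim_k (Z/B) = d for subspaces B of Z: there are w 0, ..., w (d-1) in Z whose classes form
   a basis of Z/B. *)
definition quotient_dim :: "'a ring \<Rightarrow> (nat \<Rightarrow> 'a) set \<Rightarrow> (nat \<Rightarrow> 'a) set \<Rightarrow> nat \<Rightarrow> bool" where
  "quotient_dim k Z B d \<longleftrightarrow>
     (\<exists>w. (\<forall>j<d. w j \<in> Z) \<and>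
          (\<forall>z\<in>Z. \<exists>!c. c \<in> free_vecs k d \<and>
             (\<lambda>a. z a \<ominus>\<^bsub>k\<^esub> (\<Oplus>\<^bsub>k\<^esub>j\<in>{..<d}. c j \<otimes>\<^bsub>k\<^esub> w j a)) \<in> B))"

(* dim_k Tor_i^R(I, k) for an ideal I of R = k[x_0, ..., x_{n-1}]; the Tor module, hence the
   number b below, does not depend on the free resolution of I. *)
definition betti :: "nat \<Rightarrow> 'a ring \<Rightarrow> nat \<Rightarrow> (nat multiset \<Rightarrow> 'a) set \<Rightarrow> nat" where
  "betti n k i I =
     (THE b. \<exists>m e D. free_resolution (mpoly_ring n k) I m e D \<and>
        quotient_dim k (tor_cycles k m D i) (tor_boundaries k m D i) b)"

(* The j-th Kodiyalam polynomial of I, for 1 \<le> j \<le> n. *)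
definition kodiyalam_poly :: "nat \<Rightarrow> 'a ring \<Rightarrow> nat \<Rightarrow> (nat multiset \<Rightarrow> 'a) set \<Rightarrow> rat poly" where
  "kodiyalam_poly n k j I =
     (THE P. \<forall>\<^sub>F h in sequentially.
        poly P (of_nat h) = of_nat (betti n k (j - 1) (ideal_power (mpoly_ring n k) I h)))"

end

theory Submission
  imports Defs "HOL-Library.Poly_Mapping" "HOL-Library.Numeral_Type" "HOL-Number_Theory.Residues"
begin

text \<open>The ideal is a graft of a nearly Scarf ideal of the six-vertex real projective plane, whose Betti
  numbers see the characteristic, onto an ideal generated by squares, whose powers have many generators.
  With \<open>z\<close>-variables \<open>z\<^sub>0, \<dots>, z\<^sub>s\<^sub>-\<^sub>1\<close> and one \<open>x\<close>-variable per triangle, let \<open>m\<^sub>v\<close> be the product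
  of the \<open>x\<close>-variables of the triangles missing the vertex \<open>v\<close>, and let \<open>I\<close> be generated by all \<open>z\<^sub>i\<^sup>2\<close> and
  all \<open>z\<^sub>0 z\<^sub>1 m\<^sub>v\<close>. The power \<open>I\<^sup>h\<close> is resolved by a complex that is of Taylor type in the \<open>x\<close>-variables and
  cubical in the \<open>z\<close>-variables. After tensoring with the residue field, two acyclic matchings leave
  cells without incidence between them, whose number is polynomial in \<open>h\<close>, and one copy of the block of
  the projective plane, a \<open>5 \<times> 5\<close> matrix of determinant \<open>\<plusminus>2\<close>, for each set of \<open>z\<close>-variables and each
  monomial of degree \<open>h - 1\<close> in the \<open>z\<close>-variables. Hence the Betti numbers over fields of
  characteristic 2 and 3 differ by a positive multiple of a polynomial of degree \<open>s - 1\<close>.\<close>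

section \<open>Exact complexes of matrices over a subring\<close>

text \<open>A product of two generators \<open>z_0 z_1 m_v\<close> and \<open>z_0 z_1 m_w\<close> is
  divisible by \<open>z_0^2 z_1^2\<close>, hence \<open>I^h = A^h + z_0 z_1 J A^(h-1)\<close> with
  \<open>A\<close> generated by the squares and \<open>J\<close> by the \<open>m_v\<close>. So
  \<open>J\<close> is never raised to a power, and \<open>h\<close> acts only through
  \<open>A\<close>. The least common multiple of the \<open>m_v\<close> over a set of vertices is
  the product of the triangles that do not contain the set; it is the same for all nonfaces, and
  deleting a vertex changes it as soon as a face is left. In the simplicial directions tensoring
  therefore keeps exactly the incidences onto nonfaces. The \<open>5 x 5\<close> matrix is what the
  matching by the vertex 5 leaves of the nonfaces: the Moebius strip of triangles away from 5,
  relative to its boundary circle. With \<open>t\<close> cubical directions this block sits in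
  dimensions \<open>t + 3\<close> and \<open>t + 4\<close>, and \<open>t\<close> runs from 0 to
  \<open>s\<close>; this is how a single ideal serves all \<open>j\<close>, and why
  \<open>s = i + r\<close> is enough. Since \<open>betti\<close> is a description over all
  resolutions, the dimension of Tor must be shown to be well defined; over a finite ring this is a
  matter of counting, hence finite fields.\<close>

definition subsp :: "('x \<Rightarrow> 'f::comm_ring_1) set \<Rightarrow> bool" where
  "subsp S \<longleftrightarrow> (\<lambda>_. 0) \<in> S \<and> (\<forall>v\<in>S. \<forall>w\<in>S. (\<lambda>a. v a + w a) \<in> S) \<and> (\<forall>c. \<forall>v\<in>S. (\<lambda>a. c * v a) \<in> S)"

definition linear_on :: "('x \<Rightarrow> 'f::comm_ring_1) set \<Rightarrow> (('x \<Rightarrow> 'f) \<Rightarrow> ('y \<Rightarrow> 'f)) \<Rightarrow> bool" where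
  "linear_on S f \<longleftrightarrow> (\<forall>v\<in>S. \<forall>w\<in>S. f (\<lambda>a. v a + w a) = (\<lambda>b. f v b + f w b)) \<and>
     (\<forall>c. \<forall>v\<in>S. f (\<lambda>a. c * v a) = (\<lambda>b. c * f v b))"

definition vecs :: "'r::comm_ring_1 set \<Rightarrow> nat \<Rightarrow> (nat \<Rightarrow> 'r) set" where
  "vecs C q = {v. (\<forall>b<q. v b \<in> C) \<and> (\<forall>b\<ge>q. v b = 0)}"

text \<open>Type-class counterpart of \<open>quotient_dim\<close>, with an arbitrary index type so
  that it serves vectors indexed by numbers and chains indexed by cells alike.\<close>

definition quot_dim :: "('x \<Rightarrow> 'f::comm_ring_1) set \<Rightarrow> ('x \<Rightarrow> 'f) set \<Rightarrow> nat \<Rightarrow> bool" where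
  "quot_dim Z B d \<longleftrightarrow> (\<exists>w. (\<forall>j<d. w j \<in> Z) \<and>
     (\<forall>z\<in>Z. \<exists>!c. c \<in> vecs UNIV d \<and> (\<lambda>a. z a - (\<Sum>j<d. c j * w j a)) \<in> B))"

lemma quot_dimE:
  assumes "quot_dim Z B d"
  obtains w where "\<forall>j<d. w j \<in> Z"
    "\<forall>z\<in>Z. \<exists>!c. c \<in> vecs UNIV d \<and> (\<lambda>a. z a - (\<Sum>j<d. c j * w j a)) \<in> B"
  using assms unfolding quot_dim_def by (elim exE conjE) (rule that, assumption+)

lemma linear_on_add: "linear_on S f \<Longrightarrow> v \<in> S \<Longrightarrow> w \<in> S \<Longrightarrow> f (\<lambda>a. v a + w a) = (\<lambda>b. f v b + f w b)"
  and linear_on_scale: "linear_on S f \<Longrightarrow> v \<in> S \<Longrightarrow> f (\<lambda>a. c * v a) = (\<lambda>b. c * f v b)"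
  by (simp_all add: linear_on_def)

lemma subsp_zero: "subsp S \<Longrightarrow> (\<lambda>_. 0) \<in> S"
  and subsp_add: "subsp S \<Longrightarrow> v \<in> S \<Longrightarrow> w \<in> S \<Longrightarrow> (\<lambda>a. v a + w a) \<in> S"
  and subsp_scale: "subsp S \<Longrightarrow> v \<in> S \<Longrightarrow> (\<lambda>a. c * v a) \<in> S"
  unfolding subsp_def by blast+

lemma subsp_diff: "subsp S \<Longrightarrow> v \<in> S \<Longrightarrow> w \<in> S \<Longrightarrow> (\<lambda>a. v a - w a) \<in> S"
  using subsp_add[of S v "\<lambda>a. (-1) * w a"] subsp_scale[of S w "-1"] by simp

lemma subsp_sum:
  assumes "subsp S" "\<And>j. j \<in> A \<Longrightarrow> w j \<in> S"
  shows "(\<lambda>a. \<Sum>j\<in>A. c j * w j a) \<in> S"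
  using assms(2)
proof (induction A rule: infinite_finite_induct)
  case (insert x F)
  then show ?case using subsp_add[OF assms(1) subsp_scale[OF assms(1), of "w x" "c x"]] by simp
qed (use subsp_zero[OF assms(1)] in auto)

lemma linear_on_sum:
  assumes "subsp S" "linear_on S f" "\<And>j. j \<in> A \<Longrightarrow> w j \<in> S"
  shows "f (\<lambda>a. \<Sum>j\<in>A. c j * w j a) = (\<lambda>b. \<Sum>j\<in>A. c j * f (w j) b)"
proof -
  have z: "f (\<lambda>_. 0) = (\<lambda>_. 0)"
    using linear_on_scale[OF assms(2) subsp_zero[OF assms(1)], of 0] by simp
  show ?thesis using assms(3)
  proof (induction A rule: infinite_finite_induct)
    case (insert x F)
    have a: "(\<lambda>a. c x * w x a) \<in> S" "(\<lambda>a. \<Sum>j\<in>F. c j * w j a) \<in> S"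
      by (intro subsp_scale[OF assms(1)] subsp_sum[OF assms(1)]; simp add: insert.prems)+
    have "w x \<in> S" using insert.prems by blast
    then show ?case using insert linear_on_add[OF assms(2) a] linear_on_scale[OF assms(2), of "w x" "c x"] by simp
  qed (use z in auto)
qed

lemma linear_on_diff:
  assumes "subsp S" "linear_on S f" "v \<in> S" "w \<in> S"
  shows "f (\<lambda>a. v a - w a) = (\<lambda>b. f v b - f w b)"
proof -
  have "(\<lambda>a. - w a) \<in> S" using subsp_scale[OF assms(1,4), of "-1"] by simp
  then show ?thesis
    using linear_on_add[OF assms(2,3), of "\<lambda>a. - w a"] linear_on_scale[OF assms(2,4), of "-1"] by simp
qed

text \<open>Such an \<open>f\<close> induces an isomorphism of \<open>Z / B\<close> with
  \<open>Z' / B'\<close>; being onto is asked only modulo \<open>B'\<close>. A basis is pushed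
  forward, or pulled back by choosing approximate preimages, and the coefficients stay the same.
  Comparison of resolutions, passage to cells and removal of acyclic parts all go through this
  lemma.\<close>

lemma quot_dim_iso:
  assumes sub: "subsp Z" "subsp B'" and lin: "linear_on Z f"
    and maps: "\<And>z. z \<in> Z \<Longrightarrow> f z \<in> Z'"
    and iff: "\<And>z. z \<in> Z \<Longrightarrow> f z \<in> B' \<longleftrightarrow> z \<in> B"
    and onto: "\<And>z'. z' \<in> Z' \<Longrightarrow> \<exists>z\<in>Z. (\<lambda>b. z' b - f z b) \<in> B'"
  shows "quot_dim Z B d \<longleftrightarrow> quot_dim Z' B' d"
proof
  assume qd: "quot_dim Z B d"

  obtain w where w0: "\<forall>j<d. w j \<in> Z" and u0: "\<forall>z\<in>Z. \<exists>!c. c \<in> vecs UNIV d \<and> (\<lambda>a. z a - (\<Sum>j<d. c j * w j a)) \<in> B"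
    by (rule quot_dimE[OF qd])
  note w = w0[rule_format] and u = bspec[OF u0]
  show "quot_dim Z' B' d" unfolding quot_dim_def
  proof (intro exI[of _ "\<lambda>j. f (w j)"] conjI allI impI ballI)
    show "f (w j) \<in> Z'" if "j < d" for j using w[OF that] maps by blast
    fix z' assume "z' \<in> Z'"
    then obtain z where z: "z \<in> Z" "(\<lambda>b. z' b - f z b) \<in> B'" using onto by blast
    have "(\<lambda>b. z' b - (\<Sum>j<d. c j * f (w j) b)) \<in> B' \<longleftrightarrow> (\<lambda>a. z a - (\<Sum>j<d. c j * w j a)) \<in> B" for c
    proof -
      have s: "(\<lambda>a. \<Sum>j<d. c j * w j a) \<in> Z" by (rule subsp_sum[OF sub(1)]) (simp add: w)
      have e: "f (\<lambda>a. z a - (\<Sum>j<d. c j * w j a)) = (\<lambda>b. f z b - (\<Sum>j<d. c j * f (w j) b))"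
        using linear_on_diff[OF sub(1) lin z(1) s] linear_on_sum[OF sub(1) lin, of "{..<d}" w c] w by auto
      have "(\<lambda>a. z a - (\<Sum>j<d. c j * w j a)) \<in> B \<longleftrightarrow> (\<lambda>b. f z b - (\<Sum>j<d. c j * f (w j) b)) \<in> B'"
        using iff[OF subsp_diff[OF sub(1) z(1) s]] e by simp
      also have "\<dots> \<longleftrightarrow> (\<lambda>b. z' b - (\<Sum>j<d. c j * f (w j) b)) \<in> B'"
      proof
        assume "(\<lambda>b. f z b - (\<Sum>j<d. c j * f (w j) b)) \<in> B'"
        from subsp_add[OF sub(2) z(2) this] show "(\<lambda>b. z' b - (\<Sum>j<d. c j * f (w j) b)) \<in> B'" by simp
      next
        assume "(\<lambda>b. z' b - (\<Sum>j<d. c j * f (w j) b)) \<in> B'"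
        from subsp_diff[OF sub(2) this z(2)] show "(\<lambda>b. f z b - (\<Sum>j<d. c j * f (w j) b)) \<in> B'" by simp
      qed
      finally show ?thesis by simp
    qed
    then show "\<exists>!c. c \<in> vecs UNIV d \<and> (\<lambda>b. z' b - (\<Sum>j<d. c j * f (w j) b)) \<in> B'"
      using u[OF z(1)] by simp
  qed
next
  assume qd: "quot_dim Z' B' d"
  obtain w' where w'0: "\<forall>j<d. w' j \<in> Z'" and u0: "\<forall>z\<in>Z'. \<exists>!c. c \<in> vecs UNIV d \<and> (\<lambda>a. z a - (\<Sum>j<d. c j * w' j a)) \<in> B'"
    by (rule quot_dimE[OF qd])
  note w' = w'0[rule_format] and u = bspec[OF u0]
  have "\<forall>j. \<exists>z. j < d \<longrightarrow> z\<in>Z \<and> (\<lambda>b. w' j b - f z b) \<in> B'" using onto w' by blast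
  then obtain w where w: "\<And>j. j < d \<Longrightarrow> w j \<in> Z" "\<And>j. j < d \<Longrightarrow> (\<lambda>b. w' j b - f (w j) b) \<in> B'"
    by metis
  show "quot_dim Z B d" unfolding quot_dim_def
  proof (intro exI[of _ w] conjI allI impI ballI)
    show "w j \<in> Z" if "j < d" for j using w that by blast
    fix z assume z: "z \<in> Z"
    have "(\<lambda>b. f z b - (\<Sum>j<d. c j * w' j b)) \<in> B' \<longleftrightarrow> (\<lambda>a. z a - (\<Sum>j<d. c j * w j a)) \<in> B" for c
    proof -
      have s: "(\<lambda>a. \<Sum>j<d. c j * w j a) \<in> Z" by (rule subsp_sum[OF sub(1)]) (simp add: w)
      have e: "f (\<lambda>a. z a - (\<Sum>j<d. c j * w j a)) = (\<lambda>b. f z b - (\<Sum>j<d. c j * f (w j) b))"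
        using linear_on_diff[OF sub(1) lin z(1) s] linear_on_sum[OF sub(1) lin, of "{..<d}" w c] w by auto
      have k: "(\<lambda>b. \<Sum>j<d. c j * (w' j b - f (w j) b)) \<in> B'"
        using subsp_sum[OF sub(2), of "{..<d}" "\<lambda>j b. w' j b - f (w j) b" c] w by auto
      have "(\<lambda>a. z a - (\<Sum>j<d. c j * w j a)) \<in> B \<longleftrightarrow> (\<lambda>b. f z b - (\<Sum>j<d. c j * f (w j) b)) \<in> B'"
        using iff[OF subsp_diff[OF sub(1) z(1) s]] e by simp
      also have "\<dots> \<longleftrightarrow> (\<lambda>b. f z b - (\<Sum>j<d. c j * w' j b)) \<in> B'"
      proof
        assume "(\<lambda>b. f z b - (\<Sum>j<d. c j * f (w j) b)) \<in> B'"
        from subsp_diff[OF sub(2) this k] show "(\<lambda>b. f z b - (\<Sum>j<d. c j * w' j b)) \<in> B'"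
          by (simp add: algebra_simps sum_subtractf)
      next
        assume "(\<lambda>b. f z b - (\<Sum>j<d. c j * w' j b)) \<in> B'"
        from subsp_add[OF sub(2) this k] show "(\<lambda>b. f z b - (\<Sum>j<d. c j * f (w j) b)) \<in> B'"
          by (simp add: algebra_simps sum_subtractf)
      qed
      finally show ?thesis by simp
    qed
    then show "\<exists>!c. c \<in> vecs UNIV d \<and> (\<lambda>a. z a - (\<Sum>j<d. c j * w j a)) \<in> B"
      using u[OF maps[OF z]] by simp
  qed
qed

lemma card_vecs_UNIV: "card (vecs (UNIV::'f::{finite,comm_ring_1} set) d) = CARD('f) ^ d"
proof -
  have "bij_betw (\<lambda>v. restrict v {..<d}) (vecs (UNIV::'f set) d) (PiE {..<d} (\<lambda>_. UNIV))"
    by (rule bij_betwI[where g = "\<lambda>v b. if b < d then v b else 0"])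
      (auto simp: vecs_def fun_eq_iff PiE_def extensional_def)
  then have "card (vecs (UNIV::'f set) d) = card (PiE {..<d} (\<lambda>_. UNIV::'f set))"
    by (rule bij_betw_same_card)
  then show ?thesis by (simp add: card_PiE)
qed

lemma finite_vecs_UNIV: "finite (vecs (UNIV::'f::{finite,comm_ring_1} set) d)"
  using card_vecs_UNIV[where 'f = 'f and d = d] card_eq_0_iff by fastforce

text \<open>Counting replaces linear algebra: sending a coefficient vector for one basis to the
  coefficients of the same class in the other is injective, so \<open>q^d\<close> is at most
  \<open>q^d'\<close> for a ring with \<open>q\<close> elements.\<close>

lemma quot_dim_unique_le:
  fixes Z B :: "('x \<Rightarrow> 'f::{finite,comm_ring_1}) set"
  assumes "subsp Z" "subsp B" "quot_dim Z B d" "quot_dim Z B d'"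
  shows "d \<le> d'"
proof -
  obtain w where w0: "\<forall>j<d. w j \<in> Z" and u0: "\<forall>z\<in>Z. \<exists>!c. c \<in> vecs UNIV d \<and> (\<lambda>a. z a - (\<Sum>j<d. c j * w j a)) \<in> B"
    by (rule quot_dimE[OF assms(3)])
  note w = w0[rule_format] and u = bspec[OF u0]
  obtain w' where w'0: "\<forall>j<d'. w' j \<in> Z" and u'0: "\<forall>z\<in>Z. \<exists>!c. c \<in> vecs UNIV d' \<and> (\<lambda>a. z a - (\<Sum>j<d'. c j * w' j a)) \<in> B"
    by (rule quot_dimE[OF assms(4)])
  note w' = w'0[rule_format] and u' = bspec[OF u'0]
  define z where "z c = (\<lambda>a. \<Sum>j<d. c j * w j a)" for c
  define g where "g c = (SOME c'. c' \<in> vecs UNIV d' \<and> (\<lambda>a. z c a - (\<Sum>j<d'. c' j * w' j a)) \<in> B)" for c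
  have zZ: "z c \<in> Z" for c unfolding z_def by (rule subsp_sum[OF assms(1)]) (simp add: w)
  have g: "g c \<in> vecs UNIV d'" "(\<lambda>a. z c a - (\<Sum>j<d'. g c j * w' j a)) \<in> B" for c
    using someI_ex[of "\<lambda>c'. c' \<in> vecs UNIV d' \<and> (\<lambda>a. z c a - (\<Sum>j<d'. c' j * w' j a)) \<in> B"]
      u'[OF zZ] unfolding g_def by blast+
  have "inj_on g (vecs UNIV d)"
  proof (rule inj_onI)
    fix c1 c2 assume c: "c1 \<in> vecs UNIV d" "c2 \<in> vecs UNIV d" "g c1 = g c2"
    have "(\<lambda>a. z c1 a - z c2 a) \<in> B" using subsp_diff[OF assms(2) g(2)[of c1] g(2)[of c2]] c(3) by simp
    moreover have "(\<lambda>a. z c1 a - z c1 a) \<in> B" using subsp_zero[OF assms(2)] by simp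
    ultimately show "c1 = c2" using u[OF zZ[of c1]] c(1,2) unfolding z_def by blast
  qed
  then have "card (vecs (UNIV::'f set) d) \<le> card (vecs (UNIV::'f set) d')"
    using g(1) finite_vecs_UNIV by (metis card_inj_on_le image_subsetI)
  moreover have "CARD('f) > 1"
    using card_mono[of "UNIV::'f set" "{0,1}"] by simp
  ultimately show ?thesis by (simp add: card_vecs_UNIV)
qed

lemma quot_dim_unique:
  fixes Z B :: "('x \<Rightarrow> 'f::{finite,comm_ring_1}) set"
  assumes "subsp Z" "subsp B" "quot_dim Z B d" "quot_dim Z B d'"
  shows "d = d'"
  using quot_dim_unique_le[OF assms] quot_dim_unique_le[OF assms(1,2,4,3)] by simp

section \<open>Matrix maps with entries in a subring\<close>

definition mmap :: "nat \<Rightarrow> nat \<Rightarrow> (nat \<Rightarrow> nat \<Rightarrow> 'r::comm_ring_1) \<Rightarrow> (nat \<Rightarrow> 'r) \<Rightarrow> (nat \<Rightarrow> 'r)" where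
  "mmap p q A v = (\<lambda>a. if a < p then \<Sum>b<q. A a b * v b else 0)"

definition mats :: "'r set \<Rightarrow> nat \<Rightarrow> nat \<Rightarrow> (nat \<Rightarrow> nat \<Rightarrow> 'r) set" where
  "mats C p q = {A. \<forall>a<p. \<forall>b<q. A a b \<in> C}"

definition mmult :: "nat \<Rightarrow> (nat \<Rightarrow> nat \<Rightarrow> 'r::comm_ring_1) \<Rightarrow> (nat \<Rightarrow> nat \<Rightarrow> 'r) \<Rightarrow> (nat \<Rightarrow> nat \<Rightarrow> 'r)" where
  "mmult q A B = (\<lambda>a c. \<Sum>b<q. A a b * B b c)"

locale subring_set =
  fixes C :: "'r::comm_ring_1 set"
  assumes zero_C: "0 \<in> C" and one_C: "1 \<in> C" and add_C: "\<And>x y. x \<in> C \<Longrightarrow> y \<in> C \<Longrightarrow> x + y \<in> C"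
    and mult_C: "\<And>x y. x \<in> C \<Longrightarrow> y \<in> C \<Longrightarrow> x * y \<in> C" and uminus_C: "\<And>x. x \<in> C \<Longrightarrow> - x \<in> C"
begin

lemma diff_C: "x \<in> C \<Longrightarrow> y \<in> C \<Longrightarrow> x - y \<in> C"
  using add_C[of x "-y"] uminus_C by simp

lemma sum_C: "(\<And>x. x \<in> A \<Longrightarrow> f x \<in> C) \<Longrightarrow> sum f A \<in> C"
  by (induction A rule: infinite_finite_induct) (auto intro: zero_C add_C)

lemma mmap_C: "A \<in> mats C p q \<Longrightarrow> v \<in> vecs C q \<Longrightarrow> mmap p q A v \<in> vecs C p"
  by (auto simp: mats_def vecs_def mmap_def intro!: sum_C mult_C)

lemma mmult_C: "A \<in> mats C p q \<Longrightarrow> B \<in> mats C q r \<Longrightarrow> mmult q A B \<in> mats C p r"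
  by (auto simp: mats_def mmult_def intro!: sum_C mult_C)

end

lemma mmap_mmap: "mmap p q A (mmap q r B v) = mmap p r (mmult q A B) v"
proof -
  have "(\<Sum>b<q. A a b * (\<Sum>c<r. B b c * v c)) = (\<Sum>c<r. (\<Sum>b<q. A a b * B b c) * v c)" for a
    unfolding sum_distrib_left sum_distrib_right by (subst sum.swap) (simp add: mult.assoc)
  then show ?thesis by (auto simp: mmap_def mmult_def fun_eq_iff)
qed

lemma mmap_add: "mmap p q A (\<lambda>b. v b + w b) = (\<lambda>a. mmap p q A v a + mmap p q A w a)"
  and mmap_diff: "mmap p q A (\<lambda>b. v b - w b) = (\<lambda>a. mmap p q A v a - mmap p q A w a)"
  and mmap_scale: "mmap p q A (\<lambda>b. c * v b) = (\<lambda>a. c * mmap p q A v a)"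
  and mmap_zero: "mmap p q A (\<lambda>b. 0) = (\<lambda>a. 0)"
  by (auto simp: mmap_def fun_eq_iff algebra_simps sum.distrib sum_subtractf sum_distrib_left)

lemma mmap_mat_diff: "mmap p q (\<lambda>a b. A a b - B a b) v = (\<lambda>a. mmap p q A v a - mmap p q B v a)"
  by (auto simp: mmap_def fun_eq_iff algebra_simps sum_subtractf)

lemma mmap_sum_unit: "mmap p q A (\<lambda>b. if b = c then 1 else 0) = (\<lambda>a. if a < p \<and> c < q then A a c else 0)"
  by (auto simp: mmap_def fun_eq_iff if_distrib[of "\<lambda>x. _ * x"] sum.delta cong: if_cong)

context subring_set
begin

text \<open>Free modules are projective: preimages of the images of the unit vectors are chosen as
  the columns of \<open>B\<close>.\<close>

lemma mat_lift:
  assumes "A \<in> mats C p q" "\<And>v. v \<in> vecs C q \<Longrightarrow> mmap p q A v \<in> mmap p q' P ` vecs C q'"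
  shows "\<exists>B\<in>mats C q' q. \<forall>v. mmap p q' P (mmap q' q B v) = mmap p q A v"
proof -
  have "\<forall>c. \<exists>w. c < q \<longrightarrow> w \<in> vecs C q' \<and> mmap p q' P w = mmap p q A (\<lambda>b. if b = c then 1 else 0)"
  proof (intro allI)
    fix c
    show "\<exists>w. c < q \<longrightarrow> w \<in> vecs C q' \<and> mmap p q' P w = mmap p q A (\<lambda>b. if b = c then 1 else 0)"
    proof (cases "c < q")
      case True
      then have "(\<lambda>b. if b = c then 1 else 0) \<in> vecs C q" by (auto simp: vecs_def zero_C one_C)
      from assms(2)[OF this] show ?thesis by fastforce
    qed auto
  qed
  then obtain w where w: "\<And>c. c < q \<Longrightarrow> w c \<in> vecs C q'"
    "\<And>c. c < q \<Longrightarrow> mmap p q' P (w c) = mmap p q A (\<lambda>b. if b = c then 1 else 0)" by metis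
  show ?thesis
  proof (intro bexI[of _ "\<lambda>b c. w c b"] allI)
    show "(\<lambda>b c. w c b) \<in> mats C q' q" using w(1) by (auto simp: mats_def vecs_def)
    fix v
    have "mmult q' P (\<lambda>b c. w c b) a c = A a c" if "a < p" "c < q" for a c
      using fun_cong[OF w(2)[OF that(2)], of a] that unfolding mmap_sum_unit by (simp add: mmap_def mmult_def)
    then show "mmap p q' P (mmap q' q (\<lambda>b c. w c b) v) = mmap p q A v"
      unfolding mmap_mmap by (auto simp: mmap_def fun_eq_iff)
  qed
qed

text \<open>The ring itself sits in position 0, which is why \<open>g 0 = 1\<close>, and
  \<open>E 0\<close> is the row of generators of the ideal. Homological degree \<open>j\<close> thus
  has index \<open>Suc j\<close>, and the image of \<open>E 0\<close> plays the role of the resolved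
  ideal.\<close>

definition exact_complex :: "(nat \<Rightarrow> nat) \<Rightarrow> (nat \<Rightarrow> nat \<Rightarrow> nat \<Rightarrow> 'r) \<Rightarrow> bool" where
  "exact_complex g E \<longleftrightarrow> g 0 = 1 \<and> (\<forall>i. E i \<in> mats C (g i) (g (Suc i))) \<and>
     (\<forall>i. {v\<in>vecs C (g (Suc i)). mmap (g i) (g (Suc i)) (E i) v = (\<lambda>_. 0)} =
        mmap (g (Suc i)) (g (Suc (Suc i))) (E (Suc i)) ` vecs C (g (Suc (Suc i))))"

lemma exact_complex_mats: "exact_complex g E \<Longrightarrow> E i \<in> mats C (g i) (g (Suc i))"
  unfolding exact_complex_def by blast

lemma exact_complex_im: "exact_complex g E \<Longrightarrow> v \<in> vecs C (g (Suc i)) \<Longrightarrow> mmap (g i) (g (Suc i)) (E i) v = (\<lambda>_. 0)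
   \<Longrightarrow> v \<in> mmap (g (Suc i)) (g (Suc (Suc i))) (E (Suc i)) ` vecs C (g (Suc (Suc i)))"
  unfolding exact_complex_def by blast

lemma exact_complex_sq: "exact_complex g E \<Longrightarrow> v \<in> vecs C (g (Suc (Suc i))) \<Longrightarrow>
   mmap (g i) (g (Suc i)) (E i) (mmap (g (Suc i)) (g (Suc (Suc i))) (E (Suc i)) v) = (\<lambda>_. 0)"
  unfolding exact_complex_def by blast

text \<open>Comparison theorem: the identity in position 0 is lifted step by step, because a cycle
  of the target is a boundary there.\<close>

lemma chain_map_exists:
  assumes E: "exact_complex g E" and E': "exact_complex g' E'"
    and im: "mmap 1 (g 1) (E 0) ` vecs C (g 1) \<subseteq> mmap 1 (g' 1) (E' 0) ` vecs C (g' 1)"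
  shows "\<exists>\<phi>. \<phi> 0 = (\<lambda>a b. if a = b then 1 else 0) \<and> (\<forall>i. \<phi> i \<in> mats C (g' i) (g i)) \<and>
     (\<forall>i. \<forall>v\<in>vecs C (g (Suc i)). mmap (g' i) (g' (Suc i)) (E' i) (mmap (g' (Suc i)) (g (Suc i)) (\<phi> (Suc i)) v) =
        mmap (g' i) (g i) (\<phi> i) (mmap (g i) (g (Suc i)) (E i) v))"
proof -
  \<comment> \<open>The invariant \<open>P\<close> contains the liftability of the current matrix,
    which is what the choice of the next one consumes; \<open>Q\<close> is the commuting square
    linking the two.\<close>
  define P where "P i \<phi> \<longleftrightarrow> \<phi> \<in> mats C (g' i) (g i) \<and> (i = 0 \<longrightarrow> \<phi> = (\<lambda>a b. if a = b then 1 else 0)) \<and>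
     (\<forall>v\<in>vecs C (g (Suc i)). mmap (g' i) (g i) \<phi> (mmap (g i) (g (Suc i)) (E i) v)
        \<in> mmap (g' i) (g' (Suc i)) (E' i) ` vecs C (g' (Suc i)))" for i \<phi>
  define Q where "Q i \<phi> \<psi> \<longleftrightarrow> (\<forall>v\<in>vecs C (g (Suc i)). mmap (g' i) (g' (Suc i)) (E' i) (mmap (g' (Suc i)) (g (Suc i)) \<psi> v) =
        mmap (g' i) (g i) \<phi> (mmap (g i) (g (Suc i)) (E i) v))" for i \<phi> \<psi>
  have g0: "g 0 = 1" "g' 0 = 1" using E E' unfolding exact_complex_def by auto
  have "\<exists>f. \<forall>n. P n (f n) \<and> Q n (f n) (f (Suc n))"
  proof (rule dependent_nat_choice)
    have "mmap 1 1 (\<lambda>a b. if a = b then 1 else 0) v = v" if "v \<in> vecs C 1" for v :: "nat \<Rightarrow> 'r"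
      using that by (auto simp: mmap_def fun_eq_iff vecs_def)
    moreover have "mmap 1 (g 1) (E 0) v \<in> vecs C 1" if "v \<in> vecs C (g 1)" for v
      using mmap_C exact_complex_mats[OF E, of 0] that g0 by simp
    ultimately show "\<exists>x. P 0 x"
      unfolding P_def using im by (intro exI[of _ "\<lambda>a b. if a = b then 1 else 0"])
        (auto simp: g0 mats_def zero_C one_C)
  next
    fix \<phi> n assume p: "P n \<phi>"
    have "\<exists>B\<in>mats C (g' (Suc n)) (g (Suc n)). \<forall>v. mmap (g' n) (g' (Suc n)) (E' n) (mmap (g' (Suc n)) (g (Suc n)) B v) =
        mmap (g' n) (g (Suc n)) (mmult (g n) \<phi> (E n)) v"
      using p by (intro mat_lift) (auto simp: P_def mmap_mmap intro!: mmult_C exact_complex_mats[OF E])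
    then obtain B where B: "B \<in> mats C (g' (Suc n)) (g (Suc n))"
      "\<And>v. mmap (g' n) (g' (Suc n)) (E' n) (mmap (g' (Suc n)) (g (Suc n)) B v) =
        mmap (g' n) (g n) \<phi> (mmap (g n) (g (Suc n)) (E n) v)" by (auto simp: mmap_mmap)
    have "P (Suc n) B" unfolding P_def
    proof (intro conjI ballI B)
      fix v assume v: "v \<in> vecs C (g (Suc (Suc n)))"
      show "mmap (g' (Suc n)) (g (Suc n)) B (mmap (g (Suc n)) (g (Suc (Suc n))) (E (Suc n)) v)
         \<in> mmap (g' (Suc n)) (g' (Suc (Suc n))) (E' (Suc n)) ` vecs C (g' (Suc (Suc n)))"
      proof (rule exact_complex_im[OF E'])
        show "mmap (g' (Suc n)) (g (Suc n)) B (mmap (g (Suc n)) (g (Suc (Suc n))) (E (Suc n)) v) \<in> vecs C (g' (Suc n))"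
          by (intro mmap_C B exact_complex_mats[OF E] v)
        show "mmap (g' n) (g' (Suc n)) (E' n) (mmap (g' (Suc n)) (g (Suc n)) B (mmap (g (Suc n)) (g (Suc (Suc n))) (E (Suc n)) v)) = (\<lambda>_. 0)"
          unfolding B(2) exact_complex_sq[OF E v] mmap_zero ..
      qed
    qed auto
    then show "\<exists>y. P (Suc n) y \<and> Q n \<phi> y" using B unfolding Q_def by blast
  qed
  then show ?thesis unfolding P_def Q_def by blast
qed

text \<open>If \<open>\<chi>\<close> vanishes in position 0, then \<open>\<chi>\<close> minus the
  homotopy built so far, composed with \<open>E\<close>, maps into cycles, hence lifts through the
  next matrix. That \<open>h 0\<close> is zero is kept in the conclusion: in degree 0 of Tor the
  augmentation is dropped, and the term of the homotopy passing through it has to disappear.\<close>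

lemma chain_homotopy_exists:
  assumes E: "exact_complex g E" and \<chi>: "\<And>i. \<chi> i \<in> mats C (g i) (g i)"
    and zero: "\<And>v. v \<in> vecs C (g 0) \<Longrightarrow> mmap (g 0) (g 0) (\<chi> 0) v = (\<lambda>_. 0)"
    and comm: "\<And>i v. v \<in> vecs C (g (Suc i)) \<Longrightarrow> mmap (g i) (g (Suc i)) (E i) (mmap (g (Suc i)) (g (Suc i)) (\<chi> (Suc i)) v) =
        mmap (g i) (g i) (\<chi> i) (mmap (g i) (g (Suc i)) (E i) v)"
  shows "\<exists>h. h 0 = (\<lambda>a b. 0) \<and> (\<forall>i. h i \<in> mats C (g (Suc i)) (g i)) \<and>
     (\<forall>i. \<forall>v\<in>vecs C (g (Suc i)). mmap (g (Suc i)) (g (Suc i)) (\<chi> (Suc i)) v =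
       (\<lambda>a. mmap (g (Suc i)) (g (Suc (Suc i))) (E (Suc i)) (mmap (g (Suc (Suc i))) (g (Suc i)) (h (Suc i)) v) a
          + mmap (g (Suc i)) (g i) (h i) (mmap (g i) (g (Suc i)) (E i) v) a))"
proof -
  define P where "P i h \<longleftrightarrow> h \<in> mats C (g (Suc i)) (g i) \<and> (i = 0 \<longrightarrow> h = (\<lambda>a b. 0)) \<and>
     (\<forall>v\<in>vecs C (g (Suc i)). mmap (g i) (g (Suc i)) (E i) (\<lambda>a. mmap (g (Suc i)) (g (Suc i)) (\<chi> (Suc i)) v a -
         mmap (g (Suc i)) (g i) h (mmap (g i) (g (Suc i)) (E i) v) a) = (\<lambda>_. 0))" for i h
  define Q where "Q i h h' \<longleftrightarrow> (\<forall>v\<in>vecs C (g (Suc i)). mmap (g (Suc i)) (g (Suc i)) (\<chi> (Suc i)) v =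
       (\<lambda>a. mmap (g (Suc i)) (g (Suc (Suc i))) (E (Suc i)) (mmap (g (Suc (Suc i))) (g (Suc i)) h' v) a
          + mmap (g (Suc i)) (g i) h (mmap (g i) (g (Suc i)) (E i) v) a))" for i h h'
  have "\<exists>f. \<forall>n. P n (f n) \<and> Q n (f n) (f (Suc n))"
  proof (rule dependent_nat_choice)
    have "mmap (g 0) (g 0) (\<chi> 0) (mmap (g 0) (g (Suc 0)) (E 0) v) = (\<lambda>_. 0)" if "v \<in> vecs C (g (Suc 0))" for v
      by (rule zero) (intro mmap_C exact_complex_mats[OF E] that)
    moreover have "mmap p q (\<lambda>_ _. 0) v = (\<lambda>_. 0)" for p q and v :: "nat \<Rightarrow> 'r"
      by (simp add: mmap_def fun_eq_iff)
    ultimately have "P 0 (\<lambda>_ _. 0)" unfolding P_def by (simp add: mats_def zero_C comm)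
    then show "\<exists>x. P 0 x" by (rule exI[of "P 0"])
  next
    fix h n assume p: "P n h"
    define A where "A = (\<lambda>a b. \<chi> (Suc n) a b - mmult (g n) h (E n) a b)"
    have A: "mmap (g (Suc n)) (g (Suc n)) A v = (\<lambda>a. mmap (g (Suc n)) (g (Suc n)) (\<chi> (Suc n)) v a -
         mmap (g (Suc n)) (g n) h (mmap (g n) (g (Suc n)) (E n) v) a)" for v
      unfolding A_def mmap_mat_diff mmap_mmap ..
    have hC: "h \<in> mats C (g (Suc n)) (g n)" using p P_def by blast
    have AC: "A \<in> mats C (g (Suc n)) (g (Suc n))"
      using \<chi>[of "Suc n"] mmult_C[OF hC exact_complex_mats[OF E]]
      unfolding A_def mats_def by (auto intro: diff_C)
    have "\<exists>B\<in>mats C (g (Suc (Suc n))) (g (Suc n)). \<forall>v. mmap (g (Suc n)) (g (Suc (Suc n))) (E (Suc n)) (mmap (g (Suc (Suc n))) (g (Suc n)) B v) =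
        mmap (g (Suc n)) (g (Suc n)) A v"
    proof (rule mat_lift[OF AC])
      fix v assume v: "v \<in> vecs C (g (Suc n))"
      show "mmap (g (Suc n)) (g (Suc n)) A v \<in> mmap (g (Suc n)) (g (Suc (Suc n))) (E (Suc n)) ` vecs C (g (Suc (Suc n)))"
        using p v by (intro exact_complex_im[OF E] mmap_C AC) (auto simp: A P_def)
    qed
    then obtain B where B: "B\<in>mats C (g (Suc (Suc n))) (g (Suc n))"
      "\<And>v. mmap (g (Suc n)) (g (Suc (Suc n))) (E (Suc n)) (mmap (g (Suc (Suc n))) (g (Suc n)) B v) =
        mmap (g (Suc n)) (g (Suc n)) A v" by blast
    have "Q n h B" unfolding Q_def B(2) A by auto
    moreover have "P (Suc n) B" unfolding P_def
    proof (intro conjI ballI B)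
      fix v assume v: "v \<in> vecs C (g (Suc (Suc n)))"
      have z: "mmap (g n) (g (Suc n)) (E n) (mmap (g (Suc n)) (g (Suc (Suc n))) (E (Suc n)) v) = (\<lambda>_. 0)"
        using exact_complex_sq[OF E v] .
      show "mmap (g (Suc n)) (g (Suc (Suc n))) (E (Suc n)) (\<lambda>a. mmap (g (Suc (Suc n))) (g (Suc (Suc n))) (\<chi> (Suc (Suc n))) v a -
         mmap (g (Suc (Suc n))) (g (Suc n)) B (mmap (g (Suc n)) (g (Suc (Suc n))) (E (Suc n)) v) a) = (\<lambda>_. 0)"
        unfolding mmap_diff comm[OF v] B(2) A z mmap_zero by simp
    qed auto
    ultimately show "\<exists>y. P (Suc n) y \<and> Q n h y" by blast
  qed
  then show ?thesis unfolding P_def Q_def by blast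
qed

end

section \<open>Independence of Tor from the resolution\<close>

text \<open>Degree \<open>j\<close> lives in position \<open>Suc j\<close>. In degree 0 everything
  is a cycle, since position 0 of \<open>exact_complex\<close> does not belong to the complex that
  computes Tor.\<close>

definition tor_cyc :: "(nat \<Rightarrow> nat) \<Rightarrow> (nat \<Rightarrow> nat \<Rightarrow> nat \<Rightarrow> 'f::comm_ring_1) \<Rightarrow> nat \<Rightarrow> (nat \<Rightarrow> 'f) set" where
  "tor_cyc g E j = {v \<in> vecs UNIV (g (Suc j)). j = 0 \<or> mmap (g j) (g (Suc j)) (E j) v = (\<lambda>_. 0)}"

definition tor_bnd :: "(nat \<Rightarrow> nat) \<Rightarrow> (nat \<Rightarrow> nat \<Rightarrow> nat \<Rightarrow> 'f::comm_ring_1) \<Rightarrow> nat \<Rightarrow> (nat \<Rightarrow> 'f) set" where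
  "tor_bnd g E j = mmap (g (Suc j)) (g (Suc (Suc j))) (E (Suc j)) ` vecs UNIV (g (Suc (Suc j)))"

lemma subsp_tor_cyc: "subsp (tor_cyc g E j)"
  unfolding subsp_def tor_cyc_def by (auto simp: vecs_def mmap_add mmap_scale mmap_zero)

lemma subsp_tor_bnd: "subsp (tor_bnd g E j)"
  unfolding subsp_def tor_bnd_def
proof (intro conjI ballI allI)
  let ?D = "mmap (g (Suc j)) (g (Suc (Suc j))) (E (Suc j))"
  let ?V = "vecs UNIV (g (Suc (Suc j)))"
  show "(\<lambda>_. 0) \<in> ?D ` ?V"
    by (rule image_eqI[of _ _ "\<lambda>_. 0"]) (auto simp: mmap_zero vecs_def)
  fix v assume "v \<in> ?D ` ?V" then obtain x where x: "v = ?D x" "x \<in> ?V" by blast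
  show "(\<lambda>a. c * v a) \<in> ?D ` ?V" for c
    by (rule image_eqI[of _ _ "\<lambda>b. c * x b"]) (use x in \<open>auto simp: mmap_scale vecs_def\<close>)
  fix w assume "w \<in> ?D ` ?V" then obtain y where y: "w = ?D y" "y \<in> ?V" by blast
  show "(\<lambda>a. v a + w a) \<in> ?D ` ?V"
    by (rule image_eqI[of _ _ "\<lambda>b. x b + y b"]) (use x y in \<open>auto simp: mmap_add vecs_def\<close>)
qed

lemma mmap_id: "v \<in> vecs C p \<Longrightarrow> mmap p p (\<lambda>a b. if a = b then 1 else 0) v = v"
proof -
  have "(if a = b then 1 else 0) * v b = (if b = a then v b else 0)" for a b by simp
  then show "v \<in> vecs C p \<Longrightarrow> mmap p p (\<lambda>a b. if a = b then 1 else 0) v = v"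
    by (auto simp: mmap_def vecs_def fun_eq_iff)
qed

lemma mmap_UNIV: "mmap p q A v \<in> vecs UNIV p"
  by (auto simp: mmap_def vecs_def)

text \<open>The model is the constant term of a polynomial. Surjectivity lets each vector over the
  residue ring be lifted, so identities between matrix maps over \<open>C\<close> descend.\<close>

locale residue_map = subring_set C for C :: "'r::comm_ring_1 set" +
  fixes \<pi> :: "'r \<Rightarrow> 'f::comm_ring_1"
  assumes pi_zero: "\<pi> 0 = 0" and pi_one: "\<pi> 1 = 1"
    and pi_add: "\<And>x y. x \<in> C \<Longrightarrow> y \<in> C \<Longrightarrow> \<pi> (x + y) = \<pi> x + \<pi> y"
    and pi_mult: "\<And>x y. x \<in> C \<Longrightarrow> y \<in> C \<Longrightarrow> \<pi> (x * y) = \<pi> x * \<pi> y"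
    and pi_surj: "\<And>y. \<exists>x\<in>C. \<pi> x = y"
begin

lemma pi_sum: "(\<And>x. x \<in> A \<Longrightarrow> f x \<in> C) \<Longrightarrow> \<pi> (sum f A) = (\<Sum>x\<in>A. \<pi> (f x))"
  by (induction A rule: infinite_finite_induct) (auto simp: pi_zero pi_add sum_C)

lemma pi_mmap: "A \<in> mats C p q \<Longrightarrow> v \<in> vecs C q \<Longrightarrow>
   (\<lambda>a. \<pi> (mmap p q A v a)) = mmap p q (\<lambda>a b. \<pi> (A a b)) (\<lambda>b. \<pi> (v b))"
  by (auto simp: mmap_def fun_eq_iff mats_def vecs_def pi_zero intro!: trans[OF pi_sum] sum.cong pi_mult mult_C)

lemma vecs_C: "v \<in> vecs C q \<Longrightarrow> v a \<in> C"
  using zero_C by (cases "a < q") (auto simp: vecs_def)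

lemma pi_vecs_surj: assumes "w \<in> vecs UNIV q" obtains v where "v \<in> vecs C q" "w = (\<lambda>b. \<pi> (v b))"
proof -
  obtain s where s: "\<And>y. s y \<in> C \<and> \<pi> (s y) = y" using pi_surj by metis
  show thesis
    by (rule that[of "\<lambda>b. if b < q then s (w b) else 0"])
      (use assms s in \<open>auto simp: vecs_def fun_eq_iff pi_zero\<close>)
qed

abbreviation red :: "(nat \<Rightarrow> nat \<Rightarrow> nat \<Rightarrow> 'r) \<Rightarrow> nat \<Rightarrow> nat \<Rightarrow> nat \<Rightarrow> 'f" where
  "red E \<equiv> \<lambda>i a b. \<pi> (E i a b)"

definition chain_map where
  "chain_map g E g' E' \<phi> \<longleftrightarrow> \<phi> 0 = (\<lambda>a b. if a = b then 1 else 0) \<and> (\<forall>i. \<phi> i \<in> mats C (g' i) (g i)) \<and>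
     (\<forall>i. \<forall>v\<in>vecs C (g (Suc i)). mmap (g' i) (g' (Suc i)) (E' i) (mmap (g' (Suc i)) (g (Suc i)) (\<phi> (Suc i)) v) =
        mmap (g' i) (g i) (\<phi> i) (mmap (g i) (g (Suc i)) (E i) v))"

lemma chain_map_red:
  assumes E: "exact_complex g E" "exact_complex g' E'" and \<phi>: "chain_map g E g' E' \<phi>"
    and v: "v \<in> vecs UNIV (g (Suc i))"
  shows "mmap (g' i) (g' (Suc i)) (red E' i) (mmap (g' (Suc i)) (g (Suc i)) (red \<phi> (Suc i)) v) =
        mmap (g' i) (g i) (red \<phi> i) (mmap (g i) (g (Suc i)) (red E i) v)"
proof -
  obtain w where w: "w \<in> vecs C (g (Suc i))" "v = (\<lambda>b. \<pi> (w b))" using pi_vecs_surj[OF v] .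
  have \<phi>C: "\<phi> k \<in> mats C (g' k) (g k)" for k using \<phi> unfolding chain_map_def by blast
  note m = exact_complex_mats[OF E(1)] exact_complex_mats[OF E(2)]
  have "mmap (g' i) (g' (Suc i)) (E' i) (mmap (g' (Suc i)) (g (Suc i)) (\<phi> (Suc i)) w) =
        mmap (g' i) (g i) (\<phi> i) (mmap (g i) (g (Suc i)) (E i) w)"
    using \<phi> w(1) unfolding chain_map_def by blast
  then have "(\<lambda>a. \<pi> (mmap (g' i) (g' (Suc i)) (E' i) (mmap (g' (Suc i)) (g (Suc i)) (\<phi> (Suc i)) w) a)) =
        (\<lambda>a. \<pi> (mmap (g' i) (g i) (\<phi> i) (mmap (g i) (g (Suc i)) (E i) w) a))" by simp
  then show ?thesis unfolding w(2) by (simp only: pi_mmap mmap_C m \<phi>C w(1))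
qed

lemma tor_map:
  assumes E: "exact_complex g E" "exact_complex g' E'" and \<phi>: "chain_map g E g' E' \<phi>"
  shows "v \<in> tor_cyc g (red E) j \<Longrightarrow> mmap (g' (Suc j)) (g (Suc j)) (red \<phi> (Suc j)) v \<in> tor_cyc g' (red E') j"
    and "v \<in> tor_bnd g (red E) j \<Longrightarrow> mmap (g' (Suc j)) (g (Suc j)) (red \<phi> (Suc j)) v \<in> tor_bnd g' (red E') j"
proof -
  assume "v \<in> tor_cyc g (red E) j"
  then show "mmap (g' (Suc j)) (g (Suc j)) (red \<phi> (Suc j)) v \<in> tor_cyc g' (red E') j"
    using chain_map_red[OF E \<phi>] by (auto simp: tor_cyc_def mmap_UNIV mmap_zero)
next
  assume "v \<in> tor_bnd g (red E) j"
  then obtain w where w: "w \<in> vecs UNIV (g (Suc (Suc j)))" "v = mmap (g (Suc j)) (g (Suc (Suc j))) (red E (Suc j)) w"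
    unfolding tor_bnd_def by blast
  show "mmap (g' (Suc j)) (g (Suc j)) (red \<phi> (Suc j)) v \<in> tor_bnd g' (red E') j"
    unfolding tor_bnd_def w(2) chain_map_red[OF E \<phi> w(1), symmetric] by (intro imageI mmap_UNIV)
qed

text \<open>The composite of the two chain maps differs from the identity by
  \<open>E h + h E\<close>; after reduction the second term kills cycles and the first is a
  boundary.\<close>

lemma tor_homotopy:
  assumes E: "exact_complex g E" "exact_complex g' E'"
    and \<phi>: "chain_map g E g' E' \<phi>" and \<psi>: "chain_map g' E' g E \<psi>"
    and v: "v \<in> tor_cyc g (red E) j"
  shows "(\<lambda>a. mmap (g (Suc j)) (g' (Suc j)) (red \<psi> (Suc j)) (mmap (g' (Suc j)) (g (Suc j)) (red \<phi> (Suc j)) v) a - v a)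
     \<in> tor_bnd g (red E) j"
proof -
  have \<phi>C: "\<phi> k \<in> mats C (g' k) (g k)" and \<psi>C: "\<psi> k \<in> mats C (g k) (g' k)" for k
    using \<phi> \<psi> unfolding chain_map_def by blast+
  note m = exact_complex_mats[OF E(1)] exact_complex_mats[OF E(2)]
  have g0: "g 0 = 1" "g' 0 = 1" using E unfolding exact_complex_def by auto
  define \<chi> where "\<chi> i = (\<lambda>a b. mmult (g' i) (\<psi> i) (\<phi> i) a b - (if a = b then 1 else 0))" for i
  have \<chi>: "mmap (g i) (g i) (\<chi> i) w = (\<lambda>a. mmap (g i) (g' i) (\<psi> i) (mmap (g' i) (g i) (\<phi> i) w) a - w a)"
    if "w \<in> vecs C (g i)" for i w
    unfolding \<chi>_def mmap_mat_diff mmap_mmap mmap_id[OF that] ..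
  have "\<exists>h. h 0 = (\<lambda>a b. 0) \<and> (\<forall>i. h i \<in> mats C (g (Suc i)) (g i)) \<and>
     (\<forall>i. \<forall>v\<in>vecs C (g (Suc i)). mmap (g (Suc i)) (g (Suc i)) (\<chi> (Suc i)) v =
       (\<lambda>a. mmap (g (Suc i)) (g (Suc (Suc i))) (E (Suc i)) (mmap (g (Suc (Suc i))) (g (Suc i)) (h (Suc i)) v) a
          + mmap (g (Suc i)) (g i) (h i) (mmap (g i) (g (Suc i)) (E i) v) a))"
  proof (rule chain_homotopy_exists[OF E(1)])
    show "\<chi> i \<in> mats C (g i) (g i)" for i
      using mmult_C[OF \<psi>C \<phi>C] unfolding \<chi>_def mats_def by (auto intro!: diff_C zero_C one_C)
    show "mmap (g 0) (g 0) (\<chi> 0) w = (\<lambda>_. 0)" if "w \<in> vecs C (g 0)" for w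
    proof -
      have "\<phi> 0 = (\<lambda>a b. if a = b then 1 else 0)" "\<psi> 0 = (\<lambda>a b. if a = b then 1 else 0)"
        using \<phi> \<psi> unfolding chain_map_def by auto
      then show ?thesis unfolding \<chi>[OF that] using that by (simp add: g0 mmap_id[where C = C])
    qed
    fix i w assume w: "w \<in> vecs C (g (Suc i))"
    have w': "mmap (g i) (g (Suc i)) (E i) w \<in> vecs C (g i)" by (intro mmap_C m w)
    have \<phi>w: "mmap (g' (Suc i)) (g (Suc i)) (\<phi> (Suc i)) w \<in> vecs C (g' (Suc i))" by (intro mmap_C \<phi>C w)
    have 1: "mmap (g' i) (g' (Suc i)) (E' i) (mmap (g' (Suc i)) (g (Suc i)) (\<phi> (Suc i)) w) =
        mmap (g' i) (g i) (\<phi> i) (mmap (g i) (g (Suc i)) (E i) w)"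
      using \<phi> w unfolding chain_map_def by blast
    have 2: "mmap (g i) (g (Suc i)) (E i) (mmap (g (Suc i)) (g' (Suc i)) (\<psi> (Suc i)) (mmap (g' (Suc i)) (g (Suc i)) (\<phi> (Suc i)) w)) =
        mmap (g i) (g' i) (\<psi> i) (mmap (g' i) (g' (Suc i)) (E' i) (mmap (g' (Suc i)) (g (Suc i)) (\<phi> (Suc i)) w))"
      using \<psi> \<phi>w unfolding chain_map_def by blast
    show "mmap (g i) (g (Suc i)) (E i) (mmap (g (Suc i)) (g (Suc i)) (\<chi> (Suc i)) w) =
        mmap (g i) (g i) (\<chi> i) (mmap (g i) (g (Suc i)) (E i) w)"
      unfolding \<chi>[OF w] \<chi>[OF w'] mmap_diff 2 1 ..
  qed
  then obtain h where h: "h 0 = (\<lambda>a b. 0)" "\<And>i. h i \<in> mats C (g (Suc i)) (g i)"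
     "\<And>i v. v\<in>vecs C (g (Suc i)) \<Longrightarrow> mmap (g (Suc i)) (g (Suc i)) (\<chi> (Suc i)) v =
       (\<lambda>a. mmap (g (Suc i)) (g (Suc (Suc i))) (E (Suc i)) (mmap (g (Suc (Suc i))) (g (Suc i)) (h (Suc i)) v) a
          + mmap (g (Suc i)) (g i) (h i) (mmap (g i) (g (Suc i)) (E i) v) a)" by blast
  obtain w where w: "w \<in> vecs C (g (Suc j))" "v = (\<lambda>b. \<pi> (w b))"
    using v pi_vecs_surj unfolding tor_cyc_def by blast
  have vw: "(\<lambda>a. \<pi> (mmap (g (Suc j)) (g (Suc j)) (\<chi> (Suc j)) w a)) =
    (\<lambda>a. mmap (g (Suc j)) (g' (Suc j)) (red \<psi> (Suc j)) (mmap (g' (Suc j)) (g (Suc j)) (red \<phi> (Suc j)) v) a - v a)"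
  proof -
    have "\<pi> (x - y) = \<pi> x - \<pi> y" if "x \<in> C" "y \<in> C" for x y
    proof -
      have "\<pi> x = \<pi> ((x - y) + y)" by simp
      also have "\<dots> = \<pi> (x - y) + \<pi> y" using that diff_C by (intro pi_add) auto
      finally show ?thesis by simp
    qed
    moreover have "\<forall>a. mmap (g (Suc j)) (g' (Suc j)) (\<psi> (Suc j)) (mmap (g' (Suc j)) (g (Suc j)) (\<phi> (Suc j)) w) a \<in> C"
      using vecs_C[OF mmap_C[OF \<psi>C mmap_C[OF \<phi>C w(1)]]] by blast
    moreover have "\<forall>a. w a \<in> C" using vecs_C[OF w(1)] by blast
    ultimately show ?thesis unfolding \<chi>[OF w(1)] w(2)
      by (simp add: pi_mmap[symmetric] mmap_C \<phi>C \<psi>C w(1))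
  qed
  have "(\<lambda>a. \<pi> (mmap (g (Suc j)) (g (Suc j)) (\<chi> (Suc j)) w a)) =
     (\<lambda>a. mmap (g (Suc j)) (g (Suc (Suc j))) (red E (Suc j)) (mmap (g (Suc (Suc j))) (g (Suc j)) (red h (Suc j)) v) a
          + mmap (g (Suc j)) (g j) (red h j) (mmap (g j) (g (Suc j)) (red E j) v) a)"
  proof -
    have "\<forall>a. mmap (g (Suc j)) (g (Suc (Suc j))) (E (Suc j)) (mmap (g (Suc (Suc j))) (g (Suc j)) (h (Suc j)) w) a \<in> C"
      using vecs_C[OF mmap_C[OF m(1) mmap_C[OF h(2) w(1)]]] by blast
    moreover have "\<forall>a. mmap (g (Suc j)) (g j) (h j) (mmap (g j) (g (Suc j)) (E j) w) a \<in> C"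
      using vecs_C[OF mmap_C[OF h(2) mmap_C[OF m(1) w(1)]]] by blast
    ultimately show ?thesis unfolding h(3)[OF w(1)] w(2)
      by (simp add: pi_add pi_mmap[symmetric] mmap_C h(2) m w(1))
  qed
  \<comment> \<open>For \<open>j = 0\<close> the vector need not be annihilated by the reduced
    augmentation; here the term vanishes because \<open>h 0\<close> does.\<close>
  moreover have "mmap (g (Suc j)) (g j) (red h j) (mmap (g j) (g (Suc j)) (red E j) v) = (\<lambda>_. 0)"
  proof (cases "j = 0")
    case True
    then show ?thesis using h(1) by (simp add: mmap_def pi_zero fun_eq_iff)
  next
    case False
    then show ?thesis using v by (simp add: tor_cyc_def mmap_zero)
  qed
  ultimately show ?thesis unfolding vw tor_bnd_def by (auto intro!: imageI mmap_UNIV)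
qed

text \<open>Equal images of the generator rows give chain maps in both directions, and the
  homotopies make them inverse to each other modulo boundaries.\<close>

theorem tor_unique:
  assumes E: "exact_complex g E" and E': "exact_complex g' E'"
    and im: "mmap 1 (g 1) (E 0) ` vecs C (g 1) = mmap 1 (g' 1) (E' 0) ` vecs C (g' 1)"
  shows "quot_dim (tor_cyc g (red E) j) (tor_bnd g (red E) j) d \<longleftrightarrow>
    quot_dim (tor_cyc g' (red E') j) (tor_bnd g' (red E') j) d"
proof -
  obtain \<phi> where \<phi>: "chain_map g E g' E' \<phi>"
    using chain_map_exists[OF E E'] im unfolding chain_map_def by blast
  obtain \<psi> where \<psi>: "chain_map g' E' g E \<psi>"
    using chain_map_exists[OF E' E] im unfolding chain_map_def by blast
  let ?f = "mmap (g' (Suc j)) (g (Suc j)) (red \<phi> (Suc j))"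
  let ?k = "mmap (g (Suc j)) (g' (Suc j)) (red \<psi> (Suc j))"
  show ?thesis
  proof (rule quot_dim_iso[where f = ?f, OF subsp_tor_cyc subsp_tor_bnd])
    show "linear_on (tor_cyc g (red E) j) ?f" by (simp add: linear_on_def mmap_add mmap_scale)
    show "?f z \<in> tor_cyc g' (red E') j" if "z \<in> tor_cyc g (red E) j" for z
      using tor_map(1)[OF E E' \<phi> that] .
    show "?f z \<in> tor_bnd g' (red E') j \<longleftrightarrow> z \<in> tor_bnd g (red E) j" if z: "z \<in> tor_cyc g (red E) j" for z
    proof
      assume "?f z \<in> tor_bnd g' (red E') j"
      from tor_map(2)[OF E' E \<psi> this] have "?k (?f z) \<in> tor_bnd g (red E) j" .
      from subsp_diff[OF subsp_tor_bnd this tor_homotopy[OF E E' \<phi> \<psi> z]]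
      show "z \<in> tor_bnd g (red E) j" by simp
    qed (rule tor_map(2)[OF E E' \<phi>])
    fix z' assume z': "z' \<in> tor_cyc g' (red E') j"
    show "\<exists>z\<in>tor_cyc g (red E) j. (\<lambda>b. z' b - ?f z b) \<in> tor_bnd g' (red E') j"
    proof (rule bexI)
      show "(\<lambda>b. z' b - ?f (?k z') b) \<in> tor_bnd g' (red E') j"
        using subsp_scale[OF subsp_tor_bnd tor_homotopy[OF E' E \<psi> \<phi> z'], of "-1"] by simp
    qed (rule tor_map(1)[OF E' E \<psi> z'])
  qed
qed

end

section \<open>Resolutions from labelled complexes\<close>

lemma finite_submset: "finite {u. u \<subseteq># (m::'a multiset)}"
proof (induction m)
  case (add x m)
  have "{u. u \<subseteq># add_mset x m} \<subseteq> {u. u \<subseteq># m} \<union> add_mset x ` {u. u \<subseteq># m}"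
  proof
    fix u assume u: "u \<in> {u. u \<subseteq># add_mset x m}"
    show "u \<in> {u. u \<subseteq># m} \<union> add_mset x ` {u. u \<subseteq># m}"
    proof (cases "x \<in># u")
      case True
      then have "u = add_mset x (u - {#x#})" by simp
      moreover have "u - {#x#} \<subseteq># m" using u by (simp add: subset_eq_diff_conv)
      ultimately show ?thesis by blast
    next
      case False
      then have "u - {#x#} = u" by simp
      moreover have "u - {#x#} \<subseteq># m" using u by (simp add: subset_eq_diff_conv)
      ultimately show ?thesis by simp
    qed
  qed
  then show ?case using add.IH finite_subset by blast
qed simp

text \<open>The sum over submultisets is the form in which \<open>mpoly_ring\<close> defines its
  product; this is the bridge between the type-class product and the record.\<close>

lemma lookup_times_mset:
  fixes p q :: "'v multiset \<Rightarrow>\<^sub>0 'f::comm_ring_1"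
  shows "Poly_Mapping.lookup (p * q) m = (\<Sum>u\<in>{u. u \<subseteq># m}. Poly_Mapping.lookup p u * Poly_Mapping.lookup q (m - u))"
proof -
  have inner: "(\<Sum>r. Poly_Mapping.lookup q r when m = l + r) = (if l \<subseteq># m then Poly_Mapping.lookup q (m - l) else 0)" for l
  proof (cases "l \<subseteq># m")
    case True
    then have "m = l + r \<longleftrightarrow> r = m - l" for r by auto
    then show ?thesis using True by simp
  next
    case False
    then have "m \<noteq> l + r" for r by auto
    then show ?thesis using False by simp
  qed
  have "Poly_Mapping.lookup (p * q) m = (\<Sum>l. Poly_Mapping.lookup p l * (if l \<subseteq># m then Poly_Mapping.lookup q (m - l) else 0))"
    by (simp add: lookup_mult inner)
  also have "\<dots> = (\<Sum>l\<in>{u. u \<subseteq># m}. Poly_Mapping.lookup p l * (if l \<subseteq># m then Poly_Mapping.lookup q (m - l) else 0))"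
    by (rule Sum_any.expand_superset) (auto simp: finite_submset split: if_splits)
  finally show ?thesis by simp
qed

lemma lookup_single_times:
  fixes p :: "'v multiset \<Rightarrow>\<^sub>0 'f::comm_ring_1"
  shows "Poly_Mapping.lookup (Poly_Mapping.single u c * p) m = (if u \<subseteq># m then c * Poly_Mapping.lookup p (m - u) else 0)"
proof -
  have "Poly_Mapping.lookup (Poly_Mapping.single u c) w * Poly_Mapping.lookup p (m - w) = (if w = u then c * Poly_Mapping.lookup p (m - u) else 0)" for w
    by (simp add: lookup_single when_def)
  then show ?thesis unfolding lookup_times_mset by (simp add: finite_submset)
qed

text \<open>The type of multisets over \<open>nat\<close> offers infinitely many variables, so the
  ring in \<open>n\<close> variables is a subset of the type. This is the reason for working over
  subrings \<open>C\<close> throughout.\<close>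

definition vpolys :: "nat \<Rightarrow> (nat multiset \<Rightarrow>\<^sub>0 'f::comm_ring_1) set" where
  "vpolys n = {p. \<forall>m\<in>Poly_Mapping.keys p. set_mset m \<subseteq> {..<n}}"

lemma single_vpolys: "set_mset m \<subseteq> {..<n} \<Longrightarrow> Poly_Mapping.single m c \<in> vpolys n"
  unfolding vpolys_def by (auto split: if_splits)

lemma residue_map_vpolys: "residue_map (vpolys n) (\<lambda>p. Poly_Mapping.lookup p {#} :: 'f::comm_ring_1)"
proof
  show "x + y \<in> vpolys n" if "x \<in> vpolys n" "y \<in> vpolys n" for x y :: "nat multiset \<Rightarrow>\<^sub>0 'f"
    using that keys_add[of x y] unfolding vpolys_def by blast
  show "x * y \<in> vpolys n" if xy: "x \<in> vpolys n" "y \<in> vpolys n" for x y :: "nat multiset \<Rightarrow>\<^sub>0 'f"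
  proof -
    have "set_mset m \<subseteq> {..<n}" if m: "m \<in> Poly_Mapping.keys (x * y)" for m
    proof -
      obtain a b where "m = a + b" "a \<in> Poly_Mapping.keys x" "b \<in> Poly_Mapping.keys y" using m keys_mult[of x y] by blast
      then show ?thesis using xy unfolding vpolys_def by force
    qed
    then show ?thesis unfolding vpolys_def by blast
  qed
  show "Poly_Mapping.lookup (x * y) {#} = Poly_Mapping.lookup x {#} * Poly_Mapping.lookup y {#}" for x y :: "nat multiset \<Rightarrow>\<^sub>0 'f"
    by (simp add: lookup_times_mset)
  show "\<exists>x\<in>vpolys n. Poly_Mapping.lookup x {#} = y" for y :: 'f
    by (rule bexI[of _ "Poly_Mapping.single {#} y"]) (auto intro: single_vpolys)
  show "Poly_Mapping.lookup (1 :: nat multiset \<Rightarrow>\<^sub>0 'f) {#} = 1" by (simp add: lookup_one)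
qed (auto simp: vpolys_def lookup_add in_keys_iff lookup_one when_def split: if_splits)

section \<open>Chains, cycles and boundaries of a based complex\<close>

definition chain_space :: "'c set \<Rightarrow> ('c \<Rightarrow> nat) \<Rightarrow> nat \<Rightarrow> ('c \<Rightarrow> 'f::comm_ring_1) set" where
  "chain_space K dm i = {c. \<forall>x. c x \<noteq> 0 \<longrightarrow> x \<in> K \<and> dm x = i}"

definition bdry :: "'c set \<Rightarrow> ('c \<Rightarrow> 'c \<Rightarrow> 'f::comm_ring_1) \<Rightarrow> ('c \<Rightarrow> 'f) \<Rightarrow> ('c \<Rightarrow> 'f)" where
  "bdry K \<epsilon> c = (\<lambda>b. if b \<in> K then \<Sum>a\<in>K. c a * \<epsilon> a b else 0)"

definition cyc :: "'c set \<Rightarrow> ('c \<Rightarrow> nat) \<Rightarrow> ('c \<Rightarrow> 'c \<Rightarrow> 'f::comm_ring_1) \<Rightarrow> nat \<Rightarrow> ('c \<Rightarrow> 'f) set" where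
  "cyc K dm \<epsilon> i = {c \<in> chain_space K dm i. bdry K \<epsilon> c = (\<lambda>_. 0)}"

definition bnd :: "'c set \<Rightarrow> ('c \<Rightarrow> nat) \<Rightarrow> ('c \<Rightarrow> 'c \<Rightarrow> 'f::comm_ring_1) \<Rightarrow> nat \<Rightarrow> ('c \<Rightarrow> 'f) set" where
  "bnd K dm \<epsilon> i = bdry K \<epsilon> ` chain_space K dm (Suc i)"

lemma bdry_add: "bdry K \<epsilon> (\<lambda>a. v a + w a) = (\<lambda>a. bdry K \<epsilon> v a + bdry K \<epsilon> w a)"
  and bdry_diff: "bdry K \<epsilon> (\<lambda>a. v a - w a) = (\<lambda>a. bdry K \<epsilon> v a - bdry K \<epsilon> w a)"
  and bdry_scale: "bdry K \<epsilon> (\<lambda>a. k * v a) = (\<lambda>a. k * bdry K \<epsilon> v a)"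
  and bdry_zero: "bdry K \<epsilon> (\<lambda>_. 0) = (\<lambda>_. 0)"
  by (auto simp: bdry_def fun_eq_iff algebra_simps sum.distrib sum_subtractf sum_distrib_left)

lemma chain_space_iff: "c \<in> chain_space K dm i \<longleftrightarrow> (\<forall>x. \<not> (x \<in> K \<and> dm x = i) \<longrightarrow> c x = 0)"
  by (auto simp: chain_space_def)

lemma chains_zero: "(\<lambda>_. 0) \<in> chain_space K dm i"
  and chains_add: "v \<in> chain_space K dm i \<Longrightarrow> w \<in> chain_space K dm i \<Longrightarrow> (\<lambda>a. v a + w a) \<in> chain_space K dm i"
  and chains_diff: "v \<in> chain_space K dm i \<Longrightarrow> w \<in> chain_space K dm i \<Longrightarrow> (\<lambda>a. v a - w a) \<in> chain_space K dm i"
  and chains_scale: "v \<in> chain_space K dm i \<Longrightarrow> (\<lambda>a. k * v a) \<in> chain_space K dm i"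
  by (auto simp: chain_space_iff)

lemma subsp_cyc: "subsp (cyc K dm \<epsilon> i)"
  unfolding subsp_def cyc_def by (auto simp: chains_zero chains_add chains_scale bdry_add bdry_scale bdry_zero)

lemma bnd_I: "x \<in> chain_space K dm (Suc i) \<Longrightarrow> v = bdry K \<epsilon> x \<Longrightarrow> v \<in> bnd K dm \<epsilon> i"
  by (simp add: bnd_def)

lemma bnd_E:
  assumes "v \<in> bnd K dm \<epsilon> i" obtains x where "x \<in> chain_space K dm (Suc i)" "v = bdry K \<epsilon> x"
  using assms by (auto simp: bnd_def)

lemma subsp_bnd: "subsp (bnd K dm \<epsilon> i)"
  unfolding subsp_def
proof (intro conjI ballI allI)
  show "(\<lambda>_. 0) \<in> bnd K dm \<epsilon> i"
    by (rule bnd_I[OF chains_zero]) (simp add: bdry_zero)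
  fix v assume "v \<in> bnd K dm \<epsilon> i"
  from bnd_E[OF this] obtain x where x: "x \<in> chain_space K dm (Suc i)" "v = bdry K \<epsilon> x" .
  show "(\<lambda>a. k * v a) \<in> bnd K dm \<epsilon> i" for k
    by (rule bnd_I[OF chains_scale[OF x(1), of k]]) (simp add: x bdry_scale)
  fix w assume "w \<in> bnd K dm \<epsilon> i"
  from bnd_E[OF this] obtain y where y: "y \<in> chain_space K dm (Suc i)" "w = bdry K \<epsilon> y" .
  show "(\<lambda>a. v a + w a) \<in> bnd K dm \<epsilon> i"
    by (rule bnd_I[OF chains_add[OF x(1) y(1)]]) (simp add: x y bdry_add)
qed

text \<open>The cell \<open>z\<close> is the augmentation cell, the only one of dimension 0: the cells of
  dimension \<open>i + 1\<close> index the basis of the \<open>i\<close>-th free module.\<close>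

locale labelled_complex =
  fixes n :: nat and K :: "'c set" and dm :: "'c \<Rightarrow> nat" and \<epsilon> :: "'c \<Rightarrow> 'c \<Rightarrow> 'f::comm_ring_1"
    and l :: "'c \<Rightarrow> nat multiset" and z :: 'c
  assumes fin: "finite K" and zX: "z \<in> K" and dim0: "\<And>x. x \<in> K \<Longrightarrow> dm x = 0 \<longleftrightarrow> x = z"
    and lz: "l z = {#}" and lvars: "\<And>x. x \<in> K \<Longrightarrow> set_mset (l x) \<subseteq> {..<n}"
    and inc: "\<And>a b. a \<in> K \<Longrightarrow> b \<in> K \<Longrightarrow> \<epsilon> a b \<noteq> 0 \<Longrightarrow> dm a = Suc (dm b) \<and> l b \<subseteq># l a"
    and inc_z: "\<And>a. a \<in> K \<Longrightarrow> dm a = 1 \<Longrightarrow> \<epsilon> a z = 1"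
    and sq: "\<And>a b. a \<in> K \<Longrightarrow> b \<in> K \<Longrightarrow> (\<Sum>x\<in>K. \<epsilon> a x * \<epsilon> x b) = 0"
    and strand_exact: "\<And>\<nu> i c. set_mset \<nu> \<subseteq> {..<n} \<Longrightarrow> c \<in> chain_space {x\<in>K. l x \<subseteq># \<nu>} dm (Suc i) \<Longrightarrow>
       bdry K \<epsilon> c = (\<lambda>_. 0) \<Longrightarrow> \<exists>c'\<in>chain_space {x\<in>K. l x \<subseteq># \<nu>} dm (Suc (Suc i)). bdry K \<epsilon> c' = c"
begin

definition level :: "nat \<Rightarrow> 'c set" where "level i = {x\<in>K. dm x = i}"
definition rk :: "nat \<Rightarrow> nat" where "rk i = card (level i)"
definition en :: "nat \<Rightarrow> nat \<Rightarrow> 'c" where "en i = (SOME f. bij_betw f {..<rk i} (level i))"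
definition idx :: "nat \<Rightarrow> 'c \<Rightarrow> nat" where "idx i = inv_into {..<rk i} (en i)"
text \<open>The homogenised differential: an incidence is multiplied by the quotient of the labels
  of the two cells.\<close>

definition E :: "nat \<Rightarrow> nat \<Rightarrow> nat \<Rightarrow> nat multiset \<Rightarrow>\<^sub>0 'f" where
  "E i a b = Poly_Mapping.single (l (en (Suc i) b) - l (en i a)) (\<epsilon> (en (Suc i) b) (en i a))"

text \<open>The component of multidegree \<open>\<nu>\<close> of an element of the free module, read
  as a chain on the cells whose label divides \<open>\<nu>\<close>. It turns exactness over the
  polynomial ring into exactness over the coefficients.\<close>

definition strand :: "nat \<Rightarrow> (nat \<Rightarrow> nat multiset \<Rightarrow>\<^sub>0 'f) \<Rightarrow> nat multiset \<Rightarrow> 'c \<Rightarrow> 'f" where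
  "strand i v \<nu> x = (if x \<in> level i \<and> l x \<subseteq># \<nu> then Poly_Mapping.lookup (v (idx i x)) (\<nu> - l x) else 0)"

sublocale residue_map "vpolys n" "\<lambda>p. Poly_Mapping.lookup p {#} :: 'f" by (rule residue_map_vpolys)

lemma finite_level: "finite (level i)" using fin by (simp add: level_def)

lemma en_bij: "bij_betw (en i) {..<rk i} (level i)"
proof -
  have "\<exists>f. bij_betw f {..<rk i} (level i)"
    using ex_bij_betw_nat_finite[OF finite_level[of i]] by (auto simp: rk_def atLeast0LessThan)
  then show ?thesis unfolding en_def by (rule someI_ex)
qed

lemma en_level: "b < rk i \<Longrightarrow> en i b \<in> level i" using bij_betwE[OF en_bij] by auto
lemma idx_less: "x \<in> level i \<Longrightarrow> idx i x < rk i"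
  unfolding idx_def using en_bij[of i] by (metis bij_betw_def inv_into_into lessThan_iff)
lemma en_idx: "x \<in> level i \<Longrightarrow> en i (idx i x) = x"
  unfolding idx_def using en_bij[of i] by (metis bij_betw_inv_into_right)
lemma idx_en: "b < rk i \<Longrightarrow> idx i (en i b) = b"
  unfolding idx_def using en_bij[of i] by (metis bij_betw_inv_into_left lessThan_iff)

lemma level_X: "x \<in> level i \<Longrightarrow> x \<in> K" by (simp add: level_def)

lemma sum_level: "c \<in> chain_space K dm i \<Longrightarrow> (\<Sum>a\<in>K. c a * k a) = (\<Sum>a\<in>level i. c a * k a)"
  by (rule sum.mono_neutral_right) (auto simp: fin level_def chain_space_iff)

lemma strand_chain: "strand i v \<nu> \<in> chain_space {x\<in>K. l x \<subseteq># \<nu>} dm i"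
  by (auto simp: chain_space_def strand_def level_def)

lemma chains_mono: "A \<subseteq> B \<Longrightarrow> chain_space A dm i \<subseteq> chain_space B dm i"
  by (auto simp: chain_space_def)

lemma strand_chain': "strand i v \<nu> \<in> chain_space K dm i"
  by (rule subsetD[OF chains_mono strand_chain]) auto

lemma bdry_chain: "c \<in> chain_space {x\<in>K. l x \<subseteq># \<nu>} dm (Suc i) \<Longrightarrow> bdry K \<epsilon> c \<in> chain_space {x\<in>K. l x \<subseteq># \<nu>} dm i"
proof -
  assume c: "c \<in> chain_space {x\<in>K. l x \<subseteq># \<nu>} dm (Suc i)"
  show ?thesis unfolding chain_space_def
  proof (intro CollectI allI impI)
    fix b assume "bdry K \<epsilon> c b \<noteq> 0"
    then have b: "b \<in> K" "(\<Sum>a\<in>K. c a * \<epsilon> a b) \<noteq> 0" by (auto simp: bdry_def split: if_splits)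
    then obtain a where a: "a \<in> K" "c a * \<epsilon> a b \<noteq> 0" by (meson sum.not_neutral_contains_not_neutral)
    then have "c a \<noteq> 0" "\<epsilon> a b \<noteq> 0" by auto
    then show "b \<in> {x \<in> K. l x \<subseteq># \<nu>} \<and> dm b = i"
      using c inc[OF a(1) b(1)] b(1) unfolding chain_space_def by (auto intro: subset_mset.order_trans)
  qed
qed

text \<open>Multiplying by the quotient of two labels exactly compensates the different shifts
  \<open>\<nu> - l x\<close> of the two cells, so in each multidegree the matrix acts as the plain
  boundary.\<close>

lemma strand_mmap:
  "strand i (mmap (rk i) (rk (Suc i)) (E i) v) \<nu> = bdry K \<epsilon> (strand (Suc i) v \<nu>)"
proof
  fix y
  show "strand i (mmap (rk i) (rk (Suc i)) (E i) v) \<nu> y = bdry K \<epsilon> (strand (Suc i) v \<nu>) y"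
  proof (cases "y \<in> level i \<and> l y \<subseteq># \<nu>")
    case True
    have "strand i (mmap (rk i) (rk (Suc i)) (E i) v) \<nu> y = (\<Sum>b<rk (Suc i). Poly_Mapping.lookup (E i (idx i y) b * v b) (\<nu> - l y))"
      using True idx_less by (simp add: strand_def mmap_def lookup_sum)
    also have "\<dots> = (\<Sum>b<rk (Suc i). strand (Suc i) v \<nu> (en (Suc i) b) * \<epsilon> (en (Suc i) b) y)"
    proof (rule sum.cong[OF refl])
      fix b assume b: "b \<in> {..<rk (Suc i)}"
      let ?x = "en (Suc i) b"
      have x: "?x \<in> level (Suc i)" using b en_level by auto
      show "Poly_Mapping.lookup (E i (idx i y) b * v b) (\<nu> - l y) = strand (Suc i) v \<nu> ?x * \<epsilon> ?x y"
      proof (cases "\<epsilon> ?x y = 0")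
        case True
        then show ?thesis using \<open>y \<in> level i \<and> l y \<subseteq># \<nu>\<close> by (simp add: E_def en_idx)
      next
        case False
        then have xy: "l y \<subseteq># l ?x" using inc x \<open>y \<in> level i \<and> l y \<subseteq># \<nu>\<close> level_X by blast
        have 1: "l ?x - l y \<subseteq># \<nu> - l y \<longleftrightarrow> l ?x \<subseteq># \<nu>"
          using xy True by (metis subset_mset.diff_add subset_mset.add_le_cancel_right)
        have 2: "l y + (l ?x - l y) = l ?x" using xy by simp
        show ?thesis using True x b by (simp add: E_def en_idx lookup_single_times 1 2 strand_def idx_en)
      qed
    qed
    also have "\<dots> = (\<Sum>x\<in>level (Suc i). strand (Suc i) v \<nu> x * \<epsilon> x y)"
      by (rule sum.reindex_bij_betw[OF en_bij])
    also have "\<dots> = bdry K \<epsilon> (strand (Suc i) v \<nu>) y"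
      using level_X[of y i] True by (simp add: bdry_def sum_level[OF strand_chain'])
    finally show ?thesis .
  next
    case False
    then have "strand i (mmap (rk i) (rk (Suc i)) (E i) v) \<nu> y = 0" by (auto simp: strand_def)
    moreover have "bdry K \<epsilon> (strand (Suc i) v \<nu>) y = 0"
      using False bdry_chain[OF strand_chain, of i v \<nu>] unfolding chain_space_def level_def by blast
    ultimately show ?thesis by simp
  qed
qed

lemma vec_eqI:
  assumes "v \<in> vecs C (rk i)" "w \<in> vecs C' (rk i)" "\<And>\<nu>. strand i v \<nu> = strand i w \<nu>"
  shows "v = w"
proof
  fix b
  show "v b = w b"
  proof (cases "b < rk i")
    case True
    show ?thesis
    proof (rule poly_mapping_eqI)
      fix \<kappa>
      have "strand i v (\<kappa> + l (en i b)) (en i b) = strand i w (\<kappa> + l (en i b)) (en i b)" using assms(3) by simp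
      then show "Poly_Mapping.lookup (v b) \<kappa> = Poly_Mapping.lookup (w b) \<kappa>"
        using True en_level by (simp add: strand_def idx_en)
    qed
  next
    case False then show ?thesis using assms(1,2) by (simp add: vecs_def)
  qed
qed

lemma finite_strands:
  assumes "v \<in> vecs (vpolys n) (rk i)"
  shows "finite {\<nu>. strand i v \<nu> \<noteq> (\<lambda>_. 0)}" "strand i v \<nu> \<noteq> (\<lambda>_. 0) \<Longrightarrow> set_mset \<nu> \<subseteq> {..<n}"
proof -
  have *: "\<exists>b<rk i. \<exists>\<kappa>\<in>Poly_Mapping.keys (v b). \<nu> = \<kappa> + l (en i b)" if nz: "strand i v \<nu> \<noteq> (\<lambda>_. 0)" for \<nu>
  proof -
    obtain x where x: "strand i v \<nu> x \<noteq> 0" using nz by (auto simp: fun_eq_iff)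
    then have y: "x \<in> level i" "l x \<subseteq># \<nu>" "Poly_Mapping.lookup (v (idx i x)) (\<nu> - l x) \<noteq> 0"
      by (auto simp: strand_def split: if_splits)
    show ?thesis
    proof (intro exI[of _ "idx i x"] conjI bexI[of _ "\<nu> - l x"])
      show "\<nu> = \<nu> - l x + l (en i (idx i x))" using y by (simp add: en_idx)
    qed (use y idx_less in \<open>auto simp: in_keys_iff\<close>)
  qed
  have "{\<nu>. strand i v \<nu> \<noteq> (\<lambda>_. 0)} \<subseteq> (\<Union>b\<in>{..<rk i}. (\<lambda>\<kappa>. \<kappa> + l (en i b)) ` Poly_Mapping.keys (v b))"
  proof
    fix \<nu> assume "\<nu> \<in> {\<nu>. strand i v \<nu> \<noteq> (\<lambda>_. 0)}"
    then have "\<exists>b<rk i. \<exists>\<kappa>\<in>Poly_Mapping.keys (v b). \<nu> = \<kappa> + l (en i b)" using * by simp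
    then show "\<nu> \<in> (\<Union>b\<in>{..<rk i}. (\<lambda>\<kappa>. \<kappa> + l (en i b)) ` Poly_Mapping.keys (v b))" by auto
  qed
  then show "finite {\<nu>. strand i v \<nu> \<noteq> (\<lambda>_. 0)}" by (rule finite_subset) auto
  assume "strand i v \<nu> \<noteq> (\<lambda>_. 0)"
  from *[OF this] obtain b \<kappa> where b: "b < rk i" "\<kappa> \<in> Poly_Mapping.keys (v b)" "\<nu> = \<kappa> + l (en i b)" by blast
  have "set_mset \<kappa> \<subseteq> {..<n}" using b assms by (auto simp: vecs_def vpolys_def)
  then show "set_mset \<nu> \<subseteq> {..<n}" using b lvars[OF level_X[OF en_level[OF b(1)]]] by auto
qed

text \<open>Inverse to taking strands. Only finitely many multidegrees may be prescribed, as
  polynomials have finite support.\<close>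

lemma assemble:
  assumes N: "finite N" "\<And>\<nu>. \<nu> \<in> N \<Longrightarrow> set_mset \<nu> \<subseteq> {..<n}"
    and c: "\<And>\<nu>. \<nu> \<in> N \<Longrightarrow> c \<nu> \<in> chain_space {x\<in>K. l x \<subseteq># \<nu>} dm i"
  shows "\<exists>w\<in>vecs (vpolys n) (rk i). \<forall>\<nu>. strand i w \<nu> = (if \<nu> \<in> N then c \<nu> else (\<lambda>_. 0))"
proof -
  define w where "w b = (if b < rk i then \<Sum>\<nu>\<in>{\<nu>\<in>N. l (en i b) \<subseteq># \<nu>}. Poly_Mapping.single (\<nu> - l (en i b)) (c \<nu> (en i b)) else 0)" for b
  have "w \<in> vecs (vpolys n) (rk i)" unfolding vecs_def w_def
    using N(2) by (auto intro!: sum_C single_vpolys dest: in_diffD)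
  moreover have "strand i w \<nu> = (if \<nu> \<in> N then c \<nu> else (\<lambda>_. 0))" for \<nu>
  proof
    fix x
    show "strand i w \<nu> x = (if \<nu> \<in> N then c \<nu> else (\<lambda>_. 0)) x"
    proof (cases "x \<in> level i \<and> l x \<subseteq># \<nu>")
      case True
      have e: "Poly_Mapping.lookup (Poly_Mapping.single (\<nu>' - l x) (c \<nu>' x)) (\<nu> - l x) = (if \<nu>' = \<nu> then c \<nu> x else 0)"
        if "\<nu>' \<in> {\<nu>\<in>N. l x \<subseteq># \<nu>}" for \<nu>'
      proof -
        have "\<nu>' - l x = \<nu> - l x \<longleftrightarrow> \<nu>' = \<nu>" using that True by (metis (mono_tags, lifting) mem_Collect_eq subset_mset.diff_add)
        then show ?thesis by (auto simp: lookup_single when_def)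
      qed
      have "strand i w \<nu> x = (\<Sum>\<nu>'\<in>{\<nu>\<in>N. l x \<subseteq># \<nu>}. Poly_Mapping.lookup (Poly_Mapping.single (\<nu>' - l x) (c \<nu>' x)) (\<nu> - l x))"
        using True idx_less by (simp add: strand_def w_def en_idx lookup_sum)
      also have "\<dots> = (\<Sum>\<nu>'\<in>{\<nu>\<in>N. l x \<subseteq># \<nu>}. if \<nu>' = \<nu> then c \<nu> x else 0)" by (rule sum.cong[OF refl e])
      also have "\<dots> = (if \<nu> \<in> N then c \<nu> else (\<lambda>_. 0)) x" using True N(1) by (simp add: sum.delta)
      finally show ?thesis .
    next
      case False
      have "c \<nu> x = 0" if "\<nu> \<in> N" using c[OF that] False by (auto simp: chain_space_def level_def)
      then show ?thesis using False by (auto simp: strand_def)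
    qed
  qed
  ultimately show ?thesis by blast
qed

lemma E_mats: "E i \<in> mats (vpolys n) (rk i) (rk (Suc i))"
  unfolding mats_def E_def using lvars level_X en_level
  by (auto intro!: single_vpolys dest!: in_diffD) blast

lemma level0: "level 0 = {z}" using dim0 zX by (auto simp: level_def)

lemma bdry_bdry: "bdry K \<epsilon> (bdry K \<epsilon> c) = (\<lambda>_. 0)"
proof
  fix b
  have "(\<Sum>x\<in>K. (\<Sum>a\<in>K. c a * \<epsilon> a x) * \<epsilon> x b) = (\<Sum>a\<in>K. c a * (\<Sum>x\<in>K. \<epsilon> a x * \<epsilon> x b))"
    unfolding sum_distrib_left sum_distrib_right by (subst sum.swap) (simp add: mult.assoc)
  then show "bdry K \<epsilon> (bdry K \<epsilon> c) b = 0" using sq by (simp add: bdry_def)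
qed

text \<open>A cycle has finitely many nonzero strands; \<open>strand_exact\<close> fills each of
  them and \<open>assemble\<close> glues the fillings into one vector.\<close>

theorem exact: "exact_complex rk E"
  unfolding exact_complex_def
proof (intro conjI allI E_mats)
  show "rk 0 = 1" by (simp add: rk_def level0)
  fix i
  let ?D = "\<lambda>i. mmap (rk i) (rk (Suc i)) (E i)"
  let ?V = "\<lambda>i. vecs (vpolys n) (rk i)"
  have zero: "(\<lambda>_. 0 :: nat multiset \<Rightarrow>\<^sub>0 'f) \<in> vecs (vpolys n) m" for m :: nat by (simp add: vecs_def zero_C)
  have strand_0: "strand i (\<lambda>_. 0) \<nu> = (\<lambda>_. 0)" for i \<nu> by (auto simp: strand_def)
  show "{v \<in> ?V (Suc i). ?D i v = (\<lambda>_. 0)} = ?D (Suc i) ` ?V (Suc (Suc i))"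
  proof (intro equalityI subsetI)
    fix v assume "v \<in> {v \<in> ?V (Suc i). ?D i v = (\<lambda>_. 0)}"
    then have v: "v \<in> ?V (Suc i)" "?D i v = (\<lambda>_. 0)" by auto
    let ?N = "{\<nu>. strand (Suc i) v \<nu> \<noteq> (\<lambda>_. 0)}"
    define c where "c \<nu> = (SOME c'. c' \<in> chain_space {x\<in>K. l x \<subseteq># \<nu>} dm (Suc (Suc i)) \<and>
      bdry K \<epsilon> c' = strand (Suc i) v \<nu>)" for \<nu>
    have c: "c \<nu> \<in> chain_space {x\<in>K. l x \<subseteq># \<nu>} dm (Suc (Suc i)) \<and> bdry K \<epsilon> (c \<nu>) = strand (Suc i) v \<nu>"
      if \<nu>: "\<nu> \<in> ?N" for \<nu>
    proof -
      have "\<exists>c'\<in>chain_space {x\<in>K. l x \<subseteq># \<nu>} dm (Suc (Suc i)). bdry K \<epsilon> c' = strand (Suc i) v \<nu>"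
        using \<nu> finite_strands(2)[OF v(1)] strand_mmap[of i v \<nu>]
        by (intro strand_exact strand_chain) (auto simp: v(2) strand_0)
      then show ?thesis unfolding c_def Bex_def by (rule someI_ex)
    qed
    have "\<exists>w\<in>?V (Suc (Suc i)). \<forall>\<nu>. strand (Suc (Suc i)) w \<nu> = (if \<nu> \<in> ?N then c \<nu> else (\<lambda>_. 0))"
      using finite_strands[OF v(1)] c by (intro assemble) auto
    then obtain w where w: "w \<in> ?V (Suc (Suc i))" "\<And>\<nu>. strand (Suc (Suc i)) w \<nu> = (if \<nu> \<in> ?N then c \<nu> else (\<lambda>_. 0))"
      by blast
    have "v = ?D (Suc i) w"
      by (rule vec_eqI[OF v(1) mmap_C[OF E_mats w(1)]]) (use c in \<open>auto simp: strand_mmap w(2) bdry_zero\<close>)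
    then show "v \<in> ?D (Suc i) ` ?V (Suc (Suc i))" using w(1) by blast
  next
    fix v assume "v \<in> ?D (Suc i) ` ?V (Suc (Suc i))"
    then obtain w where w: "w \<in> ?V (Suc (Suc i))" "v = ?D (Suc i) w" by blast
    have "v \<in> ?V (Suc i)" unfolding w(2) by (rule mmap_C[OF E_mats w(1)])
    moreover from this have "?D i v = (\<lambda>_. 0)"
      by (intro vec_eqI[OF mmap_C[OF E_mats] zero]) (auto simp: strand_mmap w(2) bdry_bdry strand_0)
    ultimately show "v \<in> {v \<in> ?V (Suc i). ?D i v = (\<lambda>_. 0)}" by blast
  qed
qed

text \<open>In position 0 the strand of multidegree \<open>\<nu>\<close> is the coefficient of
  \<open>\<nu>\<close>. It can be nonzero on the image only above the label of a 1-cell, and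
  conversely choosing such a cell for every monomial of \<open>v\<close> gives a preimage.\<close>

theorem image_E0:
  "mmap 1 (rk 1) (E 0) ` vecs (vpolys n) (rk 1) =
    {v \<in> vecs (vpolys n) 1. \<forall>m\<in>Poly_Mapping.keys (v 0). \<exists>x\<in>K. dm x = 1 \<and> l x \<subseteq># m}"
proof -
  have rk0: "rk 0 = 1" by (simp add: rk_def level0)
  then have en0: "en 0 0 = z" "idx 0 z = 0" using en_level[of 0 0] idx_less[of z 0] by (auto simp: level0)
  have st: "strand 0 v \<nu> = (\<lambda>x. if x = z then Poly_Mapping.lookup (v 0) \<nu> else 0)" for v \<nu>
    by (auto simp: strand_def level0 lz en0)
  show ?thesis
  proof (intro equalityI subsetI)
    fix v assume "v \<in> mmap 1 (rk 1) (E 0) ` vecs (vpolys n) (rk 1)"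
    then obtain w where w: "w \<in> vecs (vpolys n) (rk (Suc 0))" "v = mmap (rk 0) (rk (Suc 0)) (E 0) w"
      by (auto simp: rk0)
    have "\<exists>x\<in>K. dm x = 1 \<and> l x \<subseteq># m" if m: "m \<in> Poly_Mapping.keys (v 0)" for m
    proof -
      have "bdry K \<epsilon> (strand (Suc 0) w m) z \<noteq> 0"
        using m fun_cong[OF strand_mmap[of 0 w m], of z] by (simp add: st w(2) in_keys_iff)
      then have "(\<Sum>a\<in>K. strand (Suc 0) w m a * \<epsilon> a z) \<noteq> 0" by (simp add: bdry_def zX)
      then obtain a where "a \<in> K" "strand (Suc 0) w m a * \<epsilon> a z \<noteq> 0" by (meson sum.not_neutral_contains_not_neutral)
      then have "strand (Suc 0) w m a \<noteq> 0" by auto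
      then show ?thesis using strand_chain[of "Suc 0" w m] unfolding chain_space_def by auto
    qed
    then show "v \<in> {v \<in> vecs (vpolys n) 1. \<forall>m\<in>Poly_Mapping.keys (v 0). \<exists>x\<in>K. dm x = 1 \<and> l x \<subseteq># m}"
      using mmap_C[OF E_mats w(1)] unfolding w(2) rk0 by auto
  next
    fix v :: "nat \<Rightarrow> nat multiset \<Rightarrow>\<^sub>0 'f"
    assume "v \<in> {v \<in> vecs (vpolys n) 1. \<forall>m\<in>Poly_Mapping.keys (v 0). \<exists>x\<in>K. dm x = 1 \<and> l x \<subseteq># m}"
    then have v: "v \<in> vecs (vpolys n) 1" "\<And>m. m \<in> Poly_Mapping.keys (v 0) \<Longrightarrow> \<exists>x. x\<in>K \<and> dm x = 1 \<and> l x \<subseteq># m" by auto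
    then obtain x where x: "\<And>m. m \<in> Poly_Mapping.keys (v 0) \<Longrightarrow> x m\<in>K \<and> dm (x m) = 1 \<and> l (x m) \<subseteq># m" by metis
    define c where "c m = (\<lambda>y. if y = x m then Poly_Mapping.lookup (v 0) m else 0)" for m
    have "\<exists>w\<in>vecs (vpolys n) (rk (Suc 0)). \<forall>\<nu>. strand (Suc 0) w \<nu> = (if \<nu> \<in> Poly_Mapping.keys (v 0) then c \<nu> else (\<lambda>_. 0))"
      using x v(1) by (intro assemble) (auto simp: c_def chain_space_def vecs_def vpolys_def split: if_splits)
    then obtain w where w: "w \<in> vecs (vpolys n) (rk (Suc 0))"
      "\<And>\<nu>. strand (Suc 0) w \<nu> = (if \<nu> \<in> Poly_Mapping.keys (v 0) then c \<nu> else (\<lambda>_. 0))" by blast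
    have b: "bdry K \<epsilon> (c m) = (\<lambda>y. if y = z then Poly_Mapping.lookup (v 0) m else 0)" if m: "m \<in> Poly_Mapping.keys (v 0)" for m
    proof
      fix y
      have "(\<Sum>a\<in>K. c m a * \<epsilon> a y) = Poly_Mapping.lookup (v 0) m * \<epsilon> (x m) y"
      proof -
        have "c m a * \<epsilon> a y = (if a = x m then Poly_Mapping.lookup (v 0) m * \<epsilon> (x m) y else 0)" for a
          by (simp add: c_def)
        then show ?thesis using x[OF m] fin by simp
      qed
      moreover have "\<epsilon> (x m) y = (if y = z then 1 else 0)" if "y \<in> K"
      proof (cases "y = z")
        case True
        then show ?thesis using inc_z x[OF m] by simp
      next
        case False
        then have "dm y \<noteq> 0" using dim0[OF that] by simp
        then show ?thesis using inc[of "x m" y] x[OF m] that False by fastforce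
      qed
      ultimately show "bdry K \<epsilon> (c m) y = (if y = z then Poly_Mapping.lookup (v 0) m else 0)"
        using zX by (auto simp: bdry_def)
    qed
    have "v = mmap (rk 0) (rk (Suc 0)) (E 0) w"
    proof (rule vec_eqI)
      show "v \<in> vecs (vpolys n) (rk 0)" using v(1) rk0 by simp
      show "mmap (rk 0) (rk (Suc 0)) (E 0) w \<in> vecs (vpolys n) (rk 0)" by (rule mmap_C[OF E_mats w(1)])
      show "strand 0 v \<nu> = strand 0 (mmap (rk 0) (rk (Suc 0)) (E 0) w) \<nu>" for \<nu>
        unfolding strand_mmap w(2) st by (auto simp: b bdry_zero in_keys_iff)
    qed
    then show "v \<in> mmap 1 (rk 1) (E 0) ` vecs (vpolys n) (rk 1)" using w(1) rk0 by auto
  qed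
qed

text \<open>The incidences that survive tensoring with the residue field: an entry of
  \<open>E\<close> has a constant term only if the two labels agree.\<close>

definition \<epsilon>r :: "'c \<Rightarrow> 'c \<Rightarrow> 'f" where "\<epsilon>r a b = (if l a = l b then \<epsilon> a b else 0)"

lemma red_E: "a < rk i \<Longrightarrow> b < rk (Suc i) \<Longrightarrow> red E i a b = \<epsilon>r (en (Suc i) b) (en i a)"
proof -
  assume ab: "a < rk i" "b < rk (Suc i)"
  then have K: "en i a \<in> K" "en (Suc i) b \<in> K" using en_level level_X by auto
  show ?thesis
  proof (cases "\<epsilon> (en (Suc i) b) (en i a) = 0")
    case False
    then have "l (en i a) \<subseteq># l (en (Suc i) b)" using inc K by blast
    then have "l (en (Suc i) b) - l (en i a) = {#} \<longleftrightarrow> l (en (Suc i) b) = l (en i a)"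
      by (metis Diff_eq_empty_iff_mset subset_mset.antisym subset_mset.order_refl)
    then show ?thesis by (simp add: E_def \<epsilon>r_def lookup_single when_def)
  qed (simp add: E_def \<epsilon>r_def)
qed

text \<open>Replaces the enumerated matrices by functions on cells. Taking \<open>z\<close> away
  removes the augmentation, so that the 1-cells become cycles, in accordance with degree 0 of
  \<open>tor_cyc\<close>.\<close>

theorem tor_cells:
  "quot_dim (tor_cyc rk (red E) j) (tor_bnd rk (red E) j) d \<longleftrightarrow>
    quot_dim (cyc (K - {z}) dm \<epsilon>r (Suc j)) (bnd (K - {z}) dm \<epsilon>r (Suc j)) d"
proof -
  define f where "f i v = (\<lambda>x. if x \<in> level i then v (idx i x) else 0)" for i and v :: "nat \<Rightarrow> 'f"
  define k where "k i c = (\<lambda>b. if b < rk i then c (en i b) else 0)" for i and c :: "'c \<Rightarrow> 'f"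
  let ?K = "K - {z}"
  have lev: "level (Suc i) \<subseteq> ?K" for i using dim0[OF zX] by (auto simp: level_def)
  have fch: "f (Suc i) v \<in> chain_space ?K dm (Suc i)" for i v using lev by (auto simp: f_def chain_space_def level_def)
  have kv: "k i c \<in> vecs UNIV (rk i)" for i c by (auto simp: k_def vecs_def)
  have fk: "f (Suc i) (k (Suc i) c) = c" if "c \<in> chain_space ?K dm (Suc i)" for i c
    using that by (auto simp: f_def k_def chain_space_def fun_eq_iff idx_less en_idx level_def)
  have kf: "k i (f i v) = v" if "v \<in> vecs UNIV (rk i)" for i v
    using that by (auto simp: f_def k_def vecs_def fun_eq_iff en_level idx_en)
  have chX: "chain_space ?K dm i \<subseteq> chain_space K dm i" for i by (rule chains_mono) auto
  have bd: "bdry ?K \<epsilon>r (f (Suc i) v) = (if i = 0 then (\<lambda>_. 0) else f i (mmap (rk i) (rk (Suc i)) (red E i) v))"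
    if v: "v \<in> vecs UNIV (rk (Suc i))" for i v
  proof
    fix y
    have s: "(\<Sum>a\<in>?K. f (Suc i) v a * \<epsilon>r a y) = (\<Sum>a\<in>level (Suc i). f (Suc i) v a * \<epsilon>r a y)"
      using lev[of i] by (intro sum.mono_neutral_right) (auto simp: fin f_def)
    also have "\<dots> = (\<Sum>b<rk (Suc i). f (Suc i) v (en (Suc i) b) * \<epsilon>r (en (Suc i) b) y)"
      by (rule sum.reindex_bij_betw[OF en_bij, symmetric])
    also have "\<dots> = (\<Sum>b<rk (Suc i). v b * \<epsilon>r (en (Suc i) b) y)"
      by (rule sum.cong) (auto simp: f_def en_level idx_en)
    finally have s: "(\<Sum>a\<in>?K. f (Suc i) v a * \<epsilon>r a y) = (\<Sum>b<rk (Suc i). v b * \<epsilon>r (en (Suc i) b) y)" .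
    show "bdry ?K \<epsilon>r (f (Suc i) v) y = (if i = 0 then (\<lambda>_. 0) else f i (mmap (rk i) (rk (Suc i)) (red E i) v)) y"
    proof (cases "y \<in> level i \<and> y \<in> ?K")
      case True
      have "i \<noteq> 0"
      proof
        assume "i = 0"
        with True have "y \<in> level 0" "y \<noteq> z" by simp_all
        then show False unfolding level0 by simp
      qed
      moreover have "red E i (idx i y) b = \<epsilon>r (en (Suc i) b) y" if "b < rk (Suc i)" for b
      proof -
        have y: "y \<in> level i" using True by blast
        show ?thesis using red_E[OF idx_less[OF y] that] unfolding en_idx[OF y] .
      qed
      ultimately have "f i (mmap (rk i) (rk (Suc i)) (red E i) v) y = (\<Sum>b<rk (Suc i). v b * \<epsilon>r (en (Suc i) b) y)"
        using True idx_less[of y i] by (simp add: f_def mmap_def mult.commute)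
      then show ?thesis using True \<open>i \<noteq> 0\<close> by (simp add: bdry_def s)
    next
      case False
      have "\<epsilon>r (en (Suc i) b) y = 0" if "b < rk (Suc i)" "y \<in> ?K" for b
        using False inc[of "en (Suc i) b" y] that en_level[OF that(1)] by (auto simp: level_def \<epsilon>r_def)
      then have "bdry ?K \<epsilon>r (f (Suc i) v) y = 0" by (simp add: bdry_def s)
      moreover have "y \<notin> level i" if "i \<noteq> 0" 
      proof
        assume y: "y \<in> level i"
        have "dm z = 0" using dim0[OF zX] by simp
        then have "y \<noteq> z" using y that by (auto simp: level_def)
        then show False using False y level_X by blast
      qed
      ultimately show ?thesis by (auto simp: f_def)
    qed
  qed
  have inj: "f (Suc i) v = (\<lambda>_. 0) \<longleftrightarrow> v = (\<lambda>_. 0)" if "v \<in> vecs UNIV (rk (Suc i))" for i v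
  proof
    assume "f (Suc i) v = (\<lambda>_. 0)"
    then have "v = k (Suc i) (\<lambda>_. 0)" using kf[OF that] by simp
    then show "v = (\<lambda>_. 0)" by (simp add: k_def)
  qed (simp add: f_def)
  show ?thesis
  proof (rule quot_dim_iso[where f = "f (Suc j)", OF subsp_tor_cyc subsp_bnd])
    show "linear_on (tor_cyc rk (red E) j) (f (Suc j))" by (auto simp: linear_on_def f_def)
    have cy: "v \<in> tor_cyc rk (red E) j \<longleftrightarrow> f (Suc j) v \<in> cyc ?K dm \<epsilon>r (Suc j)" if v: "v \<in> vecs UNIV (rk (Suc j))" for v
    proof (cases j)
      case 0
      then show ?thesis using v by (simp add: tor_cyc_def cyc_def fch bd)
    next
      case (Suc j')
      then show ?thesis using v by (simp add: tor_cyc_def cyc_def fch bd inj[OF mmap_UNIV])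
    qed
    have vv: "v \<in> vecs UNIV (rk (Suc j))" if "v \<in> tor_cyc rk (red E) j" for v using that by (simp add: tor_cyc_def)
    show "f (Suc j) v \<in> cyc ?K dm \<epsilon>r (Suc j)" if "v \<in> tor_cyc rk (red E) j" for v
      using cy[OF vv[OF that]] that by blast
    show "f (Suc j) v \<in> bnd ?K dm \<epsilon>r (Suc j) \<longleftrightarrow> v \<in> tor_bnd rk (red E) j" if v: "v \<in> tor_cyc rk (red E) j" for v
    proof
      assume "f (Suc j) v \<in> bnd ?K dm \<epsilon>r (Suc j)"
      then obtain c where c: "c \<in> chain_space ?K dm (Suc (Suc j))" "f (Suc j) v = bdry ?K \<epsilon>r c" unfolding bnd_def by blast
      have "f (Suc j) v = f (Suc j) (mmap (rk (Suc j)) (rk (Suc (Suc j))) (red E (Suc j)) (k (Suc (Suc j)) c))"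
        using bd[OF kv, of "Suc j" c] fk[OF c(1)] c(2) by simp
      then have "v = mmap (rk (Suc j)) (rk (Suc (Suc j))) (red E (Suc j)) (k (Suc (Suc j)) c)"
        using kf[OF vv[OF v]] kf[OF mmap_UNIV] by metis
      then show "v \<in> tor_bnd rk (red E) j" unfolding tor_bnd_def using kv by blast
    next
      assume "v \<in> tor_bnd rk (red E) j"
      then obtain w where w: "w \<in> vecs UNIV (rk (Suc (Suc j)))" "v = mmap (rk (Suc j)) (rk (Suc (Suc j))) (red E (Suc j)) w"
        unfolding tor_bnd_def by blast
      have "f (Suc j) v = bdry ?K \<epsilon>r (f (Suc (Suc j)) w)" using bd[OF w(1)] w(2) by simp
      then show "f (Suc j) v \<in> bnd ?K dm \<epsilon>r (Suc j)" unfolding bnd_def using fch by blast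
    qed
    fix c assume c: "c \<in> cyc ?K dm \<epsilon>r (Suc j)"
    then have "f (Suc j) (k (Suc j) c) = c" using fk by (simp add: cyc_def)
    then show "\<exists>v\<in>tor_cyc rk (red E) j. (\<lambda>b. c b - f (Suc j) v b) \<in> bnd ?K dm \<epsilon>r (Suc j)"
      using c cy[OF kv] subsp_zero[OF subsp_bnd] by (intro bexI[of _ "k (Suc j) c"]) auto
  qed
qed

end

section \<open>Transfer between type classes and records\<close>

lemma ex1_image:
  assumes "inj f" shows "(\<exists>!c. c \<in> f ` S \<and> P c) \<longleftrightarrow> (\<exists>!c. c \<in> S \<and> P (f c))"
proof
  assume a: "\<exists>!c. c \<in> f ` S \<and> P c"
  then obtain c where c: "c \<in> f ` S" "P c" by (elim ex1E conjE)
  from c(1) obtain s where s: "c = f s" "s \<in> S" by (rule imageE)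
  show "\<exists>!c. c \<in> S \<and> P (f c)"
  proof (rule ex1I[of _ s])
    fix t assume t: "t \<in> S \<and> P (f t)"
    have "f t = f s" by (rule ex1E[OF a]) (use s t c in \<open>metis imageI\<close>)
    then show "t = s" by (rule injD[OF assms])
  qed (use s c in auto)
next
  assume a: "\<exists>!c. c \<in> S \<and> P (f c)"
  then obtain s where s: "s \<in> S" "P (f s)" by (elim ex1E conjE)
  show "\<exists>!c. c \<in> f ` S \<and> P c"
  proof (rule ex1I[of _ "f s"])
    fix c assume c: "c \<in> f ` S \<and> P c"
    then obtain t where t: "c = f t" "t \<in> S" by (elim conjE imageE)
    have "t = s" by (rule ex1E[OF a]) (use s t c in metis)
    then show "c = f s" using t by simp
  qed (use s in auto)
qed

text \<open>\<open>\<Phi>\<close> identifies a subring of a type class ring with a ring given as a record.\<close>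

locale ring_rep = subring_set C for C :: "'r::comm_ring_1 set" +
  fixes R :: "'x ring" and \<Phi> :: "'r \<Rightarrow> 'x"
  assumes Phi_bij: "bij_betw \<Phi> C (carrier R)"
    and Phi_zero: "\<Phi> 0 = \<zero>\<^bsub>R\<^esub>" and Phi_one: "\<Phi> 1 = \<one>\<^bsub>R\<^esub>"
    and Phi_add: "\<And>x y. x \<in> C \<Longrightarrow> y \<in> C \<Longrightarrow> \<Phi> (x + y) = \<Phi> x \<oplus>\<^bsub>R\<^esub> \<Phi> y"
    and Phi_mult: "\<And>x y. x \<in> C \<Longrightarrow> y \<in> C \<Longrightarrow> \<Phi> (x * y) = \<Phi> x \<otimes>\<^bsub>R\<^esub> \<Phi> y"
begin

lemma Phi_carrier: "x \<in> C \<Longrightarrow> \<Phi> x \<in> carrier R"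
  using Phi_bij bij_betwE by blast

lemma Phi_inj: "x \<in> C \<Longrightarrow> y \<in> C \<Longrightarrow> \<Phi> x = \<Phi> y \<longleftrightarrow> x = y"
  using Phi_bij by (meson bij_betw_imp_inj_on inj_on_eq_iff)

lemma carrier_cases: assumes "x \<in> carrier R" obtains y where "y \<in> C" "x = \<Phi> y"
  using assms Phi_bij unfolding bij_betw_def by blast

lemma cring_R: "cring R"
proof (rule cringI)
  show "abelian_group R"
  proof (rule abelian_groupI)
    fix x assume "x \<in> carrier R"
    then obtain x' where "x' \<in> C" "x = \<Phi> x'" by (rule carrier_cases)
    then show "\<exists>y\<in>carrier R. y \<oplus>\<^bsub>R\<^esub> x = \<zero>\<^bsub>R\<^esub>"
      using Phi_add[of "-x'" x'] Phi_zero uminus_C Phi_carrier by (intro bexI[of _ "\<Phi> (- x')"]) auto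
  next
    fix x y z assume "x \<in> carrier R" "y \<in> carrier R" "z \<in> carrier R"
    then obtain x' y' z' where "x' \<in> C" "x = \<Phi> x'" "y' \<in> C" "y = \<Phi> y'" "z' \<in> C" "z = \<Phi> z'"
      by (metis carrier_cases)
    then show "x \<oplus>\<^bsub>R\<^esub> y \<oplus>\<^bsub>R\<^esub> z = x \<oplus>\<^bsub>R\<^esub> (y \<oplus>\<^bsub>R\<^esub> z)" by (simp add: Phi_add[symmetric] add_C add.assoc)
  next
    fix x y assume "x \<in> carrier R" "y \<in> carrier R"
    then obtain x' y' where *: "x' \<in> C" "x = \<Phi> x'" "y' \<in> C" "y = \<Phi> y'" by (metis carrier_cases)
    then show "x \<oplus>\<^bsub>R\<^esub> y \<in> carrier R" "x \<oplus>\<^bsub>R\<^esub> y = y \<oplus>\<^bsub>R\<^esub> x"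
      by (simp_all add: Phi_add[symmetric] add_C add.commute Phi_carrier)
  next
    show "\<zero>\<^bsub>R\<^esub> \<in> carrier R" using Phi_zero zero_C Phi_carrier by metis
    fix x assume "x \<in> carrier R"
    then obtain x' where "x' \<in> C" "x = \<Phi> x'" by (rule carrier_cases)
    then show "\<zero>\<^bsub>R\<^esub> \<oplus>\<^bsub>R\<^esub> x = x" by (simp add: Phi_zero[symmetric] Phi_add[symmetric] zero_C)
  qed
  show "Group.comm_monoid R"
  proof (rule Group.comm_monoidI)
    fix x y z assume "x \<in> carrier R" "y \<in> carrier R" "z \<in> carrier R"
    then obtain x' y' z' where "x' \<in> C" "x = \<Phi> x'" "y' \<in> C" "y = \<Phi> y'" "z' \<in> C" "z = \<Phi> z'"
      by (metis carrier_cases)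
    then show "x \<otimes>\<^bsub>R\<^esub> y \<otimes>\<^bsub>R\<^esub> z = x \<otimes>\<^bsub>R\<^esub> (y \<otimes>\<^bsub>R\<^esub> z)" by (simp add: Phi_mult[symmetric] mult_C mult.assoc)
  next
    fix x y assume "x \<in> carrier R" "y \<in> carrier R"
    then obtain x' y' where *: "x' \<in> C" "x = \<Phi> x'" "y' \<in> C" "y = \<Phi> y'" by (metis carrier_cases)
    then show "x \<otimes>\<^bsub>R\<^esub> y \<in> carrier R" "x \<otimes>\<^bsub>R\<^esub> y = y \<otimes>\<^bsub>R\<^esub> x"
      by (simp_all add: Phi_mult[symmetric] mult_C mult.commute Phi_carrier)
  next
    show "\<one>\<^bsub>R\<^esub> \<in> carrier R" using Phi_one one_C Phi_carrier by metis
    fix x assume "x \<in> carrier R"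
    then obtain x' where "x' \<in> C" "x = \<Phi> x'" by (rule carrier_cases)
    then show "\<one>\<^bsub>R\<^esub> \<otimes>\<^bsub>R\<^esub> x = x" by (simp add: Phi_one[symmetric] Phi_mult[symmetric] one_C)
  qed
  fix x y z assume "x \<in> carrier R" "y \<in> carrier R" "z \<in> carrier R"
  then obtain x' y' z' where "x' \<in> C" "x = \<Phi> x'" "y' \<in> C" "y = \<Phi> y'" "z' \<in> C" "z = \<Phi> z'"
    by (metis carrier_cases)
  then show "(x \<oplus>\<^bsub>R\<^esub> y) \<otimes>\<^bsub>R\<^esub> z = x \<otimes>\<^bsub>R\<^esub> z \<oplus>\<^bsub>R\<^esub> y \<otimes>\<^bsub>R\<^esub> z"
    by (simp add: Phi_mult[symmetric] Phi_add[symmetric] mult_C add_C distrib_right)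
qed

lemma Phi_diff: "x \<in> C \<Longrightarrow> y \<in> C \<Longrightarrow> \<Phi> x \<ominus>\<^bsub>R\<^esub> \<Phi> y = \<Phi> (x - y)"
proof -
  assume xy: "x \<in> C" "y \<in> C"
  interpret cring R by (rule cring_R)
  have "\<Phi> x = \<Phi> (x - y) \<oplus>\<^bsub>R\<^esub> \<Phi> y" using Phi_add[of "x - y" y] xy diff_C by simp
  then show ?thesis using xy Phi_carrier diff_C by (simp add: a_minus_def a_assoc r_neg)
qed

lemma Phi_sum:
  assumes "finite A" "\<And>x. x \<in> A \<Longrightarrow> f x \<in> C" "\<And>x. x \<in> A \<Longrightarrow> F x = \<Phi> (f x)"
  shows "(\<Oplus>\<^bsub>R\<^esub>x\<in>A. F x) = \<Phi> (\<Sum>x\<in>A. f x)"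
proof -
  interpret cring R by (rule cring_R)
  show ?thesis using assms
  proof (induction A rule: finite_induct)
    case (insert a A)
    then show ?case by (subst finsum_insert) (auto simp: Phi_add sum_C Phi_carrier)
  qed (simp add: Phi_zero)
qed

definition vmap :: "('i \<Rightarrow> 'r) \<Rightarrow> ('i \<Rightarrow> 'x)" where "vmap v = (\<lambda>b. \<Phi> (v b))"

lemma vmap_inj: "v \<in> vecs C q \<Longrightarrow> w \<in> vecs C q \<Longrightarrow> vmap v = vmap w \<longleftrightarrow> v = w"
proof -
  assume vw: "v \<in> vecs C q" "w \<in> vecs C q"
  have "v b \<in> C" "w b \<in> C" for b using vw zero_C by (cases "b < q"; simp add: vecs_def)+
  then show ?thesis using Phi_inj by (auto simp: vmap_def fun_eq_iff)
qed

lemma free_vecs_eq: "free_vecs R q = vmap ` vecs C q"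
proof (intro equalityI subsetI)
  fix v assume v: "v \<in> free_vecs R q"
  define w where "w b = (if b < q then inv_into C \<Phi> (v b) else 0)" for b
  have *: "\<Phi> ` C = carrier R" using Phi_bij by (simp add: bij_betw_def)
  have w: "w b \<in> C" "\<Phi> (w b) = v b" if "b < q" for b
    using that v inv_into_into[of "v b" \<Phi> C] f_inv_into_f[of "v b" \<Phi> C] unfolding * by (auto simp: w_def free_vecs_def)
  have "v = vmap w"
  proof
    fix b show "v b = vmap w b" using v w by (cases "b < q") (auto simp: vmap_def free_vecs_def w_def Phi_zero)
  qed
  moreover have "w \<in> vecs C q" using w by (auto simp: vecs_def w_def)
  ultimately show "v \<in> vmap ` vecs C q" by (rule image_eqI)
next
  fix v assume "v \<in> vmap ` vecs C q"
  then show "v \<in> free_vecs R q" by (auto simp: vmap_def free_vecs_def vecs_def Phi_zero Phi_carrier)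
qed

definition mat_rep where
  "mat_rep p q A' A \<longleftrightarrow> A \<in> mats C p q \<and> (\<forall>a<p. \<forall>b<q. A' a b = \<Phi> (A a b))"

lemma mat_map_rep:
  assumes "mat_rep p q A' A" "v \<in> vecs C q"
  shows "mat_map R p q A' (vmap v) = vmap (mmap p q A v)"
proof
  fix a
  show "mat_map R p q A' (vmap v) a = vmap (mmap p q A v) a"
    using assms by (auto simp: mat_map_def mmap_def vmap_def mat_rep_def mats_def vecs_def Phi_zero
        intro!: Phi_sum mult_C) (simp add: Phi_mult)
qed

lemma vmap_zero: "vmap (\<lambda>_. 0) = (\<lambda>_. \<zero>\<^bsub>R\<^esub>)" by (simp add: vmap_def Phi_zero)

lemma zero_vecs: "(\<lambda>_. 0) \<in> vecs C q" by (simp add: vecs_def zero_C)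

lemma mat_im_rep: "mat_rep p q A' A \<Longrightarrow> mat_im R p q A' = vmap ` mmap p q A ` vecs C q"
  unfolding mat_im_def free_vecs_eq image_image by (rule image_cong) (auto simp: mat_map_rep)

lemma mat_ker_rep:
  assumes "mat_rep p q A' A"
  shows "mat_ker R p q A' = vmap ` {v\<in>vecs C q. mmap p q A v = (\<lambda>_. 0)}"
proof -
  have "mat_map R p q A' (vmap v) = (\<lambda>_. \<zero>\<^bsub>R\<^esub>) \<longleftrightarrow> mmap p q A v = (\<lambda>_. 0)" if "v \<in> vecs C q" for v
  proof -
    have "A \<in> mats C p q" using assms by (simp add: mat_rep_def)
    then show ?thesis
      unfolding mat_map_rep[OF assms that] using vmap_inj[OF mmap_C[OF _ that] zero_vecs] by (simp add: vmap_zero)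
  qed
  then show ?thesis unfolding mat_ker_def free_vecs_eq by blast
qed

lemma vmap_image_eq: "S \<subseteq> vecs C q \<Longrightarrow> T \<subseteq> vecs C q \<Longrightarrow> vmap ` S = vmap ` T \<longleftrightarrow> S = T"
  by (rule inj_on_image_eq_iff[where C = "vecs C q"]) (auto simp: inj_on_def vmap_inj)

lemma mmap_image_vecs: "A \<in> mats C p q \<Longrightarrow> mmap p q A ` vecs C q \<subseteq> vecs C p"
  using mmap_C by blast

text \<open>\<open>free_resolution\<close> keeps the row \<open>e\<close> apart from the matrices
  \<open>D\<close>; in \<open>exact_complex\<close> the row is matrix number 0 and everything else
  moves up by one. The exactness conditions are matched accordingly, index 0 separately from the
  successors.\<close>

theorem free_resolution_iff:
  assumes g: "g 0 = 1" "\<And>i. g (Suc i) = m i"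
    and e: "mat_rep 1 (g 1) (\<lambda>_ b. e b) (E 0)" and D: "\<And>i. mat_rep (m i) (m (Suc i)) (D i) (E (Suc i))"
  shows "free_resolution R I m e D \<longleftrightarrow>
    exact_complex g E \<and> I = (\<lambda>v. \<Phi> (v 0)) ` mmap 1 (g 1) (E 0) ` vecs C (g 1)"
proof -
  have g1: "g 1 = m 0" using g(2)[of 0] by simp
  have mats: "E i \<in> mats C (g i) (g (Suc i))" for i
    using e D g by (cases i) (auto simp: mat_rep_def)
  have row: "(\<Oplus>\<^bsub>R\<^esub>b\<in>{..<m 0}. e b \<otimes>\<^bsub>R\<^esub> vmap v b) = \<Phi> (mmap 1 (g 1) (E 0) v 0)" if "v \<in> vecs C (m 0)" for v
    using fun_cong[OF mat_map_rep[OF e, of v], of 0] that g1 by (simp add: mat_map_def vmap_def)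
  have c1: "\<forall>b<m 0. e b \<in> carrier R" using e g1 Phi_carrier by (auto simp: mat_rep_def mats_def)
  have c2: "\<forall>i. \<forall>a<m i. \<forall>b<m (Suc i). D i a b \<in> carrier R"
    using D Phi_carrier by (fastforce simp: mat_rep_def mats_def)
  have im: "(\<lambda>v. \<Oplus>\<^bsub>R\<^esub>b\<in>{..<m 0}. e b \<otimes>\<^bsub>R\<^esub> v b) ` free_vecs R (m 0) =
     (\<lambda>v. \<Phi> (v 0)) ` mmap 1 (g 1) (E 0) ` vecs C (g 1)"
    unfolding free_vecs_eq image_image g1 by (rule image_cong) (auto simp: row[unfolded g1])
  have ker0: "{v \<in> free_vecs R (m 0). (\<Oplus>\<^bsub>R\<^esub>b\<in>{..<m 0}. e b \<otimes>\<^bsub>R\<^esub> v b) = \<zero>\<^bsub>R\<^esub>} =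
     vmap ` {v\<in>vecs C (g 1). mmap (g 0) (g 1) (E 0) v = (\<lambda>_. 0)}"
  proof -
    have "(\<Oplus>\<^bsub>R\<^esub>b\<in>{..<m 0}. e b \<otimes>\<^bsub>R\<^esub> vmap v b) = \<zero>\<^bsub>R\<^esub> \<longleftrightarrow> mmap (g 0) (g 1) (E 0) v = (\<lambda>_. 0)"
      if v: "v \<in> vecs C (m 0)" for v
    proof -
      have "mmap 1 (g 1) (E 0) v \<in> vecs C 1" using mmap_C[OF mats[of 0], of v] v g g1 by simp
      then have c: "mmap 1 (g 1) (E 0) v 0 \<in> C" by (simp add: vecs_def)
      have "(\<Oplus>\<^bsub>R\<^esub>b\<in>{..<m 0}. e b \<otimes>\<^bsub>R\<^esub> vmap v b) = \<zero>\<^bsub>R\<^esub> \<longleftrightarrow> mmap 1 (g 1) (E 0) v 0 = 0"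
        unfolding row[OF v] Phi_zero[symmetric] using Phi_inj[OF c zero_C] .
      also have "\<dots> \<longleftrightarrow> mmap 1 (g 1) (E 0) v = (\<lambda>_. 0)" by (auto simp: mmap_def fun_eq_iff)
      finally show ?thesis using g by simp
    qed
    then show ?thesis unfolding free_vecs_eq g1 by blast
  qed
  have sub: "{v\<in>vecs C (g (Suc i)). mmap (g i) (g (Suc i)) (E i) v = (\<lambda>_. 0)} \<subseteq> vecs C (g (Suc i))" for i
    by blast
  have ex: "vmap ` {v\<in>vecs C (g (Suc i)). mmap (g i) (g (Suc i)) (E i) v = (\<lambda>_. 0)} =
      vmap ` mmap (g (Suc i)) (g (Suc (Suc i))) (E (Suc i)) ` vecs C (g (Suc (Suc i))) \<longleftrightarrow>
      {v\<in>vecs C (g (Suc i)). mmap (g i) (g (Suc i)) (E i) v = (\<lambda>_. 0)} =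
      mmap (g (Suc i)) (g (Suc (Suc i))) (E (Suc i)) ` vecs C (g (Suc (Suc i)))" for i
    by (rule vmap_image_eq[OF sub mmap_image_vecs[OF mats]])
  have exact: "exact_complex g E \<longleftrightarrow>
     (\<forall>i. vmap ` {v\<in>vecs C (g (Suc i)). mmap (g i) (g (Suc i)) (E i) v = (\<lambda>_. 0)} =
      vmap ` mmap (g (Suc i)) (g (Suc (Suc i))) (E (Suc i)) ` vecs C (g (Suc (Suc i))))"
    unfolding exact_complex_def ex using mats g(1) by blast
  have all: "(\<forall>i. P i) \<longleftrightarrow> P 0 \<and> (\<forall>i. P (Suc i))" for P :: "nat \<Rightarrow> bool" by (metis not0_implies_Suc)
  have k: "mat_ker R (m i) (m (Suc i)) (D i) =
     vmap ` {v\<in>vecs C (g (Suc (Suc i))). mmap (g (Suc i)) (g (Suc (Suc i))) (E (Suc i)) v = (\<lambda>_. 0)}" for i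
    unfolding mat_ker_rep[OF D] g(2) ..
  have j: "mat_im R (m i) (m (Suc i)) (D i) =
      vmap ` mmap (g (Suc i)) (g (Suc (Suc i))) (E (Suc i)) ` vecs C (g (Suc (Suc i)))" for i
    unfolding mat_im_rep[OF D] g(2) ..
  let ?Q = "\<lambda>i. vmap ` {v\<in>vecs C (g (Suc i)). mmap (g i) (g (Suc i)) (E i) v = (\<lambda>_. 0)} =
      vmap ` mmap (g (Suc i)) (g (Suc (Suc i))) (E (Suc i)) ` vecs C (g (Suc (Suc i)))"
  have ex2: "exact_complex g E \<longleftrightarrow> ?Q 0 \<and> (\<forall>i. ?Q (Suc i))" unfolding exact by (rule all)
  have j0: "mat_im R (m 0) (m 1) (D 0) = vmap ` mmap (g (Suc 0)) (g (Suc (Suc 0))) (E (Suc 0)) ` vecs C (g (Suc (Suc 0)))"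
    using j[of 0] by simp
  have g1': "g 1 = g (Suc 0)" by simp
  show ?thesis
    unfolding free_resolution_def im ker0 ex2 k j j0 g1'
    using c1 c2 by metis
qed

lemma quotient_dim_iff:
  assumes "C = UNIV"
  shows "quotient_dim R (vmap ` Z) (vmap ` B) d \<longleftrightarrow> quot_dim Z B d"
proof -
  have vinj: "vmap v = vmap w \<longleftrightarrow> v = w" for v w :: "nat \<Rightarrow> 'r"
    using Phi_inj assms by (auto simp: vmap_def fun_eq_iff)
  have comb: "(\<lambda>a. vmap z a \<ominus>\<^bsub>R\<^esub> (\<Oplus>\<^bsub>R\<^esub>j\<in>{..<d}. vmap c j \<otimes>\<^bsub>R\<^esub> w' j a)) = vmap (\<lambda>a. z a - (\<Sum>j<d. c j * w j a))"
    if "\<And>j. j < d \<Longrightarrow> w' j = vmap (w j)" for z c w w'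
  proof
    fix a
    have "(\<Oplus>\<^bsub>R\<^esub>j\<in>{..<d}. vmap c j \<otimes>\<^bsub>R\<^esub> w' j a) = \<Phi> (\<Sum>j<d. c j * w j a)"
      using that assms by (intro Phi_sum) (auto simp: vmap_def Phi_mult)
    then show "vmap z a \<ominus>\<^bsub>R\<^esub> (\<Oplus>\<^bsub>R\<^esub>j\<in>{..<d}. vmap c j \<otimes>\<^bsub>R\<^esub> w' j a) = vmap (\<lambda>a. z a - (\<Sum>j<d. c j * w j a)) a"
      using assms by (simp add: vmap_def Phi_diff)
  qed
  have mem: "vmap v \<in> vmap ` S \<longleftrightarrow> v \<in> S" for v :: "nat \<Rightarrow> 'r" and S by (rule inj_image_mem_iff) (simp add: inj_def vinj)
  have ex1: "(\<exists>!c. c \<in> free_vecs R d \<and> P c) \<longleftrightarrow> (\<exists>!c. c \<in> vecs UNIV d \<and> P (vmap c))" for P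
    unfolding free_vecs_eq assms by (rule ex1_image) (simp add: inj_def vinj)
  have main: "(\<forall>z\<in>vmap ` Z. \<exists>!c. c \<in> free_vecs R d \<and>
             (\<lambda>a. z a \<ominus>\<^bsub>R\<^esub> (\<Oplus>\<^bsub>R\<^esub>j\<in>{..<d}. c j \<otimes>\<^bsub>R\<^esub> w' j a)) \<in> vmap ` B) \<longleftrightarrow>
       (\<forall>z\<in>Z. \<exists>!c. c \<in> vecs UNIV d \<and> (\<lambda>a. z a - (\<Sum>j<d. c j * w j a)) \<in> B)"
    if "\<And>j. j < d \<Longrightarrow> w' j = vmap (w j)" for w w'
    using comb[of w' w, OF that] by (simp add: ex1 mem)
  show ?thesis
  proof
    assume "quotient_dim R (vmap ` Z) (vmap ` B) d"
    then obtain w' where w': "\<And>j. j < d \<Longrightarrow> w' j \<in> vmap ` Z"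
      "\<forall>z\<in>vmap ` Z. \<exists>!c. c \<in> free_vecs R d \<and>
             (\<lambda>a. z a \<ominus>\<^bsub>R\<^esub> (\<Oplus>\<^bsub>R\<^esub>j\<in>{..<d}. c j \<otimes>\<^bsub>R\<^esub> w' j a)) \<in> vmap ` B"
      unfolding quotient_dim_def by (elim exE conjE) (rule that, auto)
    define w where "w j = (SOME z. z \<in> Z \<and> w' j = vmap z)" for j
    have w: "w j \<in> Z" "w' j = vmap (w j)" if "j < d" for j
      using someI_ex[of "\<lambda>z. z \<in> Z \<and> w' j = vmap z"] w'(1)[OF that] unfolding w_def by auto
    show "quot_dim Z B d" unfolding quot_dim_def
      by (rule exI[of _ w], intro conjI) (use w main[of w' w, OF w(2)] w'(2) in blast)+
  next
    assume "quot_dim Z B d"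
    then obtain w where w: "\<forall>j<d. w j \<in> Z"
      "\<forall>z\<in>Z. \<exists>!c. c \<in> vecs UNIV d \<and> (\<lambda>a. z a - (\<Sum>j<d. c j * w j a)) \<in> B" by (rule quot_dimE)
    show "quotient_dim R (vmap ` Z) (vmap ` B) d" unfolding quotient_dim_def
    proof (intro exI[of _ "\<lambda>j. vmap (w j)"] conjI)
      show "\<forall>j<d. vmap (w j) \<in> vmap ` Z" using w(1) by blast
    qed (use main[of "\<lambda>j. vmap (w j)" w] w(2) in blast)
  qed
qed

end

section \<open>The polynomial ring over a coefficient record\<close>

lemma poly_mapping_monomials: "p = (\<Sum>m\<in>Poly_Mapping.keys p. Poly_Mapping.single m (Poly_Mapping.lookup p m))"
proof (rule poly_mapping_eqI)
  fix m
  have "(\<Sum>m'\<in>Poly_Mapping.keys p. Poly_Mapping.lookup p m' when m' = m) = Poly_Mapping.lookup p m"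
    by (simp add: when_def in_keys_iff)
  then show "Poly_Mapping.lookup p m = Poly_Mapping.lookup (\<Sum>m\<in>Poly_Mapping.keys p. Poly_Mapping.single m (Poly_Mapping.lookup p m)) m"
    by (simp add: lookup_sum lookup_single)
qed

text \<open>Here the coefficients fill a whole type. The instances are the numeral types
  \<open>2\<close> and \<open>3\<close>, represented by residue rings of integers.\<close>

locale coeff_rep = ring_rep UNIV k \<phi> for k :: "'a ring" and \<phi> :: "'f::comm_ring_1 \<Rightarrow> 'a"
begin

definition PP :: "(nat multiset \<Rightarrow>\<^sub>0 'f) \<Rightarrow> nat multiset \<Rightarrow> 'a" where
  "PP p = (\<lambda>m. \<phi> (Poly_Mapping.lookup p m))"

lemma PP_single: "PP (Poly_Mapping.single m c) = (\<lambda>m'. if m' = m then \<phi> c else \<zero>\<^bsub>k\<^esub>)"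
  by (auto simp: PP_def lookup_single when_def Phi_zero)

lemma ring_k: "ring k" using cring_R by (rule cring.axioms)

lemma PP_add: "PP (p + q) = ring.indexed_padd k (PP p) (PP q)"
  unfolding ring.indexed_padd_def[OF ring_k] by (simp add: PP_def lookup_add Phi_add)

lemma PP_zero: "PP 0 = ring.indexed_const k \<zero>\<^bsub>k\<^esub>"
  unfolding ring.indexed_const_def[OF ring_k] by (simp add: PP_def Phi_zero fun_eq_iff)

lemma PP_one: "PP 1 = ring.indexed_const k \<one>\<^bsub>k\<^esub>"
  unfolding ring.indexed_const_def[OF ring_k]
  by (auto simp: PP_def lookup_one when_def Phi_zero Phi_one fun_eq_iff)

text \<open>One inclusion follows the inductive generation of the carrier. For the other, a monomial
  is built from a constant by multiplication with its variables, and a polynomial is the sum of its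
  terms.\<close>

lemma indexed_pset_eq: "ring.indexed_pset k {..<n} (carrier k) = PP ` vpolys n"
proof (intro equalityI subsetI)
  fix P assume "P \<in> ring.indexed_pset k {..<n} (carrier k)"
  then show "P \<in> PP ` vpolys n"
  proof (induction rule: ring.indexed_pset.induct[OF ring_k, consumes 1, case_names indexed_const indexed_padd indexed_pmult])
    case (indexed_const c)
    then obtain y where y: "c = \<phi> y" by (metis carrier_cases)
    have "ring.indexed_const k c = PP (Poly_Mapping.single {#} y)"
      unfolding ring.indexed_const_def[OF ring_k] PP_single y ..
    then show ?case using single_vpolys[of "{#}" n y] by (intro image_eqI) auto
  next
    case (indexed_padd P Q)
    then obtain p q where pq: "P = PP p" "Q = PP q" "p \<in> vpolys n" "q \<in> vpolys n" by (elim imageE)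
    have "p + q \<in> vpolys n" using pq subring_set.add_C[OF residue_map.axioms(1)[OF residue_map_vpolys]] by blast
    then show ?case unfolding pq PP_add[symmetric] by (rule imageI)
  next
    case (indexed_pmult P i)
    then obtain p where p: "P = PP p" "p \<in> vpolys n" by (elim imageE)
    have i: "i < n" using indexed_pmult by simp
    have s: "Poly_Mapping.single {#i#} 1 \<in> vpolys n" using i by (intro single_vpolys) auto
    have "ring.indexed_pmult k P i = PP (Poly_Mapping.single {#i#} 1 * p)"
      unfolding ring.indexed_pmult_def[OF ring_k] PP_def lookup_single_times p by (auto simp: Phi_zero)
    moreover have "Poly_Mapping.single {#i#} 1 * p \<in> vpolys n"
      using s p subring_set.mult_C[OF residue_map.axioms(1)[OF residue_map_vpolys]] by blast
    ultimately show ?case by (rule image_eqI)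
  qed
next
  have mono: "PP (Poly_Mapping.single m c) \<in> ring.indexed_pset k {..<n} (carrier k)" if "set_mset m \<subseteq> {..<n}" for m c
    using that
  proof (induction m)
    case empty
    have "PP (Poly_Mapping.single {#} c) = ring.indexed_const k (\<phi> c)"
      unfolding ring.indexed_const_def[OF ring_k] PP_single ..
    then show ?case using ring.indexed_pset.indexed_const[OF ring_k, of "\<phi> c" "carrier k"] Phi_carrier by simp
  next
    case (add i m)
    have "PP (Poly_Mapping.single (add_mset i m) c) = ring.indexed_pmult k (PP (Poly_Mapping.single m c)) i"
      unfolding ring.indexed_pmult_def[OF ring_k] PP_single by (auto simp: fun_eq_iff)
    then show ?case using ring.indexed_pset.indexed_pmult[OF ring_k, of "PP (Poly_Mapping.single m c)" "{..<n}" "carrier k" i] add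
      by simp
  qed
  fix P assume "P \<in> PP ` vpolys n"
  then obtain p where p: "P = PP p" "p \<in> vpolys n" by (elim imageE)
  have "PP (\<Sum>m\<in>A. Poly_Mapping.single m (Poly_Mapping.lookup p m)) \<in> ring.indexed_pset k {..<n} (carrier k)"
    if "finite A" "\<And>m. m \<in> A \<Longrightarrow> set_mset m \<subseteq> {..<n}" for A
    using that
  proof (induction A rule: finite_induct)
    case empty
    show ?case using ring.indexed_pset.indexed_const[OF ring_k, of "\<zero>\<^bsub>k\<^esub>" "carrier k"] Phi_carrier[of 0]
      by (simp add: PP_zero Phi_zero)
  next
    case (insert m A)
    then show ?case
      using ring.indexed_pset.indexed_padd[OF ring_k mono[of m "Poly_Mapping.lookup p m"]] by (simp add: PP_add)
  qed
  from this[of "Poly_Mapping.keys p"] show "P \<in> ring.indexed_pset k {..<n} (carrier k)"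
    using p by (simp add: poly_mapping_monomials[symmetric] vpolys_def)
qed

lemma rep_mpoly: "ring_rep (vpolys n) (mpoly_ring n k) PP"
proof -
  interpret res: residue_map "vpolys n :: (nat multiset \<Rightarrow>\<^sub>0 'f) set" "\<lambda>p. Poly_Mapping.lookup p {#}"
    by (rule residue_map_vpolys)
  show ?thesis
  proof
    have "inj PP"
      by (rule injI, rule poly_mapping_eqI) (metis PP_def Phi_inj UNIV_I)
    then show "bij_betw PP (vpolys n) (carrier (mpoly_ring n k))"
      unfolding bij_betw_def by (auto simp: mpoly_ring_def indexed_pset_eq intro: inj_on_subset[OF _ subset_UNIV])
    show "PP 0 = \<zero>\<^bsub>mpoly_ring n k\<^esub>" "PP 1 = \<one>\<^bsub>mpoly_ring n k\<^esub>"
      by (simp_all add: mpoly_ring_def PP_zero PP_one)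
    show "PP (x + y) = PP x \<oplus>\<^bsub>mpoly_ring n k\<^esub> PP y" for x y by (simp add: mpoly_ring_def PP_add)
    show "PP (x * y) = PP x \<otimes>\<^bsub>mpoly_ring n k\<^esub> PP y" for x y
    proof
      fix m
      have "(\<Oplus>\<^bsub>k\<^esub>u\<in>{u. u \<subseteq># m}. PP x u \<otimes>\<^bsub>k\<^esub> PP y (m - u)) =
         \<phi> (\<Sum>u\<in>{u. u \<subseteq># m}. Poly_Mapping.lookup x u * Poly_Mapping.lookup y (m - u))"
        by (rule Phi_sum) (auto simp: finite_submset PP_def Phi_mult)
      then show "PP (x * y) m = (PP x \<otimes>\<^bsub>mpoly_ring n k\<^esub> PP y) m"
        by (simp add: mpoly_ring_def PP_def lookup_times_mset)
    qed
  qed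
qed

abbreviation redm :: "(nat \<Rightarrow> nat \<Rightarrow> nat \<Rightarrow> nat multiset \<Rightarrow>\<^sub>0 'f) \<Rightarrow> nat \<Rightarrow> nat \<Rightarrow> nat \<Rightarrow> 'f" where
  "redm E \<equiv> \<lambda>i a b. Poly_Mapping.lookup (E i a b) {#}"

lemma tor_rep:
  assumes g: "\<And>i. g (Suc i) = m i"
    and D: "\<And>i. ring_rep.mat_rep (vpolys n) PP (m i) (m (Suc i)) (D i) (E (Suc i))"
  shows "tor_cycles k m D j = vmap ` tor_cyc g (redm E) j" "tor_boundaries k m D j = vmap ` tor_bnd g (redm E) j"
proof -
  have rep: "mat_rep (m i) (m (Suc i)) (reduce_mat (D i)) (redm E (Suc i))" for i
    using D[of i] unfolding ring_rep.mat_rep_def[OF rep_mpoly] mat_rep_def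
    by (simp add: mats_def reduce_mat_def PP_def)
  show "tor_cycles k m D j = vmap ` tor_cyc g (redm E) j"
  proof (cases j)
    case 0
    then show ?thesis by (simp add: tor_cycles_def tor_cyc_def free_vecs_eq g)
  next
    case (Suc i)
    have "mat_ker k (m i) (m (Suc i)) (reduce_mat (D i)) =
       vmap ` {v \<in> vecs UNIV (m (Suc i)). mmap (m i) (m (Suc i)) (redm E (Suc i)) v = (\<lambda>_. 0)}"
      by (rule mat_ker_rep[OF rep])
    then show ?thesis by (simp add: Suc tor_cycles_def tor_cyc_def g)
  qed
  show "tor_boundaries k m D j = vmap ` tor_bnd g (redm E) j"
    unfolding tor_boundaries_def tor_bnd_def mat_im_rep[OF rep] g ..
qed

text \<open>Serves the uniqueness half of \<open>betti\<close>: an arbitrary resolution over the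
  record is pulled back along \<open>PP\<close>, so that it can be compared with the one coming from
  cells.\<close>

lemma resolution_rep:
  assumes "free_resolution (mpoly_ring n k) I m e D"
  obtains g E where "g 0 = 1" "\<And>i. g (Suc i) = m i"
    "ring_rep.mat_rep (vpolys n) PP 1 (g 1) (\<lambda>_ b. e b) (E 0)"
    "\<And>i. ring_rep.mat_rep (vpolys n) PP (m i) (m (Suc i)) (D i) (E (Suc i))"
proof -
  interpret P: ring_rep "vpolys n" "mpoly_ring n k" PP by (rule rep_mpoly)
  define h where "h = inv_into (vpolys n) PP"
  have h: "h x \<in> vpolys n" "PP (h x) = x" if "x \<in> carrier (mpoly_ring n k)" for x
    using that P.Phi_bij unfolding h_def bij_betw_def by (auto intro: inv_into_into f_inv_into_f)
  define E where "E i = (\<lambda>a b. case i of 0 \<Rightarrow> h (e b) | Suc i' \<Rightarrow> h (D i' a b))" for i :: nat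
  define g where "g i = (case i of 0 \<Rightarrow> 1 | Suc i' \<Rightarrow> m i')" for i
  show thesis
  proof (rule that[of g E])
    show "P.mat_rep 1 (g 1) (\<lambda>_ b. e b) (E 0)"
      using assms h by (auto simp: P.mat_rep_def mats_def E_def g_def free_resolution_def)
    show "P.mat_rep (m i) (m (Suc i)) (D i) (E (Suc i))" for i
      using assms h by (auto simp: P.mat_rep_def mats_def E_def g_def free_resolution_def)
  qed (simp_all add: g_def)
qed

end

section \<open>Betti numbers from a labelled complex\<close>

locale finite_coeff_rep = coeff_rep k \<phi> for k :: "'a ring" and \<phi> :: "'f::{finite,comm_ring_1} \<Rightarrow> 'a"
begin

text \<open>The description in \<open>betti\<close> is met from both sides: the cells give one
  resolution with the right dimension, and any other resolution has the same Tor by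
  \<open>tor_unique\<close>, whose dimension is unique over a finite ring.\<close>

theorem betti_labelled_complex:
  fixes \<epsilon> :: "'c \<Rightarrow> 'c \<Rightarrow> 'f"
  assumes K: "labelled_complex n K dm \<epsilon> l z"
    and d: "quot_dim (cyc (K - {z}) dm (labelled_complex.\<epsilon>r \<epsilon> l) (Suc j)) (bnd (K - {z}) dm (labelled_complex.\<epsilon>r \<epsilon> l) (Suc j)) d"
  shows "betti n k j (PP ` {p \<in> vpolys n. \<forall>m\<in>Poly_Mapping.keys p. \<exists>x\<in>K. dm x = 1 \<and> l x \<subseteq># m}) = d"
proof -
  interpret P: ring_rep "vpolys n" "mpoly_ring n k" PP by (rule rep_mpoly)
  interpret L: labelled_complex n K dm \<epsilon> l z by (rule K)
  let ?R = "mpoly_ring n k" and ?I = "PP ` {p \<in> vpolys n. \<forall>m\<in>Poly_Mapping.keys p. \<exists>x\<in>K. dm x = 1 \<and> l x \<subseteq># m}"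
  have I: "?I = (\<lambda>v. PP (v 0)) ` mmap 1 (L.rk 1) (L.E 0) ` vecs (vpolys n) (L.rk 1)"
    unfolding L.image_E0
  proof (intro equalityI subsetI)
    fix P assume "P \<in> ?I"
    then obtain p where p: "P = PP p" "p \<in> vpolys n" "\<forall>m\<in>Poly_Mapping.keys p. \<exists>x\<in>K. dm x = 1 \<and> l x \<subseteq># m" by auto
    show "P \<in> (\<lambda>v. PP (v 0)) ` {v \<in> vecs (vpolys n) 1. \<forall>m\<in>Poly_Mapping.keys (v 0). \<exists>x\<in>K. dm x = 1 \<and> l x \<subseteq># m}"
      by (rule image_eqI[of _ _ "\<lambda>b. if b = 0 then p else 0"]) (use p in \<open>auto simp: vecs_def\<close>)
  next
    fix P assume "P \<in> (\<lambda>v. PP (v 0)) ` {v \<in> vecs (vpolys n) 1. \<forall>m\<in>Poly_Mapping.keys (v 0). \<exists>x\<in>K. dm x = 1 \<and> l x \<subseteq># m}"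
    then obtain v where v: "P = PP (v 0)" "v \<in> vecs (vpolys n) 1" "\<forall>m\<in>Poly_Mapping.keys (v 0). \<exists>x\<in>K. dm x = 1 \<and> l x \<subseteq># m" by auto
    then have "v 0 \<in> vpolys n" by (simp add: vecs_def)
    then show "P \<in> ?I" using v by blast
  qed
  have rk0: "L.rk 0 = 1" using L.exact unfolding subring_set.exact_complex_def[OF P.subring_set_axioms] by blast
  let ?m = "\<lambda>i. L.rk (Suc i)" and ?e = "\<lambda>b. PP (L.E 0 0 b)" and ?D = "\<lambda>i a b. PP (L.E (Suc i) a b)"
  have e: "P.mat_rep 1 (L.rk 1) (\<lambda>_ b. ?e b) (L.E 0)"
    using L.E_mats[of 0] rk0 by (auto simp: P.mat_rep_def)
  have D: "P.mat_rep (?m i) (?m (Suc i)) (?D i) (L.E (Suc i))" for i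
    using L.E_mats[of "Suc i"] by (auto simp: P.mat_rep_def)
  have td: "quot_dim (tor_cyc L.rk (redm L.E) j) (tor_bnd L.rk (redm L.E) j) d"
    using d by (simp add: L.tor_cells)
  show ?thesis unfolding betti_def
  proof (rule the_equality)
    have "free_resolution ?R ?I ?m ?e ?D"
      using P.free_resolution_iff[where g = L.rk, OF rk0 refl e D] L.exact I by simp
    moreover have "quotient_dim k (tor_cycles k ?m ?D j) (tor_boundaries k ?m ?D j) d"
      unfolding tor_rep[where g = L.rk and m = ?m, OF refl D] quotient_dim_iff[OF refl] by (rule td)
    ultimately show "\<exists>m e D. free_resolution ?R ?I m e D \<and> quotient_dim k (tor_cycles k m D j) (tor_boundaries k m D j) d"
      by blast
  next
    fix b assume "\<exists>m e D. free_resolution ?R ?I m e D \<and> quotient_dim k (tor_cycles k m D j) (tor_boundaries k m D j) b"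
    then obtain m e' D' where r: "free_resolution ?R ?I m e' D'"
      "quotient_dim k (tor_cycles k m D' j) (tor_boundaries k m D' j) b" by blast
    from resolution_rep[OF r(1)] obtain g E where g: "g 0 = 1" "\<And>i. g (Suc i) = m i"
      "P.mat_rep 1 (g 1) (\<lambda>_ b. e' b) (E 0)" "\<And>i. P.mat_rep (m i) (m (Suc i)) (D' i) (E (Suc i))" by blast
    have ex: "P.exact_complex g E" "?I = (\<lambda>v. PP (v 0)) ` mmap 1 (g 1) (E 0) ` vecs (vpolys n) (g 1)"
      using P.free_resolution_iff[OF g] r(1) by simp_all
    have sub: "mmap 1 (g 1) (E 0) ` vecs (vpolys n) (g 1) \<subseteq> vecs (vpolys n) 1"
      "mmap 1 (L.rk 1) (L.E 0) ` vecs (vpolys n) (L.rk 1) \<subseteq> vecs (vpolys n) 1"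
      using P.mmap_image_vecs g(3) e by (auto simp: P.mat_rep_def)
    \<comment> \<open>The two ideals are known to agree as sets of record elements; injectivity on
      vectors of length 1 turns this into equality of the images of the two generator rows.\<close>
    have inj: "inj_on (\<lambda>v. PP (v 0)) (vecs (vpolys n) 1)"
    proof (rule inj_onI)
      fix v w assume vw: "v \<in> vecs (vpolys n) 1" "w \<in> vecs (vpolys n) 1" "PP (v 0) = PP (w 0)"
      then have "v 0 = w 0" using P.Phi_inj[of "v 0" "w 0"] by (simp add: vecs_def)
      show "v = w"
      proof
        fix b show "v b = w b" using vw \<open>v 0 = w 0\<close> by (cases "b = 0") (auto simp: vecs_def)
      qed
    qed
    have im: "mmap 1 (g 1) (E 0) ` vecs (vpolys n) (g 1) = mmap 1 (L.rk 1) (L.E 0) ` vecs (vpolys n) (L.rk 1)"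
      by (rule iffD1[OF inj_on_image_eq_iff[OF inj sub] trans[OF ex(2)[symmetric] I]])
    have "quot_dim (tor_cyc g (redm E) j) (tor_bnd g (redm E) j) b"
      using r(2) unfolding tor_rep[where g = g and m = m and D = D' and E = E, OF g(2,4)] quotient_dim_iff[OF refl] .
    then have "quot_dim (tor_cyc L.rk (redm L.E) j) (tor_bnd L.rk (redm L.E) j) b"
      using L.tor_unique[OF ex(1) L.exact im] by simp
    then show "b = d" using quot_dim_unique[OF subsp_tor_cyc subsp_tor_bnd _ td] by blast
  qed
qed

end

section \<open>Powers of monomial ideals\<close>

definition mono_polys :: "nat \<Rightarrow> nat multiset set \<Rightarrow> (nat multiset \<Rightarrow>\<^sub>0 'f::comm_ring_1) set" where
  "mono_polys n M = {p \<in> vpolys n. \<forall>m\<in>Poly_Mapping.keys p. m \<in> M}"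

text \<open>The start is the set of all monomials because the unit of \<open>ideals_set\<close> is
  the whole ring.\<close>

primrec mono_pow :: "nat \<Rightarrow> nat multiset set \<Rightarrow> nat \<Rightarrow> nat multiset set" where
  "mono_pow n M 0 = {m. set_mset m \<subseteq> {..<n}}"
| "mono_pow n M (Suc h) = {a + b |a b. a \<in> mono_pow n M h \<and> b \<in> M}"

lemma single_mono_polys: "set_mset m \<subseteq> {..<n} \<Longrightarrow> m \<in> M \<Longrightarrow> Poly_Mapping.single m c \<in> mono_polys n M"
  by (auto simp: mono_polys_def single_vpolys split: if_splits)

context coeff_rep
begin

lemma PP_in_closed:
  assumes "PP 0 \<in> S" "\<And>p q. p \<in> vpolys n \<Longrightarrow> q \<in> vpolys n \<Longrightarrow> PP p \<in> S \<Longrightarrow> PP q \<in> S \<Longrightarrow> PP (p + q) \<in> S"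
    and "p \<in> vpolys n" "\<And>m. m \<in> Poly_Mapping.keys p \<Longrightarrow> PP (Poly_Mapping.single m (Poly_Mapping.lookup p m)) \<in> S"
  shows "PP p \<in> S"
proof -
  have k: "set_mset m \<subseteq> {..<n}" if "m \<in> Poly_Mapping.keys p" for m using assms(3) that by (simp add: vpolys_def)
  have "PP (\<Sum>m\<in>A. Poly_Mapping.single m (Poly_Mapping.lookup p m)) \<in> S \<and>
     (\<Sum>m\<in>A. Poly_Mapping.single m (Poly_Mapping.lookup p m)) \<in> vpolys n"
    if "finite A" "A \<subseteq> Poly_Mapping.keys p" for A
    using that
  proof (induction A rule: finite_induct)
    case empty
    then show ?case using assms(1) by (simp add: vpolys_def)
  next
    case (insert m A)
    have s: "Poly_Mapping.single m (Poly_Mapping.lookup p m) \<in> vpolys n"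
      using k insert.prems by (intro single_vpolys) auto
    have IH: "PP (\<Sum>m\<in>A. Poly_Mapping.single m (Poly_Mapping.lookup p m)) \<in> S"
     "(\<Sum>m\<in>A. Poly_Mapping.single m (Poly_Mapping.lookup p m)) \<in> vpolys n" using insert by auto
    show ?case
      using assms(2)[OF s IH(2) assms(4) IH(1)] insert
        subring_set.add_C[OF residue_map.axioms(1)[OF residue_map_vpolys] s IH(2)] by simp
  qed
  from this[of "Poly_Mapping.keys p"] show ?thesis by (simp add: poly_mapping_monomials[symmetric])
qed

lemma mono_polys_ideal:
  assumes up: "\<And>m m'. m \<in> M \<Longrightarrow> m \<subseteq># m' \<Longrightarrow> m' \<in> M"
  shows "ideal (PP ` mono_polys n M) (mpoly_ring n k)"
proof -
  interpret P: ring_rep "vpolys n" "mpoly_ring n k" PP by (rule rep_mpoly)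
  interpret R: cring "mpoly_ring n k" by (rule P.cring_R)
  have sub: "p \<in> vpolys n" if "p \<in> mono_polys n M" for p :: "nat multiset \<Rightarrow>\<^sub>0 'f" using that by (simp add: mono_polys_def)
  have mult: "x * p \<in> mono_polys n M" if x: "x \<in> vpolys n" and p: "p \<in> mono_polys n M" for x p :: "nat multiset \<Rightarrow>\<^sub>0 'f"
  proof -
    have "m \<in> M" if m: "m \<in> Poly_Mapping.keys (x * p)" for m
    proof -
      obtain a b where ab: "m = a + b" "b \<in> Poly_Mapping.keys p" using m keys_mult[of x p] by blast
      then have "b \<in> M" using p by (simp add: mono_polys_def)
      then show ?thesis using up[of b m] ab by simp
    qed
    then show ?thesis using P.mult_C[OF x sub[OF p]] by (simp add: mono_polys_def)
  qed
  show ?thesis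
  proof (rule idealI[OF R.ring_axioms])
    show "subgroup (PP ` mono_polys n M) (add_monoid (mpoly_ring n k))"
    proof (rule group.subgroupI[OF R.a_group])
      show "PP ` mono_polys n M \<subseteq> carrier (add_monoid (mpoly_ring n k))"
        using P.Phi_carrier sub by auto
      have "(0 :: nat multiset \<Rightarrow>\<^sub>0 'f) \<in> mono_polys n M" by (simp add: mono_polys_def vpolys_def)
      then show "PP ` mono_polys n M \<noteq> {}" by blast
      fix a assume "a \<in> PP ` mono_polys n M"
      then obtain p where p: "a = PP p" "p \<in> mono_polys n M" by (elim imageE)
      have pC: "p \<in> vpolys n" using sub p by blast
      have np: "- p \<in> mono_polys n M"
        using p(2) P.uminus_C[OF pC] by (simp add: mono_polys_def in_keys_iff)
      have "\<ominus>\<^bsub>mpoly_ring n k\<^esub> a = PP (- p)"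
        using P.Phi_add[OF P.uminus_C[OF pC] pC] P.Phi_carrier[OF pC] P.Phi_carrier[OF P.uminus_C[OF pC]]
        by (intro R.minus_equality) (auto simp: p P.Phi_zero)
      then show "inv\<^bsub>add_monoid (mpoly_ring n k)\<^esub> a \<in> PP ` mono_polys n M"
        using np by (simp add: a_inv_def)
      fix b assume "b \<in> PP ` mono_polys n M"
      then obtain q where q: "b = PP q" "q \<in> mono_polys n M" by (elim imageE)
      have "p + q \<in> mono_polys n M"
        using p(2) q(2) P.add_C[OF pC sub[OF q(2)]] keys_add[of p q] by (auto simp: mono_polys_def)
      moreover have "a \<otimes>\<^bsub>add_monoid (mpoly_ring n k)\<^esub> b = PP (p + q)" using P.Phi_add[OF pC sub[OF q(2)]] p q by simp
      ultimately show "a \<otimes>\<^bsub>add_monoid (mpoly_ring n k)\<^esub> b \<in> PP ` mono_polys n M" by blast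
    qed
    fix a x assume "a \<in> PP ` mono_polys n M" and x: "x \<in> carrier (mpoly_ring n k)"
    then obtain p where p: "a = PP p" "p \<in> mono_polys n M" by (elim imageE)
    obtain y where y: "y \<in> vpolys n" "x = PP y" using P.carrier_cases[OF x] .
    have 1: "x \<otimes>\<^bsub>mpoly_ring n k\<^esub> a = PP (y * p)" using P.Phi_mult[OF y(1) sub[OF p(2)]] p y by simp
    then show "x \<otimes>\<^bsub>mpoly_ring n k\<^esub> a \<in> PP ` mono_polys n M" using mult[OF y(1) p(2)] by simp
    have "a \<otimes>\<^bsub>mpoly_ring n k\<^esub> x = x \<otimes>\<^bsub>mpoly_ring n k\<^esub> a"
      using R.m_comm x P.Phi_carrier[OF sub[OF p(2)]] p by simp
    then show "a \<otimes>\<^bsub>mpoly_ring n k\<^esub> x \<in> PP ` mono_polys n M" using 1 mult[OF y(1) p(2)] by simp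
  qed
qed

lemma monomial_ideal_eq:
  assumes G: "\<And>g. g \<in> G \<Longrightarrow> set_mset g \<subseteq> {..<n}"
  shows "monomial_ideal n k G = PP ` mono_polys n {m. \<exists>g\<in>G. g \<subseteq># m}"
proof -
  interpret P: ring_rep "vpolys n" "mpoly_ring n k" PP by (rule rep_mpoly)
  interpret R: cring "mpoly_ring n k" by (rule P.cring_R)
  let ?M = "{m. \<exists>g\<in>G. g \<subseteq># m}"
  have mm: "monic_monomial k g = PP (Poly_Mapping.single g 1)" for g
    unfolding monic_monomial_def PP_single Phi_one ..
  have id: "ideal (PP ` mono_polys n ?M) (mpoly_ring n k)"
    by (rule mono_polys_ideal) (auto intro: subset_mset.order_trans)
  show ?thesis unfolding monomial_ideal_def
  proof (intro equalityI)
    have "monic_monomial k ` G \<subseteq> PP ` mono_polys n ?M"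
    proof
      fix x assume "x \<in> monic_monomial k ` G"
      then obtain g where g: "g \<in> G" "x = PP (Poly_Mapping.single g 1)" unfolding mm by (elim imageE)
      then show "x \<in> PP ` mono_polys n ?M" using G[OF g(1)] by (auto intro!: imageI single_mono_polys)
    qed
    then show "Idl\<^bsub>mpoly_ring n k\<^esub> (monic_monomial k ` G) \<subseteq> PP ` mono_polys n ?M"
      by (rule R.genideal_minimal[OF id])
    let ?J = "Idl\<^bsub>mpoly_ring n k\<^esub> (monic_monomial k ` G)"
    have Gc: "monic_monomial k ` G \<subseteq> carrier (mpoly_ring n k)"
      unfolding mm using G by (auto intro!: P.Phi_carrier single_vpolys)
    interpret J: ideal ?J "mpoly_ring n k" by (rule R.genideal_ideal[OF Gc])
    show "PP ` mono_polys n ?M \<subseteq> ?J"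
    proof
      fix x assume "x \<in> PP ` mono_polys n ?M"
      then obtain p where p: "x = PP p" "p \<in> mono_polys n ?M" by (elim imageE)
      have pC: "p \<in> vpolys n" using p by (simp add: mono_polys_def)
      have "PP p \<in> ?J"
      proof (rule PP_in_closed[OF _ _ pC])
        show "PP 0 \<in> ?J" using J.zero_closed by (simp add: P.Phi_zero)
        show "PP (p + q) \<in> ?J" if "p \<in> vpolys n" "q \<in> vpolys n" "PP p \<in> ?J" "PP q \<in> ?J" for p q
          using J.a_closed that P.Phi_add by simp
        fix m assume m: "m \<in> Poly_Mapping.keys p"
        then obtain g where g: "g \<in> G" "g \<subseteq># m" using p(2) by (auto simp: mono_polys_def)
        have mv: "set_mset m \<subseteq> {..<n}" using m pC by (simp add: vpolys_def)
        have "Poly_Mapping.single m (Poly_Mapping.lookup p m) =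
          Poly_Mapping.single (m - g) (Poly_Mapping.lookup p m) * Poly_Mapping.single g 1"
          using g by (simp add: mult_single)
        moreover have 1: "Poly_Mapping.single (m - g) (Poly_Mapping.lookup p m) \<in> vpolys n"
          using mv by (intro single_vpolys) (auto dest: in_diffD)
        moreover have 2: "Poly_Mapping.single g (1::'f) \<in> vpolys n" by (rule single_vpolys[OF G[OF g(1)]])
        ultimately have "PP (Poly_Mapping.single m (Poly_Mapping.lookup p m)) =
           PP (Poly_Mapping.single (m - g) (Poly_Mapping.lookup p m)) \<otimes>\<^bsub>mpoly_ring n k\<^esub> monic_monomial k g"
          by (simp add: P.Phi_mult mm)
        moreover have "monic_monomial k g \<in> ?J" using R.genideal_self[OF Gc] g(1) by blast
        ultimately show "PP (Poly_Mapping.single m (Poly_Mapping.lookup p m)) \<in> ?J"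
          using J.I_l_closed P.Phi_carrier[OF 1] by simp
      qed
      then show "x \<in> ?J" using p by simp
    qed
  qed
qed

text \<open>Every monomial of a product is a product of monomials; conversely a term factors with
  its coefficient placed on the first factor.\<close>

lemma ideal_prod_mono_polys:
  assumes M: "\<And>m. m \<in> M \<Longrightarrow> set_mset m \<subseteq> {..<n}" and N: "\<And>m. m \<in> N \<Longrightarrow> set_mset m \<subseteq> {..<n}"
  shows "ideal_prod (mpoly_ring n k) (PP ` mono_polys n M) (PP ` mono_polys n N) =
    PP ` mono_polys n {a + b |a b. a \<in> M \<and> b \<in> N}" (is "?L = PP ` mono_polys n ?MN")
proof -
  interpret P: ring_rep "vpolys n" "mpoly_ring n k" PP by (rule rep_mpoly)
  have sub: "p \<in> vpolys n" if "p \<in> mono_polys n M" for p :: "nat multiset \<Rightarrow>\<^sub>0 'f" and M using that by (simp add: mono_polys_def)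
  show ?thesis
  proof (intro equalityI subsetI)
    fix x assume "x \<in> ?L"
    then show "x \<in> PP ` mono_polys n ?MN"
    proof (induction rule: ideal_prod.induct)
      case (prod i j)
      then obtain p q where pq: "i = PP p" "j = PP q" "p \<in> mono_polys n M" "q \<in> mono_polys n N" by (elim imageE)
      have "p * q \<in> mono_polys n ?MN"
      proof -
        have "m \<in> ?MN" if "m \<in> Poly_Mapping.keys (p * q)" for m
          using that keys_mult[of p q] pq(3,4) unfolding mono_polys_def by blast
        then show ?thesis using P.mult_C[OF sub[OF pq(3)] sub[OF pq(4)]] by (simp add: mono_polys_def)
      qed
      moreover have "i \<otimes>\<^bsub>mpoly_ring n k\<^esub> j = PP (p * q)"
        using P.Phi_mult[OF sub[OF pq(3)] sub[OF pq(4)]] pq by simp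
      ultimately show ?case by blast
    next
      case (sum s1 s2)
      then obtain p q where pq: "s1 = PP p" "s2 = PP q" "p \<in> mono_polys n ?MN" "q \<in> mono_polys n ?MN" by (elim imageE)
      have "p + q \<in> mono_polys n ?MN"
        using P.add_C[OF sub[OF pq(3)] sub[OF pq(4)]] keys_add[of p q] pq(3,4) unfolding mono_polys_def by blast
      moreover have "s1 \<oplus>\<^bsub>mpoly_ring n k\<^esub> s2 = PP (p + q)"
        using P.Phi_add[OF sub[OF pq(3)] sub[OF pq(4)]] pq by simp
      ultimately show ?case by blast
    qed
  next
    fix x assume "x \<in> PP ` mono_polys n ?MN"
    then obtain p where p: "x = PP p" "p \<in> mono_polys n ?MN" by (elim imageE)
    have z: "(0 :: nat multiset \<Rightarrow>\<^sub>0 'f) \<in> mono_polys n A" for A by (simp add: mono_polys_def vpolys_def)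
    have "PP p \<in> ?L"
    proof (rule PP_in_closed[OF _ _ sub[OF p(2)]])
      have "PP 0 \<otimes>\<^bsub>mpoly_ring n k\<^esub> PP 0 \<in> ?L" by (intro ideal_prod.prod imageI z)
      then show "PP 0 \<in> ?L" by (simp add: P.Phi_mult[OF P.zero_C P.zero_C, symmetric])
      show "PP (p + q) \<in> ?L" if "p \<in> vpolys n" "q \<in> vpolys n" "PP p \<in> ?L" "PP q \<in> ?L" for p q
        using ideal_prod.sum[OF that(3,4)] that by (simp add: P.Phi_add)
      fix m assume "m \<in> Poly_Mapping.keys p"
      then obtain a b where ab: "m = a + b" "a \<in> M" "b \<in> N" using p(2) by (auto simp: mono_polys_def)
      let ?c = "Poly_Mapping.lookup p m"
      have 1: "Poly_Mapping.single a ?c \<in> mono_polys n M" "Poly_Mapping.single b (1::'f) \<in> mono_polys n N"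
        using ab M N by (auto intro!: single_mono_polys)
      have "Poly_Mapping.single m ?c = Poly_Mapping.single a ?c * Poly_Mapping.single b 1"
        using ab by (simp add: mult_single)
      then have "PP (Poly_Mapping.single m ?c) = PP (Poly_Mapping.single a ?c) \<otimes>\<^bsub>mpoly_ring n k\<^esub> PP (Poly_Mapping.single b 1)"
        using P.Phi_mult[OF sub[OF 1(1)] sub[OF 1(2)]] by simp
      then show "PP (Poly_Mapping.single m ?c) \<in> ?L" using 1 by (auto intro: ideal_prod.prod)
    qed
    then show "x \<in> ?L" using p by simp
  qed
qed

lemma mono_pow_vars:
  assumes "\<And>m. m \<in> M \<Longrightarrow> set_mset m \<subseteq> {..<n}"
  shows "m \<in> mono_pow n M h \<Longrightarrow> set_mset m \<subseteq> {..<n}"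
proof (induction h arbitrary: m)
  case (Suc h)
  then obtain a b where "m = a + b" "a \<in> mono_pow n M h" "b \<in> M" by auto
  then show ?case using Suc.IH[of a] assms[of b] by simp
qed simp

lemma ideal_power_mono_polys:
  assumes M: "\<And>m. m \<in> M \<Longrightarrow> set_mset m \<subseteq> {..<n}"
  shows "ideal_power (mpoly_ring n k) (PP ` mono_polys n M) h = PP ` mono_polys n (mono_pow n M h)"
proof -
  have unf: "I [^]\<^bsub>S\<^esub> (0::nat) = \<one>\<^bsub>S\<^esub>" "I [^]\<^bsub>S\<^esub> (Suc j) = I [^]\<^bsub>S\<^esub> j \<otimes>\<^bsub>S\<^esub> I" for I j and S :: "(nat multiset \<Rightarrow> 'a) set ring"
    by (simp_all add: nat_pow_def)
  show ?thesis unfolding ideal_power_def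
  proof (induction h)
    case 0
    have "(mono_polys n {m. set_mset m \<subseteq> {..<n}} :: (nat multiset \<Rightarrow>\<^sub>0 'f) set) = vpolys n"
      by (auto simp: mono_polys_def vpolys_def)
    then show ?case unfolding unf by (simp add: ideals_set_def mpoly_ring_def indexed_pset_eq)
  next
    case (Suc h)
    have "PP ` mono_polys n M [^]\<^bsub>ideals_set (mpoly_ring n k)\<^esub> (Suc h) =
       ideal_prod (mpoly_ring n k) (PP ` mono_polys n (mono_pow n M h)) (PP ` mono_polys n M)"
      unfolding unf Suc by (simp add: ideals_set_def)
    also have "\<dots> = PP ` mono_polys n (mono_pow n M (Suc h))"
      using ideal_prod_mono_polys[OF mono_pow_vars[OF M] M] by simp
    finally show ?case .
  qed
qed

end

section \<open>Homology of based complexes\<close>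

definition restr :: "'c set \<Rightarrow> ('c \<Rightarrow> 'f::comm_ring_1) \<Rightarrow> 'c \<Rightarrow> 'f" where
  "restr A c = (\<lambda>x. if x \<in> A then c x else 0)"

definition acyclic_cells :: "'c set \<Rightarrow> ('c \<Rightarrow> nat) \<Rightarrow> ('c \<Rightarrow> 'c \<Rightarrow> 'f::comm_ring_1) \<Rightarrow> bool" where
  "acyclic_cells W dm \<epsilon> \<longleftrightarrow> (\<forall>i. cyc W dm \<epsilon> i \<subseteq> bnd W dm \<epsilon> i)"

text \<open>A relation and not a function: dimensions are produced by explicit bases over any
  commutative ring, while their uniqueness is a separate matter settled over finite rings.\<close>

definition hdim :: "'c set \<Rightarrow> ('c \<Rightarrow> nat) \<Rightarrow> ('c \<Rightarrow> 'c \<Rightarrow> 'f::comm_ring_1) \<Rightarrow> nat \<Rightarrow> nat \<Rightarrow> bool" where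
  "hdim W dm \<epsilon> i d \<longleftrightarrow> quot_dim (cyc W dm \<epsilon> i) (bnd W dm \<epsilon> i) d"

lemma chain_space_0: "c \<in> chain_space W dm i \<Longrightarrow> x \<notin> W \<Longrightarrow> c x = 0"
  by (auto simp: chain_space_def)

lemma chain_space_mono: "A \<subseteq> B \<Longrightarrow> c \<in> chain_space A dm i \<Longrightarrow> c \<in> chain_space B dm i"
  by (auto simp: chain_space_def)

lemma restr_chain: "c \<in> chain_space B dm i \<Longrightarrow> A \<subseteq> B \<Longrightarrow> restr A c \<in> chain_space A dm i"
  by (auto simp: chain_space_def restr_def)

lemma chain_space_sub: "c \<in> chain_space B dm i \<Longrightarrow> (\<And>x. x \<in> B \<Longrightarrow> x \<notin> A \<Longrightarrow> c x = 0) \<Longrightarrow> c \<in> chain_space A dm i"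
  by (auto simp: chain_space_def)

locale cell_complex =
  fixes W :: "'c set" and dm :: "'c \<Rightarrow> nat" and \<epsilon> :: "'c \<Rightarrow> 'c \<Rightarrow> 'f::comm_ring_1"
  assumes finW: "finite W"
    and grade: "\<And>a b. a \<in> W \<Longrightarrow> b \<in> W \<Longrightarrow> \<epsilon> a b \<noteq> 0 \<Longrightarrow> dm a = Suc (dm b)"
begin

lemma bdry_chain: "c \<in> chain_space W dm (Suc i) \<Longrightarrow> bdry W \<epsilon> c \<in> chain_space W dm i"
  unfolding chain_space_def
proof (intro CollectI allI impI)
  fix b assume c: "c \<in> {c. \<forall>x. c x \<noteq> 0 \<longrightarrow> x \<in> W \<and> dm x = Suc i}" and "bdry W \<epsilon> c b \<noteq> 0"
  then have b: "b \<in> W" "(\<Sum>a\<in>W. c a * \<epsilon> a b) \<noteq> 0" by (auto simp: bdry_def split: if_splits)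
  then obtain a where a: "a \<in> W" "c a * \<epsilon> a b \<noteq> 0" by (meson sum.not_neutral_contains_not_neutral)
  then have "c a \<noteq> 0" "\<epsilon> a b \<noteq> 0" by auto
  then show "b \<in> W \<and> dm b = i" using c grade[OF a(1) b(1)] b(1) by auto
qed

lemma bdry_add_cell:
  assumes "A \<subseteq> W"
  shows "bdry W \<epsilon> (\<lambda>x. if x \<in> A then c x else 0) b = (if b \<in> W then \<Sum>a\<in>A. c a * \<epsilon> a b else 0)"
proof -
  have "(\<Sum>a\<in>W. (if a \<in> A then c a else 0) * \<epsilon> a b) = (\<Sum>a\<in>A. c a * \<epsilon> a b)"
    using assms finW by (intro sum.mono_neutral_cong_right) auto
  then show ?thesis by (simp add: bdry_def)
qed

end

text \<open>The involution \<open>pt\<close> pairs each cell of \<open>L\<close> with one of dimension one higher; the rank \<open>r\<close> makes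
  gradient paths terminate.\<close>

locale acyclic_matching = cell_complex W dm \<epsilon> for W :: "'c set" and dm and \<epsilon> :: "'c \<Rightarrow> 'c \<Rightarrow> 'f::comm_ring_1" +
  fixes L :: "'c set" and pt :: "'c \<Rightarrow> 'c" and r :: "'c \<Rightarrow> nat"
  assumes sqW: "\<And>a b. a \<in> W \<Longrightarrow> b \<in> W \<Longrightarrow> (\<Sum>x\<in>W. \<epsilon> a x * \<epsilon> x b) = 0"
    and pt_W: "\<And>x. x \<in> W \<Longrightarrow> pt x \<in> W" and pt_pt: "\<And>x. x \<in> W \<Longrightarrow> pt (pt x) = x"
    and pt_L: "\<And>x. x \<in> W \<Longrightarrow> pt x \<in> L \<longleftrightarrow> x \<notin> L"
    and unit: "\<And>a. a \<in> W \<Longrightarrow> a \<in> L \<Longrightarrow> \<epsilon> (pt a) a * \<epsilon> (pt a) a = 1"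
    and rank: "\<And>a b. a \<in> W \<Longrightarrow> a \<in> L \<Longrightarrow> b \<in> W \<Longrightarrow> b \<in> L \<Longrightarrow> b \<noteq> a \<Longrightarrow> \<epsilon> (pt a) b \<noteq> 0 \<Longrightarrow> r b < r a"
begin

lemma bdry_bdry: "bdry W \<epsilon> (bdry W \<epsilon> c) = (\<lambda>_. 0)"
proof
  fix b
  have "(\<Sum>x\<in>W. (\<Sum>a\<in>W. c a * \<epsilon> a x) * \<epsilon> x b) = (\<Sum>a\<in>W. c a * (\<Sum>x\<in>W. \<epsilon> a x * \<epsilon> x b))"
    unfolding sum_distrib_left sum_distrib_right by (subst sum.swap) (simp add: mult.assoc)
  then show "bdry W \<epsilon> (bdry W \<epsilon> c) b = 0" using sqW by (simp add: bdry_def)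
qed

text \<open>Induction on a bound for the ranks that occur. A combination \<open>y0\<close> of the
  upper partners of the lower cells of rank \<open>N\<close> corrects all coefficients of that rank;
  it does not disturb lower cells of higher rank, because gradient steps only decrease the
  rank.\<close>

lemma clear_lower:
  assumes "c \<in> chain_space W dm i" "\<And>a. a \<in> W \<Longrightarrow> a \<in> L \<Longrightarrow> r a \<ge> N \<Longrightarrow> c a = 0"
  shows "\<exists>y\<in>chain_space W dm (Suc i). \<forall>a\<in>W. a \<in> L \<longrightarrow> c a = bdry W \<epsilon> y a"
  using assms
proof (induction N arbitrary: c)
  case 0
  show ?case by (rule bexI[OF _ chains_zero]) (use 0 in \<open>simp add: bdry_zero\<close>)
next
  case (Suc N)
  let ?A = "{x\<in>W. x \<notin> L \<and> r (pt x) = N}"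
  \<comment> \<open>By \<open>unit\<close> the incidence with the partner is its own inverse, so
    this coefficient reproduces \<open>c (pt x)\<close> in the boundary.\<close>
  define y0 where "y0 = (\<lambda>x. if x \<in> ?A then c (pt x) * \<epsilon> x (pt x) else 0)"
  have y0: "y0 \<in> chain_space W dm (Suc i)" unfolding chain_space_def
  proof (intro CollectI allI impI)
    fix x assume "y0 x \<noteq> 0"
    then have x: "x \<in> ?A" "c (pt x) \<noteq> 0" "\<epsilon> x (pt x) \<noteq> 0" by (auto simp: y0_def split: if_splits)
    then show "x \<in> W \<and> dm x = Suc i"
      using grade[of x "pt x"] pt_W[of x] Suc.prems(1) by (auto simp: chain_space_def)
  qed
  have by0: "bdry W \<epsilon> y0 b = c b" if b: "b \<in> W" "b \<in> L" "r b \<ge> N" for b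
  proof -
    have z: "c (pt x) * \<epsilon> x (pt x) * \<epsilon> x b = 0" if x: "x \<in> ?A" "x \<noteq> pt b" for x
    proof (rule ccontr)
      assume nz: "c (pt x) * \<epsilon> x (pt x) * \<epsilon> x b \<noteq> 0"
      then have "\<epsilon> x b \<noteq> 0" by auto
      moreover have "pt x \<in> W" "pt x \<in> L" "pt (pt x) = x" using x pt_W pt_L pt_pt by auto
      moreover have "b \<noteq> pt x" using x pt_pt by auto
      ultimately have "r b < r (pt x)" using rank[of "pt x" b] b by simp
      then show False using x b by simp
    qed
    have "bdry W \<epsilon> y0 b = (\<Sum>x\<in>?A. c (pt x) * \<epsilon> x (pt x) * \<epsilon> x b)"
      unfolding y0_def using bdry_add_cell[of ?A "\<lambda>x. c (pt x) * \<epsilon> x (pt x)" b] b(1) by simp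
    also have "\<dots> = c b"
    proof (cases "r b = N")
      case True
      then have pb: "pt b \<in> ?A" using b pt_W pt_L pt_pt by auto
      have "(\<Sum>x\<in>?A. c (pt x) * \<epsilon> x (pt x) * \<epsilon> x b) = (\<Sum>x\<in>{pt b}. c (pt x) * \<epsilon> x (pt x) * \<epsilon> x b)"
        using pb z finW by (intro sum.mono_neutral_right) auto
      also have "\<dots> = c b" using unit[OF b(1,2)] pt_pt[OF b(1)] by (simp add: mult.assoc)
      finally show ?thesis .
    next
      case False
      then have "pt b \<notin> ?A" using pt_pt[OF b(1)] by auto
      then have "(\<Sum>x\<in>?A. c (pt x) * \<epsilon> x (pt x) * \<epsilon> x b) = 0" using z by (intro sum.neutral) auto
      then show ?thesis using Suc.prems(2) b False by simp
    qed
    finally show ?thesis .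
  qed
  have "(\<lambda>a. c a - bdry W \<epsilon> y0 a) \<in> chain_space W dm i" by (rule chains_diff[OF Suc.prems(1) bdry_chain[OF y0]])
  from Suc.IH[OF this] obtain y1 where y1: "y1 \<in> chain_space W dm (Suc i)"
    "\<forall>a\<in>W. a \<in> L \<longrightarrow> c a - bdry W \<epsilon> y0 a = bdry W \<epsilon> y1 a" using by0 by auto
  show ?case
  proof (rule bexI[OF _ chains_add[OF y0 y1(1)]], intro ballI impI)
    fix a assume "a \<in> W" "a \<in> L"
    then have "c a - bdry W \<epsilon> y0 a = bdry W \<epsilon> y1 a" using y1(2) by blast
    then show "c a = bdry W \<epsilon> (\<lambda>a. y0 a + y1 a) a" by (simp add: bdry_add algebra_simps)
  qed
qed

text \<open>Once the lower cells are cleared, the remaining cycle \<open>d\<close> lives on upper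
  cells. If it were nonzero, take a cell \<open>x\<close> in its support whose partner has maximal
  rank: no other cell of the support meets that partner, so the boundary of \<open>d\<close> there
  is \<open>d x\<close> up to a unit.\<close>

theorem acyclic: "acyclic_cells W dm \<epsilon>"
  unfolding acyclic_cells_def
proof (intro allI subsetI)
  fix i c assume "c \<in> cyc W dm \<epsilon> i"
  then have c: "c \<in> chain_space W dm i" "bdry W \<epsilon> c = (\<lambda>_. 0)" by (auto simp: cyc_def)
  have "\<exists>y\<in>chain_space W dm (Suc i). \<forall>a\<in>W. a \<in> L \<longrightarrow> c a = bdry W \<epsilon> y a"
  \<comment> \<open>Above the maximal rank the condition on \<open>c\<close> is void, so all lower
    cells are cleared.\<close>
  proof (rule clear_lower[OF c(1), of "Suc (Max (r ` W))"])
    fix a assume "a \<in> W" "Suc (Max (r ` W)) \<le> r a"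
    moreover have "r a \<le> Max (r ` W)" using \<open>a \<in> W\<close> finW by simp
    ultimately show "c a = 0" by simp
  qed
  then obtain y where y: "y \<in> chain_space W dm (Suc i)" "\<And>a. a \<in> W \<Longrightarrow> a \<in> L \<Longrightarrow> c a = bdry W \<epsilon> y a" by blast
  define d where "d = (\<lambda>a. c a - bdry W \<epsilon> y a)"
  have dC: "d \<in> chain_space W dm i" unfolding d_def by (rule chains_diff[OF c(1) bdry_chain[OF y(1)]])
  have dL: "d a = 0" if "a \<in> L" for a
    using y(2)[of a] that chain_space_0[OF dC, of a] by (cases "a \<in> W") (auto simp: d_def)
  have db: "bdry W \<epsilon> d = (\<lambda>_. 0)" unfolding d_def bdry_diff c(2) bdry_bdry by simp
  have "d x = 0" for x
  proof (rule ccontr)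
    assume "d x \<noteq> 0"
    let ?B = "{x\<in>W. d x \<noteq> 0}"
    have "finite ?B" "?B \<noteq> {}" using finW \<open>d x \<noteq> 0\<close> chain_space_0[OF dC, of x] by auto
    then have "Max ((\<lambda>x. r (pt x)) ` ?B) \<in> (\<lambda>x. r (pt x)) ` ?B" by (intro Max_in) auto
    then obtain x where "x \<in> ?B" "Max ((\<lambda>x. r (pt x)) ` ?B) = r (pt x)" by (elim imageE)
    then have x: "x \<in> ?B" "\<And>x'. x' \<in> ?B \<Longrightarrow> r (pt x') \<le> r (pt x)"
      using Max_ge[of "(\<lambda>x. r (pt x)) ` ?B"] \<open>finite ?B\<close> by (auto simp del: Max_ge_iff)
    define b where "b = pt x"
    have xL: "x \<in> W" "x \<notin> L" using x dL by auto
    have b: "b \<in> W" "b \<in> L" "pt b = x" using xL pt_W pt_L pt_pt by (auto simp: b_def)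
    have z: "d a * \<epsilon> a b = 0" if a: "a \<in> W" "a \<noteq> x" for a
    proof (rule ccontr)
      assume nz: "d a * \<epsilon> a b \<noteq> 0"
      then have "d a \<noteq> 0" "\<epsilon> a b \<noteq> 0" by auto
      moreover have "a \<notin> L" using dL \<open>d a \<noteq> 0\<close> by blast
      moreover have "b \<noteq> pt a" using a b(3) pt_pt[of a] by auto
      ultimately have "r b < r (pt a)"
        using rank[of "pt a" b] a b pt_W[of a] pt_L[of a] pt_pt[of a] by auto
      then show False using x(2)[of a] a \<open>d a \<noteq> 0\<close> by (simp add: b_def)
    qed
    have "(\<Sum>a\<in>W. d a * \<epsilon> a b) = (\<Sum>a\<in>{x}. d a * \<epsilon> a b)"
      using z xL finW by (intro sum.mono_neutral_right) auto
    moreover have "(\<Sum>a\<in>W. d a * \<epsilon> a b) = 0" using fun_cong[OF db, of b] b by (simp add: bdry_def)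
    ultimately have "d x * \<epsilon> x b * \<epsilon> x b = 0" by simp
    then have "d x = 0" using unit[OF b(1,2)] b(3) by (simp add: mult.assoc)
    then show False using x(1) by simp
  qed
  then have "c = bdry W \<epsilon> y" unfolding d_def by (simp add: fun_eq_iff)
  then show "c \<in> bnd W dm \<epsilon> i" using y(1) by (rule bnd_I[rotated])
qed

end

section \<open>Removal of acyclic parts\<close>

locale square_zero_complex = cell_complex W dm \<epsilon> for W :: "'c set" and dm and \<epsilon> :: "'c \<Rightarrow> 'c \<Rightarrow> 'f::comm_ring_1" +
  assumes sqW: "\<And>a b. a \<in> W \<Longrightarrow> b \<in> W \<Longrightarrow> (\<Sum>x\<in>W. \<epsilon> a x * \<epsilon> x b) = 0"
begin

lemma bdry_bdry: "bdry W \<epsilon> (bdry W \<epsilon> c) = (\<lambda>_. 0)"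
proof
  fix b
  have "(\<Sum>x\<in>W. (\<Sum>a\<in>W. c a * \<epsilon> a x) * \<epsilon> x b) = (\<Sum>a\<in>W. c a * (\<Sum>x\<in>W. \<epsilon> a x * \<epsilon> x b))"
    unfolding sum_distrib_left sum_distrib_right by (subst sum.swap) (simp add: mult.assoc)
  then show "bdry W \<epsilon> (bdry W \<epsilon> c) b = 0" using sqW by (simp add: bdry_def)
qed

lemma restr_bdry:
  assumes "A \<subseteq> W" "\<And>a b. a \<in> W - A \<Longrightarrow> b \<in> A \<Longrightarrow> \<epsilon> a b = 0"
  shows "bdry A \<epsilon> (restr A c) = restr A (bdry W \<epsilon> c)"
proof
  fix b
  have "(\<Sum>a\<in>A. restr A c a * \<epsilon> a b) = (\<Sum>a\<in>W. c a * \<epsilon> a b)" if "b \<in> A"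
    using assms that finW by (intro sum.mono_neutral_cong_left) (auto simp: restr_def)
  then show "bdry A \<epsilon> (restr A c) b = restr A (bdry W \<epsilon> c) b" using assms(1) by (auto simp: bdry_def restr_def)
qed

lemma bdry_sub:
  assumes "A \<subseteq> W" "\<And>a b. a \<in> A \<Longrightarrow> b \<in> W - A \<Longrightarrow> \<epsilon> a b = 0" "c \<in> chain_space A dm i"
  shows "bdry A \<epsilon> c = bdry W \<epsilon> c"
proof
  fix b
  have 1: "(\<Sum>a\<in>W. c a * \<epsilon> a b) = (\<Sum>a\<in>A. c a * \<epsilon> a b)"
    using assms(1) finW chain_space_0[OF assms(3)] by (intro sum.mono_neutral_right) auto
  have "(\<Sum>a\<in>A. c a * \<epsilon> a b) = 0" if "b \<in> W - A" using assms(2)[OF _ that] by simp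
  then show "bdry A \<epsilon> c b = bdry W \<epsilon> c b" using 1 assms(1) by (auto simp: bdry_def)
qed

text \<open>\<open>V\<close> is a subcomplex and \<open>A\<close> the quotient, so restriction to
  \<open>A\<close> is a chain map, and acyclicity of \<open>V\<close> makes it an isomorphism on
  homology. The index is a successor so that the boundary of a lifted cycle has a dimension to live
  in.\<close>

lemma hdim_remove_sub:
  assumes W: "W = V \<union> A" "V \<inter> A = {}" and no: "\<And>a b. a \<in> V \<Longrightarrow> b \<in> A \<Longrightarrow> \<epsilon> a b = 0"
    and ac: "acyclic_cells V dm \<epsilon>"
  shows "hdim W dm \<epsilon> (Suc i) d \<longleftrightarrow> hdim A dm \<epsilon> (Suc i) d"
proof -
  have VW: "V \<subseteq> W" "A \<subseteq> W" using W by auto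
  have rb: "bdry A \<epsilon> (restr A c) = restr A (bdry W \<epsilon> c)" for c
    using W no by (intro restr_bdry) auto
  have bs: "bdry V \<epsilon> c = bdry W \<epsilon> c" if "c \<in> chain_space V dm j" for c j
    using W no that by (intro bdry_sub) auto
  have inV: "c \<in> chain_space V dm j" if "c \<in> chain_space W dm j" "restr A c = (\<lambda>_. 0)" for c j
  proof (rule chain_space_sub[OF that(1)])
    fix x assume "x \<in> W" "x \<notin> V"
    then have "x \<in> A" using W by auto
    then show "c x = 0" using fun_cong[OF that(2), of x] by (simp add: restr_def)
  qed
  have kill: "\<exists>w\<in>chain_space V dm (Suc j). c = bdry W \<epsilon> w"
    if c: "c \<in> chain_space V dm j" "bdry W \<epsilon> c = (\<lambda>_. 0)" for c j
  proof -
    have "c \<in> cyc V dm \<epsilon> j" using c bs[OF c(1)] by (simp add: cyc_def)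
    then have "c \<in> bnd V dm \<epsilon> j" using ac unfolding acyclic_cells_def by blast
    from bnd_E[OF this] obtain w where "w \<in> chain_space V dm (Suc j)" "c = bdry V \<epsilon> w" .
    then show ?thesis using bs by metis
  qed
  show ?thesis unfolding hdim_def
  proof (rule quot_dim_iso[where f = "restr A", OF subsp_cyc subsp_bnd])
    show "linear_on (cyc W dm \<epsilon> (Suc i)) (restr A)" by (auto simp: linear_on_def restr_def)
    show "restr A z \<in> cyc A dm \<epsilon> (Suc i)" if "z \<in> cyc W dm \<epsilon> (Suc i)" for z
    proof -
      have "z \<in> chain_space W dm (Suc i)" "bdry W \<epsilon> z = (\<lambda>_. 0)" using that by (auto simp: cyc_def)
      then show ?thesis using restr_chain[OF _ VW(2)] by (simp add: cyc_def rb) (simp add: restr_def)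
    qed
    show "restr A z \<in> bnd A dm \<epsilon> (Suc i) \<longleftrightarrow> z \<in> bnd W dm \<epsilon> (Suc i)" if z: "z \<in> cyc W dm \<epsilon> (Suc i)" for z
    proof
      assume "restr A z \<in> bnd A dm \<epsilon> (Suc i)"
      from bnd_E[OF this] obtain y where y: "y \<in> chain_space A dm (Suc (Suc i))" "restr A z = bdry A \<epsilon> y" .
      have yW: "y \<in> chain_space W dm (Suc (Suc i))" by (rule chain_space_mono[OF VW(2) y(1)])
      have ry: "restr A y = y" using chain_space_0[OF y(1)] by (auto simp: restr_def)
      have zW: "z \<in> chain_space W dm (Suc i)" "bdry W \<epsilon> z = (\<lambda>_. 0)" using z by (auto simp: cyc_def)
      have "(\<lambda>a. z a - bdry W \<epsilon> y a) \<in> chain_space V dm (Suc i)"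
      proof (rule inV)
        show "(\<lambda>a. z a - bdry W \<epsilon> y a) \<in> chain_space W dm (Suc i)"
          by (rule chains_diff[OF zW(1) bdry_chain[OF yW]])
        have "restr A (\<lambda>a. z a - bdry W \<epsilon> y a) = (\<lambda>a. restr A z a - restr A (bdry W \<epsilon> y) a)"
          by (auto simp: restr_def)
        then show "restr A (\<lambda>a. z a - bdry W \<epsilon> y a) = (\<lambda>_. 0)" using rb[of y] ry y(2) by simp
      qed
      moreover have "bdry W \<epsilon> (\<lambda>a. z a - bdry W \<epsilon> y a) = (\<lambda>_. 0)"
        unfolding bdry_diff zW(2) bdry_bdry by simp
      ultimately obtain w where w: "w \<in> chain_space V dm (Suc (Suc i))" "(\<lambda>a. z a - bdry W \<epsilon> y a) = bdry W \<epsilon> w"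
        using kill by blast
      have "z = bdry W \<epsilon> (\<lambda>a. y a + w a)"
      proof
        fix a show "z a = bdry W \<epsilon> (\<lambda>a. y a + w a) a" using fun_cong[OF w(2), of a] by (simp add: bdry_add algebra_simps)
      qed
      then show "z \<in> bnd W dm \<epsilon> (Suc i)"
        by (rule bnd_I[OF chains_add[OF yW chain_space_mono[OF VW(1) w(1)]]])
    next
      assume "z \<in> bnd W dm \<epsilon> (Suc i)"
      from bnd_E[OF this] obtain y where y: "y \<in> chain_space W dm (Suc (Suc i))" "z = bdry W \<epsilon> y" .
      show "restr A z \<in> bnd A dm \<epsilon> (Suc i)" by (rule bnd_I[OF restr_chain[OF y(1) VW(2)]]) (simp add: rb y)
    qed
    fix z assume "z \<in> cyc A dm \<epsilon> (Suc i)"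
    then have z: "z \<in> chain_space A dm (Suc i)" "bdry A \<epsilon> z = (\<lambda>_. 0)" by (auto simp: cyc_def)
    have zW: "z \<in> chain_space W dm (Suc i)" by (rule chain_space_mono[OF VW(2) z(1)])
    have rz: "restr A z = z" using chain_space_0[OF z(1)] by (auto simp: restr_def)
    \<comment> \<open>A cycle \<open>z\<close> of the quotient is a cycle of \<open>W\<close> only
      up to \<open>V\<close>. Its boundary is a cycle of \<open>V\<close>, hence the boundary of
      some \<open>w\<close> in \<open>V\<close>, and \<open>z - w\<close> is the lift.\<close>
    have "bdry W \<epsilon> z \<in> chain_space V dm i"
      by (rule inV[OF bdry_chain[OF zW]]) (use rb[of z] rz z(2) in simp)
    from kill[OF this bdry_bdry] obtain w where w: "w \<in> chain_space V dm (Suc i)" "bdry W \<epsilon> z = bdry W \<epsilon> w" by blast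
    have wA: "w a = 0" if "a \<in> A" for a using chain_space_0[OF w(1), of a] that W(2) by blast
    show "\<exists>y\<in>cyc W dm \<epsilon> (Suc i). (\<lambda>b. z b - restr A y b) \<in> bnd A dm \<epsilon> (Suc i)"
    proof (rule bexI[of _ "\<lambda>a. z a - w a"])
      have "(\<lambda>b. z b - restr A (\<lambda>a. z a - w a) b) = (\<lambda>_. 0)"
        using wA chain_space_0[OF z(1)] by (auto simp: restr_def)
      then show "(\<lambda>b. z b - restr A (\<lambda>a. z a - w a) b) \<in> bnd A dm \<epsilon> (Suc i)" using subsp_zero[OF subsp_bnd] by simp
      have "(\<lambda>a. z a - w a) \<in> chain_space W dm (Suc i)" by (rule chains_diff[OF zW chain_space_mono[OF VW(1) w(1)]])
      moreover have "bdry W \<epsilon> (\<lambda>a. z a - w a) = (\<lambda>_. 0)" unfolding bdry_diff w(2) by simp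
      ultimately show "(\<lambda>a. z a - w a) \<in> cyc W dm \<epsilon> (Suc i)" by (simp add: cyc_def)
    qed
  qed
qed

text \<open>Dual situation: \<open>A\<close> is a subcomplex and \<open>V\<close> an acyclic
  quotient, so the inclusion of \<open>A\<close> is an isomorphism on homology.\<close>

lemma hdim_remove_quotient:
  assumes W: "W = V \<union> A" "V \<inter> A = {}" and no: "\<And>a b. a \<in> A \<Longrightarrow> b \<in> V \<Longrightarrow> \<epsilon> a b = 0"
    and ac: "acyclic_cells V dm \<epsilon>"
  shows "hdim W dm \<epsilon> i d \<longleftrightarrow> hdim A dm \<epsilon> i d"
proof -
  have VW: "V \<subseteq> W" "A \<subseteq> W" using W by auto
  have rb: "bdry V \<epsilon> (restr V c) = restr V (bdry W \<epsilon> c)" for c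
    using W no by (intro restr_bdry) auto
  have bs: "bdry A \<epsilon> c = bdry W \<epsilon> c" if "c \<in> chain_space A dm j" for c j
    using W no that by (intro bdry_sub) auto
  \<comment> \<open>A chain whose boundary has no part in \<open>V\<close> can be pushed into
    \<open>A\<close> by subtracting a boundary. It is used twice: for cycles, and for chains whose
    boundary already lies in \<open>A\<close>.\<close>
  have clear: "\<exists>w\<in>chain_space W dm (Suc j). (\<lambda>a. c a - bdry W \<epsilon> w a) \<in> chain_space A dm j"
    if c: "c \<in> chain_space W dm j" "restr V (bdry W \<epsilon> c) = (\<lambda>_. 0)" for c j
  proof -
    have "restr V c \<in> cyc V dm \<epsilon> j" using restr_chain[OF c(1) VW(1)] c(2) by (simp add: cyc_def rb)
    then have "restr V c \<in> bnd V dm \<epsilon> j" using ac unfolding acyclic_cells_def by blast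
    from bnd_E[OF this] obtain w where w: "w \<in> chain_space V dm (Suc j)" "restr V c = bdry V \<epsilon> w" .
    have wW: "w \<in> chain_space W dm (Suc j)" by (rule chain_space_mono[OF VW(1) w(1)])
    have rw: "restr V w = w" using chain_space_0[OF w(1)] by (auto simp: restr_def)
    have e: "restr V c = restr V (bdry W \<epsilon> w)" using rb[of w] rw w(2) by simp
    have "(\<lambda>a. c a - bdry W \<epsilon> w a) \<in> chain_space A dm j"
    proof (rule chain_space_sub[OF chains_diff[OF c(1) bdry_chain[OF wW]]])
      fix x assume "x \<in> W" "x \<notin> A"
      then have "x \<in> V" using W by auto
      then show "c x - bdry W \<epsilon> w x = 0" using fun_cong[OF e, of x] by (simp add: restr_def)
    qed
    then show ?thesis using wW by blast
  qed
  have "quot_dim (cyc A dm \<epsilon> i) (bnd A dm \<epsilon> i) d \<longleftrightarrow> quot_dim (cyc W dm \<epsilon> i) (bnd W dm \<epsilon> i) d"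
  proof (rule quot_dim_iso[where f = "\<lambda>c. c", OF subsp_cyc subsp_bnd])
    show "linear_on (cyc A dm \<epsilon> i) (\<lambda>c. c)" by (simp add: linear_on_def)
    show "z \<in> cyc W dm \<epsilon> i" if "z \<in> cyc A dm \<epsilon> i" for z
    proof -
      have z: "z \<in> chain_space A dm i" "bdry A \<epsilon> z = (\<lambda>_. 0)" using that by (auto simp: cyc_def)
      show ?thesis using chain_space_mono[OF VW(2) z(1)] z(2) bs[OF z(1)] by (simp add: cyc_def)
    qed
    show "z \<in> bnd W dm \<epsilon> i \<longleftrightarrow> z \<in> bnd A dm \<epsilon> i" if "z \<in> cyc A dm \<epsilon> i" for z
    proof
      have z: "z \<in> chain_space A dm i" using that by (auto simp: cyc_def)
      assume "z \<in> bnd W dm \<epsilon> i"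
      from bnd_E[OF this] obtain y where y: "y \<in> chain_space W dm (Suc i)" "z = bdry W \<epsilon> y" .
      have "restr V (bdry W \<epsilon> y) = (\<lambda>_. 0)"
      proof
        fix x show "restr V (bdry W \<epsilon> y) x = 0"
          unfolding y(2)[symmetric] using chain_space_0[OF z, of x] W(2) by (auto simp: restr_def)
      qed
      from clear[OF y(1) this] obtain w where w: "w \<in> chain_space W dm (Suc (Suc i))"
        "(\<lambda>a. y a - bdry W \<epsilon> w a) \<in> chain_space A dm (Suc i)" by blast
      have "z = bdry A \<epsilon> (\<lambda>a. y a - bdry W \<epsilon> w a)"
        by (subst bs[OF w(2)]) (simp add: bdry_diff bdry_bdry y(2))
      then show "z \<in> bnd A dm \<epsilon> i" by (rule bnd_I[OF w(2)])
    next
      assume "z \<in> bnd A dm \<epsilon> i"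
      from bnd_E[OF this] obtain y where y: "y \<in> chain_space A dm (Suc i)" "z = bdry A \<epsilon> y" .
      show "z \<in> bnd W dm \<epsilon> i" by (rule bnd_I[OF chain_space_mono[OF VW(2) y(1)]]) (simp add: y bs[OF y(1)])
    qed
    fix z assume "z \<in> cyc W dm \<epsilon> i"
    then have z: "z \<in> chain_space W dm i" "bdry W \<epsilon> z = (\<lambda>_. 0)" by (auto simp: cyc_def)
    have "restr V (bdry W \<epsilon> z) = (\<lambda>_. 0)" by (simp add: z restr_def)
    from clear[OF z(1) this] obtain w where w: "w \<in> chain_space W dm (Suc i)"
        "(\<lambda>a. z a - bdry W \<epsilon> w a) \<in> chain_space A dm i" by blast
    show "\<exists>y\<in>cyc A dm \<epsilon> i. (\<lambda>b. z b - y b) \<in> bnd W dm \<epsilon> i"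
    proof (rule bexI[of _ "\<lambda>a. z a - bdry W \<epsilon> w a"])
      have "(\<lambda>b. z b - (z b - bdry W \<epsilon> w b)) = bdry W \<epsilon> w" by simp
      then show "(\<lambda>b. z b - (z b - bdry W \<epsilon> w b)) \<in> bnd W dm \<epsilon> i" by (rule bnd_I[OF w(1)])
      have "bdry A \<epsilon> (\<lambda>a. z a - bdry W \<epsilon> w a) = (\<lambda>_. 0)"
        by (subst bs[OF w(2)]) (simp add: bdry_diff bdry_bdry z(2))
      then show "(\<lambda>a. z a - bdry W \<epsilon> w a) \<in> cyc A dm \<epsilon> i" using w(2) by (simp add: cyc_def)
    qed
  qed
  then show ?thesis unfolding hdim_def by simp
qed

end

section \<open>Small complexes and direct sums\<close>

lemma quot_dim_0: "Z \<subseteq> B \<Longrightarrow> quot_dim Z B 0"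
  unfolding quot_dim_def
  by (rule exI[of _ "\<lambda>_ _. 0"]) (auto simp: vecs_def intro!: ex1I[of _ "\<lambda>_. 0"])

lemma quot_dim_1:
  assumes "w \<in> Z" "\<And>z a. z \<in> Z \<Longrightarrow> (\<lambda>x. z x - a * w x) \<in> B \<longleftrightarrow> a = g z"
  shows "quot_dim Z B 1"
  unfolding quot_dim_def
proof (intro exI[of _ "\<lambda>_. w"] conjI ballI allI impI assms(1))
  fix z assume z: "z \<in> Z"
  show "\<exists>!c. c \<in> vecs UNIV 1 \<and> (\<lambda>a. z a - (\<Sum>j<1. c j * w a)) \<in> B"
  proof (rule ex1I[of _ "\<lambda>j. if j = 0 then g z else 0"])
    show "(\<lambda>j. if j = 0 then g z else 0) \<in> vecs UNIV 1 \<and>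
        (\<lambda>a. z a - (\<Sum>j<1. (if j = (0::nat) then g z else 0) * w a)) \<in> B"
    proof
      have e: "(\<lambda>a. z a - (\<Sum>j<1. (if j = (0::nat) then g z else 0) * w a)) = (\<lambda>x. z x - g z * w x)"
        by (simp add: lessThan_Suc)
      show "(\<lambda>a. z a - (\<Sum>j<1. (if j = (0::nat) then g z else 0) * w a)) \<in> B"
        unfolding e using assms(2)[OF z, of "g z"] by simp
    qed (simp add: vecs_def)
    fix c :: "nat \<Rightarrow> _" assume c: "c \<in> vecs UNIV 1 \<and> (\<lambda>a. z a - (\<Sum>j<1. c j * w a)) \<in> B"
    then have "c 0 = g z" using assms(2)[OF z, of "c 0"] by simp
    then show "c = (\<lambda>j. if j = 0 then g z else 0)" using c by (auto simp: vecs_def fun_eq_iff)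
  qed
qed

lemma hdim_no_cells:
  assumes "\<And>x. x \<in> W \<Longrightarrow> dm x \<noteq> i" shows "hdim W dm \<epsilon> i 0"
  unfolding hdim_def
proof (rule quot_dim_0, rule subsetI)
  fix c assume "c \<in> cyc W dm \<epsilon> i"
  then have "c = (\<lambda>_. 0)" using assms by (auto simp: cyc_def chain_space_def)
  then show "c \<in> bnd W dm \<epsilon> i" using subsp_zero[OF subsp_bnd] by simp
qed

lemma bnd_no_cells:
  assumes "\<And>x. x \<in> W \<Longrightarrow> dm x \<noteq> Suc i" shows "c \<in> bnd W dm \<epsilon> i \<longleftrightarrow> c = (\<lambda>_. 0)"
proof
  assume "c \<in> bnd W dm \<epsilon> i"
  from bnd_E[OF this] obtain y where y: "y \<in> chain_space W dm (Suc i)" "c = bdry W \<epsilon> y" .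
  have "y = (\<lambda>_. 0)" using y(1) assms by (auto simp: chain_space_def)
  then show "c = (\<lambda>_. 0)" using y(2) by (simp add: bdry_zero)
qed (simp add: subsp_zero[OF subsp_bnd])

lemma hdim_single:
  assumes "\<epsilon> x x = 0" shows "hdim {x} dm \<epsilon> i (if dm x = i then 1 else 0)"
proof (cases "dm x = i")
  case True
  have "quot_dim (cyc {x} dm \<epsilon> i) (bnd {x} dm \<epsilon> i) 1"
  proof (rule quot_dim_1[where w = "\<lambda>y. if y = x then 1 else 0" and g = "\<lambda>z. z x"])
    show "(\<lambda>y. if y = x then 1 else 0) \<in> cyc {x} dm \<epsilon> i"
      using True assms by (auto simp: cyc_def chain_space_def bdry_def)
    fix z a assume "z \<in> cyc {x} dm \<epsilon> i"
    then have z: "z y = 0" if "y \<noteq> x" for y using that by (auto simp: cyc_def chain_space_def)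
    have "(\<lambda>y. z y - a * (if y = x then 1 else 0)) = (\<lambda>_. 0) \<longleftrightarrow> a = z x"
    proof
      assume e: "(\<lambda>y. z y - a * (if y = x then 1 else 0)) = (\<lambda>_. 0)"
      show "a = z x" using fun_cong[OF e, of x] by simp
    next
      assume "a = z x"
      then show "(\<lambda>y. z y - a * (if y = x then 1 else 0)) = (\<lambda>_. 0)" using z by auto
    qed
    then show "(\<lambda>y. z y - a * (if y = x then 1 else 0)) \<in> bnd {x} dm \<epsilon> i \<longleftrightarrow> a = z x"
      using bnd_no_cells[of "{x}" dm i _ \<epsilon>] True by simp
  qed
  then show ?thesis using True by (simp add: hdim_def)
next
  case False
  then show ?thesis using hdim_no_cells[of "{x}" dm i \<epsilon>] by simp
qed

lemma bdry_union:
  assumes "finite A" "finite B" "A \<inter> B = {}" "\<And>a b. a \<in> A \<Longrightarrow> b \<in> B \<Longrightarrow> \<epsilon> a b = 0 \<and> \<epsilon> b a = 0"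
  shows "bdry (A \<union> B) \<epsilon> c = (\<lambda>b. bdry A \<epsilon> (restr A c) b + bdry B \<epsilon> (restr B c) b)"
proof
  fix b
  have s: "(\<Sum>a\<in>A \<union> B. c a * \<epsilon> a b) = (\<Sum>a\<in>A. c a * \<epsilon> a b) + (\<Sum>a\<in>B. c a * \<epsilon> a b)"
    by (rule sum.union_disjoint[OF assms(1-3)])
  have "(\<Sum>a\<in>B. c a * \<epsilon> a b) = 0" if "b \<in> A" using that assms(4) by simp
  moreover have "(\<Sum>a\<in>A. c a * \<epsilon> a b) = 0" if "b \<in> B" using that assms(4) by simp
  moreover have "(\<Sum>a\<in>A. restr A c a * \<epsilon> a b) = (\<Sum>a\<in>A. c a * \<epsilon> a b)" "(\<Sum>a\<in>B. restr B c a * \<epsilon> a b) = (\<Sum>a\<in>B. c a * \<epsilon> a b)"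
    by (auto simp: restr_def intro!: sum.cong)
  ultimately show "bdry (A \<union> B) \<epsilon> c b = bdry A \<epsilon> (restr A c) b + bdry B \<epsilon> (restr B c) b"
    using s assms(3) by (auto simp: bdry_def)
qed

text \<open>Without incidences in either direction the complex is a direct sum, so cycles and
  boundaries split by restriction. Bases are concatenated, with the coordinates of \<open>A\<close>
  in front.\<close>

lemma hdim_union:
  assumes AB: "finite A" "finite B" "A \<inter> B = {}" "\<And>a b. a \<in> A \<Longrightarrow> b \<in> B \<Longrightarrow> \<epsilon> a b = 0 \<and> \<epsilon> b a = 0"
    and d: "hdim A dm \<epsilon> i d1" "hdim B dm \<epsilon> i d2"
  shows "hdim (A \<union> B) dm \<epsilon> i (d1 + d2)"
proof -
  note bu = bdry_union[OF AB]
  have spl: "c \<in> chain_space (A \<union> B) dm j \<Longrightarrow> c = (\<lambda>x. restr A c x + restr B c x)" for c :: "'a \<Rightarrow> 'b" and j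
    using AB(3) by (auto simp: restr_def chain_space_def fun_eq_iff)
  have off: "bdry A \<epsilon> c x = 0" if "x \<notin> A" for c x and A :: "'a set" using that by (simp add: bdry_def)
  have cyA: "restr A z \<in> cyc A dm \<epsilon> i" and cyB: "restr B z \<in> cyc B dm \<epsilon> i" if "z \<in> cyc (A \<union> B) dm \<epsilon> i" for z
  proof -
    have z: "z \<in> chain_space (A \<union> B) dm i" "bdry (A \<union> B) \<epsilon> z = (\<lambda>_. 0)" using that by (auto simp: cyc_def)
    have e: "bdry A \<epsilon> (restr A z) b + bdry B \<epsilon> (restr B z) b = 0" for b using fun_cong[OF z(2), of b] by (simp add: bu)
    have "bdry A \<epsilon> (restr A z) b = 0" for b
    proof (cases "b \<in> A")
      case True
      then have "b \<notin> B" using AB(3) by blast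
      then show ?thesis using e[of b] off[of b B] by simp
    qed (rule off)
    moreover have "bdry B \<epsilon> (restr B z) b = 0" for b
    proof (cases "b \<in> B")
      case True
      then have "b \<notin> A" using AB(3) by blast
      then show ?thesis using e[of b] off[of b A] by simp
    qed (rule off)
    ultimately show "restr A z \<in> cyc A dm \<epsilon> i" "restr B z \<in> cyc B dm \<epsilon> i"
      using restr_chain[OF z(1)] by (auto simp: cyc_def)
  qed
  have cyU: "z \<in> cyc (A \<union> B) dm \<epsilon> i" if "z \<in> cyc A dm \<epsilon> i \<or> z \<in> cyc B dm \<epsilon> i" for z
  proof -
    have "restr A z = (\<lambda>_. 0) \<and> restr B z = z" if "z \<in> chain_space B dm i"
      using that AB(3) by (auto simp: restr_def chain_space_def fun_eq_iff)
    moreover have "restr B z = (\<lambda>_. 0) \<and> restr A z = z" if "z \<in> chain_space A dm i"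
      using that AB(3) by (auto simp: restr_def chain_space_def fun_eq_iff)
    moreover have "z \<in> chain_space (A \<union> B) dm i" using that by (auto simp: cyc_def chain_space_def)
    ultimately show ?thesis using that by (auto simp: cyc_def bu bdry_zero)
  qed
  have bnU: "z \<in> bnd (A \<union> B) dm \<epsilon> i \<longleftrightarrow> restr A z \<in> bnd A dm \<epsilon> i \<and> restr B z \<in> bnd B dm \<epsilon> i"
    if zc: "z \<in> chain_space (A \<union> B) dm i" for z
  proof
    assume "z \<in> bnd (A \<union> B) dm \<epsilon> i"
    from bnd_E[OF this] obtain y where y: "y \<in> chain_space (A \<union> B) dm (Suc i)" "z = bdry (A \<union> B) \<epsilon> y" .
    have "restr A z x = bdry A \<epsilon> (restr A y) x" for x
    proof (cases "x \<in> A")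
      case True
      then have "x \<notin> B" using AB(3) by blast
      have "restr A z x = z x" using True by (simp add: restr_def)
      then show ?thesis using \<open>x \<notin> B\<close> off[of x B] by (simp add: y(2) bu)
    next
      case False
      then show ?thesis using off[of x A] by (simp add: restr_def[of A z])
    qed
    then have 1: "restr A z = bdry A \<epsilon> (restr A y)" ..
    have "restr B z x = bdry B \<epsilon> (restr B y) x" for x
    proof (cases "x \<in> B")
      case True
      then have "x \<notin> A" using AB(3) by blast
      have "restr B z x = z x" using True by (simp add: restr_def)
      then show ?thesis using \<open>x \<notin> A\<close> off[of x A] by (simp add: y(2) bu)
    next
      case False
      then show ?thesis using off[of x B] by (simp add: restr_def[of B z])
    qed
    then have 2: "restr B z = bdry B \<epsilon> (restr B y)" ..
    show "restr A z \<in> bnd A dm \<epsilon> i \<and> restr B z \<in> bnd B dm \<epsilon> i"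
      by (intro conjI bnd_I[OF restr_chain[OF y(1)]] 1 2) auto
  next
    assume z: "restr A z \<in> bnd A dm \<epsilon> i \<and> restr B z \<in> bnd B dm \<epsilon> i"
    from bnd_E[OF conjunct1[OF z]] obtain y1 where y1: "y1 \<in> chain_space A dm (Suc i)" "restr A z = bdry A \<epsilon> y1" .
    from bnd_E[OF conjunct2[OF z]] obtain y2 where y2: "y2 \<in> chain_space B dm (Suc i)" "restr B z = bdry B \<epsilon> y2" .
    have 1: "restr A (\<lambda>x. y1 x + y2 x) = y1" "restr B (\<lambda>x. y1 x + y2 x) = y2"
      using y1(1) y2(1) AB(3) by (auto simp: restr_def chain_space_def fun_eq_iff)
    show "z \<in> bnd (A \<union> B) dm \<epsilon> i"
    proof (rule bnd_I)
      show "(\<lambda>x. y1 x + y2 x) \<in> chain_space (A \<union> B) dm (Suc i)"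
        by (rule chains_add; rule chain_space_mono[OF _ y1(1)] chain_space_mono[OF _ y2(1)]) auto
      show "z = bdry (A \<union> B) \<epsilon> (\<lambda>x. y1 x + y2 x)"
      proof -
        have "bdry (A \<union> B) \<epsilon> (\<lambda>x. y1 x + y2 x) = (\<lambda>b. restr A z b + restr B z b)"
          by (simp only: bu 1 y1(2) y2(2))
        then show ?thesis using spl[OF zc] by simp
      qed
    qed
  qed
  obtain w1 where w1: "\<forall>j<d1. w1 j \<in> cyc A dm \<epsilon> i"
    "\<forall>z\<in>cyc A dm \<epsilon> i. \<exists>!c. c \<in> vecs UNIV d1 \<and> (\<lambda>a. z a - (\<Sum>j<d1. c j * w1 j a)) \<in> bnd A dm \<epsilon> i"
    using d(1) unfolding hdim_def by (rule quot_dimE)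
  obtain w2 where w2: "\<forall>j<d2. w2 j \<in> cyc B dm \<epsilon> i"
    "\<forall>z\<in>cyc B dm \<epsilon> i. \<exists>!c. c \<in> vecs UNIV d2 \<and> (\<lambda>a. z a - (\<Sum>j<d2. c j * w2 j a)) \<in> bnd B dm \<epsilon> i"
    using d(2) unfolding hdim_def by (rule quot_dimE)
  define w where "w j = (if j < d1 then w1 j else w2 (j - d1))" for j
  have wc: "w j \<in> cyc (A \<union> B) dm \<epsilon> i" if "j < d1 + d2" for j
    using w1(1) w2(1) that by (intro cyU) (auto simp: w_def)
  have sum2: "(\<Sum>j<d1+d2. c j * w j a) = (\<Sum>j<d1. c j * w1 j a) + (\<Sum>j<d2. c (d1 + j) * w2 j a)" for c a
  proof -
    have "(\<Sum>j<d1+d2. c j * w j a) = (\<Sum>j<d1. c j * w j a) + (\<Sum>j<d2. c (d1 + j) * w (d1 + j) a)"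
      by (induction d2) (simp_all add: add.assoc)
    then show ?thesis by (simp add: w_def)
  qed
  have w1B: "w1 j a = 0" if "j < d1" "a \<notin> A" for j a
    using w1(1) that unfolding cyc_def chain_space_def by blast
  have w2A: "w2 j a = 0" if "j < d2" "a \<notin> B" for j a
    using w2(1) that unfolding cyc_def chain_space_def by blast
  have key: "(\<lambda>a. z a - (\<Sum>j<d1+d2. c j * w j a)) \<in> bnd (A \<union> B) dm \<epsilon> i \<longleftrightarrow>
      (\<lambda>a. restr A z a - (\<Sum>j<d1. c j * w1 j a)) \<in> bnd A dm \<epsilon> i \<and>
      (\<lambda>a. restr B z a - (\<Sum>j<d2. c (d1 + j) * w2 j a)) \<in> bnd B dm \<epsilon> i"
    if z: "z \<in> cyc (A \<union> B) dm \<epsilon> i" for z c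
  proof -
    have "(\<lambda>a. \<Sum>j<d1+d2. c j * w j a) \<in> cyc (A \<union> B) dm \<epsilon> i"
      by (rule subsp_sum[OF subsp_cyc]) (use wc in simp)
    from subsp_diff[OF subsp_cyc z this]
    have ch: "(\<lambda>a. z a - (\<Sum>j<d1+d2. c j * w j a)) \<in> chain_space (A \<union> B) dm i" by (simp add: cyc_def)
    have "restr A (\<lambda>a. z a - (\<Sum>j<d1+d2. c j * w j a)) = (\<lambda>a. restr A z a - (\<Sum>j<d1. c j * w1 j a))"
    proof
      fix a
      have "(\<Sum>j<d2. c (d1 + j) * w2 j a) = 0" if "a \<in> A" using that AB(3) by (intro sum.neutral) (auto simp: w2A disjoint_iff)
      moreover have "(\<Sum>j<d1. c j * w1 j a) = 0" if "a \<notin> A" using w1B that by (intro sum.neutral) auto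
      ultimately show "restr A (\<lambda>a. z a - (\<Sum>j<d1+d2. c j * w j a)) a = restr A z a - (\<Sum>j<d1. c j * w1 j a)"
        by (simp add: restr_def sum2)
    qed
    moreover have "restr B (\<lambda>a. z a - (\<Sum>j<d1+d2. c j * w j a)) = (\<lambda>a. restr B z a - (\<Sum>j<d2. c (d1 + j) * w2 j a))"
    proof
      fix a
      have "(\<Sum>j<d2. c (d1 + j) * w2 j a) = 0" if "a \<notin> B" using w2A that by (intro sum.neutral) auto
      moreover have "(\<Sum>j<d1. c j * w1 j a) = 0" if "a \<in> B"
      proof -
        have "a \<notin> A" using that AB(3) by blast
        then show ?thesis using w1B by (intro sum.neutral) auto
      qed
      ultimately show "restr B (\<lambda>a. z a - (\<Sum>j<d1+d2. c j * w j a)) a = restr B z a - (\<Sum>j<d2. c (d1 + j) * w2 j a)"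
        by (simp add: restr_def sum2)
    qed
    ultimately show ?thesis using bnU[OF ch] by simp
  qed
  show ?thesis unfolding hdim_def quot_dim_def
  proof (intro exI[of _ w] conjI allI impI ballI wc)
    fix z assume z: "z \<in> cyc (A \<union> B) dm \<epsilon> i"
    from bspec[OF w1(2) cyA[OF z]] obtain c1
      where c1': "c1 \<in> vecs UNIV d1 \<and> (\<lambda>a. restr A z a - (\<Sum>j<d1. c1 j * w1 j a)) \<in> bnd A dm \<epsilon> i"
      and u1': "\<forall>c. c \<in> vecs UNIV d1 \<and> (\<lambda>a. restr A z a - (\<Sum>j<d1. c j * w1 j a)) \<in> bnd A dm \<epsilon> i \<longrightarrow> c = c1"
      by (rule ex1E)
    note c1 = conjunct1[OF c1'] conjunct2[OF c1'] and u1 = mp[OF spec[OF u1'] conjI]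
    from bspec[OF w2(2) cyB[OF z]] obtain c2
      where c2': "c2 \<in> vecs UNIV d2 \<and> (\<lambda>a. restr B z a - (\<Sum>j<d2. c2 j * w2 j a)) \<in> bnd B dm \<epsilon> i"
      and u2': "\<forall>c. c \<in> vecs UNIV d2 \<and> (\<lambda>a. restr B z a - (\<Sum>j<d2. c j * w2 j a)) \<in> bnd B dm \<epsilon> i \<longrightarrow> c = c2"
      by (rule ex1E)
    note c2 = conjunct1[OF c2'] conjunct2[OF c2'] and u2 = mp[OF spec[OF u2'] conjI]
    show "\<exists>!c. c \<in> vecs UNIV (d1 + d2) \<and> (\<lambda>a. z a - (\<Sum>j<d1+d2. c j * w j a)) \<in> bnd (A \<union> B) dm \<epsilon> i"
    proof (rule ex1I[of _ "\<lambda>j. if j < d1 then c1 j else c2 (j - d1)"])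
      let ?c = "\<lambda>j. if j < d1 then c1 j else c2 (j - d1)"
      have "?c \<in> vecs UNIV (d1 + d2)" using c2(1) by (auto simp: vecs_def)
      moreover have "(\<lambda>a. z a - (\<Sum>j<d1+d2. ?c j * w j a)) \<in> bnd (A \<union> B) dm \<epsilon> i"
        unfolding key[OF z] using c1 c2 by simp
      ultimately show "?c \<in> vecs UNIV (d1 + d2) \<and> (\<lambda>a. z a - (\<Sum>j<d1+d2. ?c j * w j a)) \<in> bnd (A \<union> B) dm \<epsilon> i" by blast
      fix c :: "nat \<Rightarrow> 'b" assume c: "c \<in> vecs UNIV (d1 + d2) \<and> (\<lambda>a. z a - (\<Sum>j<d1+d2. c j * w j a)) \<in> bnd (A \<union> B) dm \<epsilon> i"
      then have k: "(\<lambda>a. restr A z a - (\<Sum>j<d1. c j * w1 j a)) \<in> bnd A dm \<epsilon> i"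
        "(\<lambda>a. restr B z a - (\<Sum>j<d2. c (d1 + j) * w2 j a)) \<in> bnd B dm \<epsilon> i" using key[OF z] by auto
      have e1: "(\<lambda>j. if j < d1 then c j else 0) = c1" by (rule u1) (use k in \<open>auto simp: vecs_def\<close>)
      have e2: "(\<lambda>j. c (d1 + j)) = c2" by (rule u2) (use k c in \<open>auto simp: vecs_def\<close>)
      show "c = ?c"
      proof
        fix x show "c x = ?c x" using fun_cong[OF e1, of x] fun_cong[OF e2, of "x - d1"]
          by (cases "x < d1") simp_all
      qed
    qed
  qed
qed

lemma hdim_UN:
  assumes "finite T" "\<And>t. t \<in> T \<Longrightarrow> finite (P t)"
    "\<And>s t. s \<in> T \<Longrightarrow> t \<in> T \<Longrightarrow> s \<noteq> t \<Longrightarrow> P s \<inter> P t = {}"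
    "\<And>s t a b. s \<in> T \<Longrightarrow> t \<in> T \<Longrightarrow> s \<noteq> t \<Longrightarrow> a \<in> P s \<Longrightarrow> b \<in> P t \<Longrightarrow> \<epsilon> a b = 0"
    "\<And>t. t \<in> T \<Longrightarrow> hdim (P t) dm \<epsilon> i (d t)"
  shows "hdim (\<Union>t\<in>T. P t) dm \<epsilon> i (\<Sum>t\<in>T. d t)"
  using assms
proof (induction T rule: finite_induct)
  case empty
  show ?case using hdim_no_cells[of "{}" dm i \<epsilon>] by simp
next
  case (insert t T)
  have "hdim (P t \<union> (\<Union>s\<in>T. P s)) dm \<epsilon> i (d t + (\<Sum>s\<in>T. d s))"
  proof (rule hdim_union)
    show "P t \<inter> (\<Union>s\<in>T. P s) = {}" using insert.prems(2)[of t] insert.hyps(2) by blast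
    show "\<epsilon> a b = 0 \<and> \<epsilon> b a = 0" if ab: "a \<in> P t" "b \<in> (\<Union>s\<in>T. P s)" for a b
    proof -
      obtain s where s: "s \<in> T" "b \<in> P s" using ab by blast
      then have "s \<noteq> t" using insert.hyps(2) by blast
      then show ?thesis using insert.prems(3)[of t s a b] insert.prems(3)[of s t b a] s ab by auto
    qed
    show "hdim (\<Union>s\<in>T. P s) dm \<epsilon> i (\<Sum>s\<in>T. d s)"
    proof (rule insert.IH)
      show "finite (P s)" if "s \<in> T" for s using that insert.prems(1) by simp
      show "P s \<inter> P s' = {}" if "s \<in> T" "s' \<in> T" "s \<noteq> s'" for s s' using that insert.prems(2)[of s s'] by simp
      show "\<epsilon> a b = 0" if "s \<in> T" "s' \<in> T" "s \<noteq> s'" "a \<in> P s" "b \<in> P s'" for s s' a b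
        using that insert.prems(3)[of s s' a b] by simp
      show "hdim (P s) dm \<epsilon> i (d s)" if "s \<in> T" for s using that insert.prems(4) by simp
    qed
  qed (use insert in auto)
  then show ?case using insert.hyps by simp
qed

text \<open>Incidences between the diagonal quadrangles and triples of the projective plane, defined below;
  the determinant is \<open>\<plusminus>2\<close>.\<close>

definition blockM :: "nat \<Rightarrow> nat \<Rightarrow> 'f::comm_ring_1" where
  "blockM i j = (if (i, j) \<in> {(0,0),(3,0),(1,1),(4,1),(2,4),(4,4)} then 1
     else if (i, j) \<in> {(0,2),(2,2),(1,3),(3,3)} then -1 else 0)"

lemma lt5: "(i::nat) < 5 \<longleftrightarrow> i = 0 \<or> i = 1 \<or> i = 2 \<or> i = 3 \<or> i = 4" by auto

lemma sum5: "(\<Sum>i<5. f i) = f 0 + f 1 + f 2 + f 3 + f (4::nat)"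
  by (simp add: numeral_eq_Suc add.assoc)

text \<open>The chain complex of a Moebius strip relative to its boundary circle:
  \<open>\<alpha>\<close> are the five interior edges, \<open>\<beta>\<close> the five triangles.
  The unit \<open>u\<close> absorbs the common sign that the cubical directions contribute.\<close>

locale moebius_block =
  fixes \<alpha> \<beta> :: "nat \<Rightarrow> 'c" and dm :: "'c \<Rightarrow> nat" and \<epsilon> :: "'c \<Rightarrow> 'c \<Rightarrow> 'f::comm_ring_1" and u :: 'f and p :: nat
  assumes inj\<alpha>: "\<And>i j. i < 5 \<Longrightarrow> j < 5 \<Longrightarrow> \<alpha> i = \<alpha> j \<Longrightarrow> i = j"
    and inj\<beta>: "\<And>i j. i < 5 \<Longrightarrow> j < 5 \<Longrightarrow> \<beta> i = \<beta> j \<Longrightarrow> i = j"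
    and dm\<alpha>: "\<And>i. i < 5 \<Longrightarrow> dm (\<alpha> i) = p" and dm\<beta>: "\<And>i. i < 5 \<Longrightarrow> dm (\<beta> i) = Suc p"
    and uu: "u * u = 1"
    and e\<beta>\<alpha>: "\<And>i j. i < 5 \<Longrightarrow> j < 5 \<Longrightarrow> \<epsilon> (\<beta> i) (\<alpha> j) = u * blockM i j"
    and e\<alpha>: "\<And>i j. i < 5 \<Longrightarrow> j < 5 \<Longrightarrow> \<epsilon> (\<alpha> i) (\<alpha> j) = 0 \<and> \<epsilon> (\<alpha> i) (\<beta> j) = 0"
    and e\<beta>: "\<And>i j. i < 5 \<Longrightarrow> j < 5 \<Longrightarrow> \<epsilon> (\<beta> i) (\<beta> j) = 0"
begin

definition "W = \<alpha> ` {..<5} \<union> \<beta> ` {..<5}"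

lemma ne: "i < 5 \<Longrightarrow> j < 5 \<Longrightarrow> \<alpha> i \<noteq> \<beta> j"
  using dm\<alpha>[of i] dm\<beta>[of j] by auto

lemma sumW: "(\<Sum>a\<in>W. c a * \<epsilon> a b) = (\<Sum>i<5. c (\<alpha> i) * \<epsilon> (\<alpha> i) b) + (\<Sum>i<5. c (\<beta> i) * \<epsilon> (\<beta> i) b)"
proof -
  have "(\<Sum>a\<in>W. c a * \<epsilon> a b) = (\<Sum>a\<in>\<alpha> ` {..<5}. c a * \<epsilon> a b) + (\<Sum>a\<in>\<beta> ` {..<5}. c a * \<epsilon> a b)"
    unfolding W_def using ne by (intro sum.union_disjoint) auto
  then show ?thesis using inj\<alpha> inj\<beta> by (simp add: sum.reindex inj_on_def)
qed

lemma bdry_W: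
  "bdry W \<epsilon> c (\<alpha> 0) = u * (c (\<beta> 0) + c (\<beta> 3))" "bdry W \<epsilon> c (\<alpha> 1) = u * (c (\<beta> 1) + c (\<beta> 4))"
  "bdry W \<epsilon> c (\<alpha> 2) = u * (- c (\<beta> 0) - c (\<beta> 2))" "bdry W \<epsilon> c (\<alpha> 3) = u * (- c (\<beta> 1) - c (\<beta> 3))"
  "bdry W \<epsilon> c (\<alpha> 4) = u * (c (\<beta> 2) + c (\<beta> 4))" "i < 5 \<Longrightarrow> bdry W \<epsilon> c (\<beta> i) = 0"
  "x \<notin> W \<Longrightarrow> bdry W \<epsilon> c x = 0"
proof -
  have m: "\<alpha> 0 \<in> W" "\<alpha> 1 \<in> W" "\<alpha> 2 \<in> W" "\<alpha> 3 \<in> W" "\<alpha> 4 \<in> W" by (auto simp: W_def)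
  show "bdry W \<epsilon> c (\<alpha> 0) = u * (c (\<beta> 0) + c (\<beta> 3))" "bdry W \<epsilon> c (\<alpha> 1) = u * (c (\<beta> 1) + c (\<beta> 4))"
  "bdry W \<epsilon> c (\<alpha> 2) = u * (- c (\<beta> 0) - c (\<beta> 2))" "bdry W \<epsilon> c (\<alpha> 3) = u * (- c (\<beta> 1) - c (\<beta> 3))"
  "bdry W \<epsilon> c (\<alpha> 4) = u * (c (\<beta> 2) + c (\<beta> 4))"
    by (simp_all add: bdry_def m sumW sum5 e\<beta>\<alpha> e\<alpha> blockM_def algebra_simps del: One_nat_def)
  show "i < 5 \<Longrightarrow> bdry W \<epsilon> c (\<beta> i) = 0" by (simp add: bdry_def sumW sum5 e\<alpha> e\<beta>)
qed (simp add: bdry_def)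

lemma W_cases: assumes "x \<in> W" obtains i where "i < 5" "x = \<alpha> i" | i where "i < 5" "x = \<beta> i"
  using assms by (auto simp: W_def)

definition fill :: "'f \<Rightarrow> 'f \<Rightarrow> 'f \<Rightarrow> 'f \<Rightarrow> 'f \<Rightarrow> 'c \<Rightarrow> 'f" where
  "fill b0 b1 b2 b3 b4 = (\<lambda>x. if x = \<beta> 0 then b0 else if x = \<beta> 1 then b1 else if x = \<beta> 2 then b2
     else if x = \<beta> 3 then b3 else if x = \<beta> 4 then b4 else 0)"

lemma fill_simps: "fill b0 b1 b2 b3 b4 (\<beta> 0) = b0" "fill b0 b1 b2 b3 b4 (\<beta> 1) = b1"
  "fill b0 b1 b2 b3 b4 (\<beta> 2) = b2" "fill b0 b1 b2 b3 b4 (\<beta> 3) = b3" "fill b0 b1 b2 b3 b4 (\<beta> 4) = b4"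
proof -
  have n: "\<beta> i = \<beta> j \<longleftrightarrow> i = j" if "i < 5" "j < 5" for i j using inj\<beta> that by blast
  show "fill b0 b1 b2 b3 b4 (\<beta> 0) = b0" "fill b0 b1 b2 b3 b4 (\<beta> 1) = b1"
    "fill b0 b1 b2 b3 b4 (\<beta> 2) = b2" "fill b0 b1 b2 b3 b4 (\<beta> 3) = b3" "fill b0 b1 b2 b3 b4 (\<beta> 4) = b4"
    by (simp_all add: fill_def n)
qed

lemma fill_chain: "fill b0 b1 b2 b3 b4 \<in> chain_space W dm (Suc p)"
  unfolding chain_space_def
proof (intro CollectI allI impI)
  fix x assume "fill b0 b1 b2 b3 b4 x \<noteq> 0"
  then have "x \<in> \<beta> ` {..<5}" by (auto simp: fill_def split: if_splits)
  then show "x \<in> W \<and> dm x = Suc p" using dm\<beta> by (auto simp: W_def)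
qed

lemma eq_on_W:
  assumes "\<And>i. i < 5 \<Longrightarrow> c (\<alpha> i) = c' (\<alpha> i)" "\<And>i. i < 5 \<Longrightarrow> c (\<beta> i) = c' (\<beta> i)" "\<And>x. x \<notin> W \<Longrightarrow> c x = c' x"
  shows "c = c'"
proof
  fix x show "c x = c' x"
  proof (cases "x \<in> W")
    case True
    then show ?thesis by (rule W_cases) (use assms in auto)
  qed (use assms in auto)
qed

text \<open>Every interior edge lies in two triangles, so four of the five edge equations express
  all coefficients by \<open>z (\<beta> 0)\<close> up to sign. The fifth closes the way around the
  strip with the wrong sign and leaves twice that coefficient.\<close>

lemma top_cycle: "z \<in> cyc W dm \<epsilon> (Suc p) \<Longrightarrow>
    z (\<beta> 3) = - z (\<beta> 0) \<and> z (\<beta> 2) = - z (\<beta> 0) \<and> z (\<beta> 4) = z (\<beta> 0) \<and> z (\<beta> 1) = - z (\<beta> 0) \<and> 2 * z (\<beta> 0) = 0"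
proof -
  assume "z \<in> cyc W dm \<epsilon> (Suc p)"
  then have b: "bdry W \<epsilon> z x = 0" for x by (simp add: cyc_def)
  have k: "y = 0" if "u * y = 0" for y
  proof -
    have "u * (u * y) = 0" using that by simp
    then show "y = 0" using uu by (simp add: mult.assoc[symmetric])
  qed
  note e = k[OF b[of "\<alpha> 0", unfolded bdry_W]] k[OF b[of "\<alpha> 1", unfolded bdry_W]] k[OF b[of "\<alpha> 2", unfolded bdry_W]]
    k[OF b[of "\<alpha> 3", unfolded bdry_W]] k[OF b[of "\<alpha> 4", unfolded bdry_W]]
  have "z (\<beta> 3) = (z (\<beta> 0) + z (\<beta> 3)) - z (\<beta> 0)" by simp
  then have 3: "z (\<beta> 3) = - z (\<beta> 0)" unfolding e by simp
  have "z (\<beta> 2) = - z (\<beta> 0) - (- z (\<beta> 0) - z (\<beta> 2))" by simp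
  then have 2: "z (\<beta> 2) = - z (\<beta> 0)" unfolding e by simp
  have "z (\<beta> 4) = (z (\<beta> 2) + z (\<beta> 4)) - z (\<beta> 2)" by simp
  then have 4: "z (\<beta> 4) = z (\<beta> 0)" unfolding e unfolding 2 by simp
  have "z (\<beta> 1) = (z (\<beta> 1) + z (\<beta> 4)) - z (\<beta> 4)" by simp
  then have 1: "z (\<beta> 1) = - z (\<beta> 0)" unfolding e unfolding 4 by simp
  have "2 * z (\<beta> 0) = 0" using e(4) unfolding 1 3 by simp
  then show ?thesis using 1 2 3 4 by blast
qed

lemma chain_\<alpha>: "z \<in> chain_space W dm (Suc p) \<Longrightarrow> i < 5 \<Longrightarrow> z (\<alpha> i) = 0"
  using dm\<alpha>[of i] by (auto simp: chain_space_def)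
lemma chain_\<beta>: "z \<in> chain_space W dm p \<Longrightarrow> i < 5 \<Longrightarrow> z (\<beta> i) = 0"
  using dm\<beta>[of i] by (auto simp: chain_space_def)

lemma dm_W: "x \<in> W \<Longrightarrow> dm x = p \<or> dm x = Suc p"
  by (erule W_cases) (auto simp: dm\<alpha> dm\<beta>)

lemma hdim_other: "i \<noteq> p \<Longrightarrow> i \<noteq> Suc p \<Longrightarrow> hdim W dm \<epsilon> i 0"
  by (rule hdim_no_cells) (use dm_W in auto)

lemma fill_bdry:
  assumes "z \<in> chain_space W dm p"
    "u * (b0 + b3) = z (\<alpha> 0)" "u * (b1 + b4) = z (\<alpha> 1)" "u * (- b0 - b2) = z (\<alpha> 2)"
    "u * (- b1 - b3) = z (\<alpha> 3)" "u * (b2 + b4) = z (\<alpha> 4)"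
  shows "z \<in> bnd W dm \<epsilon> p"
proof (rule bnd_I[OF fill_chain[of b0 b1 b2 b3 b4]], rule eq_on_W)
  show "z (\<alpha> i) = bdry W \<epsilon> (fill b0 b1 b2 b3 b4) (\<alpha> i)" if "i < 5" for i
    using that unfolding lt5
    by (elim disjE) (simp_all add: bdry_W(1-5) fill_simps assms(2-6)[symmetric] del: One_nat_def)
  show "z (\<beta> i) = bdry W \<epsilon> (fill b0 b1 b2 b3 b4) (\<beta> i)" if "i < 5" for i
    using that chain_\<beta>[OF assms(1)] by (simp add: bdry_W)
  show "z x = bdry W \<epsilon> (fill b0 b1 b2 b3 b4) x" if "x \<notin> W" for x
    using that chain_space_0[OF assms(1)] by (simp add: bdry_W)
qed

lemma hdim_half:
  assumes t: "2 * t = (1::'f)"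
  shows "hdim W dm \<epsilon> i 0"
proof -
  consider "i = p" | "i = Suc p" | "i \<noteq> p" "i \<noteq> Suc p" by blast
  then show ?thesis
  proof cases
    case 1
    show ?thesis unfolding hdim_def 1
    proof (rule quot_dim_0, rule subsetI)
      fix z assume "z \<in> cyc W dm \<epsilon> p"
      then have z: "z \<in> chain_space W dm p" by (simp add: cyc_def)
      define a where "a i = u * z (\<alpha> i)" for i
      have ua: "u * a i = z (\<alpha> i)" for i using uu by (simp add: a_def mult.assoc[symmetric])
      \<comment> \<open>With \<open>a i\<close> as right-hand sides, this alternating sum of the
        five equations is twice the unknown \<open>b0\<close>; the other unknowns follow by
        substitution.\<close>
      define b0 where "b0 = t * (a 0 + a 1 - a 2 + a 3 - a 4)"
      have b0: "b0 + b0 = a 0 + a 1 - a 2 + a 3 - a 4"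
      proof -
        have "b0 + b0 = (2 * t) * (a 0 + a 1 - a 2 + a 3 - a 4)" by (simp only: b0_def mult_2 distrib_right)
        then show ?thesis by (simp add: t)
      qed
      show "z \<in> bnd W dm \<epsilon> p"
      proof (rule fill_bdry[OF z, of b0 "a 0 - b0" "a 1 - a 4 - a 2 - b0" "a 4 + a 2 + b0" "- a 2 - b0"])
        have "- (a 1 - a 4 - a 2 - b0) - (a 0 - b0) = a 3" using b0 by (simp add: algebra_simps)
        then show "u * (- (a 1 - a 4 - a 2 - b0) - (a 0 - b0)) = z (\<alpha> 3)" by (simp only: ua)
      qed (simp_all add: ua)
    qed
  next
    case 2
    show ?thesis unfolding hdim_def 2
    proof (rule quot_dim_0, rule subsetI)
      fix z assume zc: "z \<in> cyc W dm \<epsilon> (Suc p)"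
      then have z: "z \<in> chain_space W dm (Suc p)" by (simp add: cyc_def)
      have "z (\<beta> 0) = t * (2 * z (\<beta> 0))" using t by (simp add: mult.assoc[symmetric] mult.commute)
      then have "z (\<beta> 0) = 0" using top_cycle[OF zc] by simp
      then have "z (\<beta> i) = 0" if "i < 5" for i
        using that top_cycle[OF zc] unfolding lt5 by (elim disjE) (simp_all del: One_nat_def)
      then have "z = (\<lambda>_. 0)" by (intro eq_on_W) (auto simp: chain_\<alpha>[OF z] chain_space_0[OF z])
      then show "z \<in> bnd W dm \<epsilon> (Suc p)" using subsp_zero[OF subsp_bnd] by simp
    qed
  qed (rule hdim_other)
qed

lemma hdim_char2:
  assumes two: "(2::'f) = 0"
  shows "hdim W dm \<epsilon> i (if i = p \<or> i = Suc p then 1 else 0)"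
proof -
  have neg: "- x = x" for x :: 'f
  proof -
    have "x + x = 2 * x" by (simp only: mult_2)
    then show ?thesis using two by (simp add: eq_neg_iff_add_eq_0)
  qed
  have sub: "x - y = x + y" for x y :: 'f using neg[of y] by (metis diff_conv_add_uminus)
  have dbl: "x + x = 0" for x :: 'f using neg[of x] by (metis add.right_inverse)
  have dbl': "x + (x + y) = y" for x y :: 'f using dbl[of x] by (simp add: add.assoc[symmetric])
  consider "i = p" | "i = Suc p" | "i \<noteq> p" "i \<noteq> Suc p" by blast
  then show ?thesis
  proof cases
    case 1
    have "quot_dim (cyc W dm \<epsilon> p) (bnd W dm \<epsilon> p) 1"
    \<comment> \<open>Modulo 2 each triangle has exactly two interior edges, so the sum of all edge
      coefficients vanishes on boundaries and is the coordinate of the class.\<close>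
    proof (rule quot_dim_1[where w = "\<lambda>x. if x = \<alpha> 0 then 1 else 0" and g = "\<lambda>z. z (\<alpha> 0) + z (\<alpha> 1) + z (\<alpha> 2) + z (\<alpha> 3) + z (\<alpha> 4)"])
      let ?w = "\<lambda>x. if x = \<alpha> 0 then (1::'f) else 0"
      have cyp: "c \<in> cyc W dm \<epsilon> p \<longleftrightarrow> c \<in> chain_space W dm p" for c
      proof -
        have "bdry W \<epsilon> c = (\<lambda>_. 0)" if c: "c \<in> chain_space W dm p"
        proof (rule eq_on_W)
          show "bdry W \<epsilon> c (\<alpha> i) = 0" if "i < 5" for i
            using that chain_\<beta>[OF c, of 0] chain_\<beta>[OF c, of 1] chain_\<beta>[OF c, of 2] chain_\<beta>[OF c, of 3] chain_\<beta>[OF c, of 4]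
            unfolding lt5 by (elim disjE) (simp_all add: bdry_W(1-5) del: One_nat_def)
        qed (auto simp: bdry_W)
        then show ?thesis by (auto simp: cyc_def)
      qed
      show "?w \<in> cyc W dm \<epsilon> p" unfolding cyp using dm\<alpha>[of 0] by (auto simp: chain_space_def W_def)
      fix z a assume "z \<in> cyc W dm \<epsilon> p"
      then have z: "z \<in> chain_space W dm p" by (simp add: cyp)
      have wz: "?w (\<alpha> 0) = 1" "?w (\<alpha> 1) = 0" "?w (\<alpha> 2) = 0" "?w (\<alpha> 3) = 0" "?w (\<alpha> 4) = 0"
        using inj\<alpha>[of 1 0] inj\<alpha>[of 2 0] inj\<alpha>[of 3 0] inj\<alpha>[of 4 0] by auto
      let ?y = "\<lambda>x. z x - a * ?w x"
      have y: "?y \<in> chain_space W dm p"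
        using z dm\<alpha>[of 0] by (auto simp: chain_space_def W_def)
      show "?y \<in> bnd W dm \<epsilon> p \<longleftrightarrow> a = z (\<alpha> 0) + z (\<alpha> 1) + z (\<alpha> 2) + z (\<alpha> 3) + z (\<alpha> 4)"
      proof
        assume "?y \<in> bnd W dm \<epsilon> p"
        from bnd_E[OF this] obtain v where v: "?y = bdry W \<epsilon> v" .
        note t = trans[OF fun_cong[OF v, of "\<alpha> 0"] bdry_W(1)] trans[OF fun_cong[OF v, of "\<alpha> 1"] bdry_W(2)]
          trans[OF fun_cong[OF v, of "\<alpha> 2"] bdry_W(3)] trans[OF fun_cong[OF v, of "\<alpha> 3"] bdry_W(4)]
          trans[OF fun_cong[OF v, of "\<alpha> 4"] bdry_W(5)]
        have "?y (\<alpha> 0) + ?y (\<alpha> 1) + ?y (\<alpha> 2) + ?y (\<alpha> 3) + ?y (\<alpha> 4) =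
          u * (v (\<beta> 0) + v (\<beta> 3)) + u * (v (\<beta> 1) + v (\<beta> 4)) + u * (- v (\<beta> 0) - v (\<beta> 2)) + u * (- v (\<beta> 1) - v (\<beta> 3)) + u * (v (\<beta> 2) + v (\<beta> 4))"
          by (simp only: t)
        also have "\<dots> = u * (v (\<beta> 4) + v (\<beta> 4))" by (simp add: algebra_simps)
        also have "\<dots> = 0" by (simp add: dbl)
        finally have "(z (\<alpha> 0) - a) + z (\<alpha> 1) + z (\<alpha> 2) + z (\<alpha> 3) + z (\<alpha> 4) = 0"
          unfolding wz by simp
        then show "a = z (\<alpha> 0) + z (\<alpha> 1) + z (\<alpha> 2) + z (\<alpha> 3) + z (\<alpha> 4)" by (simp add: algebra_simps)
      next
        assume a: "a = z (\<alpha> 0) + z (\<alpha> 1) + z (\<alpha> 2) + z (\<alpha> 3) + z (\<alpha> 4)"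
        define y' where "y' i = u * ?y (\<alpha> i)" for i
        have uy: "u * y' i = ?y (\<alpha> i)" for i using uu by (simp only: y'_def mult.assoc[symmetric] mult_1)
        have s: "y' 0 + y' 1 + y' 2 + y' 3 + y' 4 = 0"
        proof -
          have "y' 0 + y' 1 + y' 2 + y' 3 + y' 4 = u * (?y (\<alpha> 0) + ?y (\<alpha> 1) + ?y (\<alpha> 2) + ?y (\<alpha> 3) + ?y (\<alpha> 4))"
            by (simp only: y'_def distrib_left)
          also have "?y (\<alpha> 0) + ?y (\<alpha> 1) + ?y (\<alpha> 2) + ?y (\<alpha> 3) + ?y (\<alpha> 4) = 0"
            unfolding wz a by (simp add: algebra_simps)
          finally show ?thesis by simp
        qed
        show "?y \<in> bnd W dm \<epsilon> p"
        \<comment> \<open>The kernel is generated by the sum of all triangles, so the coefficient of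
          \<open>\<beta> 0\<close> may be set to 0. Four equations determine the rest, and the fifth
          is the vanishing of the sum \<open>s\<close>.\<close>
        proof (rule fill_bdry[OF y, of 0 "y' 0" "y' 1 + y' 4 + y' 2" "y' 4 + y' 2" "y' 2"])
          have "y' 1 + y' 4 + y' 2 + y' 0 = y' 3"
          proof -
            have "(y' 1 + y' 4 + y' 2 + y' 0) + y' 3 = 0" using s by (simp only: add_ac)
            then have "y' 1 + y' 4 + y' 2 + y' 0 = - y' 3" by (simp only: eq_neg_iff_add_eq_0)
            then show ?thesis unfolding neg .
          qed
          then show "u * (- (y' 1 + y' 4 + y' 2) - y' 0) = ?y (\<alpha> 3)"
            unfolding uy[symmetric] unfolding neg sub by simp
          show "u * (y' 1 + y' 4 + y' 2 + (y' 4 + y' 2)) = ?y (\<alpha> 1)"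
            unfolding uy[symmetric] using dbl[of "y' 4 + y' 2"] by (simp add: add.assoc)
          show "u * (- 0 - y' 2) = ?y (\<alpha> 2)" unfolding uy[symmetric] unfolding neg sub by simp
          show "u * (y' 2 + (y' 4 + y' 2)) = ?y (\<alpha> 4)" unfolding uy[symmetric] using dbl'[of "y' 2" "y' 4"] by (simp add: add.commute)
          show "u * (0 + y' 0) = ?y (\<alpha> 0)" unfolding uy[symmetric] by simp
        qed
      qed
    qed
    then show ?thesis using 1 by (simp add: hdim_def)
  next
    case 2
    have "quot_dim (cyc W dm \<epsilon> (Suc p)) (bnd W dm \<epsilon> (Suc p)) 1"
    \<comment> \<open>The sum of all five triangles is the relative fundamental cycle modulo
      2.\<close>
    proof (rule quot_dim_1[where w = "fill 1 1 1 1 1" and g = "\<lambda>z. z (\<beta> 0)"])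
      have "bdry W \<epsilon> (fill 1 1 1 1 1) = (\<lambda>_. 0)"
      proof (rule eq_on_W)
        show "bdry W \<epsilon> (fill 1 1 1 1 1) (\<alpha> i) = 0" if "i < 5" for i
          using that unfolding lt5 by (elim disjE) (simp_all add: bdry_W(1-5) fill_simps neg sub dbl two del: One_nat_def)
      qed (auto simp: bdry_W)
      then show "fill 1 1 1 1 1 \<in> cyc W dm \<epsilon> (Suc p)" by (simp add: cyc_def fill_chain)
      fix z a assume zc: "z \<in> cyc W dm \<epsilon> (Suc p)"
      then have z: "z \<in> chain_space W dm (Suc p)" by (simp add: cyc_def)
      let ?y = "\<lambda>x. z x - a * fill 1 1 1 1 1 x"
      have b: "?y \<in> bnd W dm \<epsilon> (Suc p) \<longleftrightarrow> ?y = (\<lambda>_. 0)" by (rule bnd_no_cells) (use dm_W in force)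
      show "?y \<in> bnd W dm \<epsilon> (Suc p) \<longleftrightarrow> a = z (\<beta> 0)" unfolding b
      proof
        assume e: "?y = (\<lambda>_. 0)"
        show "a = z (\<beta> 0)" using fun_cong[OF e, of "\<beta> 0"] by (simp add: fill_simps)
      next
        assume a: "a = z (\<beta> 0)"
        show "?y = (\<lambda>_. 0)"
        proof (rule eq_on_W)
          show "?y (\<beta> i) = 0" if "i < 5" for i
            using that top_cycle[OF zc] unfolding lt5 a by (elim disjE) (simp_all add: fill_simps neg del: One_nat_def)
          show "?y (\<alpha> i) = 0" if "i < 5" for i
            using chain_\<alpha>[OF z that] chain_\<alpha>[OF fill_chain that] by simp
          show "?y x = 0" if "x \<notin> W" for x
            using chain_space_0[OF z that] chain_space_0[OF fill_chain that] by simp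
        qed
      qed
    qed
    then show ?thesis using 2 by (simp add: hdim_def)
  next
    case 3
    then show ?thesis using hdim_other by simp
  qed
qed

end

section \<open>A complex of Taylor type in some variables and cubical in the others\<close>

definition sg :: "nat \<Rightarrow> nat set \<Rightarrow> 'f::comm_ring_1" where
  "sg v \<sigma> = (-1) ^ card {w\<in>\<sigma>. w < v}"

lemma sg_sq: "sg v \<sigma> * sg v \<sigma> = (1::'f::comm_ring_1)"
  by (simp add: sg_def flip: power_add)

lemma sg_antisym:
  assumes "finite \<sigma>" "v \<in> \<sigma>" "w \<in> \<sigma>" "v \<noteq> w"
  shows "sg v \<sigma> * sg w (\<sigma> - {v}) = - (sg w \<sigma> * sg v (\<sigma> - {w}) :: 'f::comm_ring_1)"
proof -
  have less: "sg v \<sigma> * sg w (\<sigma> - {v}) = - (sg w \<sigma> * sg v (\<sigma> - {w}) :: 'f)"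
    if "v < w" "v \<in> \<sigma>" "w \<in> \<sigma>" for v w
  proof -
    have "{x\<in>\<sigma>. x < w} = insert v {x\<in>\<sigma> - {v}. x < w}" using that by auto
    then have "card {x\<in>\<sigma>. x < w} = Suc (card {x\<in>\<sigma> - {v}. x < w})" using assms(1) by simp
    then have 1: "sg w \<sigma> = - (sg w (\<sigma> - {v}) :: 'f)" by (simp add: sg_def)
    have "{x\<in>\<sigma> - {w}. x < v} = {x\<in>\<sigma>. x < v}" using that by auto
    then have 2: "sg v (\<sigma> - {w}) = (sg v \<sigma> :: 'f)" by (simp add: sg_def)
    show ?thesis unfolding 1 2 by (simp add: mult.commute)
  qed
  show ?thesis
  proof (cases "v < w")
    case False
    then have "w < v" using assms(4) by simp
    then show ?thesis using less[of w v] assms by simp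
  qed (use less assms in simp)
qed

text \<open>The diagonal is excluded and the terms are cancelled in pairs \<open>v < w\<close>,
  since in characteristic 2 it would be of no help to know that the sum equals its own
  negative.\<close>

lemma sum_antisym:
  fixes t :: "nat \<Rightarrow> nat \<Rightarrow> 'f::comm_ring_1"
  assumes "finite A" "\<And>v w. v \<in> A \<Longrightarrow> w \<in> A \<Longrightarrow> v \<noteq> w \<Longrightarrow> t v w = - t w v"
  shows "(\<Sum>v\<in>A. \<Sum>w\<in>A - {v}. t v w) = 0"
proof -
  have spl: "(\<Sum>w\<in>A - {v}. t v w) = (\<Sum>w\<in>{w\<in>A. w < v}. t v w) + (\<Sum>w\<in>{w\<in>A. v < w}. t v w)" if "v \<in> A" for v
  proof -
    have "A - {v} = {w\<in>A. w < v} \<union> {w\<in>A. v < w}" by auto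
    moreover have "(\<Sum>w\<in>{w\<in>A. w < v} \<union> {w\<in>A. v < w}. t v w) = (\<Sum>w\<in>{w\<in>A. w < v}. t v w) + (\<Sum>w\<in>{w\<in>A. v < w}. t v w)"
      using assms(1) by (intro sum.union_disjoint) auto
    ultimately show ?thesis by simp
  qed
  have "(\<Sum>v\<in>A. \<Sum>w\<in>A - {v}. t v w) = (\<Sum>v\<in>A. \<Sum>w\<in>{w\<in>A. w < v}. t v w) + (\<Sum>v\<in>A. \<Sum>w\<in>{w\<in>A. v < w}. t v w)"
    unfolding sum.distrib[symmetric] by (rule sum.cong[OF refl spl])
  also have "(\<Sum>v\<in>A. \<Sum>w\<in>{w\<in>A. v < w}. t v w) = (\<Sum>w\<in>A. \<Sum>v\<in>{v\<in>A. v < w}. t v w)"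
    by (rule sum.swap_restrict[OF assms(1) assms(1)])
  also have "\<dots> = (\<Sum>w\<in>A. \<Sum>v\<in>{v\<in>A. v < w}. - t w v)"
  proof (intro sum.cong refl)
    fix w v assume "w \<in> A" "v \<in> {v\<in>A. v < w}"
    then show "t v w = - t w v" by (intro assms(2)) auto
  qed
  finally show ?thesis by (simp add: sum_negf)
qed

text \<open>Variables below \<open>s\<close> are cubical directions, and \<open>s, \<dots>, s + q - 1\<close> number the generators of Taylor
  type. A cell \<open>(u, \<sigma>)\<close> is the product of the cube with top corner \<open>u\<close> and bottom corner \<open>base u \<sigma>\<close> and the
  simplex on the generators in \<open>\<sigma>\<close>; the generator \<open>g\<close> is present where the cubical part satisfies \<open>P g\<close>.
  The bound \<open>M\<close> on exponents only serves to make the complex finite.\<close>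

locale hybrid_complex =
  fixes s q n M :: nat and P :: "nat \<Rightarrow> nat multiset \<Rightarrow> bool" and xl :: "nat \<Rightarrow> nat set"
  assumes sn: "s \<le> n" and xl: "\<And>g. xl g \<subseteq> {s..<n}"
    and P_mono: "\<And>g y y'. P g y \<Longrightarrow> y \<subseteq># y' \<Longrightarrow> P g y'"
    and P_cap: "\<And>g y. set_mset y \<subseteq> {..<s} \<Longrightarrow> P g y \<Longrightarrow> \<exists>y'. y' \<subseteq># y \<and> (\<forall>v. count y' v \<le> M) \<and> P g y'"
begin

definition base :: "nat multiset \<Rightarrow> nat set \<Rightarrow> nat multiset" where
  "base u \<sigma> = u - mset_set (\<sigma> \<inter> {..<s})"

definition cells :: "(nat multiset \<times> nat set) set" where
  "cells = {(u, \<sigma>). \<sigma> \<subseteq> {..<s+q} \<and> \<sigma> \<inter> {s..} \<noteq> {} \<and> set_mset u \<subseteq> {..<s} \<and> (\<forall>v. count u v \<le> M) \<and>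
     mset_set (\<sigma> \<inter> {..<s}) \<subseteq># u \<and> (\<forall>g\<in>\<sigma> \<inter> {s..}. P g (base u \<sigma>))}"

definition og :: "nat multiset \<times> nat set" where "og = ({#}, {})"
definition K where "K = insert og cells"
definition xlab :: "nat set \<Rightarrow> nat set" where "xlab \<sigma> = (\<Union>g\<in>\<sigma> \<inter> {s..}. xl g)"
text \<open>The least common multiple over the vertices of the cell: the cube contributes its top
  corner, and the squarefree labels of the generators contribute the union of their
  supports.\<close>

definition lab :: "nat multiset \<times> nat set \<Rightarrow> nat multiset" where
  "lab x = fst x + mset_set (xlab (snd x))"
definition dm :: "nat multiset \<times> nat set \<Rightarrow> nat" where "dm x = card (snd x)"
text \<open>Boundary of a product of a simplex and a cube: a generator gives one face, a cubical
  direction gives the top face minus the bottom face. An empty second component marks the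
  augmentation cell, onto which every 1-cell maps with coefficient 1.\<close>

definition inc :: "nat multiset \<times> nat set \<Rightarrow> nat multiset \<times> nat set \<Rightarrow> 'f::comm_ring_1" where
  "inc a b = (if snd b = {} then (if fst b = {#} \<and> card (snd a) = 1 then 1 else 0)
     else \<Sum>v\<in>snd a. sg v (snd a) * ((if b = (fst a, snd a - {v}) then 1 else 0) -
        (if v < s \<and> b = (fst a - {#v#}, snd a - {v}) then 1 else 0)))"

lemma cellsD:
  assumes "(u, \<sigma>) \<in> cells"
  shows "\<sigma> \<subseteq> {..<s+q}" "finite \<sigma>" "\<sigma> \<inter> {s..} \<noteq> {}" "\<sigma> \<noteq> {}" "set_mset u \<subseteq> {..<s}" "count u v \<le> M"
    "mset_set (\<sigma> \<inter> {..<s}) \<subseteq># u" "\<And>g. g \<in> \<sigma> \<Longrightarrow> s \<le> g \<Longrightarrow> P g (base u \<sigma>)" "\<And>v. v \<in> \<sigma> \<Longrightarrow> v < s \<Longrightarrow> v \<in># u"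
proof -
  show 1: "\<sigma> \<subseteq> {..<s+q}" using assms by (simp add: cells_def)
  then show f: "finite \<sigma>" using finite_subset by blast
  show "\<sigma> \<inter> {s..} \<noteq> {}" "\<sigma> \<noteq> {}" "set_mset u \<subseteq> {..<s}" "count u v \<le> M" "mset_set (\<sigma> \<inter> {..<s}) \<subseteq># u"
    using assms by (auto simp: cells_def)
  then show "\<And>v. v \<in> \<sigma> \<Longrightarrow> v < s \<Longrightarrow> v \<in># u" using mset_subset_eqD[of "mset_set (\<sigma> \<inter> {..<s})" u] f by auto
  show "\<And>g. g \<in> \<sigma> \<Longrightarrow> s \<le> g \<Longrightarrow> P g (base u \<sigma>)" using assms by (auto simp: cells_def)
qed

lemma og_cells: "og \<notin> cells" by (auto simp: og_def cells_def)

lemma base_remove: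
  assumes "v \<in> \<sigma>" "v < s" "finite \<sigma>" "mset_set (\<sigma> \<inter> {..<s}) \<subseteq># u"
  shows "base u (\<sigma> - {v}) = add_mset v (base u \<sigma>)" "base (u - {#v#}) (\<sigma> - {v}) = base u \<sigma>"
    "mset_set ((\<sigma> - {v}) \<inter> {..<s}) \<subseteq># u - {#v#}" "mset_set ((\<sigma> - {v}) \<inter> {..<s}) \<subseteq># u" "v \<in># u"
proof -
  have e: "mset_set (\<sigma> \<inter> {..<s}) = add_mset v (mset_set ((\<sigma> - {v}) \<inter> {..<s}))"
    using assms(1-3) mset_set.remove[of "\<sigma> \<inter> {..<s}" v] by (simp add: Int_Diff Diff_Int_distrib2 Diff_Int2)
  then obtain r where r: "u = add_mset v (mset_set ((\<sigma> - {v}) \<inter> {..<s})) + r"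
    using assms(4) by (metis subset_mset.le_iff_add)
  show "base u (\<sigma> - {v}) = add_mset v (base u \<sigma>)" "base (u - {#v#}) (\<sigma> - {v}) = base u \<sigma>"
    "mset_set ((\<sigma> - {v}) \<inter> {..<s}) \<subseteq># u - {#v#}" "mset_set ((\<sigma> - {v}) \<inter> {..<s}) \<subseteq># u" "v \<in># u"
    unfolding base_def e r by auto
qed

lemma base_remove_ge: "s \<le> v \<Longrightarrow> base u (\<sigma> - {v}) = base u \<sigma>" "s \<le> v \<Longrightarrow> (\<sigma> - {v}) \<inter> {..<s} = \<sigma> \<inter> {..<s}"
proof -
  assume "s \<le> v" then show "(\<sigma> - {v}) \<inter> {..<s} = \<sigma> \<inter> {..<s}" by auto
  then show "base u (\<sigma> - {v}) = base u \<sigma>" by (simp add: base_def)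
qed

lemma face_top:
  assumes c: "(u, \<sigma>) \<in> cells" and v: "v \<in> \<sigma>" and ne: "(\<sigma> - {v}) \<inter> {s..} \<noteq> {}"
  shows "(u, \<sigma> - {v}) \<in> cells"
proof -
  note d = cellsD[OF c]
  have "mset_set ((\<sigma> - {v}) \<inter> {..<s}) \<subseteq># u \<and> base u \<sigma> \<subseteq># base u (\<sigma> - {v})"
  proof (cases "v < s")
    case True
    then show ?thesis using base_remove[OF v True d(2,7)] by simp
  next
    case False
    then show ?thesis using base_remove_ge[of v] d(7) by simp
  qed
  then have 1: "mset_set ((\<sigma> - {v}) \<inter> {..<s}) \<subseteq># u" and 2: "\<And>g. g \<in> \<sigma> \<Longrightarrow> s \<le> g \<Longrightarrow> P g (base u (\<sigma> - {v}))"
    using d(8) P_mono by blast+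
  show ?thesis using d(1,5,6) ne 1 2 unfolding cells_def by auto
qed

lemma face_bottom:
  assumes c: "(u, \<sigma>) \<in> cells" and v: "v \<in> \<sigma>" "v < s"
  shows "(u - {#v#}, \<sigma> - {v}) \<in> cells"
proof -
  note d = cellsD[OF c] and r = base_remove[OF v cellsD(2)[OF c] cellsD(7)[OF c]]
  have "(\<sigma> - {v}) \<inter> {s..} = \<sigma> \<inter> {s..}" using v by auto
  moreover have "count (u - {#v#}) w \<le> M" for w using d(6)[of w] by (simp add: le_diff_conv)
  moreover have "set_mset (u - {#v#}) \<subseteq> {..<s}" using d(5) by (auto dest: in_diffD)
  ultimately show ?thesis using d(1,3,8) r unfolding cells_def by auto
qed

lemma inc_nz:
  assumes "inc a b \<noteq> (0::'f::comm_ring_1)" "snd b \<noteq> {}"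
  obtains v where "v \<in> snd a" "snd b = snd a - {v}" "fst b = fst a \<or> (v < s \<and> fst b = fst a - {#v#})"
proof -
  have "(\<Sum>v\<in>snd a. sg v (snd a) * ((if b = (fst a, snd a - {v}) then 1 else 0) -
        (if v < s \<and> b = (fst a - {#v#}, snd a - {v}) then 1 else 0))) \<noteq> (0::'f)"
    using assms by (simp add: inc_def)
  then obtain v where v: "v \<in> snd a" "sg v (snd a) * ((if b = (fst a, snd a - {v}) then 1 else 0) -
        (if v < s \<and> b = (fst a - {#v#}, snd a - {v}) then 1 else 0)) \<noteq> (0::'f)"
    by (meson sum.not_neutral_contains_not_neutral)
  then have "b = (fst a, snd a - {v}) \<or> (v < s \<and> b = (fst a - {#v#}, snd a - {v}))" by (auto split: if_splits)
  then show thesis using that[OF v(1)] by auto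
qed

lemma inc_top:
  assumes "v \<in> \<sigma>" "finite \<sigma>" "v < s \<longrightarrow> v \<in># u" "\<sigma> - {v} \<noteq> {}"
  shows "inc (u, \<sigma>) (u, \<sigma> - {v}) = (sg v \<sigma> :: 'f::comm_ring_1)"
proof -
  have nd: "w < s \<Longrightarrow> w \<in># u \<Longrightarrow> u \<noteq> u - {#w#}" for w
    by (metis count_greater_zero_iff count_single diff_single_trivial insert_DiffM multi_self_add_other_not_self)
  have eqd: "\<sigma> - {v} = \<sigma> - {w} \<longleftrightarrow> w = v" if "w \<in> \<sigma>" for w using assms(1) that by blast
  have "inc (u, \<sigma>) (u, \<sigma> - {v}) = (\<Sum>w\<in>\<sigma>. sg w \<sigma> * ((if (u, \<sigma> - {v}) = (u, \<sigma> - {w}) then 1 else 0) -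
        (if w < s \<and> (u, \<sigma> - {v}) = (u - {#w#}, \<sigma> - {w}) then 1 else (0::'f))))" using assms(4) by (simp add: inc_def)
  also have "\<dots> = (\<Sum>w\<in>\<sigma>. if w = v then sg v \<sigma> else (0::'f))"
  proof (rule sum.cong[OF refl])
    fix w assume "w \<in> \<sigma>"
    from eqd[OF this] show "sg w \<sigma> * ((if (u, \<sigma> - {v}) = (u, \<sigma> - {w}) then 1 else 0) -
        (if w < s \<and> (u, \<sigma> - {v}) = (u - {#w#}, \<sigma> - {w}) then 1 else 0)) = (if w = v then sg v \<sigma> else (0::'f))"
      using assms(3) nd[of v] by (cases "w = v") auto
  qed
  finally have "inc (u, \<sigma>) (u, \<sigma> - {v}) = (\<Sum>w\<in>\<sigma>. if w = v then sg v \<sigma> else (0::'f))" .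
  then show ?thesis using assms by simp
qed

lemma inc_bottom:
  assumes "v \<in> \<sigma>" "finite \<sigma>" "v < s" "v \<in># u" "\<sigma> - {v} \<noteq> {}"
  shows "inc (u, \<sigma>) (u - {#v#}, \<sigma> - {v}) = (- sg v \<sigma> :: 'f::comm_ring_1)"
proof -
  have nd: "u - {#v#} \<noteq> u"
    using assms by (metis diff_single_trivial insert_DiffM multi_self_add_other_not_self)
  have eqd: "\<sigma> - {v} = \<sigma> - {w} \<longleftrightarrow> w = v" if "w \<in> \<sigma>" for w using assms(1) that by blast
  have "inc (u, \<sigma>) (u - {#v#}, \<sigma> - {v}) = (\<Sum>w\<in>\<sigma>. sg w \<sigma> * ((if (u - {#v#}, \<sigma> - {v}) = (u, \<sigma> - {w}) then 1 else 0) -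
        (if w < s \<and> (u - {#v#}, \<sigma> - {v}) = (u - {#w#}, \<sigma> - {w}) then 1 else (0::'f))))" using assms(5) by (simp add: inc_def)
  also have "\<dots> = (\<Sum>w\<in>\<sigma>. if w = v then - sg v \<sigma> else (0::'f))"
  proof (rule sum.cong[OF refl])
    fix w assume "w \<in> \<sigma>"
    from eqd[OF this] show "sg w \<sigma> * ((if (u - {#v#}, \<sigma> - {v}) = (u, \<sigma> - {w}) then 1 else 0) -
        (if w < s \<and> (u - {#v#}, \<sigma> - {v}) = (u - {#w#}, \<sigma> - {w}) then 1 else 0)) = (if w = v then - sg v \<sigma> else (0::'f))"
      using assms(3) nd by (cases "w = v") auto
  qed
  finally have "inc (u, \<sigma>) (u - {#v#}, \<sigma> - {v}) = (\<Sum>w\<in>\<sigma>. if w = v then - sg v \<sigma> else (0::'f))" .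
  then show ?thesis using assms by simp
qed

lemma finite_K: "finite K"
proof -
  have "{u. set_mset u \<subseteq> {..<s} \<and> (\<forall>v. count u v \<le> M)} \<subseteq> {u. u \<subseteq># (\<Sum>v<s. replicate_mset M v)}"
  proof
    fix u assume u: "u \<in> {u. set_mset u \<subseteq> {..<s} \<and> (\<forall>v. count u v \<le> M)}"
    have "count u v \<le> count (\<Sum>v<s. replicate_mset M v) v" for v
      using u by (cases "v \<in># u") (auto simp: count_sum not_in_iff sum.delta)
    then show "u \<in> {u. u \<subseteq># (\<Sum>v<s. replicate_mset M v)}" by (simp add: mset_subset_eqI)
  qed
  then have "finite {u. set_mset u \<subseteq> {..<s} \<and> (\<forall>v. count u v \<le> M)}" using finite_submset finite_subset by blast
  moreover have "cells \<subseteq> {u. set_mset u \<subseteq> {..<s} \<and> (\<forall>v. count u v \<le> M)} \<times> Pow {..<s+q}"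
    by (auto simp: cells_def)
  ultimately show ?thesis unfolding K_def by (meson finite.insertI finite_Pow_iff finite_SigmaI finite_lessThan finite_subset)
qed

lemma K_cases: assumes "x \<in> K" obtains "x = og" | u \<sigma> where "x = (u, \<sigma>)" "(u, \<sigma>) \<in> cells"
  using assms by (cases x) (auto simp: K_def)

lemma snd_og: "x \<in> K \<Longrightarrow> snd x = {} \<longleftrightarrow> x = og"
  by (erule K_cases) (auto simp: og_def dest: cellsD(4))

lemma lab_og: "lab og = {#}" by (simp add: lab_def og_def xlab_def)

lemma finite_xl: "finite (xl g)" using xl finite_subset by blast

lemma xlab_vars: "xlab \<sigma> \<subseteq> {s..<n}" using xl by (auto simp: xlab_def)

lemma finite_xlab: "finite (xlab \<sigma>)" using xlab_vars finite_subset by blast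

lemma inc_grade:
  assumes "a \<in> K" "b \<in> K" "inc a b \<noteq> (0::'f::comm_ring_1)"
  shows "dm a = Suc (dm b)" "lab b \<subseteq># lab a"
proof -
  show "dm a = Suc (dm b)"
  proof (cases "b = og")
    case True
    then show ?thesis using assms(3) by (auto simp: inc_def dm_def og_def split: if_splits)
  next
    case False
    then have "snd b \<noteq> {}" using snd_og assms by blast
    from inc_nz[OF assms(3) this] obtain v where v: "v \<in> snd a" "snd b = snd a - {v}" by metis
    have "a \<noteq> og"
    proof
      assume "a = og"
      with v(1) show False by (simp add: og_def)
    qed
    then have "finite (snd a)" using assms(1) by (auto elim!: K_cases dest: cellsD(2))
    then show ?thesis using v card_Suc_Diff1[of "snd a" v] by (simp add: dm_def)
  qed
  show "lab b \<subseteq># lab a"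
  proof (cases "b = og")
    case False
    then have "snd b \<noteq> {}" using snd_og assms by blast
    from inc_nz[OF assms(3) this] obtain v where v: "snd b = snd a - {v}" "fst b = fst a \<or> fst b = fst a - {#v#}" by metis
    have "xlab (snd b) \<subseteq> xlab (snd a)" unfolding v xlab_def by auto
    then have "mset_set (xlab (snd b)) \<subseteq># mset_set (xlab (snd a))"
      using finite_xlab by (simp add: msubset_mset_set_iff)
    moreover have "fst b \<subseteq># fst a" using v(2) by auto
    ultimately show ?thesis unfolding lab_def by (rule subset_mset.add_mono[rotated])
  qed (simp add: lab_og)
qed

text \<open>Turns a sum over all intermediate cells into a sum over directions. Bottom faces are
  always cells, whereas a top face may fail to be one, namely when the last generator has been
  deleted; this accounts for the guard.\<close>

lemma inc_via:
  assumes a: "(u, \<sigma>) \<in> cells" and g: "g og = 0"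
  shows "(\<Sum>x\<in>K. inc (u, \<sigma>) x * g x) = (\<Sum>v\<in>\<sigma>. sg v \<sigma> *
     ((if (u, \<sigma> - {v}) \<in> cells then g (u, \<sigma> - {v}) else 0) - (if v < s then g (u - {#v#}, \<sigma> - {v}) else (0::'f::comm_ring_1))))"
proof -
  have "(\<Sum>x\<in>K. inc (u, \<sigma>) x * g x) = (\<Sum>x\<in>cells. inc (u, \<sigma>) x * g x)"
    unfolding K_def using finite_K og_cells g by (simp add: K_def)
  also have "\<dots> = (\<Sum>x\<in>cells. \<Sum>v\<in>\<sigma>. sg v \<sigma> * ((if x = (u, \<sigma> - {v}) then g x else 0) -
        (if v < s \<and> x = (u - {#v#}, \<sigma> - {v}) then g x else 0)))"
  proof (rule sum.cong[OF refl])
    fix x assume "x \<in> cells"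
    then have "snd x \<noteq> {}" using cellsD(4) by (cases x) auto
    then have "inc (u, \<sigma>) x * g x = (\<Sum>v\<in>\<sigma>. sg v \<sigma> * ((if x = (u, \<sigma> - {v}) then 1 else 0) -
        (if v < s \<and> x = (u - {#v#}, \<sigma> - {v}) then 1 else 0)) * g x)" by (simp add: inc_def sum_distrib_right)
    also have "\<dots> = (\<Sum>v\<in>\<sigma>. sg v \<sigma> * ((if x = (u, \<sigma> - {v}) then g x else 0) -
        (if v < s \<and> x = (u - {#v#}, \<sigma> - {v}) then g x else 0)))"
      by (rule sum.cong) (auto simp: algebra_simps)
    finally show "inc (u, \<sigma>) x * g x = (\<Sum>v\<in>\<sigma>. sg v \<sigma> * ((if x = (u, \<sigma> - {v}) then g x else 0) -
        (if v < s \<and> x = (u - {#v#}, \<sigma> - {v}) then g x else 0)))" .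
  qed
  also have "\<dots> = (\<Sum>v\<in>\<sigma>. \<Sum>x\<in>cells. sg v \<sigma> * ((if x = (u, \<sigma> - {v}) then g x else 0) -
        (if v < s \<and> x = (u - {#v#}, \<sigma> - {v}) then g x else 0)))" by (rule sum.swap)
  also have "\<dots> = (\<Sum>v\<in>\<sigma>. sg v \<sigma> *
     ((if (u, \<sigma> - {v}) \<in> cells then g (u, \<sigma> - {v}) else 0) - (if v < s then g (u - {#v#}, \<sigma> - {v}) else 0)))"
  proof (rule sum.cong[OF refl])
    fix v assume v: "v \<in> \<sigma>"
    have fc: "finite cells" using finite_K by (simp add: K_def)
    have 1: "(\<Sum>x\<in>cells. if x = (u, \<sigma> - {v}) then g x else 0) = (if (u, \<sigma> - {v}) \<in> cells then g (u, \<sigma> - {v}) else 0)"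
      using fc by simp
    have 2: "(\<Sum>x\<in>cells. if v < s \<and> x = (u - {#v#}, \<sigma> - {v}) then g x else 0) = (if v < s then g (u - {#v#}, \<sigma> - {v}) else 0)"
      using fc face_bottom[OF a v] by (cases "v < s") simp_all
    show "(\<Sum>x\<in>cells. sg v \<sigma> * ((if x = (u, \<sigma> - {v}) then g x else 0) -
        (if v < s \<and> x = (u - {#v#}, \<sigma> - {v}) then g x else 0))) = sg v \<sigma> *
     ((if (u, \<sigma> - {v}) \<in> cells then g (u, \<sigma> - {v}) else 0) - (if v < s then g (u - {#v#}, \<sigma> - {v}) else 0))"
      unfolding sum_distrib_left[symmetric] sum_subtractf 1 2 ..
  qed
  finally show ?thesis .
qed

text \<open>Removing two directions in either order leads to the same face with opposite signs.
  Towards \<open>og\<close> the two ends of a cubical edge cancel, and only an edge joining two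
  generators remains, whose ends carry opposite signs.\<close>

lemma inc_sq:
  assumes "a \<in> K" "b \<in> K"
  shows "(\<Sum>x\<in>K. inc a x * inc x b) = (0::'f::comm_ring_1)"
proof (cases "a = og")
  case True
  have "inc og x = (0::'f)" for x by (simp add: inc_def og_def)
  then show ?thesis using True by simp
next
  case False
  then obtain u \<sigma> where a: "a = (u, \<sigma>)" "(u, \<sigma>) \<in> cells" using assms(1) by (auto elim: K_cases)
  note d = cellsD[OF a(2)]
  have ogz: "inc og b = (0::'f)" by (simp add: inc_def og_def)
  note via = inc_via[OF a(2), of "\<lambda>x. inc x b", OF ogz]
  show ?thesis
  proof (cases "b = og")
    case True
    have io: "inc x og = (if card (snd x) = 1 then 1 else (0::'f))" for x by (simp add: inc_def og_def)
    have "sg v \<sigma> * ((if (u, \<sigma> - {v}) \<in> cells then inc (u, \<sigma> - {v}) b else 0) - (if v < s then inc (u - {#v#}, \<sigma> - {v}) b else 0))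
      = (if s \<le> v \<and> (\<sigma> - {v}) \<inter> {s..} \<noteq> {} \<and> card \<sigma> = 2 then sg v \<sigma> else (0::'f))" if v: "v \<in> \<sigma>" for v
    proof (cases "v < s")
      case True
      then have "(\<sigma> - {v}) \<inter> {s..} = \<sigma> \<inter> {s..}" by auto
      then have "(u, \<sigma> - {v}) \<in> cells" using face_top[OF a(2) v] d(3) by simp
      then show ?thesis using True \<open>b = og\<close> by (simp add: io)
    next
      case False
      have "(u, \<sigma> - {v}) \<in> cells \<longleftrightarrow> (\<sigma> - {v}) \<inter> {s..} \<noteq> {}" using face_top[OF a(2) v] cellsD(3) by blast
      moreover have "card (\<sigma> - {v}) = 1 \<longleftrightarrow> card \<sigma> = 2" using d(2) v by (metis One_nat_def Suc_1 Suc_inject card_Suc_Diff1)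
      ultimately show ?thesis using False \<open>b = og\<close> by (simp add: io)
    qed
    then have e: "(\<Sum>x\<in>K. inc (u, \<sigma>) x * inc x b) = (\<Sum>v\<in>\<sigma>. if s \<le> v \<and> (\<sigma> - {v}) \<inter> {s..} \<noteq> {} \<and> card \<sigma> = 2 then sg v \<sigma> else (0::'f))"
      unfolding via by (intro sum.cong) auto
    show ?thesis
    proof (cases "card \<sigma> = 2 \<and> \<sigma> \<subseteq> {s..}")
      case True
      then obtain x y where xy: "\<sigma> = {x, y}" "x < y" by (metis card_2_iff insert_commute linorder_neqE_nat)
      have 1: "{w\<in>\<sigma>. w < x} = {}" and 2: "{w\<in>\<sigma>. w < y} = {x}" using xy by auto
      have "sg x \<sigma> = (1::'f)" unfolding sg_def 1 by simp
      moreover have "sg y \<sigma> = (-1::'f)" unfolding sg_def 2 by simp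
      moreover have "(\<sigma> - {x}) \<inter> {s..} = {y}" "(\<sigma> - {y}) \<inter> {s..} = {x}" "s \<le> x" "s \<le> y" using True xy by auto
      ultimately show ?thesis unfolding a(1) e using True xy by simp
    next
      case False
      have "\<not> (s \<le> v \<and> (\<sigma> - {v}) \<inter> {s..} \<noteq> {} \<and> card \<sigma> = 2)" if "v \<in> \<sigma>" for v
      proof
        assume v: "s \<le> v \<and> (\<sigma> - {v}) \<inter> {s..} \<noteq> {} \<and> card \<sigma> = 2"
        then obtain w where w: "w \<in> \<sigma>" "w \<noteq> v" "s \<le> w" by auto
        have "\<sigma> = {v, w}" using v w that d(2) by (metis card_2_iff doubleton_eq_iff insert_absorb insert_iff singletonD)
        then show False using False v w by auto
      qed
      then show ?thesis unfolding a(1) e by (intro sum.neutral) auto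
    qed
  next
    case False
    then have b: "b \<in> cells" "snd b \<noteq> {}" using assms(2) snd_og by (auto simp: K_def)
    \<comment> \<open>\<open>G v w\<close> collects the choices of top or bottom for the directions
      \<open>v\<close> and \<open>w\<close>. It is symmetric in them, so the antisymmetric signs
      make the double sum vanish.\<close>
    define G where "G v w = ((if b = (u, \<sigma> - {v} - {w}) then 1 else 0) - (if w < s \<and> b = (u - {#w#}, \<sigma> - {v} - {w}) then 1 else 0)) -
       (if v < s then (if b = (u - {#v#}, \<sigma> - {v} - {w}) then 1 else 0) - (if w < s \<and> b = (u - {#v#} - {#w#}, \<sigma> - {v} - {w}) then 1 else 0) else (0::'f))" for v w
    have Gs: "G v w = G w v" for v w
    proof -
      have "\<sigma> - {v} - {w} = \<sigma> - {w} - {v}" "u - {#v#} - {#w#} = u - {#w#} - {#v#}" by (auto simp: multiset_eq_iff)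
      then show ?thesis unfolding G_def by (auto simp: algebra_simps)
    qed
    have "sg v \<sigma> * ((if (u, \<sigma> - {v}) \<in> cells then inc (u, \<sigma> - {v}) b else 0) - (if v < s then inc (u - {#v#}, \<sigma> - {v}) b else 0))
       = (\<Sum>w\<in>\<sigma> - {v}. sg v \<sigma> * sg w (\<sigma> - {v}) * G v w)" if v: "v \<in> \<sigma>" for v
    proof -
      have inc': "inc (u', \<sigma>') b = (\<Sum>w\<in>\<sigma>'. sg w \<sigma>' * ((if b = (u', \<sigma>' - {w}) then 1 else 0) -
        (if w < s \<and> b = (u' - {#w#}, \<sigma>' - {w}) then 1 else (0::'f))))" for u' \<sigma>' using b(2) by (simp add: inc_def)
      have "(if (u, \<sigma> - {v}) \<in> cells then inc (u, \<sigma> - {v}) b else 0) = (inc (u, \<sigma> - {v}) b :: 'f)"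
      proof (cases "(u, \<sigma> - {v}) \<in> cells")
        case False
        then have no: "(\<sigma> - {v}) \<inter> {s..} = {}" using face_top[OF a(2) v] by blast
        have "inc (u, \<sigma> - {v}) b = (0::'f)"
        proof (rule ccontr)
          assume "inc (u, \<sigma> - {v}) b \<noteq> (0::'f)"
          from inc_nz[OF this b(2)] have "snd b \<subseteq> \<sigma> - {v}" by (metis Diff_subset snd_conv)
          then have "snd b \<inter> {s..} = {}" using no by blast
          then show False using b(1) cellsD(3)[of "fst b" "snd b"] by simp
        qed
        then show ?thesis by simp
      qed simp
      then have "(if (u, \<sigma> - {v}) \<in> cells then inc (u, \<sigma> - {v}) b else 0) - (if v < s then inc (u - {#v#}, \<sigma> - {v}) b else 0)
        = (\<Sum>w\<in>\<sigma> - {v}. sg w (\<sigma> - {v}) * G v w)"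
        unfolding inc' G_def by (cases "v < s") (simp_all add: sum_subtractf[symmetric] right_diff_distrib)
      then show ?thesis by (simp add: sum_distrib_left mult.assoc)
    qed
    then have "(\<Sum>x\<in>K. inc (u, \<sigma>) x * inc x b) = (\<Sum>v\<in>\<sigma>. \<Sum>w\<in>\<sigma> - {v}. sg v \<sigma> * sg w (\<sigma> - {v}) * G v w)"
      unfolding via by (intro sum.cong) auto
    also have "\<dots> = 0"
    proof (rule sum_antisym[OF d(2)])
      fix v w assume vw: "v \<in> \<sigma>" "w \<in> \<sigma>" "v \<noteq> w"
      show "sg v \<sigma> * sg w (\<sigma> - {v}) * G v w = - (sg w \<sigma> * sg v (\<sigma> - {w}) * G w v)"
        unfolding sg_antisym[OF d(2) vw] Gs[of v w] by simp
    qed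
    finally show ?thesis unfolding a(1) .
  qed
qed

end

section \<open>Exactness of the strands\<close>

context hybrid_complex
begin

text \<open>The largest corner available in the strand of \<open>\<nu>\<close>: the part of
  \<open>\<nu>\<close> in the cubical variables, cut at the exponent bound.\<close>

definition cap :: "nat multiset \<Rightarrow> nat multiset" where
  "cap \<nu> = (\<Sum>v<s. replicate_mset (min M (count \<nu> v)) v)"

lemma count_cap: "count (cap \<nu>) v = (if v < s then min M (count \<nu> v) else 0)"
  by (simp add: cap_def count_sum sum.delta)

lemma lab_le_iff:
  assumes "(u, \<sigma>) \<in> cells"
  shows "lab (u, \<sigma>) \<subseteq># \<nu> \<longleftrightarrow> u \<subseteq># cap \<nu> \<and> xlab \<sigma> \<subseteq> set_mset \<nu>"
proof -
  note d = cellsD[OF assms]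
  have us: "count u v = 0" if "s \<le> v" for v using d(5) that by (meson lessThan_iff not_in_iff not_less subsetD)
  have xs: "v \<notin> xlab \<sigma>" if "v < s" for v using xlab_vars[of \<sigma>] that by auto
  have cl: "count (lab (u, \<sigma>)) v = count u v + (if v \<in> xlab \<sigma> then 1 else 0)" for v
    using finite_xlab by (simp add: lab_def)
  show ?thesis
  proof
    assume a: "lab (u, \<sigma>) \<subseteq># \<nu>"
    have "count u v \<le> count (cap \<nu>) v" for v
      using mset_subset_eq_count[OF a, of v] cl[of v] d(6)[of v] us[of v] by (cases "v < s") (auto simp: count_cap)
    moreover have "v \<in># \<nu>" if "v \<in> xlab \<sigma>" for v
    proof -
      have "count u v + 1 \<le> count \<nu> v" using mset_subset_eq_count[OF a, of v] cl[of v] that by simp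
      then have "count \<nu> v > 0" by linarith
      then show ?thesis by simp
    qed
    ultimately show "u \<subseteq># cap \<nu> \<and> xlab \<sigma> \<subseteq> set_mset \<nu>" by (auto intro: mset_subset_eqI)
  next
    assume a: "u \<subseteq># cap \<nu> \<and> xlab \<sigma> \<subseteq> set_mset \<nu>"
    have "count (lab (u, \<sigma>)) v \<le> count \<nu> v" for v
    proof (cases "v < s")
      case True
      then show ?thesis using mset_subset_eq_count[OF conjunct1[OF a], of v] cl[of v] xs[of v] by (simp add: count_cap)
    next
      case False
      then have "count u v = 0" using us by simp
      moreover have "v \<in> xlab \<sigma> \<Longrightarrow> 1 \<le> count \<nu> v" using a by (auto simp: Suc_le_eq)
      ultimately show ?thesis using cl[of v] by auto
    qed
    then show "lab (u, \<sigma>) \<subseteq># \<nu>" by (rule mset_subset_eqI)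
  qed
qed

text \<open>The smallest direction in which the cubical part has not settled at the corner
  \<open>N\<close>: the cell extends along \<open>v\<close>, or there is still room to move up along
  it. It serves as the pivot of the matching.\<close>

definition isfirst where
  "isfirst N v x \<longleftrightarrow> v < s \<and> (v \<in> snd x \<or> count (fst x) v < count N v) \<and>
     (\<forall>w<v. w \<notin> snd x \<and> \<not> count (fst x) w < count N w)"

definition noneD where
  "noneD N x \<longleftrightarrow> (\<forall>w<s. w \<notin> snd x \<and> \<not> count (fst x) w < count N w)"

lemma isfirst_unique: "isfirst N v x \<Longrightarrow> isfirst N w x \<Longrightarrow> v = w"
  unfolding isfirst_def by (metis linorder_neqE_nat)

lemma isfirst_exists: "noneD N x \<or> (\<exists>v. isfirst N v x)"
proof (rule disjCI)
  assume "\<nexists>v. isfirst N v x"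
  then have n: "\<not> isfirst N v x" for v by blast
  have "w < s \<longrightarrow> w \<notin> snd x \<and> \<not> count (fst x) w < count N w" for w
  proof (induction w rule: less_induct)
    case (less w)
    then show ?case using n[of w] unfolding isfirst_def by (meson less_trans)
  qed
  then show "noneD N x" unfolding noneD_def by blast
qed

lemma isfirst_noneD: "isfirst N v x \<Longrightarrow> \<not> noneD N x"
  unfolding isfirst_def noneD_def by blast

definition fst_dir where "fst_dir N x = (THE v. isfirst N v x)"

lemma fst_dir_eq: "isfirst N v x \<Longrightarrow> fst_dir N x = v"
  unfolding fst_dir_def by (rule the_equality) (auto dest: isfirst_unique)

text \<open>The cubical part is collapsed towards its corner \<open>N\<close>. Over the corner the
  generators form a cone with apex \<open>g0\<close>, and the apex alone is paired with the
  augmentation cell.\<close>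

definition partner :: "nat multiset \<Rightarrow> nat \<Rightarrow> nat multiset \<times> nat set \<Rightarrow> nat multiset \<times> nat set" where
  "partner N g0 x = (if x = og then (N, {g0}) else if noneD N x then
      (if snd x = {g0} then og else if g0 \<in> snd x then (fst x, snd x - {g0}) else (fst x, insert g0 (snd x)))
    else let v = fst_dir N x in
      if v \<in> snd x then (fst x - {#v#}, snd x - {v}) else (add_mset v (fst x), insert v (snd x)))"

definition lower :: "nat multiset \<Rightarrow> nat \<Rightarrow> (nat multiset \<times> nat set) set" where
  "lower N g0 = {x. x = og \<or> (if noneD N x then g0 \<notin> snd x else fst_dir N x \<notin> snd x)}"

lemma isfirst_up:
  assumes "isfirst N v (u, \<sigma>)" shows "isfirst N v (add_mset v u, insert v \<sigma>)"
  using assms unfolding isfirst_def by auto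

lemma isfirst_down:
  assumes "isfirst N v (u, \<sigma>)" "v \<in># u" "count u v \<le> count N v"
  shows "isfirst N v (u - {#v#}, \<sigma> - {v})"
  unfolding isfirst_def
proof (intro conjI allI impI)
  show "v < s" using assms(1) by (simp add: isfirst_def)
  have "count (u - {#v#}) v = count u v - 1" "count u v > 0" using assms(2) by simp_all
  then have "count (u - {#v#}) v < count N v" using assms(3) by linarith
  then show "v \<in> snd (u - {#v#}, \<sigma> - {v}) \<or> count (fst (u - {#v#}, \<sigma> - {v})) v < count N v" by simp
  fix w assume w: "w < v"
  then have o: "w \<notin> \<sigma> \<and> \<not> count u w < count N w" using assms(1) by (simp add: isfirst_def)
  then show "w \<notin> snd (u - {#v#}, \<sigma> - {v})" by simp
  show "\<not> count (fst (u - {#v#}, \<sigma> - {v})) w < count N w" using o w by simp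
qed

lemma cell_up:
  assumes c: "(u, \<sigma>) \<in> cells" and v: "v < s" "v \<notin> \<sigma>" "count u v < M"
  shows "(add_mset v u, insert v \<sigma>) \<in> cells"
proof -
  note d = cellsD[OF c]
  have e: "insert v \<sigma> \<inter> {..<s} = insert v (\<sigma> \<inter> {..<s})" using v by auto
  then have m: "mset_set (insert v \<sigma> \<inter> {..<s}) = add_mset v (mset_set (\<sigma> \<inter> {..<s}))"
    using d(2) v by simp
  have b: "base (add_mset v u) (insert v \<sigma>) = base u \<sigma>" by (simp add: base_def m)
  have "insert v \<sigma> \<inter> {s..} = \<sigma> \<inter> {s..}" using v by auto
  then show ?thesis using d v b m unfolding cells_def by (auto simp: Suc_le_eq)
qed

text \<open>A lower cell other than \<open>a\<close> in the boundary of the partner of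
  \<open>a\<close> can only be the top face in the pivot direction, whose corner is one step nearer
  to \<open>cap \<nu>\<close>. All other faces still contain the pivot, or the apex, and are
  therefore upper cells.\<close>

lemma strand_matching:
  assumes g0: "s \<le> g0" "g0 < s + q" "P g0 (cap \<nu>)" "xl g0 \<subseteq> set_mset \<nu>"
  shows "acyclic_matching {x\<in>K. lab x \<subseteq># \<nu>} dm (inc :: _ \<Rightarrow> _ \<Rightarrow> 'f::comm_ring_1)
    (lower (cap \<nu>) g0) (partner (cap \<nu>) g0) (\<lambda>x. size (cap \<nu>) - size (fst x))"
proof -
  let ?N = "cap \<nu>" let ?W = "{x\<in>K. lab x \<subseteq># \<nu>}" let ?p = "partner ?N g0" let ?L = "lower ?N g0"
  have Ncell: "(?N, {g0}) \<in> cells" "(?N, {g0}) \<in> ?W"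
  proof -
    have i: "{g0} \<inter> {..<s} = {}" "{g0} \<inter> {s..} = {g0}" using g0 by auto
    have "set_mset ?N \<subseteq> {..<s}" using count_cap[of \<nu>] by (metis count_greater_zero_iff lessThan_iff less_irrefl subsetI)
    then show c: "(?N, {g0}) \<in> cells" using g0 i by (auto simp: cells_def base_def count_cap)
    have "xlab {g0} = xl g0" unfolding xlab_def i by simp
    then show "(?N, {g0}) \<in> ?W" using lab_le_iff[OF c, of \<nu>] g0(4) c by (simp add: K_def)
  qed
  have ogW: "og \<in> ?W" by (simp add: K_def lab_og)
  have Wc: "x \<in> ?W \<Longrightarrow> x \<noteq> og \<Longrightarrow> x \<in> cells" for x by (simp add: K_def)
  have Wi: "(u, \<sigma>) \<in> cells \<Longrightarrow> u \<subseteq># ?N \<Longrightarrow> xlab \<sigma> \<subseteq> set_mset \<nu> \<Longrightarrow> (u, \<sigma>) \<in> ?W" for u \<sigma>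
    using lab_le_iff by (simp add: K_def)
  have Wd: "(u, \<sigma>) \<in> ?W \<Longrightarrow> (u, \<sigma>) \<noteq> og \<Longrightarrow> (u, \<sigma>) \<in> cells \<and> u \<subseteq># ?N \<and> xlab \<sigma> \<subseteq> set_mset \<nu>" for u \<sigma>
    using lab_le_iff[of u \<sigma> \<nu>] by (simp add: K_def)
  have capM: "count ?N v \<le> M" for v by (simp add: count_cap)
  have capu: "u = ?N" if "(u, \<sigma>) \<in> cells" "u \<subseteq># ?N" "noneD ?N (u, \<sigma>)" for u \<sigma>
  proof (rule multiset_eqI)
    fix v
    show "count u v = count ?N v"
      using mset_subset_eq_count[OF that(2), of v] that(3) cellsD(5)[OF that(1)]
      by (cases "v < s") (auto simp: noneD_def count_cap)
  qed
  have nogp: "noneD ?N (?N, \<sigma>)" if "\<sigma> \<inter> {..<s} = {}" for \<sigma> using that unfolding noneD_def by auto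
  have noneS: "\<sigma> \<inter> {..<s} = {}" if "noneD ?N (u, \<sigma>)" for u \<sigma> using that unfolding noneD_def by auto
  have struct: "(x = og \<and> ?p x = (?N, {g0})) \<or>
      (\<exists>\<sigma>. x = (?N, \<sigma>) \<and> x \<in> cells \<and> \<sigma> \<inter> {..<s} = {} \<and> g0 \<notin> \<sigma> \<and> ?p x = (?N, insert g0 \<sigma>)) \<or>
      (\<exists>u \<sigma> v. x = (u, \<sigma>) \<and> x \<in> cells \<and> isfirst ?N v (u, \<sigma>) \<and> v \<notin> \<sigma> \<and> ?p x = (add_mset v u, insert v \<sigma>))"
    if x: "x \<in> ?W" "x \<in> ?L" for x
  proof (cases "x = og")
    case True then show ?thesis by (simp add: partner_def)
  next
    case False
    obtain u \<sigma> where us: "x = (u, \<sigma>)" by (cases x)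
    note w = Wd[OF x(1)[unfolded us] False[unfolded us]]
    show ?thesis
    proof (cases "noneD ?N x")
      case True
      then have "u = ?N" using capu w us by blast
      moreover have "g0 \<notin> \<sigma>" using x(2) True False us by (simp add: lower_def)
      ultimately have "x = (?N, \<sigma>) \<and> x \<in> cells \<and> \<sigma> \<inter> {..<s} = {} \<and> g0 \<notin> \<sigma> \<and> ?p x = (?N, insert g0 \<sigma>)"
        using w us True False noneS[of u \<sigma>] by (auto simp: partner_def)
      then show ?thesis by blast
    next
      case nn: False
      then obtain v where v: "isfirst ?N v x" using isfirst_exists by blast
      have "v \<notin> \<sigma>" using x(2) nn False us fst_dir_eq[OF v] by (simp add: lower_def)
      then have "x = (u, \<sigma>) \<and> x \<in> cells \<and> isfirst ?N v (u, \<sigma>) \<and> v \<notin> \<sigma> \<and> ?p x = (add_mset v u, insert v \<sigma>)"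
        using w us v nn False fst_dir_eq[OF v] by (simp add: partner_def)
      then show ?thesis by blast
    qed
  qed
  have upper: "(x = (?N, {g0}) \<and> ?p x = og) \<or>
      (\<exists>\<sigma>. x = (?N, \<sigma>) \<and> x \<in> cells \<and> \<sigma> \<inter> {..<s} = {} \<and> g0 \<in> \<sigma> \<and> \<sigma> \<noteq> {g0} \<and> ?p x = (?N, \<sigma> - {g0})) \<or>
      (\<exists>u \<sigma> v. x = (u, \<sigma>) \<and> x \<in> cells \<and> isfirst ?N v (u, \<sigma>) \<and> v \<in> \<sigma> \<and> ?p x = (u - {#v#}, \<sigma> - {v}))"
    if x: "x \<in> ?W" "x \<notin> ?L" for x
  proof -
    have nog: "x \<noteq> og" using x(2) by (auto simp: lower_def)
    obtain u \<sigma> where us: "x = (u, \<sigma>)" by (cases x)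
    note w = Wd[OF x(1)[unfolded us] nog[unfolded us]]
    show ?thesis
    proof (cases "noneD ?N x")
      case True
      then have u: "u = ?N" using capu w us by blast
      have g: "g0 \<in> \<sigma>" using x(2) True nog us by (simp add: lower_def)
      show ?thesis
      proof (cases "\<sigma> = {g0}")
        case True
        then have "x = (?N, {g0}) \<and> ?p x = og" using us u nog \<open>noneD ?N x\<close> by (simp add: partner_def)
        then show ?thesis by blast
      next
        case False
        then have "x = (?N, \<sigma>) \<and> x \<in> cells \<and> \<sigma> \<inter> {..<s} = {} \<and> g0 \<in> \<sigma> \<and> \<sigma> \<noteq> {g0} \<and> ?p x = (?N, \<sigma> - {g0})"
          using us u nog \<open>noneD ?N x\<close> g w noneS[of u \<sigma>] by (simp add: partner_def)
        then show ?thesis by blast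
      qed
    next
      case nn: False
      then obtain v where v: "isfirst ?N v x" using isfirst_exists by blast
      have "v \<in> \<sigma>" using x(2) nn nog us fst_dir_eq[OF v] by (simp add: lower_def)
      then have "x = (u, \<sigma>) \<and> x \<in> cells \<and> isfirst ?N v (u, \<sigma>) \<and> v \<in> \<sigma> \<and> ?p x = (u - {#v#}, \<sigma> - {v})"
        using w us v nn nog fst_dir_eq[OF v] by (simp add: partner_def)
      then show ?thesis by blast
    qed
  qed
  have og_ne: "(u, \<sigma>) \<in> cells \<Longrightarrow> (u, \<sigma>) \<noteq> og" for u \<sigma> using og_cells by auto
  have none_mem: "\<sigma> \<inter> {..<s} = {} \<Longrightarrow> (?N, \<sigma>) \<in> cells \<Longrightarrow> (?N, \<sigma>) \<in> ?L \<longleftrightarrow> g0 \<notin> \<sigma>" for \<sigma>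
    using nogp[of \<sigma>] og_ne[of ?N \<sigma>] by (simp add: lower_def)
  have none_p: "?p (?N, \<sigma>) = (if \<sigma> = {g0} then og else if g0 \<in> \<sigma> then (?N, \<sigma> - {g0}) else (?N, insert g0 \<sigma>))"
    if "\<sigma> \<inter> {..<s} = {}" "(?N, \<sigma>) \<in> cells" for \<sigma>
    using nogp[OF that(1)] og_ne[OF that(2)] by (simp add: partner_def)
  have first_mem: "(u, \<sigma>) \<in> ?L \<longleftrightarrow> v \<notin> \<sigma>" if "isfirst ?N v (u, \<sigma>)" "(u, \<sigma>) \<in> cells" for u \<sigma> v
    using isfirst_noneD[OF that(1)] fst_dir_eq[OF that(1)] og_ne[OF that(2)] by (simp add: lower_def)
  have first_p: "?p (u, \<sigma>) = (if v \<in> \<sigma> then (u - {#v#}, \<sigma> - {v}) else (add_mset v u, insert v \<sigma>))"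
    if "isfirst ?N v (u, \<sigma>)" "(u, \<sigma>) \<in> cells" for u \<sigma> v
    using isfirst_noneD[OF that(1)] fst_dir_eq[OF that(1)] og_ne[OF that(2)] by (simp add: partner_def)
  have low: "?p x \<in> ?W \<and> ?p x \<notin> ?L \<and> ?p (?p x) = x" if x: "x \<in> ?W" "x \<in> ?L" for x
    using struct[OF x]
  proof (elim disjE exE conjE)
    assume a: "x = og" "?p x = (?N, {g0})"
    have i: "{g0} \<inter> {..<s} = {}" using g0 by auto
    show ?thesis unfolding a(2) using Ncell none_mem[OF i Ncell(1)] none_p[OF i Ncell(1)] a(1) by simp
  next
    fix \<sigma> assume a: "x = (?N, \<sigma>)" "x \<in> cells" "\<sigma> \<inter> {..<s} = {}" "g0 \<notin> \<sigma>" "?p x = (?N, insert g0 \<sigma>)"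
    have c: "(?N, \<sigma>) \<in> cells" using a by simp
    have i: "insert g0 \<sigma> \<inter> {..<s} = {}" using a(3) g0 by auto
    have "mset_set (insert g0 \<sigma> \<inter> {..<s}) \<subseteq># ?N" unfolding i by simp
    moreover have "base ?N (insert g0 \<sigma>) = base ?N \<sigma>" unfolding base_def i a(3) ..
    moreover have "base ?N \<sigma> = ?N" unfolding base_def a(3) by simp
    ultimately have c': "(?N, insert g0 \<sigma>) \<in> cells" using cellsD[OF c] g0 unfolding cells_def by auto
    have "xlab (insert g0 \<sigma>) \<subseteq> set_mset \<nu>" using Wd[OF x(1)[unfolded a(1)] og_ne[OF c]] g0 by (auto simp: xlab_def)
    then have "(?N, insert g0 \<sigma>) \<in> ?W" using Wi[OF c'] by simp
    moreover have "insert g0 \<sigma> \<noteq> {g0}" using a(4) cellsD(4)[OF c] by auto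
    ultimately show ?thesis unfolding a(5) using none_mem[OF i c'] none_p[OF i c'] a(1,4) by simp
  next
    fix u \<sigma> v assume a: "x = (u, \<sigma>)" "x \<in> cells" "isfirst ?N v (u, \<sigma>)" "v \<notin> \<sigma>" "?p x = (add_mset v u, insert v \<sigma>)"
    have c: "(u, \<sigma>) \<in> cells" using a by simp
    have v: "v < s" "count u v < count ?N v" using a(3,4) by (auto simp: isfirst_def)
    then have "count u v < M" using capM[of v] by simp
    then have c': "(add_mset v u, insert v \<sigma>) \<in> cells" using cell_up[OF c v(1) a(4)] by simp
    have "insert v \<sigma> \<inter> {s..} = \<sigma> \<inter> {s..}" using v by auto
    then have "xlab (insert v \<sigma>) = xlab \<sigma>" by (simp add: xlab_def)
    moreover note w = Wd[OF x(1)[unfolded a(1)] og_ne[OF c]]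
    moreover have "add_mset v u \<subseteq># ?N"
    proof (rule mset_subset_eqI)
      fix w show "count (add_mset v u) w \<le> count ?N w"
        using mset_subset_eq_count[of u ?N w] w v(2) by auto
    qed
    ultimately have "(add_mset v u, insert v \<sigma>) \<in> ?W" using Wi[OF c'] by simp
    then show ?thesis unfolding a(5) using first_mem[OF isfirst_up[OF a(3)] c'] first_p[OF isfirst_up[OF a(3)] c'] a(1,4) by simp
  qed
  have up: "?p x \<in> ?W \<and> ?p x \<in> ?L \<and> ?p (?p x) = x" if x: "x \<in> ?W" "x \<notin> ?L" for x
    using upper[OF x]
  proof (elim disjE exE conjE)
    assume "x = (?N, {g0})" "?p x = og"
    then show ?thesis using ogW by (simp add: lower_def) (simp add: partner_def)
  next
    fix \<sigma> assume a: "x = (?N, \<sigma>)" "x \<in> cells" "\<sigma> \<inter> {..<s} = {}" "g0 \<in> \<sigma>" "\<sigma> \<noteq> {g0}" "?p x = (?N, \<sigma> - {g0})"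
    have c: "(?N, \<sigma>) \<in> cells" using a by simp
    have i: "(\<sigma> - {g0}) \<inter> {..<s} = {}" using a(3) by auto
    have "(\<sigma> - {g0}) \<inter> {s..} \<noteq> {}" using a(3,4,5) by (auto simp: disjoint_iff not_less)
    then have c': "(?N, \<sigma> - {g0}) \<in> cells" using face_top[OF c a(4)] by simp
    have "xlab (\<sigma> - {g0}) \<subseteq> xlab \<sigma>" by (auto simp: xlab_def)
    moreover have "xlab \<sigma> \<subseteq> set_mset \<nu>" using Wd[OF x(1)[unfolded a(1)] og_ne[OF c]] by blast
    ultimately have "(?N, \<sigma> - {g0}) \<in> ?W" by (intro Wi[OF c']) auto
    moreover have "\<sigma> - {g0} \<noteq> {g0}" by blast
    ultimately show ?thesis unfolding a(6) using none_mem[OF i c'] none_p[OF i c'] a(1,4) by (simp add: insert_absorb)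
  next
    fix u \<sigma> v assume a: "x = (u, \<sigma>)" "x \<in> cells" "isfirst ?N v (u, \<sigma>)" "v \<in> \<sigma>" "?p x = (u - {#v#}, \<sigma> - {v})"
    have c: "(u, \<sigma>) \<in> cells" using a by simp
    have v: "v < s" using a(3) by (simp add: isfirst_def)
    have vu: "v \<in># u" using cellsD(9)[OF c a(4) v] .
    have c': "(u - {#v#}, \<sigma> - {v}) \<in> cells" using face_bottom[OF c a(4) v] .
    note w = Wd[OF x(1)[unfolded a(1)] og_ne[OF c]]
    have "(\<sigma> - {v}) \<inter> {s..} = \<sigma> \<inter> {s..}" using v by auto
    then have "xlab (\<sigma> - {v}) = xlab \<sigma>" by (simp add: xlab_def)
    moreover have "u - {#v#} \<subseteq># ?N" using w by (meson diff_subset_eq_self subset_mset.order_trans)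
    ultimately have "(u - {#v#}, \<sigma> - {v}) \<in> ?W" using Wi[OF c'] w by simp
    moreover have f: "isfirst ?N v (u - {#v#}, \<sigma> - {v})"
      using isfirst_down[OF a(3) vu] mset_subset_eq_count[of u ?N v] w by simp
    ultimately show ?thesis unfolding a(5) using first_mem[OF f c'] first_p[OF f c'] a(1,4) vu by (simp add: insert_absorb)
  qed
  have lab_tr: "inc a b \<noteq> (0::'f) \<Longrightarrow> a \<in> ?W \<Longrightarrow> b \<in> K \<Longrightarrow> b \<in> ?W" for a b
    using inc_grade(2)[of a b, where 'f = 'f] by (auto intro: subset_mset.order_trans)
  show ?thesis
  proof
    show "finite ?W" using finite_K by simp
    show "dm a = Suc (dm b)" if "a \<in> ?W" "b \<in> ?W" "inc a b \<noteq> (0::'f)" for a b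
      using inc_grade(1)[where 'f = 'f] that by simp
    show "(\<Sum>x\<in>?W. inc a x * inc x b) = (0::'f)" if ab: "a \<in> ?W" "b \<in> ?W" for a b
    proof -
      have "(\<Sum>x\<in>?W. inc a x * inc x b) = (\<Sum>x\<in>K. inc a x * inc x b :: 'f)"
      proof (rule sum.mono_neutral_left[OF finite_K])
        show "\<forall>x\<in>K - ?W. inc a x * inc x b = (0::'f)"
        proof
          fix x assume "x \<in> K - ?W"
          then have "inc a x = (0::'f)" using lab_tr[of a x] ab(1) by blast
          then show "inc a x * inc x b = (0::'f)" by simp
        qed
      qed auto
      then show ?thesis using inc_sq[of a b, where 'f = 'f] ab by simp
    qed
    show "?p x \<in> ?W" "?p (?p x) = x" "?p x \<in> ?L \<longleftrightarrow> x \<notin> ?L" if "x \<in> ?W" for x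
      using low[OF that] up[OF that] by blast+
    have sq1: "(- y) * (- y) = y * y" for y :: 'f by simp
    show "inc (?p a) a * inc (?p a) a = (1::'f)" if a: "a \<in> ?W" "a \<in> ?L" for a
      using struct[OF a]
    proof (elim disjE exE conjE)
      assume "a = og" "?p a = (?N, {g0})"
      then show ?thesis by (simp add: inc_def og_def)
    next
      fix \<sigma> assume b: "a = (?N, \<sigma>)" "a \<in> cells" "g0 \<notin> \<sigma>" "?p a = (?N, insert g0 \<sigma>)"
      have "inc (?N, insert g0 \<sigma>) (?N, insert g0 \<sigma> - {g0}) = (sg g0 (insert g0 \<sigma>) :: 'f)"
        using b cellsD(2,4)[of ?N \<sigma>] g0 by (intro inc_top) auto
      then show ?thesis unfolding b(4) unfolding b(1) using b(3) by (simp add: sg_sq)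
    next
      fix u \<sigma> v assume b: "a = (u, \<sigma>)" "a \<in> cells" "isfirst ?N v (u, \<sigma>)" "v \<notin> \<sigma>" "?p a = (add_mset v u, insert v \<sigma>)"
      have "inc (add_mset v u, insert v \<sigma>) (add_mset v u - {#v#}, insert v \<sigma> - {v}) = (- sg v (insert v \<sigma>) :: 'f)"
        using b cellsD(2,4)[of u \<sigma>] by (intro inc_bottom) (auto simp: isfirst_def)
      then show ?thesis unfolding b(5) unfolding b(1) using b(4) by (simp add: sg_sq)
    qed
    fix a b assume a: "a \<in> ?W" "a \<in> ?L" and b: "b \<in> ?W" "b \<in> ?L" "b \<noteq> a" and nz: "inc (?p a) b \<noteq> (0::'f)"
    show "size ?N - size (fst b) < size ?N - size (fst a)"
      using struct[OF a]
    proof (elim disjE exE conjE)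
      assume c: "a = og" "?p a = (?N, {g0})"
      then have "snd b \<noteq> {}" using b snd_og by blast
      from inc_nz[OF nz this] have "snd b \<subseteq> {g0} - {g0}" unfolding c(2) by auto
      then show ?thesis using \<open>snd b \<noteq> {}\<close> by simp
    next
      fix \<sigma> assume c: "a = (?N, \<sigma>)" "a \<in> cells" "\<sigma> \<inter> {..<s} = {}" "g0 \<notin> \<sigma>" "?p a = (?N, insert g0 \<sigma>)"
      have ac: "(?N, \<sigma>) \<in> cells" using c by simp
      have "b \<noteq> og"
      proof
        assume "b = og"
        then have "card (insert g0 \<sigma>) = 1" using nz unfolding c(5) by (simp add: inc_def og_def split: if_splits)
        then show False using c(4) cellsD(2,4)[OF ac] by simp
      qed
      then have bc: "b \<in> cells" "snd b \<noteq> {}" using b(1) snd_og by (auto simp: K_def)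
      from inc_nz[OF nz bc(2)] obtain v where v: "v \<in> insert g0 \<sigma>" "snd b = insert g0 \<sigma> - {v}"
        "fst b = ?N \<or> (v < s \<and> fst b = ?N - {#v#})" unfolding c(5) by auto
      have "\<not> v < s" using v(1) c(3) g0 by auto
      then have fb: "fst b = ?N" using v(3) by blast
      show ?thesis
      proof (cases "v = g0")
        case True
        then have "b = a" using v(2) fb c(1,4) by (simp add: prod_eq_iff)
        then show ?thesis using b(3) by simp
      next
        case False
        then have g: "g0 \<in> snd b" using v(2) by simp
        have "snd b \<inter> {..<s} = {}" using v(2) c(3) g0 by auto
        then have "b \<notin> ?L" using none_mem[of "snd b"] bc(1) fb g by (metis prod.collapse)
        then show ?thesis using b(2) by simp
      qed
    next
      fix u \<sigma> v assume c: "a = (u, \<sigma>)" "a \<in> cells" "isfirst ?N v (u, \<sigma>)" "v \<notin> \<sigma>" "?p a = (add_mset v u, insert v \<sigma>)"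
      have ac: "(u, \<sigma>) \<in> cells" using c by simp
      have vs: "v < s" "count u v < count ?N v" using c(3,4) by (auto simp: isfirst_def)
      have uN: "u \<subseteq># ?N" using Wd[OF a(1)[unfolded c(1)] og_ne[OF ac]] by blast
      have "b \<noteq> og"
      proof
        assume "b = og"
        then have "card (insert v \<sigma>) = 1" using nz unfolding c(5) by (simp add: inc_def og_def split: if_splits)
        then show False using c(4) cellsD(2,4)[OF ac] by simp
      qed
      then have bc: "b \<in> cells" "snd b \<noteq> {}" using b(1) snd_og by (auto simp: K_def)
      from inc_nz[OF nz bc(2)] obtain w where w: "w \<in> insert v \<sigma>" "snd b = insert v \<sigma> - {w}"
        "fst b = add_mset v u \<or> (w < s \<and> fst b = add_mset v u - {#w#})" unfolding c(5) by auto
      show ?thesis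
      proof (cases "w = v")
        case True
        have sb: "snd b = \<sigma>" using w(2) True c(4) by simp
        have "fst b = add_mset v u"
        proof (rule ccontr)
          assume "fst b \<noteq> add_mset v u"
          then have "fst b = u" using w(3) True by simp
          then show False using b(3) sb c(1) by (simp add: prod_eq_iff)
        qed
        moreover have "size u < size ?N"
        proof -
          have "u \<noteq> ?N" using vs(2) by (metis less_irrefl)
          then have "u \<subset># ?N" using uN by (simp add: subset_mset.less_le)
          then show ?thesis by (rule mset_subset_size)
        qed
        ultimately show ?thesis by (simp add: c(1))
      next
        case False
        then have vb: "v \<in> snd b" using w(2) by simp
        \<comment> \<open>Below the pivot the cell has no directions. Passing to the bottom face
          along a later \<open>w\<close> thus changes nothing that decides whether \<open>v\<close>
          is the pivot.\<close>
        have wv: "v < w" if "w < s" using that w(1) False c(3) unfolding isfirst_def by (metis insertE linorder_neqE_nat snd_conv)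
        have "isfirst ?N v b" unfolding isfirst_def
        proof (intro conjI allI impI)
          fix x assume x: "x < v"
          then have o: "x \<notin> \<sigma> \<and> \<not> count u x < count ?N x" using c(3) by (simp add: isfirst_def)
          then show "x \<notin> snd b" using w(2) x by auto
          show "\<not> count (fst b) x < count ?N x" using w(3) wv o x by auto
        qed (use vs vb in auto)
        then have "b \<notin> ?L" using first_mem[of v "fst b" "snd b"] bc(1) vb by simp
        then show ?thesis using b(2) by simp
      qed
    qed
  qed
qed

theorem labelled: "labelled_complex n K dm (inc :: _ \<Rightarrow> _ \<Rightarrow> 'f::comm_ring_1) lab og"
proof
  show "finite K" by (rule finite_K)
  show "og \<in> K" by (simp add: K_def)
  show "dm x = 0 \<longleftrightarrow> x = og" if "x \<in> K" for x
    using that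
  proof (rule K_cases)
    fix u \<sigma> assume x: "x = (u, \<sigma>)" "(u, \<sigma>) \<in> cells"
    then have "x \<noteq> og" using og_cells by auto
    moreover have "card \<sigma> \<noteq> 0" using cellsD(2,4)[OF x(2)] by simp
    ultimately show ?thesis by (simp add: x(1) dm_def)
  qed (simp add: dm_def og_def)
  show "lab og = {#}" by (rule lab_og)
  show "set_mset (lab x) \<subseteq> {..<n}" if "x \<in> K" for x
    using that
  proof (rule K_cases)
    fix u \<sigma> assume x: "x = (u, \<sigma>)" "(u, \<sigma>) \<in> cells"
    show ?thesis using cellsD(5)[OF x(2)] xlab_vars[of \<sigma>] finite_xlab[of \<sigma>] sn unfolding x(1) lab_def by auto
  qed (simp add: lab_og)
  show "dm a = Suc (dm b) \<and> lab b \<subseteq># lab a" if "a \<in> K" "b \<in> K" "inc a b \<noteq> (0::'f)" for a b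
    using inc_grade[OF that] by simp
  show "inc a og = (1::'f)" if "a \<in> K" "dm a = 1" for a using that by (simp add: inc_def og_def dm_def)
  show "(\<Sum>x\<in>K. inc a x * inc x b) = (0::'f)" if "a \<in> K" "b \<in> K" for a b by (rule inc_sq[OF that])
  fix \<nu> i and c :: "nat multiset \<times> nat set \<Rightarrow> 'f"
  assume c: "c \<in> chain_space {x\<in>K. lab x \<subseteq># \<nu>} dm (Suc i)" "bdry K inc c = (\<lambda>_. 0)"
  let ?W = "{x\<in>K. lab x \<subseteq># \<nu>}"
  interpret S: square_zero_complex K dm "inc :: _ \<Rightarrow> _ \<Rightarrow> 'f"
  proof
    show "finite K" by (rule finite_K)
    show "dm a = Suc (dm b)" if "a \<in> K" "b \<in> K" "inc a b \<noteq> (0::'f)" for a b using inc_grade(1)[OF that] .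
    show "(\<Sum>x\<in>K. inc a x * inc x b) = (0::'f)" if "a \<in> K" "b \<in> K" for a b by (rule inc_sq[OF that])
  qed
  have bs: "bdry ?W inc y = (bdry K inc y :: _ \<Rightarrow> 'f)" if "y \<in> chain_space ?W dm j" for y j
  proof (rule S.bdry_sub[OF _ _ that])
    fix a b assume a: "a \<in> ?W" and b: "b \<in> K - ?W"
    show "inc a b = (0::'f)"
    proof (rule ccontr)
      assume "inc a b \<noteq> (0::'f)"
      then have "lab b \<subseteq># lab a" using inc_grade(2)[of a b, where 'f = 'f] a b by blast
      then show False using a b by (auto intro: subset_mset.order_trans)
    qed
  qed auto
  show "\<exists>c'\<in>chain_space ?W dm (Suc (Suc i)). bdry K inc c' = c"
  \<comment> \<open>If no generator is present at the corner, monotonicity of \<open>P\<close> shows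
    that it is present nowhere below, and the strand consists of \<open>og\<close> alone.\<close>
  proof (cases "\<exists>g0. s \<le> g0 \<and> g0 < s + q \<and> P g0 (cap \<nu>) \<and> xl g0 \<subseteq> set_mset \<nu>")
    case True
    then obtain g0 where g0: "s \<le> g0" "g0 < s + q" "P g0 (cap \<nu>)" "xl g0 \<subseteq> set_mset \<nu>" by blast
    have "acyclic_cells ?W dm (inc :: _ \<Rightarrow> _ \<Rightarrow> 'f)"
      by (rule acyclic_matching.acyclic[OF strand_matching[OF g0]])
    moreover have "c \<in> cyc ?W dm inc (Suc i)" using c bs[OF c(1)] by (simp add: cyc_def)
    ultimately have "c \<in> bnd ?W dm inc (Suc i)" unfolding acyclic_cells_def by blast
    from bnd_E[OF this] obtain y where y: "y \<in> chain_space ?W dm (Suc (Suc i))" "c = bdry ?W inc y" .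
    show ?thesis by (rule bexI[OF _ y(1)]) (simp add: y(2) bs[OF y(1)])
  next
    case False
    have "x = og" if x: "x \<in> ?W" for x
    proof (rule ccontr)
      assume "x \<noteq> og"
      then obtain u \<sigma> where us: "x = (u, \<sigma>)" "(u, \<sigma>) \<in> cells" using x by (auto elim: K_cases)
      note d = cellsD[OF us(2)]
      have w: "u \<subseteq># cap \<nu>" "xlab \<sigma> \<subseteq> set_mset \<nu>" using lab_le_iff[OF us(2), of \<nu>] x us by auto
      obtain g where g: "g \<in> \<sigma>" "s \<le> g" using d(3) by auto
      have "base u \<sigma> \<subseteq># cap \<nu>" using w(1) unfolding base_def by (meson diff_subset_eq_self subset_mset.order_trans)
      then have "P g (cap \<nu>)" using P_mono[OF d(8)[OF g]] by blast
      moreover have "xl g \<subseteq> set_mset \<nu>" using w(2) g by (auto simp: xlab_def)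
      ultimately show False using False g d(1) by auto
    qed
    moreover have "dm og = 0" by (simp add: dm_def og_def)
    ultimately have "\<not> (x \<in> ?W \<and> dm x = Suc i)" for x by (metis nat.distinct(1))
    then have c0: "c = (\<lambda>_. 0)" using c(1) unfolding chain_space_iff by blast
    show ?thesis unfolding c0 by (rule bexI[of _ "\<lambda>_. 0"], rule bdry_zero, rule chains_zero)
  qed
qed

text \<open>Exponents of \<open>m\<close> are unbounded while those of cells stay within
  \<open>M\<close>; \<open>P_cap\<close> provides a bounded monomial below \<open>m\<close> at which
  the generator is already present.\<close>

lemma generators:
  assumes "set_mset m \<subseteq> {..<n}"
  shows "(\<exists>x\<in>K. dm x = 1 \<and> lab x \<subseteq># m) \<longleftrightarrow>
    (\<exists>g. s \<le> g \<and> g < s + q \<and> P g (filter_mset (\<lambda>v. v < s) m) \<and> xl g \<subseteq> set_mset m)"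
proof
  assume "\<exists>x\<in>K. dm x = 1 \<and> lab x \<subseteq># m"
  then obtain x where x: "x \<in> K" "dm x = 1" "lab x \<subseteq># m" by blast
  then have "x \<noteq> og" by (auto simp: dm_def og_def)
  then obtain u \<sigma> where us: "x = (u, \<sigma>)" "(u, \<sigma>) \<in> cells" using x(1) by (auto elim: K_cases)
  note d = cellsD[OF us(2)]
  obtain g where g: "g \<in> \<sigma>" "s \<le> g" using d(3) by auto
  have "u \<subseteq># filter_mset (\<lambda>v. v < s) m"
  proof (rule mset_subset_eqI)
    fix v
    have "count u v \<le> count m v" using mset_subset_eq_count[OF x(3), of v] by (simp add: us lab_def)
    moreover have "v < s" if "count u v \<noteq> 0"
    proof -
      have "v \<in># u" using that by (meson not_in_iff)
      then show ?thesis using d(5) by auto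
    qed
    ultimately show "count u v \<le> count (filter_mset (\<lambda>v. v < s) m) v" by (cases "v < s"; cases "count u v = 0") simp_all
  qed
  then have "base u \<sigma> \<subseteq># filter_mset (\<lambda>v. v < s) m" unfolding base_def by (meson diff_subset_eq_self subset_mset.order_trans)
  then have "P g (filter_mset (\<lambda>v. v < s) m)" using P_mono[OF d(8)[OF g]] by blast
  moreover have "xl g \<subseteq> set_mset m"
  proof
    fix v assume "v \<in> xl g"
    then have "v \<in> xlab \<sigma>" using g by (auto simp: xlab_def)
    then have "v \<in># lab x" using finite_xlab by (simp add: us lab_def)
    then show "v \<in># m" using x(3) by (rule mset_subset_eqD[rotated])
  qed
  ultimately show "\<exists>g. s \<le> g \<and> g < s + q \<and> P g (filter_mset (\<lambda>v. v < s) m) \<and> xl g \<subseteq> set_mset m" using g d(1) by auto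
next
  assume "\<exists>g. s \<le> g \<and> g < s + q \<and> P g (filter_mset (\<lambda>v. v < s) m) \<and> xl g \<subseteq> set_mset m"
  then obtain g where g: "s \<le> g" "g < s + q" "P g (filter_mset (\<lambda>v. v < s) m)" "xl g \<subseteq> set_mset m" by blast
  have "set_mset (filter_mset (\<lambda>v. v < s) m) \<subseteq> {..<s}" by auto
  from P_cap[OF this g(3)] obtain y where y: "y \<subseteq># filter_mset (\<lambda>v. v < s) m" "\<And>v. count y v \<le> M" "P g y" by blast
  have i: "{g} \<inter> {..<s} = {}" "{g} \<inter> {s..} = {g}" using g(1) by auto
  have ys: "set_mset y \<subseteq> {..<s}" using mset_subset_eqD[OF y(1)] by auto
  have c: "(y, {g}) \<in> cells" using y g ys i by (auto simp: cells_def base_def)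
  have "lab (y, {g}) \<subseteq># m"
  proof (rule mset_subset_eqI)
    fix v
    have "count y v \<le> count (filter_mset (\<lambda>v. v < s) m) v" using mset_subset_eq_count[OF y(1)] .
    moreover have "v \<in> xl g \<Longrightarrow> s \<le> v \<and> 1 \<le> count m v" using xl[of g] g(4) by (auto simp: Suc_le_eq)
    moreover have "count (mset_set (xl g)) v = (if v \<in> xl g then 1 else 0)" using finite_xl by simp
    moreover have "lab (y, {g}) = y + mset_set (xl g)" using i by (simp add: lab_def xlab_def)
    ultimately show "count (lab (y, {g})) v \<le> count m v" by (cases "v < s"; cases "v \<in> xl g") simp_all
  qed
  then show "\<exists>x\<in>K. dm x = 1 \<and> lab x \<subseteq># m" using c by (intro bexI[of _ "(y, {g})"]) (auto simp: dm_def K_def)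
qed

end

section \<open>Reduction for the powers of the ideal\<close>

text \<open>The six-vertex triangulation of the real projective plane: with indices modulo 5, the triangles
  are \<open>{i, i+1, 5}\<close> and \<open>{i, i+1, i+3}\<close>.\<close>

definition facets :: "nat set list" where
  "facets = [{0,1,5},{1,2,5},{2,3,5},{3,4,5},{4,0,5},{0,1,3},{1,2,4},{2,3,0},{3,4,1},{4,0,2}]"

definition face :: "nat set \<Rightarrow> bool" where
  "face T \<longleftrightarrow> (\<exists>f<10. T \<subseteq> facets ! f)"

lemma face_mono: "face T \<Longrightarrow> T' \<subseteq> T \<Longrightarrow> face T'"
  unfolding face_def by blast

lemma face_empty: "face {}"
  unfolding face_def by (intro exI[of _ 0]) auto

text \<open>The surface has no boundary: the edge opposite to \<open>g\<close> in a triangle belongs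
  to a second triangle, and that one misses \<open>g\<close>.\<close>

lemma other_facet_aux:
  "\<forall>f\<in>{..<10}. \<forall>g\<in>facets ! f. \<exists>f'\<in>{..<10}. facets ! f - {g} \<subseteq> facets ! f' \<and> g \<notin> facets ! f'"
  by code_simp

lemma other_facet:
  assumes "face T" "g \<notin> T"
  shows "\<exists>f<10. T \<subseteq> facets ! f \<and> g \<notin> facets ! f"
proof -
  obtain f where f: "f < 10" "T \<subseteq> facets ! f" using assms(1) unfolding face_def by blast
  show ?thesis
  proof (cases "g \<in> facets ! f")
    case True
    from other_facet_aux f(1) True obtain f' where f': "f' < 10" "facets ! f - {g} \<subseteq> facets ! f'" "g \<notin> facets ! f'" by blast
    then show ?thesis using f(2) assms(2) by blast
  qed (use f in blast)
qed

definition toggle :: "nat \<Rightarrow> nat set \<Rightarrow> nat set" where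
  "toggle v \<sigma> = (if v \<in> \<sigma> then \<sigma> - {v} else insert v \<sigma>)"

lemma card_insert_le_Suc: "card (insert x A) \<le> Suc (card A)"
  by (cases "finite A") (simp_all add: card_insert_if)

lemma toggle_toggle: "toggle v (toggle v \<sigma>) = \<sigma>" by (auto simp: toggle_def)
lemma mem_toggle: "w \<in> toggle v \<sigma> \<longleftrightarrow> (if w = v then v \<notin> \<sigma> else w \<in> \<sigma>)" by (auto simp: toggle_def)

text \<open>The generators \<open>s, \<dots>, s + 5\<close> carry the labels \<open>m\<^sub>v\<close>. The generator \<open>s + 6\<close> has label 1: it is present where
  the \<open>z\<close>-part alone lies in the power of the ideal.\<close>

locale rp2_power =
  fixes s h :: nat
  assumes s2: "2 \<le> s" and h1: "1 \<le> h"
begin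

text \<open>The largest \<open>j\<close> such that \<open>y\<close> lies in the \<open>j\<close>-th
  power of the ideal generated by the squares of the variables below \<open>s\<close>.\<close>

definition half_size :: "nat multiset \<Rightarrow> nat" where "half_size y = (\<Sum>i<s. count y i div 2)"
definition PA :: "nat multiset \<Rightarrow> bool" where "PA y \<longleftrightarrow> h \<le> half_size y"
text \<open>Membership in \<open>A^h + z_0 z_1 A^(h-1)\<close>. Dividing by \<open>z_0 z_1\<close>
  costs no square exactly if both exponents are odd; otherwise a member of the second summand
  already has \<open>h\<close> squares and satisfies \<open>PA\<close>.\<close>

definition PC :: "nat multiset \<Rightarrow> bool" where
  "PC y \<longleftrightarrow> PA y \<or> (odd (count y 0) \<and> odd (count y 1) \<and> h \<le> Suc (half_size y))"
definition gen_pred :: "nat \<Rightarrow> nat multiset \<Rightarrow> bool" where "gen_pred g y = (if g = s + 6 then PA y else PC y)"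
definition xl :: "nat \<Rightarrow> nat set" where
  "xl g = {x. \<exists>f<10. x = s + f \<and> (\<exists>g'<6. g = s + g' \<and> g' \<notin> facets ! f)}"

lemma half_size_mono: "y \<subseteq># y' \<Longrightarrow> half_size y \<le> half_size y'"
  unfolding half_size_def by (intro sum_mono div_le_mono mset_subset_eq_count)

lemma half_size_strict: "y \<subseteq># y' \<Longrightarrow> i < s \<Longrightarrow> odd (count y i) \<Longrightarrow> even (count y' i) \<Longrightarrow> half_size y < half_size y'"
proof -
  assume a: "y \<subseteq># y'" "i < s" "odd (count y i)" "even (count y' i)"
  have "count y i \<le> count y' i" using a(1) by (rule mset_subset_eq_count)
  then have "count y i div 2 < count y' i div 2" using a(3,4) by (elim oddE evenE) simp
  then show ?thesis unfolding half_size_def using a(1,2)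
    by (intro sum_strict_mono_ex1) (auto intro!: div_le_mono mset_subset_eq_count)
qed

text \<open>If a multiple spoils the parity of the exponent of 0 or 1, it completes a square there,
  and \<open>half_size\<close> grows by the one that was missing for \<open>PA\<close>.\<close>

lemma PC_mono: "PC y \<Longrightarrow> y \<subseteq># y' \<Longrightarrow> PC y'"
proof -
  assume a: "PC y" "y \<subseteq># y'"
  show ?thesis
  proof (cases "PA y")
    case True
    then show ?thesis using half_size_mono[OF a(2)] by (simp add: PC_def PA_def)
  next
    case False
    then have b: "odd (count y 0)" "odd (count y 1)" "h \<le> Suc (half_size y)" using a(1) by (auto simp: PC_def)
    show ?thesis
    proof (cases "odd (count y' 0) \<and> odd (count y' 1)")
      case True
      then show ?thesis using b(3) half_size_mono[OF a(2)] by (simp add: PC_def)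
    next
      case False
      then have "half_size y < half_size y'" using half_size_strict[OF a(2), of 0] half_size_strict[OF a(2), of 1] b s2 by auto
      then show ?thesis using b(3) by (simp add: PC_def PA_def)
    qed
  qed
qed

text \<open>At \<open>2 * h\<close> a power of a single variable lies in the \<open>h\<close>-th
  power of the ideal. The additional 2 leaves room for the exponents of the top corners
  \<open>phi \<tau> y\<close>.\<close>

definition box :: nat where "box = 2 * h + 2"

sublocale hybrid_complex s 7 "s + 10" box gen_pred xl
proof
  show "s \<le> s + 10" by simp
  show "xl g \<subseteq> {s..<s + 10}" for g by (auto simp: xl_def)
  show "gen_pred g y'" if "gen_pred g y" "y \<subseteq># y'" for g y y'
    using that PC_mono[of y y'] half_size_mono[of y y'] by (auto simp: gen_pred_def PA_def split: if_splits)
  show "\<exists>y'. y' \<subseteq># y \<and> (\<forall>v. count y' v \<le> box) \<and> gen_pred g y'" if y: "set_mset y \<subseteq> {..<s}" "gen_pred g y" for g y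
  proof (cases "\<forall>v. count y v \<le> box")
    case True
    then show ?thesis using y by blast
  next
    case False
    then obtain i where i: "box < count y i" by (auto simp: not_le)
    then have "i \<in># y" by (metis not_in_iff not_less_zero)
    then have i_s: "i < s" using y(1) by auto
    \<comment> \<open>One exponent beyond the bound is enough: the power \<open>2 * h\<close> of
      that variable divides \<open>y\<close> and satisfies every predicate.\<close>
    let ?y = "replicate_mset (2 * h) i"
    have "?y \<subseteq># y" using i by (simp add: box_def count_le_replicate_mset_subset_eq[symmetric])
    moreover have "count ?y v \<le> box" for v by (simp add: box_def)
    moreover have "half_size ?y = h"
    proof -
      have "half_size ?y = (\<Sum>j<s. if j = i then h else 0)" unfolding half_size_def by (intro sum.cong) auto
      then show ?thesis using i_s by simp
    qed
    then have "gen_pred g ?y" by (simp add: gen_pred_def PC_def PA_def)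
    ultimately show ?thesis by blast
  qed
qed

text \<open>The number of squares lost on the way from the top corner to the bottom corner: lowering
  an exponent by one lowers its half precisely if the exponent is even.\<close>

definition even_card :: "nat multiset \<Rightarrow> nat set \<Rightarrow> nat" where
  "even_card u \<sigma> = card {i\<in>\<sigma>. i < s \<and> even (count u i)}"
definition verts :: "nat set \<Rightarrow> nat set" where "verts \<sigma> = {g. g < 6 \<and> s + g \<in> \<sigma>}"
text \<open>\<open>PA\<close> at the bottom corner, expressed by data at the top corner. This is
  convenient because the reduced boundary fixes the top corner and changes only the directions;
  \<open>QC\<close> does the same for \<open>PC\<close>.\<close>

definition QA :: "nat multiset \<Rightarrow> nat set \<Rightarrow> bool" where "QA u \<sigma> \<longleftrightarrow> h + even_card u \<sigma> \<le> half_size u"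
definition QC :: "nat multiset \<Rightarrow> nat set \<Rightarrow> bool" where
  "QC u \<sigma> \<longleftrightarrow> QA u \<sigma> \<or> (odd (count u 0) \<noteq> (0 \<in> \<sigma>) \<and> odd (count u 1) \<noteq> (1 \<in> \<sigma>) \<and> h + even_card u \<sigma> \<le> Suc (half_size u))"

lemma fin_even_card: "finite {i\<in>\<sigma>. i < s \<and> even (count u i)}"
  by (rule finite_subset[of _ "{..<s}"]) auto

lemma even_card_mono: "\<sigma>' \<subseteq> \<sigma> \<Longrightarrow> even_card u \<sigma>' \<le> even_card u \<sigma>"
  unfolding even_card_def by (rule card_mono[OF fin_even_card]) auto

lemma even_card_toggle: "s \<le> v \<or> odd (count u v) \<Longrightarrow> even_card u (toggle v \<sigma>) = even_card u \<sigma>"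
  unfolding even_card_def by (rule arg_cong[where f = card]) (auto simp: mem_toggle)

lemma count_base: "finite \<sigma> \<Longrightarrow> count (base u \<sigma>) i = count u i - (if i \<in> \<sigma> \<and> i < s then 1 else 0)"
  by (simp add: base_def)

lemma half_size_base:
  assumes "finite \<sigma>" "\<sigma> \<inter> {..<s} \<subseteq> set_mset u"
  shows "half_size (base u \<sigma>) + even_card u \<sigma> = half_size u"
proof -
  have "even_card u \<sigma> = (\<Sum>i<s. if i \<in> \<sigma> \<and> even (count u i) then 1 else 0)"
  proof -
    have "{i\<in>\<sigma>. i < s \<and> even (count u i)} = {i\<in>{..<s}. i \<in> \<sigma> \<and> even (count u i)}" by auto
    then show ?thesis unfolding even_card_def by (simp only: card_eq_sum sum.inter_filter[OF finite_lessThan])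
  qed
  then have "half_size (base u \<sigma>) + even_card u \<sigma> = (\<Sum>i<s. count (base u \<sigma>) i div 2 + (if i \<in> \<sigma> \<and> even (count u i) then 1 else 0))"
    by (simp add: half_size_def sum.distrib)
  also have "\<dots> = half_size u" unfolding half_size_def
  proof (rule sum.cong[OF refl])
    fix i assume i: "i \<in> {..<s}"
    show "count (base u \<sigma>) i div 2 + (if i \<in> \<sigma> \<and> even (count u i) then 1 else 0) = count u i div 2"
    proof (cases "i \<in> \<sigma>")
      case True
      then have "i \<in># u" using assms(2) i by auto
      then obtain m where m: "count u i = Suc m" by (metis not0_implies_Suc not_in_iff)
      show ?thesis
      proof (cases "even (count u i)")
        case True
        then obtain k where k: "count u i = 2 * k" by (elim evenE)
        then obtain k' where "k = Suc k'" using m by (cases k) auto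
        then show ?thesis using k \<open>i \<in> \<sigma>\<close> i assms(1) by (simp add: count_base)
      next
        case False
        then obtain k where "count u i = 2 * k + 1" by (elim oddE)
        then show ?thesis using \<open>i \<in> \<sigma>\<close> i assms(1) by (simp add: count_base)
      qed
    qed (use assms(1) in \<open>simp add: count_base\<close>)
  qed
  finally show ?thesis .
qed

lemma PA_base: "finite \<sigma> \<Longrightarrow> \<sigma> \<inter> {..<s} \<subseteq> set_mset u \<Longrightarrow> PA (base u \<sigma>) \<longleftrightarrow> QA u \<sigma>"
  using half_size_base[of \<sigma> u] by (auto simp: PA_def QA_def)

lemma odd_base: "finite \<sigma> \<Longrightarrow> \<sigma> \<inter> {..<s} \<subseteq> set_mset u \<Longrightarrow> i < s \<Longrightarrow> odd (count (base u \<sigma>) i) \<longleftrightarrow> odd (count u i) \<noteq> (i \<in> \<sigma>)"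
proof -
  assume a: "finite \<sigma>" "\<sigma> \<inter> {..<s} \<subseteq> set_mset u" "i < s"
  show ?thesis
  proof (cases "i \<in> \<sigma>")
    case True
    then have "i \<in># u" using a by auto
    then have "0 < count u i" by simp
    then show ?thesis using a True by (simp add: count_base)
  qed (use a in \<open>simp add: count_base\<close>)
qed

lemma PC_base: "finite \<sigma> \<Longrightarrow> \<sigma> \<inter> {..<s} \<subseteq> set_mset u \<Longrightarrow> PC (base u \<sigma>) \<longleftrightarrow> QC u \<sigma>"
  using half_size_base[of \<sigma> u] odd_base[of \<sigma> u 0] odd_base[of \<sigma> u 1] s2 PA_base[of \<sigma> u]
  by (auto simp: PC_def QC_def)

lemma cells_iff:
  "(u, \<sigma>) \<in> cells \<longleftrightarrow> \<sigma> \<subseteq> {..<s+7} \<and> \<sigma> \<inter> {s..} \<noteq> {} \<and> set_mset u \<subseteq> {..<s} \<and> (\<forall>v. count u v \<le> box) \<and>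
     \<sigma> \<inter> {..<s} \<subseteq> set_mset u \<and> (s + 6 \<in> \<sigma> \<longrightarrow> QA u \<sigma>) \<and> (verts \<sigma> \<noteq> {} \<longrightarrow> QC u \<sigma>)"
proof (cases "\<sigma> \<subseteq> {..<s+7}")
  case True
  then have f: "finite \<sigma>" using finite_subset by blast
  have m: "mset_set (\<sigma> \<inter> {..<s}) \<subseteq># u \<longleftrightarrow> \<sigma> \<inter> {..<s} \<subseteq> set_mset u"
  proof
    assume "mset_set (\<sigma> \<inter> {..<s}) \<subseteq># u"
    then show "\<sigma> \<inter> {..<s} \<subseteq> set_mset u" using set_mset_mono f by fastforce
  next
    assume a: "\<sigma> \<inter> {..<s} \<subseteq> set_mset u"
    show "mset_set (\<sigma> \<inter> {..<s}) \<subseteq># u"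
    proof (rule mset_subset_eqI)
      fix v
      have "v \<in> \<sigma> \<inter> {..<s} \<Longrightarrow> 0 < count u v" using a by auto
      then show "count (mset_set (\<sigma> \<inter> {..<s})) v \<le> count u v" using f by (cases "v \<in> \<sigma> \<inter> {..<s}") (auto simp: Suc_le_eq)
    qed
  qed
  have g: "(\<forall>g\<in>\<sigma> \<inter> {s..}. gen_pred g (base u \<sigma>)) \<longleftrightarrow> (s + 6 \<in> \<sigma> \<longrightarrow> QA u \<sigma>) \<and> (verts \<sigma> \<noteq> {} \<longrightarrow> QC u \<sigma>)"
    if a: "\<sigma> \<inter> {..<s} \<subseteq> set_mset u"
  proof -
    have "(\<forall>g\<in>\<sigma> \<inter> {s..}. gen_pred g (base u \<sigma>)) \<longleftrightarrow> (\<forall>g<7. s + g \<in> \<sigma> \<longrightarrow> gen_pred (s + g) (base u \<sigma>))"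
    proof (intro iffI allI impI ballI)
      fix x assume A: "\<forall>g<7. s + g \<in> \<sigma> \<longrightarrow> gen_pred (s + g) (base u \<sigma>)" and x: "x \<in> \<sigma> \<inter> {s..}"
      then have "s + (x - s) = x" "x - s < 7" using True by auto
      then show "gen_pred x (base u \<sigma>)" using A x by fastforce
    qed auto
    also have "\<dots> \<longleftrightarrow> (s + 6 \<in> \<sigma> \<longrightarrow> PA (base u \<sigma>)) \<and> (\<forall>g<6. s + g \<in> \<sigma> \<longrightarrow> PC (base u \<sigma>))"
    proof -
      have "g < 7 \<longleftrightarrow> g < 6 \<or> g = 6" for g :: nat by auto
      then show ?thesis by (auto simp: gen_pred_def)
    qed
    finally show ?thesis using PA_base[OF f a] PC_base[OF f a] by (auto simp: verts_def)
  qed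
  show ?thesis unfolding cells_def using m g by auto
qed (auto simp: cells_def)

lemma xlab_eq: "xlab \<sigma> = {x. \<exists>f<10. x = s + f \<and> \<not> verts \<sigma> \<subseteq> facets ! f}"
  unfolding xlab_def xl_def verts_def by auto

lemma xlab_iff: "s + f \<in> xlab \<sigma> \<longleftrightarrow> f < 10 \<and> \<not> verts \<sigma> \<subseteq> facets ! f"
  by (auto simp: xlab_eq)

lemma verts_remove: "verts (\<sigma> - {s + g}) = verts \<sigma> - {g}" "v < s \<Longrightarrow> verts (\<sigma> - {v}) = verts \<sigma>" "verts (\<sigma> - {s + 6}) = verts \<sigma>"
  by (auto simp: verts_def)

lemma verts_toggle: "v < s \<Longrightarrow> verts (toggle v \<sigma>) = verts \<sigma>" "verts (toggle (s + 6) \<sigma>) = verts \<sigma>"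
  by (auto simp: verts_def mem_toggle)

lemma xlab_cong: "verts \<sigma> = verts \<sigma>' \<Longrightarrow> xlab \<sigma> = xlab \<sigma>'"
  by (simp add: xlab_eq)

text \<open>The label of a vertex set consists of the triangles not containing it. Over a nonface it
  is the set of all triangles, before and after the deletion. If a face is left, a triangle that
  contains it and misses \<open>g\<close> leaves the label, and it exists because the surface is
  closed.\<close>

lemma xlab_remove:
  assumes "g \<in> verts \<sigma>" shows "xlab (\<sigma> - {s + g}) = xlab \<sigma> \<longleftrightarrow> \<not> face (verts \<sigma> - {g})"
proof
  assume e: "xlab (\<sigma> - {s + g}) = xlab \<sigma>"
  show "\<not> face (verts \<sigma> - {g})"
  proof
    assume "face (verts \<sigma> - {g})"
    from other_facet[OF this, of g] obtain f where f: "f < 10" "verts \<sigma> - {g} \<subseteq> facets ! f" "g \<notin> facets ! f" by blast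
    have "s + f \<notin> xlab (\<sigma> - {s + g})" using f by (simp add: xlab_iff verts_remove)
    moreover have "s + f \<in> xlab \<sigma>" using f assms by (auto simp: xlab_iff)
    ultimately show False using e by simp
  qed
next
  assume n: "\<not> face (verts \<sigma> - {g})"
  then have "\<not> verts \<sigma> - {g} \<subseteq> facets ! f" "\<not> verts \<sigma> \<subseteq> facets ! f" if "f < 10" for f
    using that unfolding face_def by blast+
  then show "xlab (\<sigma> - {s + g}) = xlab \<sigma>" unfolding xlab_eq verts_remove by auto
qed

section \<open>The complex after tensoring, and its two matchings\<close>

definition red_inc :: "nat multiset \<times> nat set \<Rightarrow> nat multiset \<times> nat set \<Rightarrow> 'f::comm_ring_1" where
  "red_inc a b = (if lab a = lab b then inc a b else 0)"

lemma lab_eq: "(u, \<sigma>) \<in> cells \<Longrightarrow> (u', \<sigma>') \<in> cells \<Longrightarrow> lab (u, \<sigma>) = lab (u', \<sigma>') \<longleftrightarrow> u = u' \<and> xlab \<sigma> = xlab \<sigma>'"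
proof -
  assume c: "(u, \<sigma>) \<in> cells" "(u', \<sigma>') \<in> cells"
  have z: "count u v = 0" if "s \<le> v" "(u, \<sigma>) \<in> cells" for u \<sigma> v
    using cellsD(5)[OF that(2)] that(1) by (meson lessThan_iff not_in_iff not_less subsetD)
  have x: "v \<notin> xlab \<sigma>" if "v < s" for v \<sigma> using xlab_vars[of \<sigma>] that by auto
  show ?thesis
  proof
    assume e: "lab (u, \<sigma>) = lab (u', \<sigma>')"
    have k: "count u v + (if v \<in> xlab \<sigma> then 1 else 0) = count u' v + (if v \<in> xlab \<sigma>' then 1 else 0)" for v
    proof -
      have "count u v + count (mset_set (xlab \<sigma>)) v = count u' v + count (mset_set (xlab \<sigma>')) v"
        using arg_cong[OF e, of "\<lambda>m. count m v"] by (simp add: lab_def)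
      then show ?thesis unfolding count_mset_set' by (simp add: finite_xlab)
    qed
    have "count u v = count u' v" for v using k[of v] x[of v] z[of v] c by (cases "v < s") auto
    moreover from this have "v \<in> xlab \<sigma> \<longleftrightarrow> v \<in> xlab \<sigma>'" for v using k[of v] by (auto split: if_splits)
    ultimately show "u = u' \<and> xlab \<sigma> = xlab \<sigma>'" by (auto intro: multiset_eqI)
  qed (simp add: lab_def)
qed

text \<open>A bottom face has a smaller top corner and so a different label; only top faces and
  deletions of generators survive.\<close>

lemma red_inc_nz:
  assumes "(u, \<sigma>) \<in> cells" "b \<in> cells" "red_inc (u, \<sigma>) b \<noteq> (0::'f::comm_ring_1)"
  obtains v where "v \<in> \<sigma>" "b = (u, \<sigma> - {v})" "xlab (\<sigma> - {v}) = xlab \<sigma>"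
proof -
  obtain u' \<sigma>' where b: "b = (u', \<sigma>')" by (cases b)
  have i: "inc (u, \<sigma>) b \<noteq> (0::'f)" "lab (u, \<sigma>) = lab b" using assms(3) by (auto simp: red_inc_def split: if_splits)
  then have e: "u = u'" "xlab \<sigma> = xlab \<sigma>'" using lab_eq[OF assms(1), of u' \<sigma>'] assms(2) b by auto
  have "snd b \<noteq> {}" using cellsD(4) assms(2) b by auto
  from inc_nz[OF i(1) this] obtain v where "v \<in> \<sigma>" "\<sigma>' = \<sigma> - {v}" unfolding b by auto
  then show thesis using that[of v] e b by simp
qed

lemma red_inc_val:
  assumes "(u, \<sigma>) \<in> cells" "(u, \<sigma> - {v}) \<in> cells" "v \<in> \<sigma>"
  shows "red_inc (u, \<sigma>) (u, \<sigma> - {v}) = (if xlab (\<sigma> - {v}) = xlab \<sigma> then sg v \<sigma> else (0::'f::comm_ring_1))"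
  using lab_eq[OF assms(1,2)] inc_top[of v \<sigma> u, where 'f = 'f] cellsD(2,9)[OF assms(1)] cellsD(4)[OF assms(2)] assms(3)
  by (auto simp: red_inc_def)

lemma red_inc_grade: "a \<in> cells \<Longrightarrow> b \<in> cells \<Longrightarrow> red_inc a b \<noteq> (0::'f::comm_ring_1) \<Longrightarrow> dm a = Suc (dm b)"
  using inc_grade(1)[of a b, where 'f = 'f] by (simp add: red_inc_def K_def split: if_splits)

lemma finite_cells: "finite cells" using finite_K by (simp add: K_def)

text \<open>Labels decrease along incidences, so between two cells with equal labels every
  intermediate cell has that label too, and the relation is inherited from
  \<open>inc_sq\<close>.\<close>

lemma red_inc_sq:
  assumes "a \<in> cells" "b \<in> cells"
  shows "(\<Sum>x\<in>cells. red_inc a x * red_inc x b) = (0::'f::comm_ring_1)"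
proof (cases "lab a = lab b")
  case True
  have K: "a \<in> K" "b \<in> K" using assms by (auto simp: K_def)
  have og0: "inc og b = (0::'f)" by (simp add: inc_def og_def)
  have "red_inc a x * red_inc x b = (inc a x * inc x b :: 'f)" if x: "x \<in> cells" for x
  proof (cases "inc a x = (0::'f) \<or> inc x b = (0::'f)")
    case False
    have "x \<in> K" using x by (simp add: K_def)
    then have "lab x \<subseteq># lab a" "lab b \<subseteq># lab x"
      using inc_grade(2)[of a x, where 'f = 'f] inc_grade(2)[of x b, where 'f = 'f] K False by auto
    then have "lab x = lab a" using True by (metis subset_mset.antisym)
    then show ?thesis using True by (simp add: red_inc_def)
  qed (auto simp: red_inc_def)
  then have "(\<Sum>x\<in>cells. red_inc a x * red_inc x b) = (\<Sum>x\<in>cells. inc a x * inc x b :: 'f)" by (rule sum.cong[OF refl])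
  also have "\<dots> = (\<Sum>x\<in>K. inc a x * inc x b)" unfolding K_def using finite_cells og_cells og0 by simp
  also have "\<dots> = 0" by (rule inc_sq[OF K])
  finally show ?thesis .
next
  case False
  then have "red_inc a x * red_inc x b = (0::'f)" for x by (auto simp: red_inc_def)
  then show ?thesis by simp
qed

text \<open>The first part is closed under taking boundaries and is matched by toggling \<open>match_vertex\<close>; the
  second spans a quotient and is matched by toggling \<open>s + 5\<close>.\<close>

definition sub_matched :: "(nat multiset \<times> nat set) set" where
  "sub_matched = {x. x \<in> cells \<and> (case x of (u, \<sigma>) \<Rightarrow>
     (if QA u \<sigma> then verts \<sigma> \<noteq> {} \<or> (\<exists>i<s. odd (count u i)) \<or> card (\<sigma> \<inter> {..<s} - {LEAST i. i \<in># u}) + h < half_size u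
      else \<exists>i<s. 2 \<le> i \<and> odd (count u i)))}"

definition quot_matched :: "(nat multiset \<times> nat set) set" where
  "quot_matched = {x. x \<in> cells \<and> (case x of (u, \<sigma>) \<Rightarrow>
     \<not> QA u \<sigma> \<and> (\<forall>i<s. 2 \<le> i \<longrightarrow> even (count u i)) \<and> \<not> face (verts \<sigma> - {5}))}"

definition crit :: "(nat multiset \<times> nat set) set" where "crit = cells - sub_matched - quot_matched"

text \<open>Under \<open>QA\<close> the generator \<open>s + 6\<close> cones off every cell that has
  a vertex. Without vertices an odd exponent may be toggled, as this changes no half; if all
  exponents are even, the least variable may be toggled as long as a square is to spare. Without
  \<open>QA\<close> the parities at 0 and 1 matter for \<open>QC\<close>, so only an odd exponent
  from 2 on is toggled.\<close>

definition match_vertex :: "nat multiset \<times> nat set \<Rightarrow> nat" where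
  "match_vertex x = (case x of (u, \<sigma>) \<Rightarrow> if QA u \<sigma> then (if verts \<sigma> \<noteq> {} then s + 6
      else if \<exists>i<s. odd (count u i) then LEAST i. i < s \<and> odd (count u i) else LEAST i. i \<in># u)
    else LEAST i. i < s \<and> 2 \<le> i \<and> odd (count u i))"

lemma match_vertex_cong:
  assumes "QA u \<sigma> \<longleftrightarrow> QA u \<sigma>'" "QA u \<sigma> \<Longrightarrow> verts \<sigma> = {} \<longleftrightarrow> verts \<sigma>' = {}"
  shows "match_vertex (u, \<sigma>) = match_vertex (u, \<sigma>')"
  using assms by (cases "QA u \<sigma>"; cases "verts \<sigma> = {}") (simp_all add: match_vertex_def)

lemma verts_empty: "(u, \<sigma>) \<in> cells \<Longrightarrow> verts \<sigma> = {} \<Longrightarrow> \<sigma> \<inter> {s..} = {s + 6} \<and> QA u \<sigma>"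
proof -
  assume c: "(u, \<sigma>) \<in> cells" and e: "verts \<sigma> = {}"
  have sub: "\<sigma> \<inter> {s..} \<subseteq> {s + 6}"
  proof
    fix x assume x: "x \<in> \<sigma> \<inter> {s..}"
    then have "x \<in> {..<s+7}" "s \<le> x" using c unfolding cells_iff by blast+
    then have "s + (x - s) = x" "x - s < 7" by auto
    moreover have "x - s \<notin> verts \<sigma>" using e by simp
    ultimately show "x \<in> {s + 6}" using x by (auto simp: verts_def)
  qed
  then show ?thesis using c unfolding cells_iff by blast
qed

lemma QA_mono: "QA u \<sigma> \<Longrightarrow> \<sigma>' \<subseteq> \<sigma> \<Longrightarrow> QA u \<sigma>'"
  unfolding QA_def using even_card_mono[of \<sigma>' \<sigma> u] by linarith

lemma odd_mem: "odd (count u i) \<Longrightarrow> i \<in># u"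
  by (metis even_zero not_in_iff)

text \<open>The toggled direction is chosen by data that the toggling itself preserves:
  \<open>u\<close>, the vertex set and the status \<open>QA\<close>. The status is the point to
  check, and it could change only in the case of even exponents.\<close>

lemma toggle_sub_matched:
  assumes "x \<in> sub_matched" defines "v \<equiv> match_vertex x"
  shows "(fst x, toggle v (snd x)) \<in> sub_matched" "match_vertex (fst x, toggle v (snd x)) = v" "xlab (toggle v (snd x)) = xlab (snd x)"
proof -
  obtain u \<sigma> where x: "x = (u, \<sigma>)" by (cases x)
  have c: "(u, \<sigma>) \<in> cells" using assms(1) by (auto simp: sub_matched_def x)
  note ci = c[unfolded cells_iff]
  have "(u, toggle v \<sigma>) \<in> sub_matched \<and> match_vertex (u, toggle v \<sigma>) = v \<and> verts (toggle v \<sigma>) = verts \<sigma>"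
  proof (cases "QA u \<sigma>")
    case QA: True
    show ?thesis
    proof (cases "verts \<sigma> = {}")
      case False
      then have v: "v = s + 6" using QA by (simp add: v_def match_vertex_def x)
      have e: "even_card u (toggle v \<sigma>) = even_card u \<sigma>" "verts (toggle v \<sigma>) = verts \<sigma>" using v even_card_toggle[of v u \<sigma>] verts_toggle by auto
      have q: "QA u (toggle v \<sigma>)" using QA by (simp add: QA_def e)
      have t: "toggle v \<sigma> \<inter> {..<s} = \<sigma> \<inter> {..<s}" using v by (auto simp: mem_toggle)
      have "toggle v \<sigma> \<inter> {s..} \<noteq> {}"
      proof -
        obtain g where "g < 6" "s + g \<in> \<sigma>" using False by (auto simp: verts_def)
        then have "s + g \<in> toggle v \<sigma> \<inter> {s..}" using v by (auto simp: mem_toggle)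
        then show ?thesis by blast
      qed
      moreover have "toggle v \<sigma> \<subseteq> {..<s+7}" using ci v by (auto simp: toggle_def split: if_splits)
      ultimately have "(u, toggle v \<sigma>) \<in> cells" using ci q t e unfolding cells_iff by (auto simp: QC_def)
      then show ?thesis using q e False v by (simp add: sub_matched_def match_vertex_def)
    next
      case True
      have st: "\<sigma> \<inter> {s..} = {s + 6}" using verts_empty[OF c True] by simp
      have vs: "v < s" and vu: "v \<in># u" and cond: "(odd (count u v) \<and> (\<exists>i<s. odd (count u i)) \<and> v = (LEAST i. i < s \<and> odd (count u i))) \<or>
         (\<not> (\<exists>i<s. odd (count u i)) \<and> v = (LEAST i. i \<in># u))"
      proof -
        have "v < s \<and> v \<in># u \<and> ((odd (count u v) \<and> (\<exists>i<s. odd (count u i)) \<and> v = (LEAST i. i < s \<and> odd (count u i))) \<or>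
         (\<not> (\<exists>i<s. odd (count u i)) \<and> v = (LEAST i. i \<in># u)))"
        proof (cases "\<exists>i<s. odd (count u i)")
          case o: True
          then have v: "v = (LEAST i. i < s \<and> odd (count u i))" using QA True by (simp add: v_def match_vertex_def x)
          have "v < s \<and> odd (count u v)" unfolding v by (rule LeastI_ex) (use o in blast)
          then show ?thesis using v o odd_mem[of u v] by blast
        next
          case o: False
          then have v: "v = (LEAST i. i \<in># u)" using QA True by (auto simp: v_def match_vertex_def x)
          have "u \<noteq> {#}" using QA h1 by (auto simp: QA_def half_size_def)
          then have "\<exists>i. i \<in># u" by auto
          then have "v \<in># u" unfolding v by (rule LeastI_ex)
          moreover from this have "v < s" using ci by auto
          ultimately show ?thesis using v o by blast
        qed
        then show "v < s" "v \<in># u" "(odd (count u v) \<and> (\<exists>i<s. odd (count u i)) \<and> v = (LEAST i. i < s \<and> odd (count u i))) \<or>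
         (\<not> (\<exists>i<s. odd (count u i)) \<and> v = (LEAST i. i \<in># u))" by blast+
      qed
      have S': "verts (toggle v \<sigma>) = verts \<sigma>" "toggle v \<sigma> \<inter> {s..} = \<sigma> \<inter> {s..}" using verts_toggle(1)[OF vs] vs by (auto simp: mem_toggle)
      have card_eq: "toggle v \<sigma> \<inter> {..<s} - {v} = \<sigma> \<inter> {..<s} - {v}" by (auto simp: mem_toggle)
      have q: "QA u (toggle v \<sigma>)"
        using cond
      proof (elim disjE conjE)
        assume "odd (count u v)"
        then show ?thesis using QA even_card_toggle[of v u \<sigma>] by (simp add: QA_def)
      next
        \<comment> \<open>Adding \<open>v\<close> costs at most one square, and the strict
          inequality in \<open>sub_matched\<close> supplies it.\<close>
        assume o: "\<not> (\<exists>i<s. odd (count u i))" "v = (LEAST i. i \<in># u)"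
        then have lt: "card (\<sigma> \<inter> {..<s} - {v}) + h < half_size u"
          using assms(1) QA True unfolding sub_matched_def x o(2) by auto
        have "even_card u (toggle v \<sigma>) \<le> card (insert v (toggle v \<sigma> \<inter> {..<s} - {v}))"
          unfolding even_card_def by (rule card_mono) auto
        also have "\<dots> \<le> Suc (card (\<sigma> \<inter> {..<s} - {v}))" unfolding card_eq by (rule card_insert_le_Suc)
        finally show ?thesis using lt by (simp add: QA_def)
      qed
      have "toggle v \<sigma> \<subseteq> {..<s+7}" "toggle v \<sigma> \<inter> {..<s} \<subseteq> set_mset u"
        using ci vs vu by (auto simp: toggle_def split: if_splits)
      then have cc: "(u, toggle v \<sigma>) \<in> cells" using ci q S' True unfolding cells_iff by auto
      have tvv: "match_vertex (u, toggle v \<sigma>) = v" using q S' True cond by (auto simp: match_vertex_def)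
      have "(u, toggle v \<sigma>) \<in> sub_matched"
        using cond
      proof (elim disjE conjE)
        assume "\<exists>i<s. odd (count u i)"
        then show ?thesis using cc q by (simp add: sub_matched_def)
      next
        assume o: "\<not> (\<exists>i<s. odd (count u i))" "v = (LEAST i. i \<in># u)"
        then have "card (\<sigma> \<inter> {..<s} - {v}) + h < half_size u" using assms(1) QA True unfolding sub_matched_def x o(2) by auto
        then have "card (toggle v \<sigma> \<inter> {..<s} - {LEAST i. i \<in># u}) + h < half_size u" unfolding o(2)[symmetric] card_eq .
        then show ?thesis using cc q by (simp add: sub_matched_def)
      qed
      then show ?thesis using tvv S' by blast
    qed
  next
    case QA: False
    then have o: "\<exists>i<s. 2 \<le> i \<and> odd (count u i)" using assms(1) by (simp add: sub_matched_def x)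
    have v: "v = (LEAST i. i < s \<and> 2 \<le> i \<and> odd (count u i))" using QA by (simp add: v_def match_vertex_def x)
    have v': "v < s \<and> 2 \<le> v \<and> odd (count u v)" unfolding v by (rule LeastI_ex) (use o in blast)
    have e: "even_card u (toggle v \<sigma>) = even_card u \<sigma>" "verts (toggle v \<sigma>) = verts \<sigma>" using v' even_card_toggle[of v u \<sigma>] verts_toggle by auto
    have q: "QA u (toggle v \<sigma>) = QA u \<sigma>" "QC u (toggle v \<sigma>) = QC u \<sigma>" using v' by (auto simp: QA_def QC_def e mem_toggle)
    have "toggle v \<sigma> \<inter> {s..} = \<sigma> \<inter> {s..}" using v' by (auto simp: mem_toggle)
    moreover have "toggle v \<sigma> \<subseteq> {..<s+7}" "toggle v \<sigma> \<inter> {..<s} \<subseteq> set_mset u"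
        using ci v' odd_mem[of u v] by (auto simp: toggle_def split: if_splits)
    moreover have "s + 6 \<in> toggle v \<sigma> \<longleftrightarrow> s + 6 \<in> \<sigma>" using v' by (auto simp: mem_toggle)
    ultimately have "(u, toggle v \<sigma>) \<in> cells" using ci q e unfolding cells_iff by auto
    then show ?thesis using QA q o e v by (simp add: sub_matched_def match_vertex_def)
  qed
  then show "(fst x, toggle v (snd x)) \<in> sub_matched" "match_vertex (fst x, toggle v (snd x)) = v" "xlab (toggle v (snd x)) = xlab (snd x)"
    using xlab_cong[of "toggle v \<sigma>" \<sigma>] by (simp_all add: x)
qed

lemma red_inc_cases:
  assumes "(u, \<sigma>) \<in> cells" "b \<in> cells" "red_inc (u, \<sigma>) b \<noteq> (0::'f::comm_ring_1)"
  obtains w where "w \<in> \<sigma>" "b = (u, \<sigma> - {w})" "w < s" "verts (\<sigma> - {w}) = verts \<sigma>"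
  | "s + 6 \<in> \<sigma>" "b = (u, \<sigma> - {s + 6})" "verts (\<sigma> - {s + 6}) = verts \<sigma>"
  | g where "g \<in> verts \<sigma>" "b = (u, \<sigma> - {s + g})" "verts (\<sigma> - {s + g}) = verts \<sigma> - {g}" "\<not> face (verts \<sigma> - {g})"
proof -
  from red_inc_nz[OF assms] obtain v where v: "v \<in> \<sigma>" "b = (u, \<sigma> - {v})" "xlab (\<sigma> - {v}) = xlab \<sigma>" .
  consider "v < s" | "v = s + 6" | "s \<le> v" "v < s + 6"
  proof -
    have "v < s + 7" using v(1) assms(1) unfolding cells_iff by blast
    then show thesis using that by linarith
  qed
  then show thesis
  proof cases
    case 1
    then show ?thesis using that(1)[of v] v verts_remove(2)[of v \<sigma>] by blast
  next
    case 2
    then show ?thesis using that(2) v verts_remove(3)[of \<sigma>] by blast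
  next
    case 3
    then have e: "s + (v - s) = v" "v - s \<in> verts \<sigma>" using v(1) by (auto simp: verts_def)
    show ?thesis using that(3)[of "v - s"] e v xlab_remove[OF e(2)] verts_remove(1)[of \<sigma> "v - s"] by simp
  qed
qed

text \<open>The delicate face is one under \<open>QA\<close> without vertices. It cannot arise by
  deleting the last vertex, since the empty set is a face and such an incidence is zero; so
  \<open>a\<close> had no vertices either, and its condition passes to the smaller set of
  directions.\<close>

lemma sub_matched_closed:
  assumes a: "a \<in> sub_matched" and b: "b \<in> cells" and nz: "red_inc a b \<noteq> (0::'f::comm_ring_1)"
  shows "b \<in> sub_matched"
proof -
  obtain u \<sigma> where x: "a = (u, \<sigma>)" by (cases a)
  have c: "(u, \<sigma>) \<in> cells" using a by (auto simp: sub_matched_def x)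
  from red_inc_nz[OF c b nz[unfolded x]] obtain v where v: "v \<in> \<sigma>" "b = (u, \<sigma> - {v})" .
  have cb: "(u, \<sigma> - {v}) \<in> cells" using b v by simp
  show ?thesis
  proof (cases "QA u (\<sigma> - {v})")
    case True
    show ?thesis
    proof (cases "verts (\<sigma> - {v}) = {}")
      case e: True
      then have s6: "s + 6 \<in> \<sigma> - {v}" using verts_empty[OF cb] by auto
      then have QA: "QA u \<sigma>" using c unfolding cells_iff by blast
      have "verts \<sigma> = {}"
        using red_inc_cases[OF c b nz[unfolded x]]
      proof cases
        case (3 g)
        then have "\<sigma> - {s + g} = \<sigma> - {v}" using v(2) by simp
        then have "verts \<sigma> - {g} = {}" using 3(3) e by simp
        then show ?thesis using 3(4) face_empty by metis
      qed (use e v in auto)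
      then consider "\<exists>i<s. odd (count u i)" | "card (\<sigma> \<inter> {..<s} - {LEAST i. i \<in># u}) + h < half_size u"
        using a QA unfolding sub_matched_def x by auto
      then show ?thesis
      proof cases
        case 1
        then show ?thesis using True cb v by (simp add: sub_matched_def)
      next
        case 2
        have "card ((\<sigma> - {v}) \<inter> {..<s} - {LEAST i. i \<in># u}) \<le> card (\<sigma> \<inter> {..<s} - {LEAST i. i \<in># u})"
          by (rule card_mono) auto
        then show ?thesis using 2 True cb v by (simp add: sub_matched_def)
      qed
    qed (use True cb v in \<open>simp add: sub_matched_def\<close>)
  next
    case False
    then have "\<not> QA u \<sigma>" using QA_mono[of u \<sigma> "\<sigma> - {v}"] by blast
    then show ?thesis using a False cb v unfolding sub_matched_def x by auto
  qed
qed

text \<open>All conditions go up: a set containing a nonface is a nonface, and \<open>QA\<close>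
  would pass from \<sigma> to its subsets.\<close>

lemma quot_matched_closed:
  assumes b: "b \<in> quot_matched" and a: "a \<in> cells" and nz: "red_inc a b \<noteq> (0::'f::comm_ring_1)"
  shows "a \<in> quot_matched"
proof -
  obtain u \<sigma> where x: "a = (u, \<sigma>)" by (cases a)
  have c: "(u, \<sigma>) \<in> cells" using a x by simp
  have bc: "b \<in> cells" using b by (simp add: quot_matched_def)
  from red_inc_nz[OF c bc nz[unfolded x]] obtain v where v: "v \<in> \<sigma>" "b = (u, \<sigma> - {v})" .
  have "verts (\<sigma> - {v}) - {5} \<subseteq> verts \<sigma> - {5}" by (auto simp: verts_def)
  then have "\<not> face (verts \<sigma> - {5})" using b v face_mono by (auto simp: quot_matched_def)
  moreover have "\<not> QA u \<sigma>" using b v QA_mono[of u \<sigma> "\<sigma> - {v}"] by (auto simp: quot_matched_def)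
  ultimately show ?thesis using b v c by (auto simp: quot_matched_def x)
qed

text \<open>A face of the partner of \<open>a\<close> with unchanged status has the same match
  vertex and still contains it, hence is an upper cell. A gradient step must therefore enter
  \<open>QA\<close>, which the two-valued rank records.\<close>

lemma sub_matched_acyclic: "acyclic_cells sub_matched dm (red_inc :: _ \<Rightarrow> _ \<Rightarrow> 'f::comm_ring_1)"
proof (rule acyclic_matching.acyclic)
  have W1c: "sub_matched \<subseteq> cells" by (auto simp: sub_matched_def)
  show "acyclic_matching sub_matched dm (red_inc :: _ \<Rightarrow> _ \<Rightarrow> 'f) {x. match_vertex x \<notin> snd x} (\<lambda>x. (fst x, toggle (match_vertex x) (snd x)))
     (\<lambda>x. if QA (fst x) (snd x) then 0 else 1)"
  proof
    show "finite sub_matched" using W1c finite_cells finite_subset by blast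
    show "dm a = Suc (dm b)" if "a \<in> sub_matched" "b \<in> sub_matched" "red_inc a b \<noteq> (0::'f)" for a b using red_inc_grade that W1c by blast
    show "(\<Sum>x\<in>sub_matched. red_inc a x * red_inc x b) = (0::'f)" if ab: "a \<in> sub_matched" "b \<in> sub_matched" for a b
    proof -
      have "(\<Sum>x\<in>sub_matched. red_inc a x * red_inc x b) = (\<Sum>x\<in>cells. red_inc a x * red_inc x b :: 'f)"
      proof (rule sum.mono_neutral_left[OF finite_cells W1c])
        show "\<forall>x\<in>cells - sub_matched. red_inc a x * red_inc x b = (0::'f)"
        proof
          fix x assume "x \<in> cells - sub_matched"
          then have "red_inc a x = (0::'f)" using sub_matched_closed[OF ab(1), of x, where 'f = 'f] by blast
          then show "red_inc a x * red_inc x b = (0::'f)" by simp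
        qed
      qed
      then show ?thesis using red_inc_sq[of a b, where 'f = 'f] ab W1c by auto
    qed
    show "(fst x, toggle (match_vertex x) (snd x)) \<in> sub_matched" if "x \<in> sub_matched" for x using toggle_sub_matched(1)[OF that] .
    show "(fst (fst x, toggle (match_vertex x) (snd x)), toggle (match_vertex (fst x, toggle (match_vertex x) (snd x))) (snd (fst x, toggle (match_vertex x) (snd x)))) = x"
      if "x \<in> sub_matched" for x unfolding toggle_sub_matched(2)[OF that] by (simp add: toggle_toggle)
    show "(fst x, toggle (match_vertex x) (snd x)) \<in> {x. match_vertex x \<notin> snd x} \<longleftrightarrow> x \<notin> {x. match_vertex x \<notin> snd x}" if "x \<in> sub_matched" for x
      using toggle_sub_matched(2)[OF that] by (simp add: mem_toggle)
    show "red_inc (fst a, toggle (match_vertex a) (snd a)) a * red_inc (fst a, toggle (match_vertex a) (snd a)) a = (1::'f)"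
      if a: "a \<in> sub_matched" "a \<in> {x. match_vertex x \<notin> snd x}" for a
    proof -
      obtain u \<sigma> where x: "a = (u, \<sigma>)" by (cases a)
      let ?v = "match_vertex a"
      have v: "?v \<notin> \<sigma>" "toggle ?v \<sigma> = insert ?v \<sigma>" using a(2) by (auto simp: x toggle_def)
      have c: "(u, insert ?v \<sigma>) \<in> cells" "(u, insert ?v \<sigma> - {?v}) \<in> cells"
        using toggle_sub_matched(1)[OF a(1)] a(1) v W1c x by auto
      have "red_inc (u, insert ?v \<sigma>) (u, insert ?v \<sigma> - {?v}) = (sg ?v (insert ?v \<sigma>) :: 'f)"
        using red_inc_val[OF c, where 'f = 'f] toggle_sub_matched(3)[OF a(1)] v by (simp add: x)
      then show ?thesis using v by (simp add: x sg_sq)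
    qed
    fix a b assume a: "a \<in> sub_matched" "a \<in> {x. match_vertex x \<notin> snd x}" and b: "b \<in> sub_matched" "b \<in> {x. match_vertex x \<notin> snd x}" "b \<noteq> a"
      and nz: "red_inc (fst a, toggle (match_vertex a) (snd a)) b \<noteq> (0::'f)"
    obtain u \<sigma> where x: "a = (u, \<sigma>)" by (cases a)
    let ?v = "match_vertex a"
    have v: "?v \<notin> \<sigma>" "toggle ?v \<sigma> = insert ?v \<sigma>" using a(2) by (auto simp: x toggle_def)
    have p: "(u, insert ?v \<sigma>) \<in> sub_matched" "match_vertex (u, insert ?v \<sigma>) = ?v" using toggle_sub_matched(1,2)[OF a(1)] v by (simp_all add: x)
    then have pc: "(u, insert ?v \<sigma>) \<in> cells" using W1c by blast
    have nz': "red_inc (u, insert ?v \<sigma>) b \<noteq> (0::'f)" using nz v by (simp add: x)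
    have bc: "b \<in> cells" using b W1c by blast
    from red_inc_nz[OF pc bc nz'] obtain w where w: "w \<in> insert ?v \<sigma>" "b = (u, insert ?v \<sigma> - {w})" .
    have wv: "w \<noteq> ?v" using b(3) w(2) v(1) by (auto simp: x)
    then have vb: "?v \<in> snd b" using w(2) by simp
    then have ne: "match_vertex b \<noteq> ?v" using b(2) by auto
    show "(if QA (fst b) (snd b) then 0 else (1::nat)) < (if QA (fst a) (snd a) then 0 else 1)"
    proof (rule ccontr)
      assume "\<not> ?thesis"
      then have "QA (fst a) (snd a) \<or> \<not> QA (fst b) (snd b)" by (simp split: if_splits)
      moreover have "fst a = u" "snd a = \<sigma>" using x by simp_all
      moreover have "fst b = u" "snd b = insert ?v \<sigma> - {w}" using w(2) by simp_all
      ultimately have qq: "QA u \<sigma> \<or> \<not> QA u (insert ?v \<sigma> - {w})" by metis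
      have "match_vertex b = match_vertex (u, insert ?v \<sigma>)"
      proof (cases "QA u (insert ?v \<sigma>)")
        case True
        then have q: "QA u (insert ?v \<sigma> - {w})" by (rule QA_mono) auto
        have "verts (insert ?v \<sigma> - {w}) = {} \<longleftrightarrow> verts (insert ?v \<sigma>) = {}"
          using red_inc_cases[OF pc bc nz']
        proof cases
          case (3 g)
          then have "verts (insert ?v \<sigma> - {w}) = verts (insert ?v \<sigma>) - {g}" using w(2) by auto
          moreover have "verts (insert ?v \<sigma>) - {g} \<noteq> {}" using 3 face_empty by metis
          ultimately show ?thesis by auto
        qed (use w in auto)
        then show ?thesis unfolding w(2) using True q by (intro match_vertex_cong) blast+
      next
        case False
        have "\<not> QA u (insert ?v \<sigma> - {w})"
        proof (cases "QA u \<sigma>")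
          case True
          \<comment> \<open>a matched pair has the same status, so this case is void\<close>
          have "match_vertex (u, \<sigma>) = match_vertex (u, insert ?v \<sigma>)" using p(2) by (simp add: x)
          then have "odd (count u ?v)" "?v < s"
          proof -
            have "\<exists>i<s. 2 \<le> i \<and> odd (count u i)" using p(1) False by (simp add: sub_matched_def)
            moreover have "?v = (LEAST i. i < s \<and> 2 \<le> i \<and> odd (count u i))" using p(2) False by (simp add: match_vertex_def)
            ultimately have "?v < s \<and> 2 \<le> ?v \<and> odd (count u ?v)"
              using LeastI_ex[of "\<lambda>i. i < s \<and> 2 \<le> i \<and> odd (count u i)"] by metis
            then show "odd (count u ?v)" "?v < s" by auto
          qed
          then have "even_card u (toggle ?v \<sigma>) = even_card u \<sigma>" using even_card_toggle by blast
          then show ?thesis using True False v(2) by (simp add: QA_def)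
        qed (use qq in blast)
        then show ?thesis unfolding w(2) using False by (intro match_vertex_cong) blast+
      qed
      then show False using ne p(2) by simp
    qed
  qed
qed

text \<open>The toggled vertex is the same everywhere, so every face of a partner other than
  \<open>a\<close> contains it and is an upper cell. There are no gradient steps at all, and a
  constant rank will do.\<close>

lemma quot_matched_acyclic: "acyclic_cells quot_matched dm (red_inc :: _ \<Rightarrow> _ \<Rightarrow> 'f::comm_ring_1)"
proof (rule acyclic_matching.acyclic)
  have W2c: "quot_matched \<subseteq> cells" by (auto simp: quot_matched_def)
  have tg: "(u, toggle (s + 5) \<sigma>) \<in> quot_matched" "verts (toggle (s + 5) \<sigma>) - {5} = verts \<sigma> - {5}" if "(u, \<sigma>) \<in> quot_matched" for u \<sigma>
  proof -
    have c: "(u, \<sigma>) \<in> cells" using that W2c by blast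
    note ci = c[unfolded cells_iff]
    show S': "verts (toggle (s + 5) \<sigma>) - {5} = verts \<sigma> - {5}" by (auto simp: verts_def mem_toggle)
    have nf: "\<not> face (verts \<sigma> - {5})" "\<not> QA u \<sigma>" using that by (auto simp: quot_matched_def)
    then have ne: "verts \<sigma> - {5} \<noteq> {}" using face_empty by metis
    then obtain g where g: "g \<in> verts (toggle (s + 5) \<sigma>)" "g \<in> verts \<sigma>" using S' by blast
    have e: "even_card u (toggle (s + 5) \<sigma>) = even_card u \<sigma>" by (rule even_card_toggle) simp
    have q: "QA u (toggle (s + 5) \<sigma>) = QA u \<sigma>" "QC u (toggle (s + 5) \<sigma>) = QC u \<sigma>" using s2 by (auto simp: QA_def QC_def e mem_toggle)
    have "toggle (s + 5) \<sigma> \<inter> {s..} \<noteq> {}" using g(1) by (auto simp: verts_def)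
    moreover have "toggle (s + 5) \<sigma> \<subseteq> {..<s+7}" "toggle (s + 5) \<sigma> \<inter> {..<s} = \<sigma> \<inter> {..<s}"
      using ci by (auto simp: toggle_def split: if_splits)
    moreover have "s + 6 \<in> toggle (s + 5) \<sigma> \<longleftrightarrow> s + 6 \<in> \<sigma>" by (simp add: mem_toggle)
    moreover have "verts \<sigma> \<noteq> {}" using g by blast
    ultimately have "(u, toggle (s + 5) \<sigma>) \<in> cells" using ci q unfolding cells_iff by auto
    then show "(u, toggle (s + 5) \<sigma>) \<in> quot_matched" using that S' q by (auto simp: quot_matched_def)
  qed
  show "acyclic_matching quot_matched dm (red_inc :: _ \<Rightarrow> _ \<Rightarrow> 'f) {x. s + 5 \<notin> snd x} (\<lambda>x. (fst x, toggle (s + 5) (snd x))) (\<lambda>x. 0)"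
  proof
    show "finite quot_matched" using W2c finite_cells finite_subset by blast
    show "dm a = Suc (dm b)" if "a \<in> quot_matched" "b \<in> quot_matched" "red_inc a b \<noteq> (0::'f)" for a b using red_inc_grade that W2c by blast
    show "(\<Sum>x\<in>quot_matched. red_inc a x * red_inc x b) = (0::'f)" if ab: "a \<in> quot_matched" "b \<in> quot_matched" for a b
    proof -
      have "(\<Sum>x\<in>quot_matched. red_inc a x * red_inc x b) = (\<Sum>x\<in>cells. red_inc a x * red_inc x b :: 'f)"
      proof (rule sum.mono_neutral_left[OF finite_cells W2c])
        show "\<forall>x\<in>cells - quot_matched. red_inc a x * red_inc x b = (0::'f)"
        proof
          fix x assume "x \<in> cells - quot_matched"
          then have "red_inc x b = (0::'f)" using quot_matched_closed[OF ab(2), of x, where 'f = 'f] by blast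
          then show "red_inc a x * red_inc x b = (0::'f)" by simp
        qed
      qed
      then show ?thesis using red_inc_sq[of a b, where 'f = 'f] ab W2c by auto
    qed
    show "(fst x, toggle (s + 5) (snd x)) \<in> quot_matched" if "x \<in> quot_matched" for x using tg(1)[of "fst x" "snd x"] that by simp
    show "(fst (fst x, toggle (s + 5) (snd x)), toggle (s + 5) (snd (fst x, toggle (s + 5) (snd x)))) = x" for x :: "nat multiset \<times> nat set"
      by (simp add: toggle_toggle)
    show "(fst x, toggle (s + 5) (snd x)) \<in> {x. s + 5 \<notin> snd x} \<longleftrightarrow> x \<notin> {x. s + 5 \<notin> snd x}" for x :: "nat multiset \<times> nat set"
      by (simp add: mem_toggle)
    show "red_inc (fst a, toggle (s + 5) (snd a)) a * red_inc (fst a, toggle (s + 5) (snd a)) a = (1::'f)"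
      if a: "a \<in> quot_matched" "a \<in> {x. s + 5 \<notin> snd x}" for a
    proof -
      obtain u \<sigma> where x: "a = (u, \<sigma>)" by (cases a)
      let ?v = "s + 5"
      have v: "?v \<notin> \<sigma>" "toggle ?v \<sigma> = insert ?v \<sigma>" using a(2) by (auto simp: x toggle_def)
      have t: "(u, toggle ?v \<sigma>) \<in> quot_matched" "verts (toggle ?v \<sigma>) - {5} = verts \<sigma> - {5}" using tg a(1) x by auto
      have c: "(u, insert ?v \<sigma>) \<in> cells" "(u, insert ?v \<sigma> - {?v}) \<in> cells"
        using t(1) a(1) v W2c x by auto
      have "5 \<in> verts (insert ?v \<sigma>)" by (simp add: verts_def)
      moreover have "\<not> face (verts (insert ?v \<sigma>) - {5})" using t(2) a(1) v(2) by (simp add: quot_matched_def x)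
      ultimately have "xlab (insert ?v \<sigma> - {?v}) = xlab (insert ?v \<sigma>)" using xlab_remove[of 5] by blast
      then have "red_inc (u, insert ?v \<sigma>) (u, insert ?v \<sigma> - {?v}) = (sg ?v (insert ?v \<sigma>) :: 'f)"
        using red_inc_val[OF c, where 'f = 'f] by simp
      then show ?thesis using v by (simp add: x sg_sq)
    qed
    fix a b assume a: "a \<in> quot_matched" "a \<in> {x. s + 5 \<notin> snd x}" and b: "b \<in> quot_matched" "b \<in> {x. s + 5 \<notin> snd x}" "b \<noteq> a"
      and nz: "red_inc (fst a, toggle (s + 5) (snd a)) b \<noteq> (0::'f)"
    obtain u \<sigma> where x: "a = (u, \<sigma>)" by (cases a)
    have v: "s + 5 \<notin> \<sigma>" "toggle (s + 5) \<sigma> = insert (s + 5) \<sigma>" using a(2) by (auto simp: x toggle_def)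
    have pc: "(u, insert (s + 5) \<sigma>) \<in> cells" using tg(1)[of u \<sigma>] a(1) v W2c x by auto
    have bc: "b \<in> cells" using b W2c by blast
    have nz': "red_inc (u, insert (s + 5) \<sigma>) b \<noteq> (0::'f)" using nz v by (simp add: x)
    from red_inc_nz[OF pc bc nz'] obtain w where w: "w \<in> insert (s + 5) \<sigma>" "b = (u, insert (s + 5) \<sigma> - {w})" .
    then have "w = s + 5" using b(2) by auto
    then have "b = a" using w v by (simp add: x)
    then show "(0::nat) < 0" using b(3) by simp
  qed
qed

theorem hdim_crit: "hdim cells dm (red_inc :: _ \<Rightarrow> _ \<Rightarrow> 'f::comm_ring_1) (Suc i) d \<longleftrightarrow> hdim crit dm (red_inc :: _ \<Rightarrow> _ \<Rightarrow> 'f) (Suc i) d"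
proof -
  interpret A: square_zero_complex cells dm "red_inc :: _ \<Rightarrow> _ \<Rightarrow> 'f"
    using finite_cells red_inc_grade[where 'f = 'f] red_inc_sq[where 'f = 'f] by unfold_locales blast+
  let ?B = "cells - sub_matched"
  have "hdim cells dm (red_inc :: _ \<Rightarrow> _ \<Rightarrow> 'f) (Suc i) d \<longleftrightarrow> hdim ?B dm (red_inc :: _ \<Rightarrow> _ \<Rightarrow> 'f) (Suc i) d"
  proof (rule A.hdim_remove_sub[of sub_matched ?B])
    show "cells = sub_matched \<union> ?B" by (auto simp: sub_matched_def)
    show "red_inc a b = (0::'f)" if "a \<in> sub_matched" "b \<in> ?B" for a b using sub_matched_closed[OF that(1), of b, where 'f = 'f] that(2) by blast
  qed (use sub_matched_acyclic in auto)
  also have "\<dots> \<longleftrightarrow> hdim crit dm (red_inc :: _ \<Rightarrow> _ \<Rightarrow> 'f) (Suc i) d"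
  proof -
    interpret B: square_zero_complex ?B dm "red_inc :: _ \<Rightarrow> _ \<Rightarrow> 'f"
    proof
      show "finite ?B" using finite_cells by simp
      show "dm a = Suc (dm b)" if "a \<in> ?B" "b \<in> ?B" "red_inc a b \<noteq> (0::'f)" for a b using red_inc_grade that by blast
      show "(\<Sum>x\<in>?B. red_inc a x * red_inc x b) = (0::'f)" if ab: "a \<in> ?B" "b \<in> ?B" for a b
      proof -
        have "(\<Sum>x\<in>?B. red_inc a x * red_inc x b) = (\<Sum>x\<in>cells. red_inc a x * red_inc x b :: 'f)"
        proof (rule sum.mono_neutral_left[OF finite_cells])
          show "\<forall>x\<in>cells - ?B. red_inc a x * red_inc x b = (0::'f)"
          proof
            fix x assume "x \<in> cells - ?B"
            then have "red_inc x b = (0::'f)" using sub_matched_closed[of x b, where 'f = 'f] ab(2) by blast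
            then show "red_inc a x * red_inc x b = (0::'f)" by simp
          qed
        qed auto
        then show ?thesis using red_inc_sq[of a b, where 'f = 'f] ab by auto
      qed
    qed
    have W12: "quot_matched \<inter> sub_matched = {}" by (auto simp: sub_matched_def quot_matched_def split: if_splits)
    show ?thesis
    proof (rule B.hdim_remove_quotient[of quot_matched crit])
      show "?B = quot_matched \<union> crit" using W12 by (auto simp: crit_def quot_matched_def)
      show "quot_matched \<inter> crit = {}" by (auto simp: crit_def)
      show "red_inc a b = (0::'f)" if "a \<in> crit" "b \<in> quot_matched" for a b
        using quot_matched_closed[OF that(2), of a, where 'f = 'f] that(1) by (auto simp: crit_def)
    qed (rule quot_matched_acyclic)
  qed
  finally show ?thesis .
qed

end

section \<open>Homology of the critical cells\<close>

text \<open>The nonfaces \<open>S\<close> for which \<open>S - {5}\<close> is a face; no matching by the vertex 5 removes them.\<close>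

definition diag_triple :: "nat \<Rightarrow> nat set" where "diag_triple i = [{1,3,5},{2,4,5},{0,3,5},{1,4,5},{0,2,5}] ! i"
definition diag_quad :: "nat \<Rightarrow> nat set" where "diag_quad i = [{0,1,3,5},{1,2,4,5},{0,2,3,5},{1,3,4,5},{0,2,4,5}] ! i"

text \<open>Integral and executable: the block is evaluated once and then carried to any ring by
  \<open>of_int\<close>.\<close>

definition simplex_inc :: "nat set \<Rightarrow> nat set \<Rightarrow> int" where
  "simplex_inc S S' = (\<Sum>g\<in>S. if S' = S - {g} then (-1) ^ card (Set.filter (\<lambda>w. w < g) S) else 0)"

lemma simplex_inc_diag_quad_diag_triple: "\<forall>i\<in>{..<5}. \<forall>j\<in>{..<5}. simplex_inc (diag_quad i) (diag_triple j) = blockM i j"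
  by code_simp

text \<open>Such a nonface contains 5, and without 5 it is a face away from 5 that is not in the
  link of 5: one of the five diagonals or five triangles of the Moebius strip.\<close>

lemma critical_nonfaces_aux: "Set.filter (\<lambda>S. \<not> (\<exists>f\<in>{..<10}. S \<subseteq> facets ! f) \<and> (\<exists>f\<in>{..<10}. S - {5} \<subseteq> facets ! f)) (Pow {..<6}) =
    diag_triple ` {..<5} \<union> diag_quad ` {..<5}"
  by code_simp

lemma critical_nonfaces: "S \<subseteq> {..<6} \<and> \<not> face S \<and> face (S - {5}) \<longleftrightarrow> S \<in> diag_triple ` {..<5} \<union> diag_quad ` {..<5}"
  unfolding critical_nonfaces_aux[symmetric] face_def by auto

lemma inj_diag_triple_diag_quad: "\<forall>i\<in>{..<5}. \<forall>j\<in>{..<5}. (diag_triple i = diag_triple j \<longrightarrow> i = j) \<and> (diag_quad i = diag_quad j \<longrightarrow> i = j)"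
  by code_simp

lemma card_diag_triple_diag_quad: "\<forall>i\<in>{..<5}. card (diag_triple i) = 3 \<and> card (diag_quad i) = 4"
  by code_simp

lemma of_int_blockM: "of_int (blockM i j) = (blockM i j :: 'f::comm_ring_1)"
  by (simp add: blockM_def)

lemma simplex_inc_remove:
  assumes "finite S" "g \<in> S"
  shows "simplex_inc S (S - {g}) = (-1) ^ card {w\<in>S. w < g}"
proof -
  have "S - {g} = S - {g'} \<longleftrightarrow> g' = g" if "g' \<in> S" for g' using that assms(2) by blast
  then have "simplex_inc S (S - {g}) = (\<Sum>g'\<in>S. if g' = g then (-1) ^ card {w\<in>S. w < g'} else 0)"
    unfolding simplex_inc_def by (intro sum.cong) auto
  then show ?thesis using assms by simp
qed

lemma simplex_inc_other: "(\<And>g. g \<in> S \<Longrightarrow> S' \<noteq> S - {g}) \<Longrightarrow> simplex_inc S S' = 0"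
  unfolding simplex_inc_def by (intro sum.neutral) auto

definition ne_faces :: "nat set set" where "ne_faces = {S. S \<subseteq> {..<6} \<and> S \<noteq> {} \<and> face S}"

lemma finite_ne_faces: "finite ne_faces"
  by (rule finite_subset[of _ "Pow {..<6}"]) (auto simp: ne_faces_def)

text \<open>The contribution of a cubical part of dimension \<open>t\<close>; the summand \<open>e\<close> comes from the Moebius block and is
  1 in characteristic 2 and 0 when 2 is invertible.\<close>

definition part_dim :: "nat \<Rightarrow> nat \<Rightarrow> nat \<Rightarrow> nat" where
  "part_dim e j t = (\<Sum>S\<in>ne_faces. if t + card S = j then 1 else 0) + (if j = t + 3 \<or> j = t + 4 then e else 0)"

section \<open>Splitting the critical cells\<close>

context rp2_power begin

definition mk_cell :: "nat multiset \<Rightarrow> nat set \<Rightarrow> nat set \<Rightarrow> nat multiset \<times> nat set" where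
  "mk_cell u \<tau> S = (u, \<tau> \<union> (+) s ` S)"

definition pure_crit :: "(nat multiset \<times> nat set) set" where "pure_crit = {x\<in>crit. QA (fst x) (snd x)}"

text \<open>The cubical parts of the critical cells that avoid the generator \<open>s + 6\<close>.\<close>

definition mixed_index :: "(nat multiset \<times> nat set) set" where
  "mixed_index = {(u, \<tau>). \<tau> \<subseteq> {..<s} \<and> set_mset u \<subseteq> {..<s} \<and> (\<forall>v. count u v \<le> box) \<and> \<tau> \<subseteq> set_mset u \<and>
     (\<forall>i<s. 2 \<le> i \<longrightarrow> even (count u i)) \<and> odd (count u 0) \<noteq> (0 \<in> \<tau>) \<and> odd (count u 1) \<noteq> (1 \<in> \<tau>) \<and>
     h + even_card u \<tau> = Suc (half_size u)}"

definition part_face :: "nat multiset \<times> nat set \<Rightarrow> (nat multiset \<times> nat set) set" where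
  "part_face p = mk_cell (fst p) (snd p) ` ne_faces"

definition part_block :: "nat multiset \<times> nat set \<Rightarrow> (nat multiset \<times> nat set) set" where
  "part_block p = (\<lambda>i. mk_cell (fst p) (snd p) (diag_triple i)) ` {..<5} \<union> (\<lambda>i. mk_cell (fst p) (snd p) (diag_quad i)) ` {..<5}"

lemma finite_mixed_index: "finite mixed_index"
proof (rule finite_subset)
  show "mixed_index \<subseteq> {u. set_mset u \<subseteq> {..<s} \<and> (\<forall>v. count u v \<le> box)} \<times> Pow {..<s}" by (auto simp: mixed_index_def)
  have "{u. set_mset u \<subseteq> {..<s} \<and> (\<forall>v. count u v \<le> box)} \<subseteq> {u. u \<subseteq># sum (\<lambda>i. replicate_mset box i) {..<s}}"
  proof (rule subsetI, unfold mem_Collect_eq, rule mset_subset_eqI)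
    fix u v assume u: "set_mset u \<subseteq> {..<s} \<and> (\<forall>v. count u v \<le> box)"
    have "count (sum (\<lambda>i. replicate_mset box i) {..<s}) v = (if v < s then box else 0)"
      by (simp add: count_sum sum.delta)
    moreover have "count u v = 0" if "\<not> v < s" using u that by (metis lessThan_iff not_in_iff subsetD)
    ultimately show "count u v \<le> count (sum (\<lambda>i. replicate_mset box i) {..<s}) v" using u by auto
  qed
  then show "finite ({u. set_mset u \<subseteq> {..<s} \<and> (\<forall>v. count u v \<le> box)} \<times> Pow {..<s})"
    using finite_submset finite_subset by blast
qed

lemma even_card_mk_cell: "\<tau> \<subseteq> {..<s} \<Longrightarrow> even_card u (\<tau> \<union> (+) s ` S) = even_card u \<tau>"
  unfolding even_card_def by (rule arg_cong[where f = card]) auto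

lemma verts_mk_cell: "\<tau> \<subseteq> {..<s} \<Longrightarrow> S \<subseteq> {..<6} \<Longrightarrow> verts (\<tau> \<union> (+) s ` S) = S"
  by (auto simp: verts_def)

lemma cell_split:
  assumes "\<sigma> \<subseteq> {..<s+7}" "s + 6 \<notin> \<sigma>" shows "\<sigma> = \<sigma> \<inter> {..<s} \<union> (+) s ` verts \<sigma>"
proof (rule Set.set_eqI)
  fix x
  show "x \<in> \<sigma> \<longleftrightarrow> x \<in> \<sigma> \<inter> {..<s} \<union> (+) s ` verts \<sigma>"
  proof (cases "x < s")
    case False
    then obtain g where g: "x = s + g" using le_Suc_ex not_less by blast
    have "x \<in> \<sigma> \<Longrightarrow> g < 7 \<and> g \<noteq> 6" using assms g by auto
    then show ?thesis using g by (auto simp: verts_def)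
  qed auto
qed

text \<open>A critical cell without \<open>QA\<close> cannot contain \<open>s + 6\<close>, so it is
  a cubical part together with a vertex set \<open>S\<close>. The conditions separate: those on the
  cubical part form \<open>mixed_index\<close>, and \<open>S\<close> ranges over nonempty sets whose
  remainder without 5 is a face.\<close>

lemma crit_split: "crit = pure_crit \<union> (\<Union>p\<in>mixed_index. part_face p \<union> part_block p)"
proof (rule Set.set_eqI)
  fix x :: "nat multiset \<times> nat set"
  obtain u \<sigma> where x: "x = (u, \<sigma>)" by (cases x)
  have "x \<in> crit \<and> \<not> QA u \<sigma> \<longleftrightarrow> (\<exists>\<tau> S. (u, \<tau>) \<in> mixed_index \<and> \<sigma> = \<tau> \<union> (+) s ` S \<and> S \<subseteq> {..<6} \<and> S \<noteq> {} \<and> face (S - {5}))"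
  proof
    assume a: "x \<in> crit \<and> \<not> QA u \<sigma>"
    then have c: "(u, \<sigma>) \<in> cells" and nq: "\<not> QA u \<sigma>" by (auto simp: crit_def x)
    note ci = c[unfolded cells_iff]
    have odd: "\<forall>i<s. 2 \<le> i \<longrightarrow> even (count u i)" using a c by (auto simp: crit_def sub_matched_def x)
    have f: "face (verts \<sigma> - {5})" using a c odd by (auto simp: crit_def quot_matched_def x)
    have ne: "verts \<sigma> \<noteq> {}" using verts_empty[OF c] nq by blast
    then have q: "QC u \<sigma>" and s6: "s + 6 \<notin> \<sigma>" using ci nq by blast+
    have sp: "\<sigma> = \<sigma> \<inter> {..<s} \<union> (+) s ` verts \<sigma>" using cell_split ci s6 by blast
    have e: "even_card u (\<sigma> \<inter> {..<s}) = even_card u \<sigma>" unfolding even_card_def by (rule arg_cong[where f = card]) auto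
    have "h + even_card u \<sigma> = Suc (half_size u)" using q nq by (auto simp: QC_def QA_def)
    then have "(u, \<sigma> \<inter> {..<s}) \<in> mixed_index" using ci odd q nq s2 unfolding mixed_index_def e[symmetric] by (auto simp: QC_def)
    moreover have "verts \<sigma> \<subseteq> {..<6}" by (auto simp: verts_def)
    ultimately show "\<exists>\<tau> S. (u, \<tau>) \<in> mixed_index \<and> \<sigma> = \<tau> \<union> (+) s ` S \<and> S \<subseteq> {..<6} \<and> S \<noteq> {} \<and> face (S - {5})"
      using sp ne f by blast
  next
    assume "\<exists>\<tau> S. (u, \<tau>) \<in> mixed_index \<and> \<sigma> = \<tau> \<union> (+) s ` S \<and> S \<subseteq> {..<6} \<and> S \<noteq> {} \<and> face (S - {5})"
    then obtain \<tau> S where t: "(u, \<tau>) \<in> mixed_index" and \<sigma>: "\<sigma> = \<tau> \<union> (+) s ` S" and S: "S \<subseteq> {..<6}" "S \<noteq> {}" "face (S - {5})" by blast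
    have ts: "\<tau> \<subseteq> {..<s}" using t by (simp add: mixed_index_def)
    have SSs: "verts \<sigma> = S" unfolding \<sigma> by (rule verts_mk_cell[OF ts S(1)])
    have e: "even_card u \<sigma> = even_card u \<tau>" unfolding \<sigma> by (rule even_card_mk_cell[OF ts])
    have nq: "\<not> QA u \<sigma>" using t by (auto simp: QA_def e mixed_index_def)
    have m: "i \<in> \<sigma> \<longleftrightarrow> i \<in> \<tau>" if "i < s" for i using that \<sigma> by auto
    have q: "QC u \<sigma>" using t m[of 0] m[of 1] s2 by (auto simp: QC_def e mixed_index_def)
    have "\<sigma> \<subseteq> {..<s+7}" "\<sigma> \<inter> {s..} \<noteq> {}" "\<sigma> \<inter> {..<s} = \<tau>" "s + 6 \<notin> \<sigma>"
      using ts S by (auto simp: \<sigma>)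
    then have "(u, \<sigma>) \<in> cells" unfolding cells_iff using t q by (auto simp: mixed_index_def)
    moreover have "\<forall>i<s. 2 \<le> i \<longrightarrow> even (count u i)" using t by (simp add: mixed_index_def)
    ultimately show "x \<in> crit \<and> \<not> QA u \<sigma>" using nq S(3) by (auto simp: crit_def sub_matched_def quot_matched_def x SSs)
  qed
  also have "\<dots> \<longleftrightarrow> x \<in> (\<Union>p\<in>mixed_index. part_face p \<union> part_block p)"
  proof
    assume "\<exists>\<tau> S. (u, \<tau>) \<in> mixed_index \<and> \<sigma> = \<tau> \<union> (+) s ` S \<and> S \<subseteq> {..<6} \<and> S \<noteq> {} \<and> face (S - {5})"
    then obtain \<tau> S where t: "(u, \<tau>) \<in> mixed_index" "\<sigma> = \<tau> \<union> (+) s ` S" "S \<subseteq> {..<6}" "S \<noteq> {}" "face (S - {5})" by blast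
    have "x \<in> part_face (u, \<tau>) \<union> part_block (u, \<tau>)"
    proof (cases "face S")
      case True
      then have "S \<in> ne_faces" using t by (simp add: ne_faces_def)
      then show ?thesis using t(2) by (auto simp: part_face_def x mk_cell_def)
    next
      case False
      then have "S \<in> diag_triple ` {..<5} \<union> diag_quad ` {..<5}" using critical_nonfaces[of S] t by blast
      then show ?thesis using t(2) by (auto simp: part_block_def x mk_cell_def)
    qed
    then show "x \<in> (\<Union>p\<in>mixed_index. part_face p \<union> part_block p)" using t(1) by blast
  next
    assume "x \<in> (\<Union>p\<in>mixed_index. part_face p \<union> part_block p)"
    then obtain p where p: "p \<in> mixed_index" "x \<in> part_face p \<union> part_block p" by blast
    obtain \<tau> where pt: "p = (u, \<tau>)" using p(2) by (cases p) (auto simp: part_face_def part_block_def x mk_cell_def)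
    have "\<exists>S. x = mk_cell u \<tau> S \<and> S \<in> ne_faces \<union> (diag_triple ` {..<5} \<union> diag_quad ` {..<5})"
      using p(2) unfolding pt part_face_def part_block_def by auto
    then obtain S where S: "x = mk_cell u \<tau> S" "S \<in> ne_faces \<union> (diag_triple ` {..<5} \<union> diag_quad ` {..<5})" by blast
    have "S \<subseteq> {..<6} \<and> face (S - {5}) \<and> S \<noteq> {}"
    proof (cases "S \<in> ne_faces")
      case True
      then show ?thesis using face_mono[of S "S - {5}"] by (auto simp: ne_faces_def)
    next
      case False
      then have "S \<subseteq> {..<6} \<and> \<not> face S \<and> face (S - {5})" using critical_nonfaces[of S] S(2) by blast
      then show ?thesis using face_empty by blast
    qed
    then show "\<exists>\<tau> S. (u, \<tau>) \<in> mixed_index \<and> \<sigma> = \<tau> \<union> (+) s ` S \<and> S \<subseteq> {..<6} \<and> S \<noteq> {} \<and> face (S - {5})"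
      using S(1) p(1) pt by (auto simp: x mk_cell_def)
  qed
  finally show "x \<in> crit \<longleftrightarrow> x \<in> pure_crit \<union> (\<Union>p\<in>mixed_index. part_face p \<union> part_block p)"
    by (auto simp: pure_crit_def x)
qed

text \<open>Deleting a cubical direction keeps \<open>u\<close>. Directions 0 and 1 are ruled out by
  the parity conditions; any other has an even exponent, so its deletion lowers
  \<open>even_card\<close>, against the equation in \<open>mixed_index\<close>. What is left is the
  deletion of a vertex, which survives only onto a nonface.\<close>

lemma part_nz:
  assumes p: "(u, \<tau>) \<in> mixed_index" "(u', \<tau>') \<in> mixed_index" and S: "S \<subseteq> {..<6}" "S' \<subseteq> {..<6}"
    and c: "mk_cell u \<tau> S \<in> cells" "mk_cell u' \<tau>' S' \<in> cells" and nz: "red_inc (mk_cell u \<tau> S) (mk_cell u' \<tau>' S') \<noteq> (0::'f::comm_ring_1)"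
  shows "u' = u \<and> \<tau>' = \<tau> \<and> (\<exists>g\<in>S. S' = S - {g}) \<and> \<not> face S'"
proof -
  let ?\<sigma> = "\<tau> \<union> (+) s ` S" and ?\<sigma>' = "\<tau>' \<union> (+) s ` S'"
  have t: "\<tau> \<subseteq> {..<s}" "\<tau>' \<subseteq> {..<s}" using p by (auto simp: mixed_index_def)
  have SSs: "verts ?\<sigma> = S" "verts ?\<sigma>' = S'" using verts_mk_cell t S by auto
  have r: "?\<sigma> \<inter> {..<s} = \<tau>" "?\<sigma>' \<inter> {..<s} = \<tau>'" using t by auto
  have s6: "s + 6 \<notin> ?\<sigma>" using t S by auto
  from red_inc_cases[OF c(1)[unfolded mk_cell_def] c(2)[unfolded mk_cell_def] nz[unfolded mk_cell_def]]
  show ?thesis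
  proof cases
    case (1 w)
    then have w: "w \<in> \<tau>" and u: "u' = u" and \<tau>': "\<tau>' = \<tau> - {w}" using r by auto
    have k: "odd (count u 0) \<noteq> (0 \<in> \<tau>)" "odd (count u 1) \<noteq> (1 \<in> \<tau>)" "odd (count u 0) \<noteq> (0 \<in> \<tau> - {w})"
      "odd (count u 1) \<noteq> (1 \<in> \<tau> - {w})" "h + even_card u \<tau> = Suc (half_size u)" "h + even_card u (\<tau> - {w}) = Suc (half_size u)"
      "\<forall>i<s. 2 \<le> i \<longrightarrow> even (count u i)"
      using p unfolding u \<tau>' mixed_index_def by auto
    have "w \<noteq> 0" using k(1,3) w by (cases "w = 0") simp_all
    moreover have "w \<noteq> 1" using k(2,4) w by (cases "w = 1") simp_all
    ultimately have "even (count u w)" using k(7) 1(3) by auto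
    then have "w \<in> {i\<in>\<tau>. i < s \<and> even (count u i)}" using w 1(3) by simp
    then have "{i\<in>\<tau> - {w}. i < s \<and> even (count u i)} \<subset> {i\<in>\<tau>. i < s \<and> even (count u i)}" by blast
    then have "even_card u (\<tau> - {w}) < even_card u \<tau>" unfolding even_card_def by (rule psubset_card_mono[OF fin_even_card])
    then show ?thesis using k(5,6) by simp
  next
    case 2
    then show ?thesis using s6 by blast
  next
    case (3 g)
    have e: "u' = u" "?\<sigma>' = ?\<sigma> - {s + g}" using 3(2) by auto
    then have S': "S' = S - {g}" using 3(3) SSs by simp
    have "\<tau>' = (?\<sigma> - {s + g}) \<inter> {..<s}" using r(2) e(2) by simp
    also have "\<dots> = \<tau>" using r(1) by auto
    finally show ?thesis using e(1) S' 3(1,4) SSs by auto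
  qed
qed

text \<open>Generators are numbered above the cubical directions, so every sign carries the common
  factor \<open>(-1) ^ card \<tau>\<close>, the unit \<open>u\<close> of the Moebius block.\<close>

lemma part_val:
  assumes t: "(u, \<tau>) \<in> mixed_index" and S: "S \<subseteq> {..<6}" "g \<in> S" "\<not> face (S - {g})"
    and c: "mk_cell u \<tau> S \<in> cells" "mk_cell u \<tau> (S - {g}) \<in> cells"
  shows "red_inc (mk_cell u \<tau> S) (mk_cell u \<tau> (S - {g})) = ((-1) ^ card \<tau> * (-1) ^ card {w\<in>S. w < g} :: 'f::comm_ring_1)"
proof -
  let ?\<sigma> = "\<tau> \<union> (+) s ` S"
  have ts: "\<tau> \<subseteq> {..<s}" using t by (simp add: mixed_index_def)
  have e: "\<tau> \<union> (+) s ` (S - {g}) = ?\<sigma> - {s + g}" using ts by auto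
  have SSs: "verts ?\<sigma> = S" by (rule verts_mk_cell[OF ts S(1)])
  have "xlab (?\<sigma> - {s + g}) = xlab ?\<sigma>" using xlab_remove[of g ?\<sigma>] S SSs by simp
  moreover have "s + g \<in> ?\<sigma>" using S(2) by blast
  ultimately have v: "red_inc (mk_cell u \<tau> S) (mk_cell u \<tau> (S - {g})) = (sg (s + g) ?\<sigma> :: 'f)"
    using red_inc_val[of u ?\<sigma> "s + g", where 'f = 'f] c unfolding mk_cell_def e by simp
  have "{w\<in>?\<sigma>. w < s + g} = \<tau> \<union> (+) s ` {w\<in>S. w < g}" using ts by auto
  moreover have "card (\<tau> \<union> (+) s ` {w\<in>S. w < g}) = card \<tau> + card ((+) s ` {w\<in>S. w < g})"
    using ts S(1) by (intro card_Un_disjoint) (auto intro: finite_subset)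
  moreover have "card ((+) s ` {w\<in>S. w < g}) = card {w\<in>S. w < g}" by (rule card_image) simp
  ultimately show ?thesis unfolding v sg_def by (simp add: power_add)
qed

lemma dm_mk_cell: "\<tau> \<subseteq> {..<s} \<Longrightarrow> S \<subseteq> {..<6} \<Longrightarrow> dm (mk_cell u \<tau> S) = card \<tau> + card S"
proof -
  assume a: "\<tau> \<subseteq> {..<s}" "S \<subseteq> {..<6}"
  have "card (\<tau> \<union> (+) s ` S) = card \<tau> + card ((+) s ` S)"
    using a by (intro card_Un_disjoint) (auto intro: finite_subset)
  moreover have "card ((+) s ` S) = card S" by (rule card_image) simp
  ultimately show ?thesis by (simp add: dm_def mk_cell_def)
qed

lemma mk_cell_inj: "\<tau> \<subseteq> {..<s} \<Longrightarrow> \<tau>' \<subseteq> {..<s} \<Longrightarrow> S \<subseteq> {..<6} \<Longrightarrow> S' \<subseteq> {..<6} \<Longrightarrow>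
    mk_cell u \<tau> S = mk_cell u' \<tau>' S' \<longleftrightarrow> u = u' \<and> \<tau> = \<tau>' \<and> S = S'"
proof -
  assume a: "\<tau> \<subseteq> {..<s}" "\<tau>' \<subseteq> {..<s}" "S \<subseteq> {..<6}" "S' \<subseteq> {..<6}"
  have r: "(\<tau> \<union> (+) s ` S) \<inter> {..<s} = \<tau>" "(\<tau>' \<union> (+) s ` S') \<inter> {..<s} = \<tau>'" using a by auto
  show ?thesis unfolding mk_cell_def using r verts_mk_cell[OF a(1,3)] verts_mk_cell[OF a(2,4)] by auto
qed

text \<open>With even exponents \<open>QA\<close> bounds \<open>h + card \<tau>\<close> by
  \<open>half_size u\<close>, for \<open>\<tau>\<close> the cubical part of \<sigma>, while escaping
  \<open>sub_matched\<close> gives the reverse bound even after the least variable of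
  \<open>u\<close> is taken out of \<open>\<tau>\<close>. So equality holds and that variable is not
  in \<open>\<tau>\<close>.\<close>

lemma pure_crit_iff: "(u, \<sigma>) \<in> pure_crit \<longleftrightarrow> (u, \<sigma>) \<in> cells \<and> \<sigma> \<inter> {s..} = {s + 6} \<and> (\<forall>i<s. even (count u i)) \<and>
    h + card (\<sigma> \<inter> {..<s}) = half_size u \<and> (LEAST i. i \<in># u) \<notin> \<sigma>"
proof (cases "(u, \<sigma>) \<in> cells \<and> (\<forall>i<s. even (count u i)) \<and> \<sigma> \<inter> {s..} = {s + 6}")
  case True
  let ?L = "LEAST i. i \<in># u"
  have ci: "set_mset u \<subseteq> {..<s}" using True by (simp add: cells_iff)
  have e: "even_card u \<sigma> = card (\<sigma> \<inter> {..<s})" unfolding even_card_def using True by (intro arg_cong[where f = card]) auto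
  have SSe: "verts \<sigma> = {}"
  proof -
    have "s + g \<notin> \<sigma>" if "g < 6" for g
    proof
      assume "s + g \<in> \<sigma>"
      then have "s + g \<in> \<sigma> \<inter> {s..}" by simp
      then show False using True that by simp
    qed
    then show ?thesis by (auto simp: verts_def)
  qed
  have "(u, \<sigma>) \<in> pure_crit \<longleftrightarrow> QA u \<sigma> \<and> half_size u \<le> card (\<sigma> \<inter> {..<s} - {?L}) + h"
    using True SSe by (auto simp: pure_crit_def crit_def sub_matched_def quot_matched_def)
  also have "\<dots> \<longleftrightarrow> h + card (\<sigma> \<inter> {..<s}) = half_size u \<and> ?L \<notin> \<sigma>"
  proof (cases "?L \<in> \<sigma>")
    case L: True
    have "\<not> (QA u \<sigma> \<and> half_size u \<le> card (\<sigma> \<inter> {..<s} - {?L}) + h)"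
    proof
      assume a: "QA u \<sigma> \<and> half_size u \<le> card (\<sigma> \<inter> {..<s} - {?L}) + h"
      then have "u \<noteq> {#}" using h1 by (auto simp: QA_def half_size_def)
      then have "\<exists>i. i \<in># u" by auto
      then have "?L \<in># u" by (rule LeastI_ex)
      then have "?L \<in> \<sigma> \<inter> {..<s}" using ci L by auto
      then have "card (\<sigma> \<inter> {..<s} - {?L}) < card (\<sigma> \<inter> {..<s})" by (intro psubset_card_mono) auto
      then show False using a e by (simp add: QA_def)
    qed
    then show ?thesis using L by blast
  qed (auto simp: QA_def e)
  finally show ?thesis using True by blast
next
  case False
  have "(u, \<sigma>) \<notin> pure_crit"
  proof
    assume y: "(u, \<sigma>) \<in> pure_crit"
    then have c: "(u, \<sigma>) \<in> cells" and q: "QA u \<sigma>" and w: "(u, \<sigma>) \<notin> sub_matched" by (auto simp: pure_crit_def crit_def)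
    then have "verts \<sigma> = {}" "\<forall>i<s. even (count u i)" by (auto simp: sub_matched_def)
    then show False using verts_empty[OF c] False c by blast
  qed
  then show ?thesis using False by blast
qed

text \<open>An incidence would have to delete a cubical direction, but \<open>u\<close> is fixed and
  determines the number of directions.\<close>

lemma red_inc_pure_crit: assumes "x \<in> pure_crit" "y \<in> pure_crit" shows "red_inc x y = (0::'f::comm_ring_1)"
proof (rule ccontr)
  assume nz: "red_inc x y \<noteq> (0::'f)"
  obtain u \<sigma> where x: "x = (u, \<sigma>)" by (cases x)
  have X: "(u, \<sigma>) \<in> cells" "\<sigma> \<inter> {s..} = {s + 6}" "h + card (\<sigma> \<inter> {..<s}) = half_size u" using assms(1) unfolding x pure_crit_iff by blast+
  have yc: "y \<in> cells" using assms(2) by (auto simp: pure_crit_def crit_def)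
  from red_inc_nz[OF X(1) yc nz[unfolded x]] obtain v where v: "v \<in> \<sigma>" "y = (u, \<sigma> - {v})" .
  have Y: "(\<sigma> - {v}) \<inter> {s..} = {s + 6}" "h + card ((\<sigma> - {v}) \<inter> {..<s}) = half_size u" using assms(2) unfolding v pure_crit_iff by blast+
  have "v < s"
  proof (rule ccontr)
    assume "\<not> v < s"
    then have "v \<in> \<sigma> \<inter> {s..}" using v(1) by simp
    then have "v = s + 6" unfolding X(2) by simp
    moreover have "s + 6 \<in> (\<sigma> - {v}) \<inter> {s..}" unfolding Y(1) by simp
    ultimately show False by blast
  qed
  then have "v \<in> \<sigma> \<inter> {..<s}" using v(1) by simp
  then have "card ((\<sigma> - {v}) \<inter> {..<s}) < card (\<sigma> \<inter> {..<s})" by (intro psubset_card_mono) auto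
  then show False using X(3) Y(2) by simp
qed

lemma part_cells: "p \<in> mixed_index \<Longrightarrow> part_face p \<union> part_block p \<subseteq> cells"
  using crit_split by (auto simp: crit_def)

lemma nonface_shapes: "i < 5 \<Longrightarrow> diag_triple i \<subseteq> {..<6} \<and> \<not> face (diag_triple i)" "i < 5 \<Longrightarrow> diag_quad i \<subseteq> {..<6} \<and> \<not> face (diag_quad i)"
  using critical_nonfaces[of "diag_triple i"] critical_nonfaces[of "diag_quad i"] by blast+

lemma part_face_elem:
  assumes "x \<in> part_face p" obtains S where "S \<subseteq> {..<6}" "face S" "S \<in> ne_faces" "x = mk_cell (fst p) (snd p) S"
  using assms unfolding part_face_def ne_faces_def by blast

lemma part_block_elem:
  assumes "x \<in> part_block p" obtains S where "S \<subseteq> {..<6}" "\<not> face S" "x = mk_cell (fst p) (snd p) S"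
  using assms nonface_shapes unfolding part_block_def by blast

lemma part_elem:
  assumes "x \<in> part_face p \<union> part_block p" obtains S where "S \<subseteq> {..<6}" "x = mk_cell (fst p) (snd p) S"
proof (cases "x \<in> part_face p")
  case True
  then show thesis by (rule part_face_elem) (rule that)
next
  case False
  then have "x \<in> part_block p" using assms by blast
  then show thesis by (rule part_block_elem) (rule that)
qed

text \<open>Incidences end in nonfaces, and a subset of a face is a face. So the cells over faces
  are isolated, and each gives one class in every characteristic.\<close>

lemma red_inc_part_face:
  assumes p: "p \<in> mixed_index" and x: "x \<in> part_face p" and y: "y \<in> part_face p \<union> part_block p"
  shows "red_inc x y = (0::'f::comm_ring_1)" "y \<in> part_face p \<union> part_block p \<Longrightarrow> red_inc y x = (0::'f)"
proof -
  obtain S where S: "S \<subseteq> {..<6}" "face S" "x = mk_cell (fst p) (snd p) S" using x by (rule part_face_elem)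
  obtain S' where S': "S' \<subseteq> {..<6}" "y = mk_cell (fst p) (snd p) S'" using y by (rule part_elem)
  have c: "x \<in> cells" "y \<in> cells" using part_cells[OF p] x y by blast+
  have p': "(fst p, snd p) \<in> mixed_index" using p by simp
  show "red_inc x y = (0::'f)"
  proof (rule ccontr)
    assume "red_inc x y \<noteq> (0::'f)"
    from part_nz[OF p' p' S(1) S'(1) c[unfolded S(3) S'(2)] this[unfolded S(3) S'(2)]]
    obtain g where "S' = S - {g}" "\<not> face S'" by blast
    then show False using face_mono[OF S(2), of S'] by blast
  qed
  show "red_inc y x = (0::'f)"
  proof (rule ccontr)
    assume "red_inc y x \<noteq> (0::'f)"
    from part_nz[OF p' p' S'(1) S(1) c(2,1)[unfolded S(3) S'(2)] this[unfolded S(3) S'(2)]]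
    show False using S(2) by blast
  qed
qed

lemma red_inc_other_part:
  assumes p: "p \<in> mixed_index" "p' \<in> mixed_index" and ne: "p \<noteq> p'" and x: "x \<in> part_face p \<union> part_block p" and y: "y \<in> part_face p' \<union> part_block p'"
  shows "red_inc x y = (0::'f::comm_ring_1)"
proof (rule ccontr)
  assume nz: "red_inc x y \<noteq> (0::'f)"
  obtain S where S: "S \<subseteq> {..<6}" "x = mk_cell (fst p) (snd p) S" using x by (rule part_elem)
  obtain S' where S': "S' \<subseteq> {..<6}" "y = mk_cell (fst p') (snd p') S'" using y by (rule part_elem)
  have c: "x \<in> cells" "y \<in> cells" using part_cells[OF p(1)] part_cells[OF p(2)] x y by blast+
  have p': "(fst p, snd p) \<in> mixed_index" "(fst p', snd p') \<in> mixed_index" using p by simp_all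
  from part_nz[OF p' S(1) S'(1) c[unfolded S(2) S'(2)] nz[unfolded S(2) S'(2)]]
  have "fst p' = fst p \<and> snd p' = snd p" by blast
  then show False using ne by (simp add: prod_eq_iff)
qed

lemma mixed_index_sub: "p \<in> mixed_index \<Longrightarrow> snd p \<subseteq> {..<s}" by (auto simp: mixed_index_def)

lemma part_disjoint:
  assumes p: "p \<in> mixed_index" "p' \<in> mixed_index" and ne: "p \<noteq> p'"
  shows "(part_face p \<union> part_block p) \<inter> (part_face p' \<union> part_block p') = {}"
proof (rule equals0I)
  fix x assume "x \<in> (part_face p \<union> part_block p) \<inter> (part_face p' \<union> part_block p')"
  then have x: "x \<in> part_face p \<union> part_block p" "x \<in> part_face p' \<union> part_block p'" by blast+
  obtain S where S: "S \<subseteq> {..<6}" "x = mk_cell (fst p) (snd p) S" using x(1) by (rule part_elem)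
  obtain S' where S': "S' \<subseteq> {..<6}" "x = mk_cell (fst p') (snd p') S'" using x(2) by (rule part_elem)
  have "fst p = fst p' \<and> snd p = snd p'"
    using mk_cell_inj[OF mixed_index_sub[OF p(1)] mixed_index_sub[OF p(2)] S(1) S'(1)] S(2) S'(2) by metis
  then show False using ne by (simp add: prod_eq_iff)
qed

lemma red_inc_part_block:
  assumes p: "p \<in> mixed_index" and S: "S \<subseteq> {..<6}" "S' \<subseteq> {..<6}" "\<not> face S'"
    and c: "mk_cell (fst p) (snd p) S \<in> cells" "mk_cell (fst p) (snd p) S' \<in> cells"
  shows "red_inc (mk_cell (fst p) (snd p) S) (mk_cell (fst p) (snd p) S') = ((-1) ^ card (snd p) * of_int (simplex_inc S S') :: 'f::comm_ring_1)"
proof (cases "\<exists>g\<in>S. S' = S - {g}")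
  case True
  then obtain g where g: "g \<in> S" "S' = S - {g}" by blast
  have "finite S" using S(1) finite_subset by blast
  moreover have "(fst p, snd p) \<in> mixed_index" using p by simp
  ultimately show ?thesis
    using part_val[of "fst p" "snd p" S g, where 'f = 'f] S c g by (simp add: simplex_inc_remove)
next
  case False
  have p': "(fst p, snd p) \<in> mixed_index" using p by simp
  have "red_inc (mk_cell (fst p) (snd p) S) (mk_cell (fst p) (snd p) S') = (0::'f)"
    using part_nz[OF p' p' S(1,2) c, where 'f = 'f] False by blast
  moreover have "simplex_inc S S' = 0" by (rule simplex_inc_other) (use False in blast)
  ultimately show ?thesis by simp
qed

lemma moebius_part:
  assumes p: "p \<in> mixed_index"
  shows "moebius_block (\<lambda>i. mk_cell (fst p) (snd p) (diag_triple i)) (\<lambda>i. mk_cell (fst p) (snd p) (diag_quad i)) dm (red_inc :: _ \<Rightarrow> _ \<Rightarrow> 'f::comm_ring_1)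
    ((-1) ^ card (snd p)) (card (snd p) + 3)"
proof
  note ts = mixed_index_sub[OF p]
  have ca: "mk_cell (fst p) (snd p) (diag_triple i) \<in> cells" "mk_cell (fst p) (snd p) (diag_quad i) \<in> cells" if "i < 5" for i
    using part_cells[OF p] that unfolding part_block_def by blast+
  show "i = j" if "i < 5" "j < 5" "mk_cell (fst p) (snd p) (diag_triple i) = mk_cell (fst p) (snd p) (diag_triple j)" for i j
    using mk_cell_inj[OF ts ts, of "diag_triple i" "diag_triple j"] nonface_shapes(1)[of i] nonface_shapes(1)[of j] inj_diag_triple_diag_quad that by simp
  show "i = j" if "i < 5" "j < 5" "mk_cell (fst p) (snd p) (diag_quad i) = mk_cell (fst p) (snd p) (diag_quad j)" for i j
    using mk_cell_inj[OF ts ts, of "diag_quad i" "diag_quad j"] nonface_shapes(2)[of i] nonface_shapes(2)[of j] inj_diag_triple_diag_quad that by simp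
  show dma: "dm (mk_cell (fst p) (snd p) (diag_triple i)) = card (snd p) + 3" if "i < 5" for i
    using dm_mk_cell[OF ts, of "diag_triple i"] nonface_shapes(1)[of i] card_diag_triple_diag_quad that by simp
  show dmb: "dm (mk_cell (fst p) (snd p) (diag_quad i)) = Suc (card (snd p) + 3)" if "i < 5" for i
    using dm_mk_cell[OF ts, of "diag_quad i"] nonface_shapes(2)[of i] card_diag_triple_diag_quad that by simp
  show "(-1) ^ card (snd p) * (-1) ^ card (snd p) = (1::'f)" by (simp flip: power_add)
  show "red_inc (mk_cell (fst p) (snd p) (diag_quad i)) (mk_cell (fst p) (snd p) (diag_triple j)) = ((-1) ^ card (snd p) * blockM i j :: 'f)"
    if "i < 5" "j < 5" for i j
    using red_inc_part_block[OF p, of "diag_quad i" "diag_triple j", where 'f = 'f] nonface_shapes(2)[of i] nonface_shapes(1)[of j] ca that simplex_inc_diag_quad_diag_triple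
    by (simp add: of_int_blockM)
  show "red_inc (mk_cell (fst p) (snd p) (diag_triple i)) (mk_cell (fst p) (snd p) (diag_triple j)) = (0::'f) \<and>
      red_inc (mk_cell (fst p) (snd p) (diag_triple i)) (mk_cell (fst p) (snd p) (diag_quad j)) = (0::'f)" if "i < 5" "j < 5" for i j
    using red_inc_grade[OF ca(1) ca(1), of i j, where 'f = 'f] red_inc_grade[OF ca(1) ca(2), of i j, where 'f = 'f] dma dmb that by fastforce
  show "red_inc (mk_cell (fst p) (snd p) (diag_quad i)) (mk_cell (fst p) (snd p) (diag_quad j)) = (0::'f)" if "i < 5" "j < 5" for i j
    using red_inc_grade[OF ca(2) ca(2), of i j, where 'f = 'f] dmb that by fastforce
qed

lemma hdim_part_block:
  assumes p: "p \<in> mixed_index" and e: "(e = 1 \<and> (2::'f::comm_ring_1) = 0) \<or> (e = 0 \<and> (\<exists>t::'f. 2 * t = 1))"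
  shows "hdim (part_block p) dm (red_inc :: _ \<Rightarrow> _ \<Rightarrow> 'f) j (if j = card (snd p) + 3 \<or> j = card (snd p) + 4 then e else 0)"
proof -
  interpret M: moebius_block "\<lambda>i. mk_cell (fst p) (snd p) (diag_triple i)" "\<lambda>i. mk_cell (fst p) (snd p) (diag_quad i)" dm "red_inc :: _ \<Rightarrow> _ \<Rightarrow> 'f"
    "(-1) ^ card (snd p)" "card (snd p) + 3" by (rule moebius_part[OF p])
  have W: "part_block p = M.W" unfolding part_block_def M.W_def ..
  show ?thesis using e
  proof (elim disjE conjE exE)
    assume "e = 1" "(2::'f) = 0"
    have "(if j = card (snd p) + 3 \<or> j = Suc (card (snd p) + 3) then 1 else 0) =
        (if j = card (snd p) + 3 \<or> j = card (snd p) + 4 then e else 0)" using \<open>e = 1\<close> by simp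
    then show ?thesis using M.hdim_char2[OF \<open>(2::'f) = 0\<close>, of j] unfolding W by (simp only:)
  next
    fix t :: 'f assume "e = 0" "2 * t = 1"
    then show ?thesis using M.hdim_half[of t j] unfolding W by simp
  qed
qed

lemma hdim_part_face:
  assumes p: "p \<in> mixed_index"
  shows "hdim (part_face p) dm (red_inc :: _ \<Rightarrow> _ \<Rightarrow> 'f::comm_ring_1) j (\<Sum>S\<in>ne_faces. if card (snd p) + card S = j then 1 else 0)"
proof -
  note ts = mixed_index_sub[OF p]
  have FS6: "S \<subseteq> {..<6}" if "S \<in> ne_faces" for S using that by (simp add: ne_faces_def)
  have mem: "mk_cell (fst p) (snd p) S \<in> part_face p" if "S \<in> ne_faces" for S using that by (simp add: part_face_def)
  have "hdim (\<Union>S\<in>ne_faces. {mk_cell (fst p) (snd p) S}) dm (red_inc :: _ \<Rightarrow> _ \<Rightarrow> 'f) j (\<Sum>S\<in>ne_faces. if card (snd p) + card S = j then 1 else 0)"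
  proof (rule hdim_UN[OF finite_ne_faces])
    show "{mk_cell (fst p) (snd p) S} \<inter> {mk_cell (fst p) (snd p) S'} = {}" if "S \<in> ne_faces" "S' \<in> ne_faces" "S \<noteq> S'" for S S'
      using mk_cell_inj[OF ts ts FS6[OF that(1)] FS6[OF that(2)]] that(3) by simp
    show "red_inc a b = (0::'f)" if "S \<in> ne_faces" "S' \<in> ne_faces" "a \<in> {mk_cell (fst p) (snd p) S}" "b \<in> {mk_cell (fst p) (snd p) S'}" for S S' a b
      using red_inc_part_face(1)[OF p mem[OF that(1)], of b] mem[OF that(2)] that(3,4) by simp
    show "hdim {mk_cell (fst p) (snd p) S} dm (red_inc :: _ \<Rightarrow> _ \<Rightarrow> 'f) j (if card (snd p) + card S = j then 1 else 0)" if S: "S \<in> ne_faces" for S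
    proof -
      have "red_inc (mk_cell (fst p) (snd p) S) (mk_cell (fst p) (snd p) S) = (0::'f)"
        using red_inc_part_face(1)[OF p mem[OF S]] mem[OF S] by blast
      from hdim_single[where \<epsilon> = red_inc, OF this, of dm j] show ?thesis unfolding dm_mk_cell[OF ts FS6[OF S]] .
    qed
  qed simp
  moreover have "(\<Union>S\<in>ne_faces. {mk_cell (fst p) (snd p) S}) = part_face p" by (auto simp: part_face_def)
  ultimately show ?thesis by simp
qed

text \<open>Pure and mixed cells do not interact: \<open>QA\<close> passes to faces, so a pure cell
  has no mixed face, and a mixed cell lacks \<open>s + 6\<close>, so it has no pure face. Only the
  Moebius blocks bring in the value \<open>e\<close>.\<close>

theorem hdim_cells:
  assumes e: "(e = 1 \<and> (2::'f::comm_ring_1) = 0) \<or> (e = 0 \<and> (\<exists>t::'f. 2 * t = 1))"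
  shows "hdim cells dm (red_inc :: _ \<Rightarrow> _ \<Rightarrow> 'f) (Suc j) (card {x\<in>pure_crit. dm x = Suc j} + (\<Sum>p\<in>mixed_index. part_dim e (Suc j) (card (snd p))))"
  unfolding hdim_crit crit_split
proof (rule hdim_union)
  have Y1c: "pure_crit \<subseteq> cells" by (auto simp: pure_crit_def crit_def)
  show fY: "finite pure_crit" using Y1c finite_cells finite_subset by blast
  have fp: "finite (part_face p \<union> part_block p)" for p
    by (simp add: part_face_def part_block_def finite_ne_faces)
  show "finite (\<Union>p\<in>mixed_index. part_face p \<union> part_block p)" using finite_mixed_index fp by blast
  have T2q: "\<exists>u \<tau> S. x = mk_cell u \<tau> S \<and> x \<in> cells \<and> \<not> QA (fst x) (snd x) \<and> s + 6 \<notin> snd x" if x: "x \<in> (\<Union>p\<in>mixed_index. part_face p \<union> part_block p)" for x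
  proof -
    obtain p where p: "p \<in> mixed_index" "x \<in> part_face p \<union> part_block p" using x by blast
    obtain S where S: "S \<subseteq> {..<6}" "x = mk_cell (fst p) (snd p) S" using p(2) by (rule part_elem)
    have "h + even_card (fst p) (snd p) = Suc (half_size (fst p))" using p(1) by (auto simp: mixed_index_def)
    then have "\<not> QA (fst x) (snd x)" unfolding S(2) mk_cell_def by (simp add: QA_def even_card_mk_cell[OF mixed_index_sub[OF p(1)]])
    moreover have "s + 6 \<notin> snd x" using mixed_index_sub[OF p(1)] S by (auto simp: mk_cell_def)
    ultimately show ?thesis using S(2) part_cells[OF p(1)] p(2) by blast
  qed
  show "pure_crit \<inter> (\<Union>p\<in>mixed_index. part_face p \<union> part_block p) = {}"
  proof (rule equals0I)
    fix x assume "x \<in> pure_crit \<inter> (\<Union>p\<in>mixed_index. part_face p \<union> part_block p)"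
    then have "x \<in> pure_crit" "x \<in> (\<Union>p\<in>mixed_index. part_face p \<union> part_block p)" by blast+
    then show False using T2q[of x] by (simp add: pure_crit_def)
  qed
  show "red_inc a b = (0::'f) \<and> red_inc b a = (0::'f)" if a: "a \<in> pure_crit" and b: "b \<in> (\<Union>p\<in>mixed_index. part_face p \<union> part_block p)" for a b
  proof -
    obtain u \<sigma> where x: "a = (u, \<sigma>)" by (cases a)
    have qa: "QA u \<sigma>" "(u, \<sigma>) \<in> cells" "\<sigma> \<inter> {s..} = {s + 6}" using a pure_crit_iff[of u \<sigma>] by (auto simp: x pure_crit_def crit_def)
    obtain u' \<sigma>' where y: "b = (u', \<sigma>')" by (cases b)
    have qb: "b \<in> cells" "\<not> QA u' \<sigma>'" "s + 6 \<notin> \<sigma>'" using T2q[OF b] by (auto simp: y)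
    have "red_inc a b = (0::'f)"
    proof (rule ccontr)
      assume nz: "red_inc a b \<noteq> (0::'f)"
      from red_inc_nz[OF qa(2) qb(1) nz[unfolded x]] obtain v where "b = (u, \<sigma> - {v})" .
      then show False using QA_mono[OF qa(1), of "\<sigma> - {v}"] qb(2) y by auto
    qed
    moreover have "red_inc b a = (0::'f)"
    proof (rule ccontr)
      assume nz: "red_inc b a \<noteq> (0::'f)"
      have ac: "a \<in> cells" using qa x by simp
      from red_inc_nz[OF qb(1)[unfolded y] ac nz[unfolded y]] obtain v where "a = (u', \<sigma>' - {v})" .
      then have "\<sigma> \<subseteq> \<sigma>'" using x by auto
      then show False using qa(3) qb(3) by auto
    qed
    ultimately show ?thesis ..
  qed
  have "hdim (\<Union>x\<in>pure_crit. {x}) dm (red_inc :: _ \<Rightarrow> _ \<Rightarrow> 'f) (Suc j) (\<Sum>x\<in>pure_crit. if dm x = Suc j then 1 else 0)"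
  proof (rule hdim_UN[OF fY])
    show "hdim {x} dm (red_inc :: _ \<Rightarrow> _ \<Rightarrow> 'f) (Suc j) (if dm x = Suc j then 1 else 0)" if "x \<in> pure_crit" for x
      by (rule hdim_single[where \<epsilon> = red_inc, OF red_inc_pure_crit[OF that that]])
    show "red_inc a b = (0::'f)" if "x \<in> pure_crit" "y \<in> pure_crit" "a \<in> {x}" "b \<in> {y}" for x y a b
      using red_inc_pure_crit[of a b] that by simp
  qed auto
  then show "hdim pure_crit dm (red_inc :: _ \<Rightarrow> _ \<Rightarrow> 'f) (Suc j) (card {x\<in>pure_crit. dm x = Suc j})"
    by (simp add: sum.inter_filter[OF fY, symmetric])
  show "hdim (\<Union>p\<in>mixed_index. part_face p \<union> part_block p) dm (red_inc :: _ \<Rightarrow> _ \<Rightarrow> 'f) (Suc j) (\<Sum>p\<in>mixed_index. part_dim e (Suc j) (card (snd p)))"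
  proof (rule hdim_UN[OF finite_mixed_index fp])
    show "(part_face p \<union> part_block p) \<inter> (part_face p' \<union> part_block p') = {}" if "p \<in> mixed_index" "p' \<in> mixed_index" "p \<noteq> p'" for p p'
      using that by (rule part_disjoint)
    show "red_inc a b = (0::'f)" if "p \<in> mixed_index" "p' \<in> mixed_index" "p \<noteq> p'" "a \<in> part_face p \<union> part_block p" "b \<in> part_face p' \<union> part_block p'" for p p' a b
      using that by (rule red_inc_other_part)
    show "hdim (part_face p \<union> part_block p) dm (red_inc :: _ \<Rightarrow> _ \<Rightarrow> 'f) (Suc j) (part_dim e (Suc j) (card (snd p)))" if p: "p \<in> mixed_index" for p
      unfolding part_dim_def
    proof (rule hdim_union)
      show "finite (part_face p)" "finite (part_block p)" using fp[of p] by simp_all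
      show "part_face p \<inter> part_block p = {}"
      proof (rule equals0I)
        fix x assume "x \<in> part_face p \<inter> part_block p"
        then have x: "x \<in> part_face p" "x \<in> part_block p" by blast+
        obtain S where S: "S \<subseteq> {..<6}" "face S" "x = mk_cell (fst p) (snd p) S" using x(1) by (rule part_face_elem)
        obtain S' where S': "S' \<subseteq> {..<6}" "\<not> face S'" "x = mk_cell (fst p) (snd p) S'" using x(2) by (rule part_block_elem)
        have "S = S'" using mk_cell_inj[OF mixed_index_sub[OF p] mixed_index_sub[OF p] S(1) S'(1)] S(3) S'(3) by metis
        then show False using S(2) S'(2) by blast
      qed
      show "red_inc a b = (0::'f) \<and> red_inc b a = (0::'f)" if "a \<in> part_face p" "b \<in> part_block p" for a b
        using red_inc_part_face[OF p that(1), of b, where 'f = 'f] that(2) by blast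
    qed (rule hdim_part_face[OF p] hdim_part_block[OF p e])+
  qed
qed

end

section \<open>Counting the critical cells\<close>

context rp2_power begin

definition half_mset :: "nat multiset \<Rightarrow> nat multiset" where
  "half_mset u = (\<Sum>i<s. replicate_mset (count u i div 2) i)"

lemma count_half_mset: "count (half_mset u) i = (if i < s then count u i div 2 else 0)"
  by (simp add: half_mset_def count_sum sum.delta)

lemma size_count: "set_mset y \<subseteq> {..<s} \<Longrightarrow> size y = (\<Sum>i<s. count y i)"
  unfolding size_multiset_overloaded_eq by (rule sum.mono_neutral_left) (auto simp: not_in_iff)

lemma set_half_mset: "set_mset (half_mset u) \<subseteq> {..<s}"
  by (auto simp: count_half_mset simp flip: count_greater_zero_iff split: if_splits)

lemma count_mset_set_if: "finite A \<Longrightarrow> count (mset_set A) i = (if i \<in> A then 1 else 0)"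
  by simp

lemma sum_indicator_card: "\<tau> \<subseteq> {..<s} \<Longrightarrow> (\<Sum>i<s. if i \<in> \<tau> then 1 else 0) = card \<tau>"
  by (simp add: sum.If_cases Int_absorb1)

lemma half_size_shift:
  assumes "\<tau> \<subseteq> {..<s}" "set_mset b \<subseteq> {..<s}" "\<And>i. i < s \<Longrightarrow> count u i div 2 = count b i + (if i \<in> \<tau> then 1 else 0)"
  shows "half_size u = size b + card \<tau>"
proof -
  have "half_size u = (\<Sum>i<s. count b i + (if i \<in> \<tau> then 1 else 0))"
    unfolding half_size_def by (rule sum.cong) (use assms(3) in auto)
  also have "\<dots> = (\<Sum>i<s. count b i) + card \<tau>"
    unfolding sum.distrib sum_indicator_card[OF assms(1)] ..
  finally show ?thesis unfolding size_count[OF assms(2)] .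
qed

lemma even_card_all: "\<tau> \<subseteq> {..<s} \<Longrightarrow> \<forall>i\<in>\<tau>. even (count u i) \<Longrightarrow> even_card u \<tau> = card \<tau>"
  unfolding even_card_def by (rule arg_cong[where f = card]) auto

text \<open>The top corner of the cube with directions \<open>\<tau>\<close> whose bottom corner is
  the square of \<open>b\<close> times, once each, the variables 0, 1 and those of
  \<open>\<tau>\<close>.\<close>

definition psi :: "nat set \<Rightarrow> nat multiset \<Rightarrow> nat multiset" where
  "psi \<tau> b = b + b + mset_set \<tau> + mset_set (\<tau> \<inter> {2..}) + mset_set {0,1}"

lemma count_psi: "\<tau> \<subseteq> {..<s} \<Longrightarrow> count (psi \<tau> b) i =
    2 * count b i + (if i \<in> \<tau> then 1 else 0) + (if i \<in> \<tau> \<and> 2 \<le> i then 1 else 0) + (if i < 2 then 1 else 0)"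
proof -
  assume "\<tau> \<subseteq> {..<s}"
  then have "finite \<tau>" using finite_subset by blast
  moreover have "i \<in> {0,1} \<longleftrightarrow> i < 2" by auto
  ultimately show ?thesis unfolding psi_def count_union by (simp add: count_mset_set_if del: count_mset_set(3))
qed

lemma half_mset_minus:
  assumes \<tau>: "\<tau> \<subseteq> {..<s}" "\<tau> \<subseteq> set_mset u" "\<forall>i\<in>\<tau>. even (count u i)"
  shows "i < s \<Longrightarrow> count u i div 2 = count (half_mset u - mset_set \<tau>) i + (if i \<in> \<tau> then 1 else 0)"
    "set_mset (half_mset u - mset_set \<tau>) \<subseteq> {..<s}" "size (half_mset u - mset_set \<tau>) + card \<tau> = half_size u"
proof -
  have f: "finite \<tau>" using \<tau>(1) finite_subset by blast
  show c: "count u i div 2 = count (half_mset u - mset_set \<tau>) i + (if i \<in> \<tau> then 1 else 0)" if "i < s" for i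
  proof (cases "i \<in> \<tau>")
    case True
    then have "0 < count u i" "even (count u i)" using \<tau> by auto
    then have "1 \<le> count u i div 2" by (elim evenE) auto
    then show ?thesis using True that f by (simp add: count_half_mset)
  qed (use that f in \<open>simp add: count_half_mset\<close>)
  show s: "set_mset (half_mset u - mset_set \<tau>) \<subseteq> {..<s}" using set_half_mset[of u] by (meson in_diffD subset_iff)
  show "size (half_mset u - mset_set \<tau>) + card \<tau> = half_size u" using half_size_shift[OF \<tau>(1) s c] by simp
qed

lemma psi_mixed_index:
  assumes \<tau>: "\<tau> \<subseteq> {..<s}" and b: "b \<in> multisets_of_size {..<s} (h - 1)"
  shows "(psi \<tau> b, \<tau>) \<in> mixed_index"
proof -
  have sb: "set_mset b \<subseteq> {..<s}" "size b = h - 1" using b by (auto simp: multisets_of_size_def)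
  note c = count_psi[OF \<tau>, of b]
  have pos: "i \<in># psi \<tau> b \<Longrightarrow> i < s" for i
  proof (rule ccontr)
    assume a: "i \<in># psi \<tau> b" "\<not> i < s"
    then have "i \<notin># b" "i \<notin> \<tau>" "\<not> i < 2" using sb \<tau> s2 by auto
    then have "count (psi \<tau> b) i = 0" by (simp add: c not_in_iff)
    then show False using a(1) by (simp add: not_in_iff[symmetric])
  qed
  have bound: "count (psi \<tau> b) v \<le> box" for v
  proof -
    have "count b v \<le> h - 1" using count_le_size[of b v] sb by simp
    then have "2 * count b v + 2 \<le> 2 * h" using h1 by linarith
    then show ?thesis by (simp add: c box_def)
  qed
  have mem: "i \<in> \<tau> \<Longrightarrow> i \<in># psi \<tau> b" for i by (simp add: c flip: count_greater_zero_iff)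
  have par: "i < 2 \<Longrightarrow> odd (count (psi \<tau> b) i) \<longleftrightarrow> i \<notin> \<tau>" for i by (simp add: c)
  have par2: "2 \<le> i \<Longrightarrow> even (count (psi \<tau> b) i)" for i by (simp add: c)
  have "even (count (psi \<tau> b) i)" if "i \<in> \<tau>" for i using par[of i] par2[of i] that by (cases "i < 2") auto
  then have e: "even_card (psi \<tau> b) \<tau> = card \<tau>" using even_card_all[OF \<tau>] by blast
  have "count (psi \<tau> b) i div 2 = count b i + (if i \<in> \<tau> then 1 else 0)" for i
    by (simp add: c)
  then have "half_size (psi \<tau> b) = size b + card \<tau>" using half_size_shift[OF \<tau> sb(1)] by blast
  then have "h + even_card (psi \<tau> b) \<tau> = Suc (half_size (psi \<tau> b))" using e sb(2) h1 by simp
  then show ?thesis using \<tau> pos bound mem par[of 0] par[of 1] par2 unfolding mixed_index_def by auto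
qed

text \<open>The half of the bottom corner is an arbitrary monomial of degree \<open>h - 1\<close>,
  independent of the set of directions. The sum therefore factors, and \<open>h\<close> appears only
  in the number of monomials.\<close>

lemma sum_mixed_index: "(\<Sum>p\<in>mixed_index. F (card (snd p))) = card (multisets_of_size {..<s} (h - 1)) * (\<Sum>\<tau>\<in>Pow {..<s}. F (card \<tau>))"
proof -
  let ?M = "multisets_of_size {..<s} (h - 1)"
  have "(\<Sum>p\<in>mixed_index. F (card (snd p))) = (\<Sum>q\<in>Pow {..<s} \<times> ?M. F (card (fst q)))"
  proof (rule sum.reindex_bij_witness[where i = "\<lambda>q. (psi (fst q) (snd q), fst q)" and j = "\<lambda>p. (snd p, half_mset (fst p) - mset_set (snd p))"])
    fix p assume p: "p \<in> mixed_index"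
    obtain u \<tau> where x: "p = (u, \<tau>)" by (cases p)
    have t: "\<tau> \<subseteq> {..<s}" "set_mset u \<subseteq> {..<s}" "\<tau> \<subseteq> set_mset u" "\<forall>i<s. 2 \<le> i \<longrightarrow> even (count u i)"
      "odd (count u 0) \<noteq> (0 \<in> \<tau>)" "odd (count u 1) \<noteq> (1 \<in> \<tau>)" "h + even_card u \<tau> = Suc (half_size u)" using p unfolding x mixed_index_def by blast+
    have par: "odd (count u i) \<longleftrightarrow> i \<notin> \<tau>" if "i < 2" for i
    proof -
      have "i = 0 \<or> i = 1" using that by auto
      then show ?thesis using t(5,6) by metis
    qed
    have "even (count u i)" if "i \<in> \<tau>" for i using t(1,4) par[of i] that by (cases "i < 2") auto
    then have evn: "\<forall>i\<in>\<tau>. even (count u i)" by blast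
    note m = half_mset_minus[OF t(1) t(3) evn]
    have sz: "size (half_mset u - mset_set \<tau>) = h - 1" using m(3) even_card_all[OF t(1) evn] t(7) by simp
    then show "(snd p, half_mset (fst p) - mset_set (snd p)) \<in> Pow {..<s} \<times> ?M"
      using t(1) m(2) by (simp add: x multisets_of_size_def)
    have "psi \<tau> (half_mset u - mset_set \<tau>) = u"
    proof (rule multiset_eqI)
      fix i
      show "count (psi \<tau> (half_mset u - mset_set \<tau>)) i = count u i"
      proof (cases "i < s")
        case True
        have c: "count (psi \<tau> (half_mset u - mset_set \<tau>)) i = 2 * (count u i div 2) + (if i < 2 \<and> i \<notin> \<tau> then 1 else 0)"
          unfolding count_psi[OF t(1)] m(1)[OF True] by simp
        have "odd (count u i) \<longleftrightarrow> i < 2 \<and> i \<notin> \<tau>" using par[of i] t(4) True by (cases "i < 2") auto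
        then show ?thesis unfolding c by (cases "i < 2 \<and> i \<notin> \<tau>") simp_all
      next
        case False
        then have "i \<notin># u" "i \<notin># half_mset u - mset_set \<tau>" "i \<notin> \<tau>" "\<not> i < 2" using t m(2) s2 by auto
        then show ?thesis unfolding count_psi[OF t(1)] by (simp add: not_in_iff)
      qed
    qed
    then show "(psi (fst (snd p, half_mset (fst p) - mset_set (snd p))) (snd (snd p, half_mset (fst p) - mset_set (snd p))), fst (snd p, half_mset (fst p) - mset_set (snd p))) = p"
      by (simp add: x)
    show "F (card (fst (snd p, half_mset (fst p) - mset_set (snd p)))) = F (card (snd p))" by simp
  next
    fix q assume q: "q \<in> Pow {..<s} \<times> ?M"
    obtain \<tau> b where x: "q = (\<tau>, b)" by (cases q)
    have \<tau>: "\<tau> \<subseteq> {..<s}" and b: "b \<in> ?M" using q by (auto simp: x)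
    show "(psi (fst q) (snd q), fst q) \<in> mixed_index" using psi_mixed_index[OF \<tau> b] by (simp add: x)
    have "half_mset (psi \<tau> b) - mset_set \<tau> = b"
    proof (rule multiset_eqI)
      fix i
      have f: "finite \<tau>" using \<tau> finite_subset by blast
      have "i \<notin># b" if "\<not> i < s" using b that by (auto simp: multisets_of_size_def)
      then show "count (half_mset (psi \<tau> b) - mset_set \<tau>) i = count b i"
        using f \<tau> by (simp add: count_half_mset count_psi[OF \<tau>] not_in_iff count_mset_set_if del: count_mset_set(3))
    qed
    then show "(snd (psi (fst q) (snd q), fst q), half_mset (fst (psi (fst q) (snd q), fst q)) - mset_set (snd (psi (fst q) (snd q), fst q))) = q"
      by (simp add: x)
  qed
  also have "\<dots> = (\<Sum>\<tau>\<in>Pow {..<s}. \<Sum>b\<in>?M. F (card \<tau>))"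
    unfolding sum.cartesian_product by (rule sum.cong) auto
  finally show ?thesis by (simp add: sum_distrib_left)
qed

text \<open>The square of \<open>y\<close> times the square of every variable in
  \<open>\<tau>\<close>, so that lowering along \<open>\<tau>\<close> loses one square per direction
  and leaves exactly \<open>size y\<close> of them.\<close>

definition phi :: "nat set \<Rightarrow> nat multiset \<Rightarrow> nat multiset" where
  "phi \<tau> y = y + y + mset_set \<tau> + mset_set \<tau>"

lemma count_phi: "\<tau> \<subseteq> {..<s} \<Longrightarrow> count (phi \<tau> b) i = 2 * (count b i + (if i \<in> \<tau> then 1 else 0))"
proof -
  assume "\<tau> \<subseteq> {..<s}"
  then have "finite \<tau>" using finite_subset by blast
  then show ?thesis unfolding phi_def count_union by (simp add: count_mset_set_if del: count_mset_set(3))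
qed

lemma phi_pure_crit:
  assumes \<tau>: "\<tau> \<subseteq> {..<s}" and y: "y \<in> multisets_of_size {..<s} h" "\<exists>i\<in>#y. \<forall>t\<in>\<tau>. i < t"
  shows "(phi \<tau> y, insert (s + 6) \<tau>) \<in> pure_crit"
proof -
  let ?u = "phi \<tau> y" and ?\<sigma> = "insert (s + 6) \<tau>"
  have sy: "set_mset y \<subseteq> {..<s}" "size y = h" using y by (auto simp: multisets_of_size_def)
  note c = count_phi[OF \<tau>, of y]
  have su: "i \<in># ?u \<longleftrightarrow> i \<in># y \<or> i \<in> \<tau>" for i
    by (simp add: c flip: count_greater_zero_iff)
  have r: "?\<sigma> \<inter> {..<s} = \<tau>" "?\<sigma> \<inter> {s..} = {s + 6}" using \<tau> by auto
  have e: "even_card ?u ?\<sigma> = card \<tau>" using even_card_all[OF \<tau>, of ?u] even_card_mk_cell[OF \<tau>, of ?u "{6}"] c by simp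
  have "count ?u i div 2 = count y i + (if i \<in> \<tau> then 1 else 0)" for i by (simp add: c)
  then have f: "half_size ?u = h + card \<tau>" using half_size_shift[OF \<tau> sy(1)] sy(2) by blast
  have bound: "count ?u v \<le> box" for v using count_le_size[of y v] sy by (simp add: c box_def)
  have SSe: "verts ?\<sigma> = {}" using verts_mk_cell[OF \<tau>, of "{}"] verts_remove(3)[of ?\<sigma>] \<tau> by (auto simp: verts_def)
  have "?\<sigma> \<subseteq> {..<s+7}" using \<tau> by auto
  then have cell: "(?u, ?\<sigma>) \<in> cells" unfolding cells_iff r SSe QA_def e f using su sy(1) \<tau> bound by auto
  obtain i where i: "i \<in># y" "\<forall>t\<in>\<tau>. i < t" using y(2) by blast
  have L: "(LEAST i. i \<in># ?u) \<le> i" by (rule Least_le) (simp add: su i)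
  then have "(LEAST i. i \<in># ?u) \<notin> \<tau>" using i(2) by fastforce
  moreover have "(LEAST i. i \<in># ?u) \<noteq> s + 6" using L i(1) sy(1) by auto
  ultimately show ?thesis unfolding pure_crit_iff r using cell f c by auto
qed

text \<open>The pairs on the right are the Eliahou-Kervaire symbols of the \<open>h\<close>-th power
  of the ideal of all variables, with the order of the variables reversed; here the variables are
  replaced by their squares.\<close>

lemma card_pure_crit: "card {x\<in>pure_crit. dm x = Suc j} =
    (\<Sum>\<tau>\<in>{\<tau>. \<tau> \<subseteq> {..<s} \<and> card \<tau> = j}. card {y\<in>multisets_of_size {..<s} h. \<exists>i\<in>#y. \<forall>t\<in>\<tau>. i < t})"
proof -
  let ?A = "\<lambda>\<tau>. {y\<in>multisets_of_size {..<s} h. \<exists>i\<in>#y. \<forall>t\<in>\<tau>. i < t}"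
  let ?T = "{\<tau>. \<tau> \<subseteq> {..<s} \<and> card \<tau> = j}"
  have fT: "finite ?T" by (rule finite_subset[of _ "Pow {..<s}"]) auto
  have fA: "finite (?A \<tau>)" for \<tau> by (simp add: finite_multisets_of_size)
  have "bij_betw (\<lambda>q. (phi (fst q) (snd q), insert (s + 6) (fst q))) (Sigma ?T ?A) {x\<in>pure_crit. dm x = Suc j}"
  proof (rule bij_betwI[where g = "\<lambda>x. (snd x \<inter> {..<s}, half_mset (fst x) - mset_set (snd x \<inter> {..<s}))"])
    show "(\<lambda>q. (phi (fst q) (snd q), insert (s + 6) (fst q))) \<in> Sigma ?T ?A \<rightarrow> {x\<in>pure_crit. dm x = Suc j}"
    proof
      fix q assume q: "q \<in> Sigma ?T ?A"
      then have \<tau>: "fst q \<subseteq> {..<s}" "card (fst q) = j" and y: "snd q \<in> multisets_of_size {..<s} h" "\<exists>i\<in>#snd q. \<forall>t\<in>fst q. i < t"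
        by (cases q, simp)+
      have "finite (fst q)" "s + 6 \<notin> fst q" using \<tau> finite_subset by auto
      then have "dm (phi (fst q) (snd q), insert (s + 6) (fst q)) = Suc j" using \<tau>(2) by (simp add: dm_def)
      then show "(phi (fst q) (snd q), insert (s + 6) (fst q)) \<in> {x\<in>pure_crit. dm x = Suc j}" using phi_pure_crit[OF \<tau>(1) y] by blast
    qed
    show "(\<lambda>x. (snd x \<inter> {..<s}, half_mset (fst x) - mset_set (snd x \<inter> {..<s}))) \<in> {x\<in>pure_crit. dm x = Suc j} \<rightarrow> Sigma ?T ?A"
    proof
      fix x assume x: "x \<in> {x\<in>pure_crit. dm x = Suc j}"
      obtain u \<sigma> where xx: "x = (u, \<sigma>)" by (cases x)
      have "(u, \<sigma>) \<in> pure_crit" and d: "card \<sigma> = Suc j" using x by (auto simp: xx dm_def)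
      then have y: "(u, \<sigma>) \<in> cells" "\<sigma> \<inter> {s..} = {s + 6}" "\<forall>i<s. even (count u i)" "h + card (\<sigma> \<inter> {..<s}) = half_size u"
        "(LEAST i. i \<in># u) \<notin> \<sigma>" unfolding pure_crit_iff by blast+
      let ?\<tau> = "\<sigma> \<inter> {..<s}"
      have \<tau>: "?\<tau> \<subseteq> {..<s}" "?\<tau> \<subseteq> set_mset u" and even_card: "\<forall>i\<in>?\<tau>. even (count u i)" and su: "set_mset u \<subseteq> {..<s}"
        using y(1,3) unfolding cells_iff by auto
      note m = half_mset_minus[OF \<tau> even_card]
      have sp: "\<sigma> = insert (s + 6) ?\<tau>" 
      proof -
        have "\<sigma> = ?\<tau> \<union> \<sigma> \<inter> {s..}" by auto
        also have "\<dots> = insert (s + 6) ?\<tau>" unfolding y(2) by simp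
        finally show ?thesis .
      qed
      have "finite ?\<tau>" by simp
      then have "card \<sigma> = Suc (card ?\<tau>)" by (subst sp, subst card_insert_disjoint) auto
      then have c: "card ?\<tau> = j" using d by simp
      have "half_mset u - mset_set ?\<tau> \<in> multisets_of_size {..<s} h" using m(2,3) y(4) by (simp add: multisets_of_size_def)
      moreover have "\<exists>i\<in>#half_mset u - mset_set ?\<tau>. \<forall>t\<in>?\<tau>. i < t"
      \<comment> \<open>The least variable of \<open>u\<close> has a positive even exponent and is
        not a direction, so it remains after the directions are divided out. All directions occur in
        \<open>u\<close> and are therefore larger.\<close>
      proof (rule bexI[of _ "LEAST i. i \<in># u"])
        have "u \<noteq> {#}" using y(4) h1 by (auto simp: half_size_def)
        then have "\<exists>i. i \<in># u" by auto
        then have L: "(LEAST i. i \<in># u) \<in># u" by (rule LeastI_ex)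
        then have ls: "(LEAST i. i \<in># u) < s" using su by auto
        have "0 < count u (LEAST i. i \<in># u)" "even (count u (LEAST i. i \<in># u))" using L ls y(3) by auto
        then have "1 \<le> count u (LEAST i. i \<in># u) div 2" by (elim evenE) auto
        then show "(LEAST i. i \<in># u) \<in># half_mset u - mset_set ?\<tau>"
          using m(1)[OF ls] y(5) by (simp flip: count_greater_zero_iff)
        show "\<forall>t\<in>?\<tau>. (LEAST i. i \<in># u) < t"
        proof
          fix t assume t: "t \<in> ?\<tau>"
          then have "(LEAST i. i \<in># u) \<le> t" using \<tau>(2) by (intro Least_le) auto
          moreover have "(LEAST i. i \<in># u) \<noteq> t" using t y(5) by auto
          ultimately show "(LEAST i. i \<in># u) < t" by simp
        qed
      qed
      ultimately show "(snd x \<inter> {..<s}, half_mset (fst x) - mset_set (snd x \<inter> {..<s})) \<in> Sigma ?T ?A"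
        using \<tau>(1) c by (simp add: xx)
    qed
    show "(snd (phi (fst q) (snd q), insert (s + 6) (fst q)) \<inter> {..<s}, half_mset (fst (phi (fst q) (snd q), insert (s + 6) (fst q))) -
       mset_set (snd (phi (fst q) (snd q), insert (s + 6) (fst q)) \<inter> {..<s})) = q" if q: "q \<in> Sigma ?T ?A" for q
    proof -
      have \<tau>: "fst q \<subseteq> {..<s}" and y: "snd q \<in> multisets_of_size {..<s} h" using q by auto
      have r: "insert (s + 6) (fst q) \<inter> {..<s} = fst q" using \<tau> by auto
      have f: "finite (fst q)" using \<tau> finite_subset by blast
      have "half_mset (phi (fst q) (snd q)) - mset_set (fst q) = snd q"
      proof (rule multiset_eqI)
        fix i
        have "i \<notin># snd q" if "\<not> i < s" using y that by (auto simp: multisets_of_size_def)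
        then show "count (half_mset (phi (fst q) (snd q)) - mset_set (fst q)) i = count (snd q) i"
          using f by (simp add: count_half_mset count_phi[OF \<tau>] not_in_iff count_mset_set_if del: count_mset_set(3))
      qed
      then show ?thesis by (simp add: r)
    qed
    show "(phi (fst (snd x \<inter> {..<s}, half_mset (fst x) - mset_set (snd x \<inter> {..<s}))) (snd (snd x \<inter> {..<s}, half_mset (fst x) - mset_set (snd x \<inter> {..<s}))),
        insert (s + 6) (fst (snd x \<inter> {..<s}, half_mset (fst x) - mset_set (snd x \<inter> {..<s})))) = x" if x: "x \<in> {x\<in>pure_crit. dm x = Suc j}" for x
    proof -
      obtain u \<sigma> where xx: "x = (u, \<sigma>)" by (cases x)
      have "(u, \<sigma>) \<in> pure_crit" using x by (auto simp: xx dm_def)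
      then have y: "(u, \<sigma>) \<in> cells" "\<sigma> \<inter> {s..} = {s + 6}" "\<forall>i<s. even (count u i)" unfolding pure_crit_iff by blast+
      let ?\<tau> = "\<sigma> \<inter> {..<s}"
      have \<tau>: "?\<tau> \<subseteq> {..<s}" "?\<tau> \<subseteq> set_mset u" and even_card: "\<forall>i\<in>?\<tau>. even (count u i)" and su: "set_mset u \<subseteq> {..<s}"
        using y(1,3) unfolding cells_iff by auto
      note m = half_mset_minus[OF \<tau> even_card]
      have sp: "\<sigma> = insert (s + 6) ?\<tau>" 
      proof -
        have "\<sigma> = ?\<tau> \<union> \<sigma> \<inter> {s..}" by auto
        also have "\<dots> = insert (s + 6) ?\<tau>" unfolding y(2) by simp
        finally show ?thesis .
      qed
      have "phi ?\<tau> (half_mset u - mset_set ?\<tau>) = u"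
      proof (rule multiset_eqI)
        fix i
        show "count (phi ?\<tau> (half_mset u - mset_set ?\<tau>)) i = count u i"
        proof (cases "i < s")
          case True
          then show ?thesis unfolding count_phi[OF \<tau>(1)] m(1)[OF True, symmetric] using y(3) by simp
        next
          case False
          then have "i \<notin># u" "i \<notin># half_mset u - mset_set ?\<tau>" "i \<notin> ?\<tau>" using su m(2) by auto
          then show ?thesis unfolding count_phi[OF \<tau>(1)] by (simp add: not_in_iff)
        qed
      qed
      then show ?thesis using sp by (simp add: xx)
    qed
  qed
  from bij_betw_same_card[OF this] have "card {x\<in>pure_crit. dm x = Suc j} = card (Sigma ?T ?A)" by (rule sym)
  also have "\<dots> = (\<Sum>\<tau>\<in>?T. card (?A \<tau>))" by (rule card_SigmaI[OF fT]) (use fA in blast)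
  finally show ?thesis .
qed

end

section \<open>The ideal and its Betti numbers\<close>

definition edge_mono :: "nat \<Rightarrow> nat \<Rightarrow> nat multiset" where
  "edge_mono s v = {#0, 1#} + mset_set {x. \<exists>f<10. x = s + f \<and> v \<notin> facets ! f}"

definition gens :: "nat \<Rightarrow> nat multiset set" where
  "gens s = (\<lambda>i. replicate_mset 2 i) ` {..<s} \<union> edge_mono s ` {..<6}"

lemma finite_link: "finite {x. \<exists>f<10. x = s + f \<and> v \<notin> facets ! f}"
  by (rule finite_subset[of _ "{..<s+10}"]) auto

text \<open>Provides a variable of \<open>m_v\<close> that is missing in \<open>m_w\<close>, so that
  neither of two such generators divides the other.\<close>

lemma facets_separate:
  assumes "v < 6" "w < 6" "v \<noteq> w"
  shows "\<exists>f<10. v \<notin> facets ! f \<and> w \<in> facets ! f"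
proof -
  have A: "\<forall>v\<in>{0,1,2,3,4,5::nat}. \<forall>w\<in>{0,1,2,3,4,5}. v = w \<or> (\<exists>T\<in>set facets. v \<notin> T \<and> w \<in> T)"
    unfolding facets_def by simp
  have "v \<in> {0,1,2,3,4,5}" "w \<in> {0,1,2,3,4,5}" using assms by auto
  from bspec[OF bspec[OF A this(1)] this(2)] obtain T where T: "T \<in> set facets" "v \<notin> T" "w \<in> T"
    using assms(3) by (elim disjE bexE conjE) simp_all
  then obtain f where f: "f < length facets" "T = facets ! f" by (metis in_set_conv_nth)
  moreover have "length facets = 10" by (simp add: facets_def)
  ultimately show ?thesis using T(2,3) by (intro exI[of _ f]) simp
qed

lemma count_edge_mono: "2 \<le> s \<Longrightarrow> count (edge_mono s v) x =
    (if x < 2 \<or> (\<exists>f<10. x = s + f \<and> v \<notin> facets ! f) then 1 else 0)"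
  using finite_link[of s v] by (auto simp: edge_mono_def)

lemma minimal_gens:
  assumes s: "2 \<le> s" shows "minimal_monomial_system (s + 10) (gens s)"
  unfolding minimal_monomial_system_def
proof (intro conjI ballI impI)
  show "finite (gens s)" by (simp add: gens_def)
next
  fix u assume "u \<in> gens s"
  then show "set_mset u \<subseteq> {..<s + 10}"
    using s finite_link by (auto simp: gens_def edge_mono_def split: if_splits)
next
  fix u v assume uv: "u \<in> gens s" "v \<in> gens s" "u \<subseteq># v"
  have c: "count u x \<le> count v x" for x using uv(3) by (rule mset_subset_eq_count)
  have u: "(\<exists>i<s. u = replicate_mset 2 i) \<or> (\<exists>a<6. u = edge_mono s a)" using uv(1) by (auto simp: gens_def)
  have v: "(\<exists>i<s. v = replicate_mset 2 i) \<or> (\<exists>a<6. v = edge_mono s a)" using uv(2) by (auto simp: gens_def)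
  show "u = v"
    using u v
  proof (elim disjE exE conjE)
    fix i j assume "u = replicate_mset 2 i" "v = replicate_mset 2 j"
    then show ?thesis using c[of i] by (auto split: if_splits)
  next
    fix i a assume "u = replicate_mset 2 i" "v = edge_mono s a"
    then show ?thesis using c[of i] by (simp add: count_edge_mono[OF s] split: if_splits)
  next
    fix i a assume "u = edge_mono s a" "v = replicate_mset 2 i"
    then show ?thesis using c[of 0] c[of 1] by (simp add: count_edge_mono[OF s] split: if_splits)
  next
    fix a b assume ab: "u = edge_mono s a" "v = edge_mono s b" "a < 6" "b < 6"
    have "a = b"
    proof (rule ccontr)
      assume "a \<noteq> b"
      then obtain f where f: "f < 10" "a \<notin> facets ! f" "b \<in> facets ! f" using facets_separate[of a b] ab by blast
      have "count (edge_mono s a) (s + f) = 1" "count (edge_mono s b) (s + f) = 0"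
        using f s by (auto simp: count_edge_mono)
      then show False using c[of "s + f"] ab by simp
    qed
    then show ?thesis using ab by simp
  qed
qed

section \<open>Monomials in the powers of the ideal\<close>

context rp2_power begin

definition in_J :: "nat multiset \<Rightarrow> bool" where "in_J m \<longleftrightarrow> (\<exists>v<6. xl (s + v) \<subseteq> set_mset m)"

text \<open>The monomials of \<open>A^j + z_0 z_1 J A^(j-1)\<close>, where \<open>in_J\<close> tests
  the factor from \<open>J\<close>. That this describes the \<open>j\<close>-th power of the ideal
  is the content of \<open>mono_pow_iff\<close>.\<close>

definition pow_mono :: "nat \<Rightarrow> nat multiset \<Rightarrow> bool" where
  "pow_mono j m \<longleftrightarrow> j \<le> half_size m \<or> (odd (count m 0) \<and> odd (count m 1) \<and> j \<le> Suc (half_size m) \<and> in_J m)"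

lemma in_J_mono: "in_J a \<Longrightarrow> a \<subseteq># b \<Longrightarrow> in_J b"
  unfolding in_J_def using set_mset_mono by blast

lemma half_size_add: "half_size (a + b) = half_size a + half_size b + (\<Sum>i<s. if odd (count a i) \<and> odd (count b i) then 1 else 0)"
proof -
  have "(x + y) div 2 = x div 2 + y div 2 + (if odd x \<and> odd y then 1 else 0)" for x y :: nat
    by (cases "odd x"; cases "odd y") (auto elim!: oddE evenE)
  then show ?thesis by (simp add: half_size_def sum.distrib)
qed

lemma half_size_add_ge:
  assumes "T \<subseteq> {..<s}" "\<And>i. i \<in> T \<Longrightarrow> odd (count a i) \<and> odd (count b i)"
  shows "half_size a + half_size b + card T \<le> half_size (a + b)"
proof -
  have "card T = (\<Sum>i\<in>T. if odd (count a i) \<and> odd (count b i) then 1 else 0)" using assms(2) by simp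
  also have "\<dots> \<le> (\<Sum>i<s. if odd (count a i) \<and> odd (count b i) then 1 else 0)"
    using assms(1) by (intro sum_mono2) auto
  finally show ?thesis unfolding half_size_add by simp
qed

lemma pow_mono_add:
  assumes a: "pow_mono j a" and b: "pow_mono 1 b"
  shows "pow_mono (Suc j) (a + b)"
proof -
  have ge: "half_size a + half_size b \<le> half_size (a + b)" using half_size_add_ge[of "{}" a b] by simp
  have g0: "half_size a + half_size b + 1 \<le> half_size (a + b)" if "odd (count a 0)" "odd (count b 0)" using half_size_add_ge[of "{0}" a b] that s2 by simp
  have g1: "half_size a + half_size b + 1 \<le> half_size (a + b)" if "odd (count a 1)" "odd (count b 1)" using half_size_add_ge[of "{1}" a b] that s2 by simp
  \<comment> \<open>Two mixed factors combine to a square in each of the variables 0 and 1. These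
    two squares make up for the two that the factors may lack, so no power of \<open>J\<close>
    appears.\<close>
  have g01: "half_size a + half_size b + 2 \<le> half_size (a + b)" if "odd (count a 0)" "odd (count b 0)" "odd (count a 1)" "odd (count b 1)"
  proof -
    have "\<And>i. i \<in> {0, 1} \<Longrightarrow> odd (count a i) \<and> odd (count b i)" using that by auto
    from half_size_add_ge[of "{0, 1}" a b, OF _ this] s2 show ?thesis by simp
  qed
  have J: "in_J a \<Longrightarrow> in_J (a + b)" "in_J b \<Longrightarrow> in_J (a + b)" using in_J_mono[of a "a + b"] in_J_mono[of b "a + b"] by auto
  consider "j \<le> half_size a" "1 \<le> half_size b" | "j \<le> half_size a" "odd (count b 0)" "odd (count b 1)" "in_J b"
    | "odd (count a 0)" "odd (count a 1)" "j \<le> Suc (half_size a)" "in_J a" "1 \<le> half_size b"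
    | "odd (count a 0)" "odd (count a 1)" "j \<le> Suc (half_size a)" "odd (count b 0)" "odd (count b 1)"
    using a b unfolding pow_mono_def by blast
  then show ?thesis
  proof cases
    case 1
    then show ?thesis using ge by (simp add: pow_mono_def)
  next
    case 2
    then show ?thesis using ge g0 g1 J by (cases "odd (count a 0)"; cases "odd (count a 1)") (simp_all add: pow_mono_def)
  next
    case 3
    then show ?thesis using ge g0 g1 J by (cases "odd (count b 0)"; cases "odd (count b 1)") (simp_all add: pow_mono_def)
  next
    case 4
    then show ?thesis using g01 by (simp add: pow_mono_def)
  qed
qed

lemma half_size_pos: "1 \<le> half_size m \<Longrightarrow> \<exists>i<s. replicate_mset 2 i \<subseteq># m"
proof (rule ccontr)
  assume "1 \<le> half_size m" "\<not> (\<exists>i<s. replicate_mset 2 i \<subseteq># m)"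
  then have "count m i < 2" if "i < s" for i using that by (auto simp: count_le_replicate_mset_subset_eq[symmetric] not_le)
  then have "half_size m = 0" by (simp add: half_size_def)
  then show False using \<open>1 \<le> half_size m\<close> by simp
qed

lemma split_square:
  assumes "i < s" "replicate_mset 2 i \<subseteq># m"
  shows "m = (m - replicate_mset 2 i) + replicate_mset 2 i" "half_size m = Suc (half_size (m - replicate_mset 2 i))"
    "odd (count (m - replicate_mset 2 i) v) \<longleftrightarrow> odd (count m v)" "half_size (replicate_mset 2 i) = 1"
proof -
  show m: "m = (m - replicate_mset 2 i) + replicate_mset 2 i" using assms(2) by (simp add: subset_mset.diff_add)
  have "half_size (replicate_mset 2 i) = (\<Sum>j<s. if j = i then 1 else 0)" unfolding half_size_def by (intro sum.cong) auto
  then show r: "half_size (replicate_mset 2 i) = 1" using assms(1) by simp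
  have "half_size m = half_size ((m - replicate_mset 2 i) + replicate_mset 2 i)" using m by simp
  also have "\<dots> = Suc (half_size (m - replicate_mset 2 i))" unfolding half_size_add r by (simp add: if_distrib cong: if_cong)
  finally show "half_size m = Suc (half_size (m - replicate_mset 2 i))" .
  have "2 \<le> count m i" using assms(2) by (simp add: count_le_replicate_mset_subset_eq)
  then show "odd (count (m - replicate_mset 2 i) v) \<longleftrightarrow> odd (count m v)" by simp
qed

lemma in_J_minus: "i < s \<Longrightarrow> in_J m \<Longrightarrow> in_J (m - replicate_mset 2 i)"
proof -
  assume i: "i < s" and "in_J m"
  then obtain v where v: "v < 6" "xl (s + v) \<subseteq> set_mset m" by (auto simp: in_J_def)
  have "x \<in># m - replicate_mset 2 i" if "x \<in> xl (s + v)" for x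
  proof -
    have "x \<noteq> i" using that i by (auto simp: xl_def)
    moreover have "x \<in># m" using v that by blast
    ultimately show ?thesis by (simp flip: count_greater_zero_iff)
  qed
  then show ?thesis using v(1) by (auto simp: in_J_def)
qed

text \<open>If some square divides \<open>m\<close>, it is split off, which affects neither the
  parities nor the part in \<open>J\<close>. If none does, \<open>half_size m = 0\<close> forces
  \<open>j = 0\<close>.\<close>

lemma pow_mono_split:
  assumes m: "pow_mono (Suc j) m"
  shows "\<exists>a b. m = a + b \<and> pow_mono j a \<and> pow_mono 1 b"
proof -
  consider i where "i < s" "replicate_mset 2 i \<subseteq># m" | "half_size m = 0" using half_size_pos[of m] by fastforce
  then show ?thesis
  proof cases
    case (1 i)
    note sp = split_square[OF 1]
    have "pow_mono j (m - replicate_mset 2 i)"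
      using m in_J_minus[OF 1(1), of m] unfolding pow_mono_def sp(2,3) by auto
    moreover have "pow_mono 1 (replicate_mset 2 i)" by (simp add: pow_mono_def sp(4))
    ultimately show ?thesis using sp(1) by blast
  next
    case 2
    then have "j = 0" "pow_mono 1 m" using m by (auto simp: pow_mono_def)
    then have "m = {#} + m \<and> pow_mono j {#} \<and> pow_mono 1 m" by (simp add: pow_mono_def)
    then show ?thesis by blast
  qed
qed

lemma xl_edge: "v < 6 \<Longrightarrow> xl (s + v) = {x. \<exists>f<10. x = s + f \<and> v \<notin> facets ! f}"
  by (auto simp: xl_def)

lemma pow_mono_1: "pow_mono 1 m \<longleftrightarrow> (\<exists>g\<in>gens s. g \<subseteq># m)"
proof
  assume m: "pow_mono 1 m"
  show "\<exists>g\<in>gens s. g \<subseteq># m"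
  proof (cases "1 \<le> half_size m")
    case True
    then show ?thesis using half_size_pos unfolding gens_def by blast
  next
    case False
    then have o: "odd (count m 0)" "odd (count m 1)" "in_J m" using m by (auto simp: pow_mono_def)
    then obtain v where v: "v < 6" "xl (s + v) \<subseteq> set_mset m" by (auto simp: in_J_def)
    have "edge_mono s v \<subseteq># m"
    proof (rule mset_subset_eqI)
      fix x
      have "x < 2 \<Longrightarrow> 0 < count m x" using odd_pos[OF o(1)] odd_pos[OF o(2)] by (auto simp: less_2_cases_iff)
      then show "count (edge_mono s v) x \<le> count m x"
        using v(2) unfolding xl_edge[OF v(1)] count_edge_mono[OF s2] by auto
    qed
    then show ?thesis using v(1) unfolding gens_def by blast
  qed
next
  assume "\<exists>g\<in>gens s. g \<subseteq># m"
  then consider i where "i < s" "replicate_mset 2 i \<subseteq># m" | v where "v < 6" "edge_mono s v \<subseteq># m"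
    unfolding gens_def by auto
  then show "pow_mono 1 m"
  proof cases
    case (1 i)
    then show ?thesis using split_square(2)[OF 1] by (simp add: pow_mono_def)
  next
    case (2 v)
    have c: "count (edge_mono s v) x \<le> count m x" for x using 2(2) by (rule mset_subset_eq_count)
    have J: "in_J m" unfolding in_J_def
    proof (intro exI[of _ v] conjI 2(1) subsetI)
      fix x assume "x \<in> xl (s + v)"
      then have "count (edge_mono s v) x = 1" using xl_edge[OF 2(1)] count_edge_mono[OF s2, of v x] by auto
      then have "0 < count m x" using c[of x] by simp
      then show "x \<in># m" by simp
    qed
    have p: "1 \<le> count m 0" "1 \<le> count m 1" using c[of 0] c[of 1] by (simp_all add: count_edge_mono[OF s2])
    show ?thesis
    proof (cases "half_size m = 0")
      case True
      then have "count m i div 2 = 0" if "i < s" for i using that by (simp add: half_size_def)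
      then have "count m 0 div 2 = 0" "count m 1 div 2 = 0" using s2 by simp_all
      then have "count m 0 < 2" "count m 1 < 2" by linarith+
      then have "count m 0 = 1" "count m 1 = 1" using p by linarith+
      then show ?thesis using J by (simp add: pow_mono_def)
    qed (simp add: pow_mono_def)
  qed
qed

lemma mono_pow_iff: "mono_pow n {m. set_mset m \<subseteq> {..<n} \<and> (\<exists>g\<in>gens s. g \<subseteq># m)} j = {m. set_mset m \<subseteq> {..<n} \<and> pow_mono j m}"
proof (induction j)
  case 0
  show ?case by (simp add: pow_mono_def)
next
  case (Suc j)
  show ?case
  proof (rule Set.set_eqI)
    fix m
    have "m \<in> mono_pow n {m. set_mset m \<subseteq> {..<n} \<and> (\<exists>g\<in>gens s. g \<subseteq># m)} (Suc j) \<longleftrightarrow>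
        (\<exists>a b. m = a + b \<and> (set_mset a \<subseteq> {..<n} \<and> pow_mono j a) \<and> (set_mset b \<subseteq> {..<n} \<and> pow_mono 1 b))"
      unfolding mono_pow.simps Suc.IH pow_mono_1 by blast
    also have "\<dots> \<longleftrightarrow> set_mset m \<subseteq> {..<n} \<and> pow_mono (Suc j) m"
    proof
      assume "\<exists>a b. m = a + b \<and> (set_mset a \<subseteq> {..<n} \<and> pow_mono j a) \<and> (set_mset b \<subseteq> {..<n} \<and> pow_mono 1 b)"
      then show "set_mset m \<subseteq> {..<n} \<and> pow_mono (Suc j) m" using pow_mono_add by auto
    next
      assume a: "set_mset m \<subseteq> {..<n} \<and> pow_mono (Suc j) m"
      then obtain a b where ab: "m = a + b" "pow_mono j a" "pow_mono 1 b" using pow_mono_split by blast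
      have "set_mset a \<subseteq> {..<n}" "set_mset b \<subseteq> {..<n}" using a ab(1) by auto
      then show "\<exists>a b. m = a + b \<and> (set_mset a \<subseteq> {..<n} \<and> pow_mono j a) \<and> (set_mset b \<subseteq> {..<n} \<and> pow_mono 1 b)"
        using ab by blast
    qed
    finally show "m \<in> mono_pow n {m. set_mset m \<subseteq> {..<n} \<and> (\<exists>g\<in>gens s. g \<subseteq># m)} (Suc j) \<longleftrightarrow> m \<in> {m. set_mset m \<subseteq> {..<n} \<and> pow_mono (Suc j) m}"
      by simp
  qed
qed

lemma generators_pow_mono:
  assumes m: "set_mset m \<subseteq> {..<s + 10}"
  shows "(\<exists>x\<in>K. dm x = 1 \<and> lab x \<subseteq># m) \<longleftrightarrow> pow_mono h m"
proof -
  let ?y = "filter_mset (\<lambda>v. v < s) m"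
  have f: "half_size ?y = half_size m" unfolding half_size_def by (rule sum.cong) auto
  have o: "count ?y 0 = count m 0" "count ?y 1 = count m 1" using s2 by auto
  have x6: "xl (s + 6) = {}" by (auto simp: xl_def)
  have "(\<exists>g. s \<le> g \<and> g < s + 7 \<and> gen_pred g ?y \<and> xl g \<subseteq> set_mset m) \<longleftrightarrow> (\<exists>g<7. gen_pred (s + g) ?y \<and> xl (s + g) \<subseteq> set_mset m)"
    by (metis le_Suc_ex le_add1 nat_add_left_cancel_less)
  also have "\<dots> \<longleftrightarrow> gen_pred (s + 6) ?y \<or> (\<exists>g<6. gen_pred (s + g) ?y \<and> xl (s + g) \<subseteq> set_mset m)"
  proof -
    have "g < 7 \<longleftrightarrow> g < 6 \<or> g = 6" for g :: nat by auto
    then show ?thesis using x6 by auto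
  qed
  also have "\<dots> \<longleftrightarrow> PA ?y \<or> (PC ?y \<and> in_J m)"
  proof -
    have "gen_pred (s + 6) ?y \<longleftrightarrow> PA ?y" "g < 6 \<Longrightarrow> gen_pred (s + g) ?y \<longleftrightarrow> PC ?y" for g by (simp_all add: gen_pred_def)
    then show ?thesis unfolding in_J_def by blast
  qed
  also have "\<dots> \<longleftrightarrow> pow_mono h m" unfolding PA_def PC_def pow_mono_def f o by blast
  finally show ?thesis unfolding generators[OF m] .
qed

lemma \<epsilon>r_red_inc: "labelled_complex.\<epsilon>r inc lab = (red_inc :: _ \<Rightarrow> _ \<Rightarrow> 'f::comm_ring_1)"
  by (intro ext) (simp add: labelled_complex.\<epsilon>r_def[OF labelled] red_inc_def)

lemma cells_K: "K - {og} = cells"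
  using og_cells by (auto simp: K_def)

end

context finite_coeff_rep begin

text \<open>Degree \<open>j\<close> corresponds to cells of dimension \<open>Suc j\<close>. The
  first summand counts the resolution of the power of the squares; the field enters the second one
  alone, and there only through the factor that does not contain \<open>h\<close>.\<close>

theorem betti_power:
  assumes s: "2 \<le> s" and h: "1 \<le> h" and e: "(e = 1 \<and> (2::'f) = 0) \<or> (e = 0 \<and> (\<exists>t::'f. 2 * t = 1))"
  shows "betti (s + 10) k j (ideal_power (mpoly_ring (s + 10) k) (monomial_ideal (s + 10) k (gens s)) h) =
    (\<Sum>\<tau>\<in>{\<tau>. \<tau> \<subseteq> {..<s} \<and> card \<tau> = j}. card {y\<in>multisets_of_size {..<s} h. \<exists>i\<in>#y. \<forall>t\<in>\<tau>. i < t}) +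
    card (multisets_of_size {..<s} (h - 1)) * (\<Sum>\<tau>\<in>Pow {..<s}. part_dim e (Suc j) (card \<tau>))"
proof -
  interpret R: rp2_power s h by unfold_locales (fact s h)+
  let ?n = "s + 10"
  let ?M = "{m. set_mset m \<subseteq> {..<?n} \<and> (\<exists>g\<in>gens s. g \<subseteq># m)}"
  have G: "set_mset g \<subseteq> {..<?n}" if "g \<in> gens s" for g
    using minimal_gens[OF s] that unfolding minimal_monomial_system_def by blast
  have "mono_polys ?n {m. \<exists>g\<in>gens s. g \<subseteq># m} = (mono_polys ?n ?M :: (nat multiset \<Rightarrow>\<^sub>0 'f) set)"
    unfolding mono_polys_def vpolys_def by auto
  then have "ideal_power (mpoly_ring ?n k) (monomial_ideal ?n k (gens s)) h = PP ` mono_polys ?n (mono_pow ?n ?M h)"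
    using monomial_ideal_eq[of "gens s" ?n, OF G] ideal_power_mono_polys[of ?M ?n h] by simp
  also have "mono_polys ?n (mono_pow ?n ?M h) = {p \<in> vpolys ?n. \<forall>m\<in>Poly_Mapping.keys p. \<exists>x\<in>R.K. R.dm x = 1 \<and> R.lab x \<subseteq># m}"
    unfolding R.mono_pow_iff mono_polys_def vpolys_def using R.generators_pow_mono by auto
  finally have I: "ideal_power (mpoly_ring ?n k) (monomial_ideal ?n k (gens s)) h =
      PP ` {p \<in> vpolys ?n. \<forall>m\<in>Poly_Mapping.keys p. \<exists>x\<in>R.K. R.dm x = 1 \<and> R.lab x \<subseteq># m}" .
  have "hdim R.cells R.dm (R.red_inc :: _ \<Rightarrow> _ \<Rightarrow> 'f) (Suc j)
      ((\<Sum>\<tau>\<in>{\<tau>. \<tau> \<subseteq> {..<s} \<and> card \<tau> = j}. card {y\<in>multisets_of_size {..<s} h. \<exists>i\<in>#y. \<forall>t\<in>\<tau>. i < t}) +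
      card (multisets_of_size {..<s} (h - 1)) * (\<Sum>\<tau>\<in>Pow {..<s}. part_dim e (Suc j) (card \<tau>)))"
    using R.hdim_cells[OF e, of j] unfolding R.card_pure_crit R.sum_mixed_index .
  then show ?thesis unfolding I
    by (intro betti_labelled_complex[OF R.labelled]) (simp add: hdim_def R.\<epsilon>r_red_inc R.cells_K)
qed

end

section \<open>Kodiyalam polynomials\<close>

text \<open>The binomial coefficient \<open>h + w - 1\<close> over \<open>w\<close> as a polynomial
  in \<open>h\<close>; its value at \<open>h\<close> counts the multisets of size
  \<open>h - 1\<close> on \<open>w + 1\<close> elements.\<close>

definition bin_poly :: "nat \<Rightarrow> rat poly" where
  "bin_poly w = smult (1 / fact w) (\<Prod>i<w. [:of_nat i, 1:])"

lemma degree_bin_poly: "degree (bin_poly w) = w" "coeff (bin_poly w) w \<noteq> 0"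
proof -
  have d: "degree (\<Prod>i<w. [:of_nat i, 1::rat:]) = w" by (subst degree_prod_sum_eq) auto
  then show "degree (bin_poly w) = w" by (simp add: bin_poly_def)
  have "(\<Prod>i<w. [:of_nat i, 1::rat:]) \<noteq> 0" by simp
  then have "lead_coeff (\<Prod>i<w. [:of_nat i, 1::rat:]) \<noteq> 0" by (rule leading_coeff_neq_0)
  then show "coeff (bin_poly w) w \<noteq> 0" unfolding d by (simp add: bin_poly_def)
qed

lemma poly_bin_poly: "1 \<le> h \<Longrightarrow> poly (bin_poly w) (of_nat h) = of_nat ((w + (h - 1)) choose (h - 1))"
proof -
  assume h: "1 \<le> h"
  have "(w + (h - 1)) choose (h - 1) = (w + (h - 1)) choose w"
    using binomial_symmetric[of w "w + (h - 1)"] by simp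
  then have "of_nat ((w + (h - 1)) choose (h - 1)) = (of_nat (w + (h - 1)) gchoose w :: rat)"
    by (simp add: binomial_gbinomial)
  also have "\<dots> = pochhammer (of_nat (w + (h - 1)) - of_nat w + 1) w / fact w"
    by (rule gbinomial_pochhammer')
  also have "of_nat (w + (h - 1)) - of_nat w + 1 = (of_nat h :: rat)" using h by (simp add: of_nat_diff)
  also have "pochhammer (of_nat h :: rat) w = (\<Prod>i<w. of_nat h + of_nat i)"
    by (simp add: pochhammer_prod atLeast0LessThan)
  finally show ?thesis by (simp add: bin_poly_def poly_prod add.commute)
qed

lemma multisets_poly:
  assumes "finite A" "A \<noteq> {}" "1 \<le> h"
  shows "of_nat (card (multisets_of_size A (h - 1))) = poly (bin_poly (card A - 1)) (of_nat h)"
proof -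
  have "0 < card A" using assms by (simp add: card_gt_0_iff)
  then have "card A + (h - 1) - 1 = (card A - 1) + (h - 1)" by simp
  then show ?thesis using assms by (simp add: card_multisets_of_size poly_bin_poly)
qed

lemma multisets_poly':
  assumes "finite A"
  shows "\<exists>P::rat poly. \<forall>h\<ge>1. poly P (of_nat h) = of_nat (card (multisets_of_size A h))"
proof (cases "A = {}")
  case True
  have "multisets_of_size A h = {}" if "1 \<le> h" for h using that by (auto simp: multisets_of_size_def True)
  then show ?thesis by (intro exI[of _ 0]) simp
next
  case False
  have "poly (pcompose (bin_poly (card A - 1)) [:1, 1:]) (of_nat h) = of_nat (card (multisets_of_size A h))" for h
    using multisets_poly[OF assms False, of "Suc h"] by (simp add: poly_pcompose)
  then show ?thesis by blast
qed

text \<open>The complement consists of the multisets supported on the elements that are not below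
  all of \<open>\<tau>\<close>, so the count is a difference of two numbers of multisets.\<close>

lemma initial_count_poly:
  "\<exists>P::rat poly. \<forall>h\<ge>1. poly P (of_nat h) = of_nat (card {y\<in>multisets_of_size {..<s} h. \<exists>i\<in>#y. \<forall>t\<in>\<tau>. i < (t::nat)})"
proof -
  let ?B = "{i\<in>{..<s}. \<not> (\<forall>t\<in>\<tau>. i < t)}"
  obtain P where P: "\<And>h. 1 \<le> h \<Longrightarrow> poly P (of_nat h :: rat) = of_nat (card (multisets_of_size {..<s} h))"
    using multisets_poly'[of "{..<s}"] by auto
  obtain Q where Q: "\<And>h. 1 \<le> h \<Longrightarrow> poly Q (of_nat h :: rat) = of_nat (card (multisets_of_size ?B h))"
    using multisets_poly'[of ?B] by auto
  have "poly (P - Q) (of_nat h) = of_nat (card {y\<in>multisets_of_size {..<s} h. \<exists>i\<in>#y. \<forall>t\<in>\<tau>. i < t})" if h: "1 \<le> h" for h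
  proof -
    let ?A = "{y\<in>multisets_of_size {..<s} h. \<exists>i\<in>#y. \<forall>t\<in>\<tau>. i < t}"
    have u: "multisets_of_size {..<s} h = ?A \<union> multisets_of_size ?B h" "?A \<inter> multisets_of_size ?B h = {}"
      unfolding multisets_of_size_def by blast+
    have f: "finite ?A" "finite (multisets_of_size ?B h)" by (simp_all add: finite_multisets_of_size)
    have "card (multisets_of_size {..<s} h) = card ?A + card (multisets_of_size ?B h)"
      using card_Un_disjoint[OF f u(2)] u(1) by metis
    then show ?thesis unfolding poly_diff P[OF h] Q[OF h] by simp
  qed
  then show ?thesis by blast
qed

text \<open>Polynomials that agree at infinitely many integers are equal, hence any candidate for
  the description coincides with \<open>P\<close>.\<close>

lemma kodiyalam_poly_eq:
  assumes "\<And>h. 1 \<le> h \<Longrightarrow> poly P (of_nat h) = of_nat (betti n k (j - 1) (ideal_power (mpoly_ring n k) I h))"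
  shows "kodiyalam_poly n k j I = P"
  unfolding kodiyalam_poly_def
proof (rule the_equality)
  show "\<forall>\<^sub>F h in sequentially. poly P (of_nat h) = of_nat (betti n k (j - 1) (ideal_power (mpoly_ring n k) I h))"
    using assms by (auto simp: eventually_sequentially)
next
  fix Q :: "rat poly"
  assume "\<forall>\<^sub>F h in sequentially. poly Q (of_nat h) = of_nat (betti n k (j - 1) (ideal_power (mpoly_ring n k) I h))"
  then obtain N where N: "\<And>h. N \<le> h \<Longrightarrow> poly Q (of_nat h) = of_nat (betti n k (j - 1) (ideal_power (mpoly_ring n k) I h))"
    unfolding eventually_sequentially by blast
  show "Q = P"
  proof (rule ccontr)
    assume "Q \<noteq> P"
    then have f: "finite {x. poly (Q - P) x = 0}" by (intro poly_roots_finite) simp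
    have "of_nat ` {N + 1..} \<subseteq> {x. poly (Q - P) x = 0}" using N assms by auto
    then have "finite ((of_nat :: nat \<Rightarrow> rat) ` {N + 1..})" using f finite_subset by blast
    moreover have "inj_on (of_nat :: nat \<Rightarrow> rat) {N + 1..}" by (simp add: inj_on_def)
    ultimately have "finite {N + 1..}" using finite_imageD by blast
    then show False using infinite_Ici by blast
  qed
qed

text \<open>The polynomials \<open>P \<tau>\<close> are a parameter and depend on \<open>s\<close>
  alone, so that for two fields they are literally the same and cancel in a comparison.\<close>

lemma (in finite_coeff_rep) kodiyalam_gens:
  assumes s: "2 \<le> s" and e: "(e = 1 \<and> (2::'f) = 0) \<or> (e = 0 \<and> (\<exists>t::'f. 2 * t = 1))" and j: "1 \<le> j"
    and P: "\<forall>\<tau>. \<forall>h\<ge>1. poly (P \<tau> :: rat poly) (of_nat h) = of_nat (card {y\<in>multisets_of_size {..<s} h. \<exists>i\<in>#y. \<forall>t\<in>\<tau>. i < t})"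
  shows "kodiyalam_poly (s + 10) k j (monomial_ideal (s + 10) k (gens s)) =
    (\<Sum>\<tau>\<in>{\<tau>. \<tau> \<subseteq> {..<s} \<and> card \<tau> = j - 1}. P \<tau>) + smult (of_nat (\<Sum>\<tau>\<in>Pow {..<s}. part_dim e j (card \<tau>))) (bin_poly (s - 1))"
proof (rule kodiyalam_poly_eq)
  fix h :: nat assume h: "1 \<le> h"
  have "{..<s} \<noteq> {}" using s by (auto simp: lessThan_empty_iff)
  then have "poly (bin_poly (s - 1)) (of_nat h) = of_nat (card (multisets_of_size {..<s} (h - 1)))"
    using multisets_poly[of "{..<s}" h] h by simp
  moreover have "Suc (j - 1) = j" using j by simp
  ultimately show "poly ((\<Sum>\<tau>\<in>{\<tau>. \<tau> \<subseteq> {..<s} \<and> card \<tau> = j - 1}. P \<tau>) +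
        smult (of_nat (\<Sum>\<tau>\<in>Pow {..<s}. part_dim e j (card \<tau>))) (bin_poly (s - 1))) (of_nat h) =
      of_nat (betti (s + 10) k (j - 1) (ideal_power (mpoly_ring (s + 10) k) (monomial_ideal (s + 10) k (gens s)) h))"
    unfolding betti_power[OF s h e] by (simp add: poly_sum P[rule_format, OF h] mult.commute)
qed

lemma part_dim_less:
  assumes "3 \<le> j" "j \<le> s + 3"
  shows "(\<Sum>\<tau>\<in>Pow {..<s}. part_dim 0 j (card \<tau>)) < (\<Sum>\<tau>\<in>Pow {..<s}. part_dim 1 j (card \<tau>))"
proof (rule sum_strict_mono_ex1)
  show "\<forall>\<tau>\<in>Pow {..<s}. part_dim 0 j (card \<tau>) \<le> part_dim 1 j (card \<tau>)" by (simp add: part_dim_def)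
  \<comment> \<open>With \<open>j - 3\<close> cubical directions the lower cells of the block have
    dimension \<open>j\<close>, so at least one block is counted.\<close>
  have "{..<j - 3} \<in> Pow {..<s}" "part_dim 0 j (card {..<j - 3}) < part_dim 1 j (card {..<j - 3})"
    using assms by (auto simp: part_dim_def)
  then show "\<exists>\<tau>\<in>Pow {..<s}. part_dim 0 j (card \<tau>) < part_dim 1 j (card \<tau>)" by blast
qed simp

section \<open>The fields with two and three elements\<close>

lemma residue_ring_rep:
  assumes "mod_type n Rep (Abs :: int \<Rightarrow> 'f::comm_ring_1)"
  shows "ring_rep UNIV (residue_ring n) Rep"
proof -
  interpret mod_type n Rep Abs by (rule assms)
  show ?thesis
  proof
    have "Rep ` UNIV = {0..n - 1}"
    proof -
      have "Rep ` UNIV = {0..<n}" using type by (rule type_definition.Rep_range)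
      then show ?thesis by auto
    qed
    moreover have "inj Rep" by (simp add: inj_def Rep_inject_sym)
    ultimately show "bij_betw Rep UNIV (carrier (residue_ring n))" by (simp add: bij_betw_def residue_ring_def)
    show "Rep 0 = \<zero>\<^bsub>residue_ring n\<^esub>" "Rep 1 = \<one>\<^bsub>residue_ring n\<^esub>"
      by (simp_all add: residue_ring_def Rep_0 Rep_1)
    show "Rep (x + y) = Rep x \<oplus>\<^bsub>residue_ring n\<^esub> Rep y" "Rep (x * y) = Rep x \<otimes>\<^bsub>residue_ring n\<^esub> Rep y" for x y
      by (simp_all add: residue_ring_def add_def mult_def Rep_Abs_mod)
  qed auto
qed

lemma finite_coeff_rep_2: "finite_coeff_rep (residue_ring 2) (Rep_bit0 :: 2 \<Rightarrow> int)"
proof -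
  have "mod_type 2 (Rep_bit0 :: 2 \<Rightarrow> int) Abs_bit0" using bit0.mod_type_axioms[where 'a = num1] by simp
  then show ?thesis unfolding finite_coeff_rep_def coeff_rep_def by (rule residue_ring_rep)
qed

lemma finite_coeff_rep_3: "finite_coeff_rep (residue_ring 3) (Rep_bit1 :: 3 \<Rightarrow> int)"
proof -
  have "mod_type 3 (Rep_bit1 :: 3 \<Rightarrow> int) Abs_bit1" using bit1.mod_type_axioms[where 'a = num1] by simp
  then show ?thesis unfolding finite_coeff_rep_def coeff_rep_def by (rule residue_ring_rep)
qed

lemma residue_ring_char:
  assumes "1 < p" shows "ring_char (residue_ring (int p)) = p"
proof -
  interpret residues "int p" "residue_ring (int p)" by unfold_locales (use assms in simp_all)
  have "[n] \<cdot>\<^bsub>residue_ring (int p)\<^esub> \<one>\<^bsub>residue_ring (int p)\<^esub> = int n mod int p" for n :: nat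
  proof (induction n)
    case (Suc n)
    then show ?case by (simp add: res_add_eq res_one_eq mod_simps add.commute)
  qed (simp add: res_zero_eq)
  then have "{n::nat. [n] \<cdot>\<^bsub>residue_ring (int p)\<^esub> \<one>\<^bsub>residue_ring (int p)\<^esub> = \<zero>\<^bsub>residue_ring (int p)\<^esub>} = {n. p dvd n}"
    by (auto simp: res_zero_eq simp flip: of_nat_mod dvd_eq_mod_eq_0)
  moreover have "Gcd {n. p dvd n} = p"
    by (rule Gcd_eqI) (auto intro: dvd_refl)
  ultimately show ?thesis by (simp add: ring_char_def)
qed

theorem theorem4p11:
  fixes i r :: nat
  assumes "i \<ge> 3"
  shows "\<exists>n G. i + r \<le> n \<and> minimal_monomial_system n G \<and>
    (\<forall>j. 3 \<le> j \<and> j \<le> i + r \<longrightarrow>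
      (\<exists>d\<ge>r. \<exists>(k::int ring) (k'::int ring).
         field k \<and> field k' \<and> ring_char k \<noteq> ring_char k' \<and>
         Polynomial.coeff (kodiyalam_poly n k j (monomial_ideal n k G)) d \<noteq>
         Polynomial.coeff (kodiyalam_poly n k' j (monomial_ideal n k' G)) d))"
proof -
  \<comment> \<open>This keeps \<open>j\<close> within \<open>s + 3\<close>, the reach of the blocks
    in \<open>part_dim_less\<close>, and makes the degree \<open>s - 1\<close> at least
    \<open>r\<close> because \<open>i\<close> is positive.\<close>
  define s where "s = i + r"
  have s: "2 \<le> s" using assms by (simp add: s_def)
  have "\<forall>\<tau>. \<exists>P::rat poly. \<forall>h\<ge>1. poly P (of_nat h) = of_nat (card {y\<in>multisets_of_size {..<s} h. \<exists>i\<in>#y. \<forall>t\<in>\<tau>. i < t})"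
    by (rule allI, rule initial_count_poly)
  from choice[OF this] obtain P :: "nat set \<Rightarrow> rat poly" where
    P: "\<forall>\<tau>. \<forall>h\<ge>1. poly (P \<tau>) (of_nat h) = of_nat (card {y\<in>multisets_of_size {..<s} h. \<exists>i\<in>#y. \<forall>t\<in>\<tau>. i < t})"
    by (elim exE)
  interpret R2: residues_prime 2 "residue_ring 2" by unfold_locales (simp_all add: two_is_prime_nat)
  interpret R3: residues_prime 3 "residue_ring 3" by unfold_locales simp_all
  interpret F2: finite_coeff_rep "residue_ring 2" "Rep_bit0 :: 2 \<Rightarrow> int" by (rule finite_coeff_rep_2)
  interpret F3: finite_coeff_rep "residue_ring 3" "Rep_bit1 :: 3 \<Rightarrow> int" by (rule finite_coeff_rep_3)
  let ?d = "s - 1"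
  show ?thesis
  proof (rule exI[of _ "s + 10"], rule exI[of _ "gens s"], intro conjI allI impI)
    show "i + r \<le> s + 10" by (simp add: s_def)
    show "minimal_monomial_system (s + 10) (gens s)" by (rule minimal_gens[OF s])
    fix j assume j: "3 \<le> j \<and> j \<le> i + r"
    show "\<exists>d\<ge>r. \<exists>(k::int ring) (k'::int ring).
         field k \<and> field k' \<and> ring_char k \<noteq> ring_char k' \<and>
         coeff (kodiyalam_poly (s + 10) k j (monomial_ideal (s + 10) k (gens s))) d \<noteq>
         coeff (kodiyalam_poly (s + 10) k' j (monomial_ideal (s + 10) k' (gens s))) d"
    proof (rule exI[of _ ?d], rule conjI)
      show "r \<le> ?d" using assms by (simp add: s_def)
      show "\<exists>(k::int ring) (k'::int ring).
         field k \<and> field k' \<and> ring_char k \<noteq> ring_char k' \<and>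
         coeff (kodiyalam_poly (s + 10) k j (monomial_ideal (s + 10) k (gens s))) ?d \<noteq>
         coeff (kodiyalam_poly (s + 10) k' j (monomial_ideal (s + 10) k' (gens s))) ?d"
      proof (rule exI[of _ "residue_ring 2"], rule exI[of _ "residue_ring 3"], intro conjI)
      show "field (residue_ring 2)" by (rule R2.is_field)
      show "field (residue_ring 3)" by (rule R3.is_field)
      show "ring_char (residue_ring 2) \<noteq> ring_char (residue_ring 3)"
        using residue_ring_char[of 2] residue_ring_char[of 3] by simp
      have j1: "1 \<le> j" using j by simp
      have two: "(2::2) = 0" by simp
      have half: "\<exists>t::3. 2 * t = 1" by (rule exI[of _ 2]) simp
      \<comment> \<open>The two polynomials differ by a nonzero multiple of
        \<open>bin_poly (s - 1)\<close>, whose coefficient in degree \<open>s - 1\<close> does not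
        vanish.\<close>
      have "(\<Sum>\<tau>\<in>Pow {..<s}. part_dim 0 j (card \<tau>)) < (\<Sum>\<tau>\<in>Pow {..<s}. part_dim 1 j (card \<tau>))"
        by (rule part_dim_less) (use j s_def in auto)
      then show "coeff (kodiyalam_poly (s + 10) (residue_ring 2) j (monomial_ideal (s + 10) (residue_ring 2) (gens s))) ?d \<noteq>
         coeff (kodiyalam_poly (s + 10) (residue_ring 3) j (monomial_ideal (s + 10) (residue_ring 3) (gens s))) ?d"
        unfolding F2.kodiyalam_gens[OF s disjI1[OF conjI[OF refl two]] j1 P] F3.kodiyalam_gens[OF s disjI2[OF conjI[OF refl half]] j1 P]
        using degree_bin_poly(2)[of ?d] by (simp del: of_nat_sum)
      qed
    qed
  qed
qed

end
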